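(* There exists a unique solution $u_{h,\boldsymbol\tau}\in\mathcal{W}_{h,\boldsymbol\tau}$ to the VEM-DG problem: find $u_{h,\boldsymbol\tau}\in\mathcal{W}_{h,\boldsymbol\tau}$ such that $$\mathcal{A}(u_{h,\boldsymbol\tau},w)=\mathcal{F}(w)\qquad\text{for all } w\in\mathcal{W}_{h,\boldsymbol\tau}.$$
   Context: Let $d\in\{2,3\}$, $\Omega\subset\mathbb{R}^d$ an open bounded convex polygonal (polyhedral if $d=3$) domain, $T>0$, $\nu>0$ a constant, $f\in L^2(\Omega\times(0,T))$. The notation $x\lesssim y$ means $x\le c\,y$ with a positive constant $c$ independent of the discretization parameters. Dots denote time derivatives. Mesh. $\mathcal{T}_h$ is a (not necessarily conforming) decomposition of $\Omega$ into finitely many non-overlapping open polygons $E$ with flat faces; $h_E=\operatorname{diam}(E)$, $h=\max_E h_E$. There are constants $\gamma,c>0$ independent of $h$ and $E$ such that each $E$ is star-shaped with respect to a ball of radius $\gamma h_E$ and the distance between any two vertices of $E$ is larger than $c\,h_E$. Virtual element space. Let $k\ge 1$ be an integer and $\mathbb{P}_k(E)$ the polynomials of total degree $\le k$ on $E$. Put $a^E(v,w)=\int_E\nabla v\cdot\nabla w\,dx$. $\Pi^{\nabla,E}:H^1(E)\to\mathbb{P}_k(E)$ is defined by $a^E(q_k,w-\Pi^{\nabla,E}w)=0$ for all $q_k\in\mathbb{P}_k(E)$ and $\int_E\Pi^{\nabla,E}w\,dx=\int_E w\,dx$. $\Pi^{0,E}:L^2(E)\to\mathbb{P}_k(E)$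 is the $L^2(E)$-orthogonal projection. For $d=2$ let $\mathbb{B}_k(\partial E)=\{v\in C^0(\partial E): v|_e\in\mathbb{P}_k(e)\ \text{for every edge } e\}$, $V_h^E=\{w\in H^1(E): w|_{\partial E}\in\mathbb{B}_k(\partial E),\ \Delta w\in\mathbb{P}_k(E)\}$, and $$W_h^E=\{w\in V_h^E:(w-\Pi^{\nabla,E}w,q)_{L^2(E)}=0\ \text{for all } q\in\mathbb{P}_k(E)/\mathbb{P}_{k-2}(E)\},$$ where $\mathbb{P}_k(E)/\mathbb{P}_{k-2}(E)$ is the set of polynomials of degree $\le k$ that are $L^2(E)$-orthogonal to $\mathbb{P}_{k-2}(E)$ (with $\mathbb{P}_{-1}=\emptyset$, so no orthogonality is required for $k=1$). Degrees of freedom (DOFs): values at vertices, values at $k-1$ Gauss-Lobatto points on each edge, and for $k\ge2$ moments in $E$ against $\mathbb{P}_{k-2}(E)$. For $d=3$ one uses the standard analogue: elements are polyhedra, $\mathbb{B}_k(\partial E)$ is replaced by the continuous functions on $\partial E$ whose restriction to each face $f$ belongs to the two-dimensional enhanced space $W_h^f$, face moments up to order $k-2$ are added to the DOFs, and faces satisfy the same shape-regularity. Set $W_h=\{v\in H^1_0(\Omega): v|_E\in W_h^E\ \text{for all } E\in\mathcal{T}_h\}$. Bilinear forms. For $v_h,w_h\in W_h^E$, $$a_h^E(v_h,w_h)=a^E(\Pi^{\nabla,E}v_h,\Pi^{\nabla,E}w_h)+S^E((I-\Pi^{\nabla,E})v_h,(I-\Pi^{\nabla,E})w_h),$$ $$m_h^E(v_h,w_h)=(\Pi^{0,E}v_h,\Pi^{0,E}w_h)_{L^2(E)}+R^E((I-\Pi^{0,E})v_h,(I-\Pi^{0,E})w_h),$$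 where $S^E,R^E$ are symmetric bilinear forms on $W_h^E$ with $a^E(v_h,v_h)\lesssim S^E(v_h,v_h)\lesssim a^E(v_h,v_h)$ for $v_h\in W_h^E$ with $\Pi^{\nabla,E}v_h=0$, and $\|w_h\|_{L^2(E)}^2\lesssim R^E(w_h,w_h)\lesssim\|w_h\|_{L^2(E)}^2$ for $w_h\in W_h^E$ with $\Pi^{0,E}w_h=0$. Set $a_h=\sum_E a_h^E$, $m_h=\sum_E m_h^E$ on $W_h\times W_h$. Data. $f_h(t)|_E=\Pi^{0,E}f(t)$ for $E\in\mathcal{T}_h$; $u_{h,0},z_{h,0}\in W_h$ are the virtual element interpolants of (smooth enough) $u_0,z_0\in H^1_0(\Omega)$, i.e. the elements of $W_h$ having the same global DOFs as $u_0,z_0$. Time discretization. $0=t_0<t_1<\dots<t_{N_T}=T$, $I_n=(t_{n-1},t_n]$, $\tau_n=t_n-t_{n-1}$, $\boldsymbol\tau=(\tau_n)_n$. For each $n$ let $r_n\ge2$ be an integer, and $W_{\boldsymbol\tau}=\{v\in L^2(0,T): v|_{I_n}\in\mathbb{P}_{r_n}(I_n),\ n=1,\dots,N_T\}$. One-sided limits are $v(t^\pm)=\lim_{\varepsilon\to0^\pm}v(t+\varepsilon)$, and $[v]_n=v(t_n^+)-v(t_n^-)$. The space $\mathcal{W}_{h,\boldsymbol\tau}=W_h\otimes W_{\boldsymbol\tau}$ is the linear span of the functions $w(x,t)=w_1(x)w_2(t)$ with $w_1\in W_h$, $w_2\in W_{\boldsymbol\tau}$. The bilinear form $\mathcal{A}$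 and linear form $\mathcal{F}$ are given, for $v=v_1v_2$, $w=w_1w_2$ of product form (and extended by linearity), by $$\begin{aligned}\mathcal{A}(v,w)=&\sum_{n=1}^{N_T}\big[m_h(v_1,w_1)(\ddot v_2,\dot w_2)_{L^2(I_n)}+\nu\,m_h(v_1,w_1)(\dot v_2,\dot w_2)_{L^2(I_n)}+a_h(v_1,w_1)(v_2,\dot w_2)_{L^2(I_n)}\big]\\ &+\sum_{n=1}^{N_T-1}\big[m_h(v_1,w_1)[\dot v_2]_n\dot w_2(t_n^+)+a_h(v_1,w_1)[v_2]_n w_2(t_n^+)\big]\\ &+m_h(v_1,w_1)\dot v_2(0^+)\dot w_2(0^+)+a_h(v_1,w_1)v_2(0^+)w_2(0^+),\end{aligned}$$ $$\mathcal{F}(w)=\sum_{n=1}^{N_T}(f_h,\dot w)_{L^2(\Omega\times I_n)}+m_h(z_{h,0},w_1)\dot w_2(0^+)+a_h(u_{h,0},w_1)w_2(0^+).$$ *)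

theory Defs
  imports "HOL-Analysis.Analysis" "HOL-Computational_Algebra.Polynomial"
begin

text \<open>Functions on an open set are represented by total functions on the ambient space;
  everything below only depends on the values almost everywhere on that set. All integrals are
  with respect to Lebesgue measure.\<close>

section \<open>Sobolev spaces\<close>

definition L2 :: "'a::euclidean_space set \<Rightarrow> ('a \<Rightarrow> real) set" where
  "L2 E = {w. set_borel_measurable lebesgue E w \<and> set_integrable lebesgue E (\<lambda>x. (w x)\<^sup>2)}"

definition ip :: "'a::euclidean_space set \<Rightarrow> ('a \<Rightarrow> real) \<Rightarrow> ('a \<Rightarrow> real) \<Rightarrow> real" where
  "ip E v w = (LINT x:E|lebesgue. v x * w x)"

definition partial :: "'a::euclidean_space \<Rightarrow> ('a \<Rightarrow> real) \<Rightarrow> 'a \<Rightarrow> real" where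
  "partial i f = (\<lambda>x. frechet_derivative f (at x) i)"

text \<open>\<open>C\<^sup>\<infinity>\<close>: all iterated partial derivatives exist and are again (totally) differentiable.\<close>

definition smooth :: "('a::euclidean_space \<Rightarrow> real) \<Rightarrow> bool" where
  "smooth f \<longleftrightarrow> (\<forall>is \<in> lists Basis. foldr partial is f differentiable_on UNIV)"

definition test_functions :: "'a::euclidean_space set \<Rightarrow> ('a \<Rightarrow> real) set" where
  "test_functions E = {\<phi>. smooth \<phi> \<and> compact (closure {x. \<phi> x \<noteq> 0}) \<and> closure {x. \<phi> x \<noteq> 0} \<subseteq> E}"

definition is_weak_gradient :: "'a::euclidean_space set \<Rightarrow> ('a \<Rightarrow> real) \<Rightarrow> ('a \<Rightarrow> 'a) \<Rightarrow> bool" where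
  "is_weak_gradient E w g \<longleftrightarrow>
     (\<forall>i\<in>Basis. (\<lambda>x. g x \<bullet> i) \<in> L2 E) \<and>
     (\<forall>\<phi>\<in>test_functions E. \<forall>i\<in>Basis. ip E w (partial i \<phi>) = - ip E (\<lambda>x. g x \<bullet> i) \<phi>)"

definition H1 :: "'a::euclidean_space set \<Rightarrow> ('a \<Rightarrow> real) set" where
  "H1 E = {w \<in> L2 E. \<exists>g. is_weak_gradient E w g}"

text \<open>The weak gradient is unique up to a null set of \<open>E\<close>.\<close>

definition grad :: "'a::euclidean_space set \<Rightarrow> ('a \<Rightarrow> real) \<Rightarrow> 'a \<Rightarrow> 'a" where
  "grad E w = (SOME g. is_weak_gradient E w g)"

definition aE :: "'a::euclidean_space set \<Rightarrow> ('a \<Rightarrow> real) \<Rightarrow> ('a \<Rightarrow> real) \<Rightarrow> real" where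
  "aE E v w = (LINT x:E|lebesgue. grad E v x \<bullet> grad E w x)"

definition H1_norm :: "'a::euclidean_space set \<Rightarrow> ('a \<Rightarrow> real) \<Rightarrow> real" where
  "H1_norm E w = sqrt (ip E w w + aE E w w)"

definition H10 :: "'a::euclidean_space set \<Rightarrow> ('a \<Rightarrow> real) set" where
  "H10 E = {w \<in> H1 E. \<exists>\<phi>. (\<forall>j::nat. \<phi> j \<in> test_functions E) \<and>
                           (\<lambda>j. H1_norm E (\<lambda>x. w x - \<phi> j x)) \<longlonglongrightarrow> 0}"

text \<open>\<open>w\<close> restricted to the boundary is the continuous function \<open>g\<close>, in the Sobolev sense:
  \<open>w - G \<in> H\<^sub>0\<^sup>1(E)\<close> for an extension \<open>G \<in> H\<^sup>1(E) \<inter> C\<^sup>0(cl E)\<close> of \<open>g\<close>.\<close>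

definition has_boundary_values ::
    "'a::euclidean_space set \<Rightarrow> ('a \<Rightarrow> real) \<Rightarrow> ('a \<Rightarrow> real) \<Rightarrow> bool" where
  "has_boundary_values E w g \<longleftrightarrow>
     (\<exists>G\<in>H1 E. continuous_on (closure E) G \<and> (\<forall>x\<in>frontier E. G x = g x) \<and>
               (\<lambda>x. w x - G x) \<in> H10 E)"

definition has_weak_laplacian ::
    "'a::euclidean_space set \<Rightarrow> ('a \<Rightarrow> real) \<Rightarrow> ('a \<Rightarrow> real) \<Rightarrow> bool" where
  "has_weak_laplacian E w q \<longleftrightarrow>
     (\<forall>\<phi>\<in>test_functions E. ip E w (\<lambda>x. \<Sum>i\<in>Basis. partial i (partial i \<phi>) x) = ip E q \<phi>)"

section \<open>Polynomials and projections\<close>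

text \<open>Polynomial functions of total degree at most \<open>k\<close>. On a nonempty open set they are determined
  by their restriction, so one set serves every element.\<close>

definition Pk :: "nat \<Rightarrow> ('a::euclidean_space \<Rightarrow> real) set" where
  "Pk k = {q. \<exists>c. q = (\<lambda>x. \<Sum>\<alpha> | \<alpha> \<in> Basis \<rightarrow>\<^sub>E UNIV \<and> (\<Sum>b\<in>Basis. \<alpha> b) \<le> k.
                              c (\<alpha> :: 'a \<Rightarrow> nat) * (\<Prod>b\<in>Basis. (x \<bullet> b) ^ \<alpha> b))}"

text \<open>\<open>P\<^sub>k(E) / P\<^sub>k\<^sub>-\<^sub>2(E)\<close>; no orthogonality is required for \<open>k < 2\<close>.\<close>

definition Pk_quot :: "nat \<Rightarrow> 'a::euclidean_space set \<Rightarrow> ('a \<Rightarrow> real) set" where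
  "Pk_quot k E = {q \<in> Pk k. 2 \<le> k \<longrightarrow> (\<forall>p\<in>Pk (k - 2). ip E q p = 0)}"

definition proj_grad :: "nat \<Rightarrow> 'a::euclidean_space set \<Rightarrow> ('a \<Rightarrow> real) \<Rightarrow> 'a \<Rightarrow> real" where
  "proj_grad k E w = (THE p. p \<in> Pk k \<and>
      (\<forall>q\<in>Pk k. aE E q (\<lambda>x. w x - p x) = 0) \<and>
      (LINT x:E|lebesgue. p x) = (LINT x:E|lebesgue. w x))"

definition proj_L2 :: "nat \<Rightarrow> 'a::euclidean_space set \<Rightarrow> ('a \<Rightarrow> real) \<Rightarrow> 'a \<Rightarrow> real" where
  "proj_L2 k E w = (THE p. p \<in> Pk k \<and> (\<forall>q\<in>Pk k. ip E (\<lambda>x. w x - p x) q = 0))"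

section \<open>Elements and meshes\<close>

text \<open>An element carries its open cell, its vertices and, in dimension three, its (relatively open,
  planar) faces; in dimension two \<open>faces\<close> is empty. The vertex set is data, so that hanging nodes of
  a nonconforming mesh may count as vertices; likewise coplanar faces are allowed.\<close>

record 'a element =
  cell :: "'a set"
  verts :: "'a set"
  faces :: "'a set set"

text \<open>The open edges: what remains of the boundary without faces and vertices.\<close>

definition edges :: "('a::euclidean_space) element \<Rightarrow> 'a set set" where
  "edges K = components (frontier (cell K) - \<Union> (faces K) - verts K)"

definition skeleton_ok :: "('a::euclidean_space) element \<Rightarrow> bool" where
  "skeleton_ok K \<longleftrightarrow>
     open (cell K) \<and> bounded (cell K) \<and> cell K \<noteq> {} \<and>
     finite (verts K) \<and> verts K \<subseteq> frontier (cell K) - \<Union> (faces K) \<and>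
     (\<forall>e\<in>edges K. \<exists>a\<in>verts K. \<exists>b\<in>verts K. e = open_segment a b)"

definition polygonal :: "('a::euclidean_space) element \<Rightarrow> bool" where
  "polygonal K \<longleftrightarrow> faces K = {} \<and> skeleton_ok K"

text \<open>A face is identified with a polygon in the plane by an isometry. The choice of the isometry is
  immaterial, since all notions used on faces are invariant under rigid motions.\<close>

definition is_chart :: "('a::euclidean_space) set \<Rightarrow> (real^2 \<Rightarrow> 'a) \<Rightarrow> bool" where
  "is_chart F \<psi> \<longleftrightarrow> (\<forall>x y. dist (\<psi> x) (\<psi> y) = dist x y) \<and> F \<subseteq> range \<psi>"

definition chart :: "('a::euclidean_space) set \<Rightarrow> real^2 \<Rightarrow> 'a" where
  "chart F = (SOME \<psi>. is_chart F \<psi>)"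

definition face_element :: "('a::euclidean_space) element \<Rightarrow> 'a set \<Rightarrow> (real^2) element" where
  "face_element K F =
     \<lparr> cell = chart F -` F, verts = chart F -` (verts K \<inter> closure F), faces = {} \<rparr>"

definition polyhedral :: "('a::euclidean_space) element \<Rightarrow> bool" where
  "polyhedral K \<longleftrightarrow>
     finite (faces K) \<and> pairwise disjnt (faces K) \<and>
     frontier (cell K) = (\<Union>F\<in>faces K. closure F) \<and>
     (\<forall>F\<in>faces K. (\<exists>\<psi>. is_chart F \<psi>) \<and> polygonal (face_element K F)) \<and>
     skeleton_ok K"

definition shape_regular :: "real \<Rightarrow> real \<Rightarrow> ('a::euclidean_space) element \<Rightarrow> bool" where
  "shape_regular \<gamma> c K \<longleftrightarrow>
     (\<exists>z. \<forall>y\<in>ball z (\<gamma> * diameter (cell K)). \<forall>x\<in>cell K. closed_segment y x \<subseteq> cell K) \<and>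
     (\<forall>v\<in>verts K. \<forall>v'\<in>verts K. v \<noteq> v' \<longrightarrow> dist v v' > c * diameter (cell K))"

definition is_mesh ::
    "real \<Rightarrow> real \<Rightarrow> ('a::euclidean_space) set \<Rightarrow> 'a element set \<Rightarrow> bool" where
  "is_mesh \<gamma> c \<Omega> Th \<longleftrightarrow>
     finite Th \<and> pairwise (\<lambda>K K'. disjnt (cell K) (cell K')) Th \<and>
     (\<forall>K\<in>Th. cell K \<subseteq> \<Omega>) \<and> closure \<Omega> = (\<Union>K\<in>Th. closure (cell K)) \<and>
     (\<forall>K\<in>Th. (if DIM('a) = 2 then polygonal K else polyhedral K) \<and>
              shape_regular \<gamma> c K \<and> (\<forall>F\<in>faces K. shape_regular \<gamma> c (face_element K F)))"

section \<open>Virtual element spaces\<close>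

definition B_edges :: "nat \<Rightarrow> ('a::euclidean_space) element \<Rightarrow> ('a \<Rightarrow> real) set" where
  "B_edges k K = {g. continuous_on (frontier (cell K)) g \<and>
     (\<forall>a b. open_segment a b \<in> edges K \<longrightarrow>
        (\<exists>p::real poly. degree p \<le> k \<and> (\<forall>s\<in>{0..1}. g (a + s *\<^sub>R (b - a)) = poly p s)))}"

definition V_loc ::
    "nat \<Rightarrow> ('a::euclidean_space \<Rightarrow> real) set \<Rightarrow> 'a set \<Rightarrow> ('a \<Rightarrow> real) set" where
  "V_loc k B E = {w \<in> H1 E. (\<exists>g\<in>B. has_boundary_values E w g) \<and> (\<exists>q\<in>Pk k. has_weak_laplacian E w q)}"

definition W_loc ::
    "nat \<Rightarrow> ('a::euclidean_space \<Rightarrow> real) set \<Rightarrow> 'a set \<Rightarrow> ('a \<Rightarrow> real) set" where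
  "W_loc k B E = {w \<in> V_loc k B E. \<forall>q\<in>Pk_quot k E. ip E (\<lambda>x. w x - proj_grad k E w x) q = 0}"

definition B_faces :: "nat \<Rightarrow> ('a::euclidean_space) element \<Rightarrow> ('a \<Rightarrow> real) set" where
  "B_faces k K = {g. continuous_on (frontier (cell K)) g \<and>
     (\<forall>F\<in>faces K. g \<circ> chart F \<in> W_loc k (B_edges k (face_element K F)) (cell (face_element K F)))}"

definition B_bdry :: "nat \<Rightarrow> ('a::euclidean_space) element \<Rightarrow> ('a \<Rightarrow> real) set" where
  "B_bdry k K = (if DIM('a) = 2 then B_edges k K else B_faces k K)"

definition W_elem :: "nat \<Rightarrow> ('a::euclidean_space) element \<Rightarrow> ('a \<Rightarrow> real) set" where
  "W_elem k K = W_loc k (B_bdry k K) (cell K)"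

definition W_h ::
    "nat \<Rightarrow> ('a::euclidean_space) set \<Rightarrow> 'a element set \<Rightarrow> ('a \<Rightarrow> real) set" where
  "W_h k \<Omega> Th = {v \<in> H10 \<Omega>. \<forall>K\<in>Th. v \<in> W_elem k K}"

text \<open>The \<open>k - 1\<close> interior Gauss-Lobatto nodes on \<open>[-1,1]\<close> are the zeros of the derivative of the
  Legendre polynomial of degree \<open>k\<close>, which is a multiple of the \<open>k\<close>-th derivative of
  \<open>(x\<^sup>2 - 1)^k\<close>.\<close>

definition gauss_lobatto :: "nat \<Rightarrow> real set" where
  "gauss_lobatto k = {s \<in> {-1<..<1}. poly ((pderiv ^^ (k + 1)) ([:-1, 0, 1:] ^ k)) s = 0}"

text \<open>\<open>w\<close> has the same degrees of freedom on \<open>K\<close> as \<open>u\<close>, where \<open>u\<close> is continuous up to the boundary.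
  Point values and face moments of \<open>w\<close> are those of its boundary restriction \<open>g\<close>.\<close>

definition same_dofs ::
    "nat \<Rightarrow> ('a::euclidean_space) element \<Rightarrow> ('a \<Rightarrow> real) \<Rightarrow> ('a \<Rightarrow> real) \<Rightarrow> bool" where
  "same_dofs k K w u \<longleftrightarrow> (\<exists>g\<in>B_bdry k K. has_boundary_values (cell K) w g \<and>
     (\<forall>v\<in>verts K. g v = u v) \<and>
     (\<forall>a b. open_segment a b \<in> edges K \<longrightarrow>
        (\<forall>s\<in>gauss_lobatto k. g (a + ((1 + s) / 2) *\<^sub>R (b - a)) = u (a + ((1 + s) / 2) *\<^sub>R (b - a)))) \<and>
     (2 \<le> k \<longrightarrow>
        (\<forall>q\<in>Pk (k - 2). ip (cell K) w q = ip (cell K) u q) \<and>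
        (\<forall>F\<in>faces K. \<forall>q\<in>Pk (k - 2). ip (chart F -` F) (g \<circ> chart F) q
                                       = ip (chart F -` F) (u \<circ> chart F) q)))"

definition is_interpolant ::
    "nat \<Rightarrow> ('a::euclidean_space) set \<Rightarrow> 'a element set \<Rightarrow> ('a \<Rightarrow> real) \<Rightarrow> ('a \<Rightarrow> real) \<Rightarrow> bool" where
  "is_interpolant k \<Omega> Th w u \<longleftrightarrow> w \<in> W_h k \<Omega> Th \<and> (\<forall>K\<in>Th. same_dofs k K w u)"

section \<open>Discrete bilinear forms in space\<close>

definition linear_form_on :: "('b \<Rightarrow> real) set \<Rightarrow> (('b \<Rightarrow> real) \<Rightarrow> real) \<Rightarrow> bool" where
  "linear_form_on W L \<longleftrightarrow>
     (\<forall>u\<in>W. \<forall>v\<in>W. \<forall>a b. L (\<lambda>x. a * u x + b * v x) = a * L u + b * L v)"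

definition bilinear_form_on ::
    "('b \<Rightarrow> real) set \<Rightarrow> (('b \<Rightarrow> real) \<Rightarrow> ('b \<Rightarrow> real) \<Rightarrow> real) \<Rightarrow> bool" where
  "bilinear_form_on W B \<longleftrightarrow>
     (\<forall>u\<in>W. linear_form_on W (B u)) \<and> (\<forall>w\<in>W. linear_form_on W (\<lambda>u. B u w))"

definition symmetric_on ::
    "('b \<Rightarrow> real) set \<Rightarrow> (('b \<Rightarrow> real) \<Rightarrow> ('b \<Rightarrow> real) \<Rightarrow> real) \<Rightarrow> bool" where
  "symmetric_on W B \<longleftrightarrow> (\<forall>u\<in>W. \<forall>w\<in>W. B u w = B w u)"

type_synonym 'a elem_form = "'a element \<Rightarrow> ('a \<Rightarrow> real) \<Rightarrow> ('a \<Rightarrow> real) \<Rightarrow> real"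

definition stabilizes_a ::
    "nat \<Rightarrow> ('a::euclidean_space) element set \<Rightarrow> 'a elem_form \<Rightarrow> bool" where
  "stabilizes_a k Th S \<longleftrightarrow>
     (\<forall>K\<in>Th. bilinear_form_on (W_elem k K) (S K) \<and> symmetric_on (W_elem k K) (S K)) \<and>
     (\<exists>c1>0. \<exists>c2>0. \<forall>K\<in>Th. \<forall>v\<in>W_elem k K. proj_grad k (cell K) v = (\<lambda>x. 0) \<longrightarrow>
        aE (cell K) v v \<le> c1 * S K v v \<and> S K v v \<le> c2 * aE (cell K) v v)"

definition stabilizes_m ::
    "nat \<Rightarrow> ('a::euclidean_space) element set \<Rightarrow> 'a elem_form \<Rightarrow> bool" where
  "stabilizes_m k Th R \<longleftrightarrow>
     (\<forall>K\<in>Th. bilinear_form_on (W_elem k K) (R K) \<and> symmetric_on (W_elem k K) (R K)) \<and>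
     (\<exists>c1>0. \<exists>c2>0. \<forall>K\<in>Th. \<forall>w\<in>W_elem k K. proj_L2 k (cell K) w = (\<lambda>x. 0) \<longrightarrow>
        ip (cell K) w w \<le> c1 * R K w w \<and> R K w w \<le> c2 * ip (cell K) w w)"

definition a_h ::
    "nat \<Rightarrow> ('a::euclidean_space) element set \<Rightarrow> 'a elem_form \<Rightarrow> ('a \<Rightarrow> real) \<Rightarrow> ('a \<Rightarrow> real) \<Rightarrow> real" where
  "a_h k Th S v w = (\<Sum>K\<in>Th.
     aE (cell K) (proj_grad k (cell K) v) (proj_grad k (cell K) w)
     + S K (\<lambda>x. v x - proj_grad k (cell K) v x) (\<lambda>x. w x - proj_grad k (cell K) w x))"

definition m_h ::
    "nat \<Rightarrow> ('a::euclidean_space) element set \<Rightarrow> 'a elem_form \<Rightarrow> ('a \<Rightarrow> real) \<Rightarrow> ('a \<Rightarrow> real) \<Rightarrow> real" where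
  "m_h k Th R v w = (\<Sum>K\<in>Th.
     ip (cell K) (proj_L2 k (cell K) v) (proj_L2 k (cell K) w)
     + R K (\<lambda>x. v x - proj_L2 k (cell K) v x) (\<lambda>x. w x - proj_L2 k (cell K) w x))"

definition f_h ::
    "nat \<Rightarrow> ('a::euclidean_space) element set \<Rightarrow> ('a \<times> real \<Rightarrow> real) \<Rightarrow> 'a \<times> real \<Rightarrow> real" where
  "f_h k Th f = (\<lambda>(x, s). \<Sum>K\<in>Th. indicator (cell K) x * proj_L2 k (cell K) (\<lambda>y. f (y, s)) x)"

section \<open>Discontinuous Galerkin discretization in time\<close>

text \<open>The interval \<open>I\<^sub>n\<close> for \<open>n \<ge> 1\<close>.\<close>

definition slab :: "(nat \<Rightarrow> real) \<Rightarrow> nat \<Rightarrow> real set" where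
  "slab t n = {t (n - 1)<..t n}"

definition W_tau :: "nat \<Rightarrow> (nat \<Rightarrow> real) \<Rightarrow> (nat \<Rightarrow> nat) \<Rightarrow> (real \<Rightarrow> real) set" where
  "W_tau N t r = {v. \<forall>n\<in>{1..N}. \<exists>p::real poly. degree p \<le> r n \<and> (\<forall>s\<in>slab t n. v s = poly p s)}"

definition rlim :: "(real \<Rightarrow> real) \<Rightarrow> real \<Rightarrow> real" where
  "rlim v s = Lim (at_right s) v"

definition llim :: "(real \<Rightarrow> real) \<Rightarrow> real \<Rightarrow> real" where
  "llim v s = Lim (at_left s) v"

definition jump :: "(real \<Rightarrow> real) \<Rightarrow> real \<Rightarrow> real" where
  "jump v s = rlim v s - llim v s"

definition tprod :: "('a \<Rightarrow> real) \<Rightarrow> (real \<Rightarrow> real) \<Rightarrow> 'a \<times> real \<Rightarrow> real" where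
  "tprod w1 w2 = (\<lambda>(x, s). w1 x * w2 s)"

text \<open>The linear span of the products.\<close>

definition tensor_space ::
    "('a \<Rightarrow> real) set \<Rightarrow> (real \<Rightarrow> real) set \<Rightarrow> ('a \<times> real \<Rightarrow> real) set" where
  "tensor_space X Y = {w. \<exists>(m::nat) c v1 v2. (\<forall>i<m. v1 i \<in> X \<and> v2 i \<in> Y) \<and>
                           w = (\<lambda>z. \<Sum>i<m. c i * tprod (v1 i) (v2 i) z)}"

definition A_prod ::
    "(('a \<Rightarrow> real) \<Rightarrow> ('a \<Rightarrow> real) \<Rightarrow> real) \<Rightarrow> (('a \<Rightarrow> real) \<Rightarrow> ('a \<Rightarrow> real) \<Rightarrow> real) \<Rightarrow>
     real \<Rightarrow> nat \<Rightarrow> (nat \<Rightarrow> real) \<Rightarrow>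
     ('a \<Rightarrow> real) \<Rightarrow> (real \<Rightarrow> real) \<Rightarrow> ('a \<Rightarrow> real) \<Rightarrow> (real \<Rightarrow> real) \<Rightarrow> real" where
  "A_prod m a \<nu> N t v1 v2 w1 w2 =
     (\<Sum>n=1..N. m v1 w1 * ip (slab t n) (deriv (deriv v2)) (deriv w2)
               + \<nu> * m v1 w1 * ip (slab t n) (deriv v2) (deriv w2)
               + a v1 w1 * ip (slab t n) v2 (deriv w2))
     + (\<Sum>n=1..N-1. m v1 w1 * jump (deriv v2) (t n) * rlim (deriv w2) (t n)
                   + a v1 w1 * jump v2 (t n) * rlim w2 (t n))
     + m v1 w1 * rlim (deriv v2) 0 * rlim (deriv w2) 0
     + a v1 w1 * rlim v2 0 * rlim w2 0"

definition F_prod ::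
    "(('a::euclidean_space \<Rightarrow> real) \<Rightarrow> ('a \<Rightarrow> real) \<Rightarrow> real) \<Rightarrow> (('a \<Rightarrow> real) \<Rightarrow> ('a \<Rightarrow> real) \<Rightarrow> real) \<Rightarrow>
     ('a \<times> real \<Rightarrow> real) \<Rightarrow> ('a \<Rightarrow> real) \<Rightarrow> ('a \<Rightarrow> real) \<Rightarrow> 'a set \<Rightarrow> nat \<Rightarrow> (nat \<Rightarrow> real) \<Rightarrow>
     ('a \<Rightarrow> real) \<Rightarrow> (real \<Rightarrow> real) \<Rightarrow> real" where
  "F_prod m a fh uh0 zh0 \<Omega> N t w1 w2 =
     (\<Sum>n=1..N. ip (\<Omega> \<times> slab t n) fh (tprod w1 (deriv w2)))
     + m zh0 w1 * rlim (deriv w2) 0 + a uh0 w1 * rlim w2 0"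

text \<open>Extension by (bi)linearity from products to the tensor space. The extension is determined
  on the tensor space because the products span it.\<close>

definition bilinear_ext ::
    "('a \<Rightarrow> real) set \<Rightarrow> (real \<Rightarrow> real) set \<Rightarrow>
     (('a \<Rightarrow> real) \<Rightarrow> (real \<Rightarrow> real) \<Rightarrow> ('a \<Rightarrow> real) \<Rightarrow> (real \<Rightarrow> real) \<Rightarrow> real) \<Rightarrow>
     ('a \<times> real \<Rightarrow> real) \<Rightarrow> ('a \<times> real \<Rightarrow> real) \<Rightarrow> real" where
  "bilinear_ext X Y b = (SOME B. bilinear_form_on (tensor_space X Y) B \<and>
     (\<forall>v1\<in>X. \<forall>v2\<in>Y. \<forall>w1\<in>X. \<forall>w2\<in>Y. B (tprod v1 v2) (tprod w1 w2) = b v1 v2 w1 w2))"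

definition linear_ext ::
    "('a \<Rightarrow> real) set \<Rightarrow> (real \<Rightarrow> real) set \<Rightarrow> (('a \<Rightarrow> real) \<Rightarrow> (real \<Rightarrow> real) \<Rightarrow> real) \<Rightarrow>
     ('a \<times> real \<Rightarrow> real) \<Rightarrow> real" where
  "linear_ext X Y l = (SOME L. linear_form_on (tensor_space X Y) L \<and>
     (\<forall>w1\<in>X. \<forall>w2\<in>Y. L (tprod w1 w2) = l w1 w2))"

definition solves_vem_dg ::
    "nat \<Rightarrow> ('a::euclidean_space) set \<Rightarrow> 'a element set \<Rightarrow> 'a elem_form \<Rightarrow> 'a elem_form \<Rightarrow>
     nat \<Rightarrow> (nat \<Rightarrow> real) \<Rightarrow> (nat \<Rightarrow> nat) \<Rightarrow> real \<Rightarrow> ('a \<times> real \<Rightarrow> real) \<Rightarrow>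
     ('a \<Rightarrow> real) \<Rightarrow> ('a \<Rightarrow> real) \<Rightarrow> ('a \<times> real \<Rightarrow> real) \<Rightarrow> bool" where
  "solves_vem_dg k \<Omega> Th S R N t r \<nu> f uh0 zh0 u \<longleftrightarrow>
     (let X = W_h k \<Omega> Th; Y = W_tau N t r; a = a_h k Th S; m = m_h k Th R;
          A = bilinear_ext X Y (A_prod m a \<nu> N t);
          F = linear_ext X Y (F_prod m a (f_h k Th f) uh0 zh0 \<Omega> N t)
      in u \<in> tensor_space X Y \<and> (\<forall>w\<in>tensor_space X Y. A u w = F w))"

end

theory Submission
  imports Defs
begin

text \<open>Symmetrizing the time forms by integration by parts on each slab gives the energy identity: \<open>2 A(v, v)\<close>
  is a sum of nonnegative terms, namely the \<open>m\<close>-energies of \<open>\<partial>\<^sub>t v\<close> and the \<open>a\<close>-energies of \<open>v\<close> at \<open>0\<^sup>+\<close>, at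
  \<open>T\<^sup>-\<close> and at the jumps, and \<open>2 \<nu>\<close> times the \<open>m\<close>-energy of \<open>\<partial>\<^sub>t v\<close> integrated over \<open>(0, T)\<close>. If it vanishes, \<open>v\<close> is
  constant on each slab, does not jump and starts from \<open>0\<close>, so all its time slices vanish almost everywhere; here
  \<open>m\<^sub>h\<close> and \<open>a\<^sub>h\<close> are definite modulo null sets by the stability of \<open>R\<close> and \<open>S\<close> and the boundary condition in
  \<open>H10\<close>. This gives uniqueness, and existence follows because the discrete space is finite-dimensional modulo null
  sets: a virtual function on an element is determined by its Laplacian and its boundary values, since a weakly
  harmonic function with zero boundary values vanishes.\<close>

section \<open>Linear spaces and forms\<close>

text \<open>No quotient by null functions is ever formed. All spaces consist of total functions, the
  forms are only semidefinite on them, and equality is replaced by membership in a null space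
  (\<open>zae\<close>, \<open>NX\<close>, \<open>NZ\<close>). Hence the solvability lemma must
  tolerate a degenerate form. Three obstacles shape the rest. Boundary values of virtual functions
  are given through a continuous \<open>H1\<close> extension, so uniqueness for the Dirichlet
  problem requires that a continuous \<open>H1\<close> function with zero boundary values be a weak
  limit of test functions; truncating a mollified zero extension provides this. Boundary functions
  and Laplacians are attached to a virtual function by existence only, so no linear map into a space
  of data is at hand, and dimensions are counted by elimination among coefficient vectors. Finally,
  the extensions to the tensor space and the discrete load are defined by choice and description:
  the extensions must be shown to exist, and the load becomes measurable in time only through an
  explicit orthonormal formula for the projection.\<close>

definition lin_space :: "('b \<Rightarrow> real) set \<Rightarrow> bool" where
  "lin_space V \<longleftrightarrow> (\<lambda>x. 0) \<in> V \<and> (\<forall>u\<in>V. \<forall>v\<in>V. \<forall>a b. (\<lambda>x. a * u x + b * v x) \<in> V)"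

lemma lin_space_0: "lin_space V \<Longrightarrow> (\<lambda>x. 0) \<in> V"
  by (simp add: lin_space_def)

lemma lin_space_comb: "lin_space V \<Longrightarrow> u \<in> V \<Longrightarrow> v \<in> V \<Longrightarrow> (\<lambda>x. a * u x + b * v x) \<in> V"
  by (simp add: lin_space_def)

lemma lin_space_add: "lin_space V \<Longrightarrow> u \<in> V \<Longrightarrow> v \<in> V \<Longrightarrow> (\<lambda>x. u x + v x) \<in> V"
  using lin_space_comb[of V u v 1 1] by simp

lemma lin_space_diff: "lin_space V \<Longrightarrow> u \<in> V \<Longrightarrow> v \<in> V \<Longrightarrow> (\<lambda>x. u x - v x) \<in> V"
  using lin_space_comb[of V u v 1 "-1"] by simp

lemma lin_space_scale: "lin_space V \<Longrightarrow> u \<in> V \<Longrightarrow> (\<lambda>x. a * u x) \<in> V"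
  using lin_space_comb[of V u u a 0] by simp

lemma lin_space_sum:
  assumes "lin_space V" "\<And>i. i \<in> I \<Longrightarrow> v i \<in> V"
  shows "(\<lambda>x. \<Sum>i\<in>I. c i * v i x) \<in> V"
proof (cases "finite I")
  case True then show ?thesis using assms(2)
  proof (induction I rule: finite_induct)
    case empty then show ?case using lin_space_0[OF assms(1)] by simp
  next
    case (insert j J)
    have "(\<lambda>x. c j * v j x + 1 * (\<Sum>i\<in>J. c i * v i x)) \<in> V"
      by (rule lin_space_comb[OF assms(1)]) (use insert in auto)
    then show ?case using insert by simp
  qed
qed (use lin_space_0[OF assms(1)] in simp)

lemma linear_form_comb:
  "linear_form_on V L \<Longrightarrow> u \<in> V \<Longrightarrow> v \<in> V \<Longrightarrow> L (\<lambda>x. a * u x + b * v x) = a * L u + b * L v"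
  by (simp add: linear_form_on_def)

lemma linear_form_0: "linear_form_on V L \<Longrightarrow> lin_space V \<Longrightarrow> L (\<lambda>x. 0) = 0"
  using linear_form_comb[of V L "\<lambda>x. 0" "\<lambda>x. 0" 0 0] lin_space_0[of V] by simp

lemma linear_form_add:
  "linear_form_on V L \<Longrightarrow> u \<in> V \<Longrightarrow> v \<in> V \<Longrightarrow> L (\<lambda>x. u x + v x) = L u + L v"
  using linear_form_comb[of V L u v 1 1] by simp

lemma linear_form_diff:
  "linear_form_on V L \<Longrightarrow> u \<in> V \<Longrightarrow> v \<in> V \<Longrightarrow> L (\<lambda>x. u x - v x) = L u - L v"
  using linear_form_comb[of V L u v 1 "-1"] by simp

lemma linear_form_scale:
  "linear_form_on V L \<Longrightarrow> u \<in> V \<Longrightarrow> L (\<lambda>x. a * u x) = a * L u"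
  using linear_form_comb[of V L u u a 0] by simp

lemma linear_form_sum:
  assumes "lin_space V" "linear_form_on V L" "\<And>i. i \<in> I \<Longrightarrow> v i \<in> V"
  shows "L (\<lambda>x. \<Sum>i\<in>I. c i * v i x) = (\<Sum>i\<in>I. c i * L (v i))"
proof (cases "finite I")
  case True then show ?thesis using assms(3)
  proof (induction I rule: finite_induct)
    case empty then show ?case using linear_form_0[OF assms(2,1)] by simp
  next
    case (insert j J)
    have "L (\<lambda>x. c j * v j x + 1 * (\<Sum>i\<in>J. c i * v i x)) = c j * L (v j) + 1 * L (\<lambda>x. \<Sum>i\<in>J. c i * v i x)"
      by (intro linear_form_comb[OF assms(2)] lin_space_sum[OF assms(1)]; use insert in auto)
    then show ?case using insert by simp
  qed
qed (use linear_form_0[OF assms(2,1)] in simp)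

lemma bilinear_left: "bilinear_form_on V B \<Longrightarrow> w \<in> V \<Longrightarrow> linear_form_on V (\<lambda>u. B u w)"
  and bilinear_right: "bilinear_form_on V B \<Longrightarrow> u \<in> V \<Longrightarrow> linear_form_on V (B u)"
  by (auto simp: bilinear_form_on_def)

lemma bilinear_formI:
  assumes "\<And>u v w a b. \<lbrakk>u \<in> V; v \<in> V; w \<in> V\<rbrakk> \<Longrightarrow> B u (\<lambda>x. a * v x + b * w x) = a * B u v + b * B u w"
    and "\<And>u v w a b. \<lbrakk>u \<in> V; v \<in> V; w \<in> V\<rbrakk> \<Longrightarrow> B (\<lambda>x. a * v x + b * w x) u = a * B v u + b * B w u"
  shows "bilinear_form_on V B"
  using assms unfolding bilinear_form_on_def linear_form_on_def by blast

lemma bilinear_form_subset: "bilinear_form_on V B \<Longrightarrow> U \<subseteq> V \<Longrightarrow> bilinear_form_on U B"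
  unfolding bilinear_form_on_def linear_form_on_def by blast

lemma bilinear_form_sum:
  assumes "\<And>i. i \<in> I \<Longrightarrow> bilinear_form_on V (B i)"
  shows "bilinear_form_on V (\<lambda>u v. \<Sum>i\<in>I. B i u v)"
  using assms unfolding bilinear_form_on_def linear_form_on_def
  by (auto simp: sum.distrib sum_distrib_left)

lemma bilinear_form_add:
  assumes "bilinear_form_on V A" "bilinear_form_on V B"
  shows "bilinear_form_on V (\<lambda>u v. A u v + B u v)"
  using assms unfolding bilinear_form_on_def linear_form_on_def
  by (auto simp: algebra_simps)

section \<open>Semidefinite forms and Galerkin systems\<close>

definition psd_on :: "('b \<Rightarrow> real) set \<Rightarrow> (('b \<Rightarrow> real) \<Rightarrow> ('b \<Rightarrow> real) \<Rightarrow> real) \<Rightarrow> bool" where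
  "psd_on V B \<longleftrightarrow> bilinear_form_on V B \<and> symmetric_on V B \<and> (\<forall>v\<in>V. 0 \<le> B v v)"

text \<open>The form may be degenerate, so the nonnegative quadratic in \<open>a\<close> and
  \<open>b\<close> is evaluated without dividing by \<open>B v v\<close>, and isotropic
  \<open>v\<close> is a case of its own.\<close>

lemma psd_cauchy_schwarz:
  assumes V: "lin_space V" and B: "psd_on V B" and u: "u \<in> V" and v: "v \<in> V"
  shows "(B u v)\<^sup>2 \<le> B u u * B v v"
proof -
  have bil: "bilinear_form_on V B" and sym: "B v u = B u v" and pos: "\<And>w. w \<in> V \<Longrightarrow> 0 \<le> B w w"
    using B u v by (auto simp: psd_on_def symmetric_on_def)
  have q: "0 \<le> a\<^sup>2 * B u u + 2 * a * b * B u v + b\<^sup>2 * B v v" for a b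
  proof -
    let ?w = "\<lambda>x. a * u x + b * v x"
    have w: "?w \<in> V" using lin_space_comb[OF V u v] .
    have "B ?w ?w = a * B u ?w + b * B v ?w"
      using linear_form_comb[OF bilinear_left[OF bil w] u v] .
    also have "\<dots> = a * (a * B u u + b * B u v) + b * (a * B v u + b * B v v)"
      using linear_form_comb[OF bilinear_right[OF bil u] u v]
        linear_form_comb[OF bilinear_right[OF bil v] u v] by simp
    finally show ?thesis using pos[OF w] sym by (simp add: algebra_simps power2_eq_square)
  qed
  show ?thesis
  proof (cases "B v v = 0")
    case True
    have "B u v = 0"
    proof (rule ccontr)
      assume n: "B u v \<noteq> 0"
      \<comment> \<open>For isotropic \<open>v\<close> the quadratic is affine in \<open>b\<close>;
        this value of \<open>b\<close> makes it equal to -1.\<close>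
      have "0 \<le> B u u + 2 * (- (B u u + 1) / (2 * B u v)) * B u v"
        using q[of 1 "- (B u u + 1) / (2 * B u v)"] True by simp
      also have "\<dots> = -1" using n by (simp add: field_simps)
      finally show False by simp
    qed
    then show ?thesis using True by simp
  next
    case False
    then have p: "B v v > 0" using pos[OF v] by simp
    \<comment> \<open>The minimizer of the quadratic, scaled by \<open>B v v\<close> to avoid a
      division.\<close>
    have "0 \<le> (B v v)\<^sup>2 * B u u - B v v * (B u v)\<^sup>2"
      using q[of "B v v" "- B u v"] by (simp add: algebra_simps power2_eq_square)
    then have "0 \<le> B v v * (B v v * B u u - (B u v)\<^sup>2)"
      by (simp add: algebra_simps power2_eq_square)
    then show ?thesis using p by (simp add: zero_le_mult_iff mult.commute)
  qed
qed

lemma psd_abs_le: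
  assumes "lin_space V" "psd_on V B" "u \<in> V" "v \<in> V"
  shows "\<bar>B u v\<bar> \<le> sqrt (B u u) * sqrt (B v v)"
proof -
  have "sqrt ((B u v)\<^sup>2) \<le> sqrt (B u u * B v v)"
    using psd_cauchy_schwarz[OF assms] real_sqrt_le_mono by blast
  then show ?thesis by (simp add: real_sqrt_mult)
qed

text \<open>By Cauchy-Schwarz an isotropic vector of a semidefinite form lies in its radical. This
  is what lets null functions be dropped from either argument.\<close>

lemma psd_null:
  assumes "lin_space V" "psd_on V B" "u \<in> V" "v \<in> V" "B u u = 0"
  shows "B u v = 0" "B v u = 0"
  using psd_abs_le[OF assms(1-4)] psd_abs_le[OF assms(1,2,4,3)] assms(5) by auto

lemma psd_on_subset: "psd_on V B \<Longrightarrow> U \<subseteq> V \<Longrightarrow> psd_on U B"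
  unfolding psd_on_def symmetric_on_def using bilinear_form_subset by blast

text \<open>The same expansion with \<open>-b\<close> in place of \<open>b\<close> is nonnegative,
  and the two expansions add up to the right-hand side.\<close>

lemma psd_parallelogram:
  assumes V: "lin_space V" and B: "psd_on V B" and u: "u \<in> V" and v: "v \<in> V"
  shows "B (\<lambda>x. a * u x + b * v x) (\<lambda>x. a * u x + b * v x) \<le> 2 * (a\<^sup>2 * B u u) + 2 * (b\<^sup>2 * B v v)"
proof -
  have bil: "bilinear_form_on V B" and pos: "\<And>w. w \<in> V \<Longrightarrow> 0 \<le> B w w"
    using B by (auto simp: psd_on_def)
  have e: "B (\<lambda>x. a * u x + b * v x) (\<lambda>x. a * u x + b * v x)
     = a\<^sup>2 * B u u + a * b * (B u v + B v u) + b\<^sup>2 * B v v" for a b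
  proof -
    let ?w = "\<lambda>x. a * u x + b * v x"
    have w: "?w \<in> V" using lin_space_comb[OF V u v] .
    have "B ?w ?w = a * B u ?w + b * B v ?w"
      using linear_form_comb[OF bilinear_left[OF bil w] u v] .
    also have "\<dots> = a * (a * B u u + b * B u v) + b * (a * B v u + b * B v v)"
      using linear_form_comb[OF bilinear_right[OF bil u] u v]
        linear_form_comb[OF bilinear_right[OF bil v] u v] by simp
    finally show ?thesis by (simp add: algebra_simps power2_eq_square)
  qed
  have "0 \<le> B (\<lambda>x. a * u x + (-b) * v x) (\<lambda>x. a * u x + (-b) * v x)"
    by (intro pos lin_space_comb V u v)
  then show ?thesis unfolding e by (simp add: algebra_simps)
qed

text \<open>Galerkin systems for a nonsymmetric form are solvable when the form is positive modulo its
  isotropic vectors. The new test function is made left-orthogonal to the old ones; if the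
  result is isotropic, the new equation already holds.\<close>

lemma galerkin_finite:
  assumes V: "lin_space V" and A: "bilinear_form_on V A"
    and iso: "\<And>e u. \<lbrakk>e \<in> V; u \<in> V; A e e = 0\<rbrakk> \<Longrightarrow> A u e = 0"
    and v: "\<And>i. i < (n::nat) \<Longrightarrow> v i \<in> V"
    and F: "linear_form_on V F" "\<And>e. e \<in> V \<Longrightarrow> A e e = 0 \<Longrightarrow> F e = 0"
  shows "\<exists>c. \<forall>j<n. A (\<lambda>x. \<Sum>i<n. c i * v i x) (v j) = F (v j)"
  using v F
proof (induction n arbitrary: F)
  case 0 then show ?case by simp
next
  case (Suc n)
  have vn: "v n \<in> V" and vi: "\<And>i. i < n \<Longrightarrow> v i \<in> V" using Suc.prems(1) by auto
  obtain c where c: "\<forall>j<n. A (\<lambda>x. \<Sum>i<n. c i * v i x) (v j) = F (v j)"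
    using Suc.IH[OF vi Suc.prems(2,3)] by blast
  \<comment> \<open>The induction hypothesis for the load \<open>A (v n)\<close>: subtracting this
    solution from \<open>v n\<close> leaves a vector left-orthogonal to the old test functions. This
    is why \<open>F\<close> varies in the induction.\<close>
  obtain d where d: "\<forall>j<n. A (\<lambda>x. \<Sum>i<n. d i * v i x) (v j) = A (v n) (v j)"
    using Suc.IH[OF vi bilinear_right[OF A vn]] iso vn by blast
  define u where "u = (\<lambda>x. \<Sum>i<n. c i * v i x)"
  define y where "y = (\<lambda>x. \<Sum>i<n. d i * v i x)"
  define e where "e = (\<lambda>x. v n x - y x)"
  have u: "u \<in> V" and y: "y \<in> V" unfolding u_def y_def by (intro lin_space_sum V; use vi in auto)+
  have e: "e \<in> V" unfolding e_def by (intro lin_space_diff V vn y)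
  have Aev: "A e (v j) = 0" if "j < n" for j
    using linear_form_diff[OF bilinear_left[OF A vi[OF that]] vn y] d that by (simp add: e_def y_def)
  have Aey: "A e y = 0"
    using linear_form_sum[OF V bilinear_right[OF A e], of "{..<n}" v d] vi Aev by (simp add: y_def)
  have vney: "v n = (\<lambda>x. e x + y x)" by (simp add: e_def)
  have Aevn: "A e (v n) = A e e"
    using linear_form_add[OF bilinear_right[OF A e] e y] Aey vney by simp
  \<comment> \<open>Adding a multiple of \<open>e\<close> keeps the old equations, and since
    \<open>A e (v n) = A e e\<close>, this multiple also fulfils the new one. For isotropic
    \<open>e\<close> nothing is added.\<close>
  define \<alpha> where "\<alpha> = (if A e e = 0 then 0 else (F (v n) - A u (v n)) / A e e)"
  define c' where "c' = (\<lambda>i. if i < n then c i - \<alpha> * d i else \<alpha>)"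
  have U: "(\<lambda>x. \<Sum>i<Suc n. c' i * v i x) = (\<lambda>x. 1 * u x + \<alpha> * e x)"
  proof
    fix x
    have "(\<Sum>i<n. c' i * v i x) = (\<Sum>i<n. c i * v i x - \<alpha> * (d i * v i x))"
      by (rule sum.cong) (auto simp: c'_def algebra_simps)
    also have "\<dots> = u x - \<alpha> * y x"
      by (simp add: sum_subtractf u_def y_def sum_distrib_left)
    finally show "(\<Sum>i<Suc n. c' i * v i x) = 1 * u x + \<alpha> * e x"
      by (simp add: c'_def e_def algebra_simps)
  qed
  have AU: "A (\<lambda>x. 1 * u x + \<alpha> * e x) w = A u w + \<alpha> * A e w" if "w \<in> V" for w
    using linear_form_comb[OF bilinear_left[OF A that] u e, of 1 \<alpha>] by simp
  have "A (\<lambda>x. \<Sum>i<Suc n. c' i * v i x) (v j) = F (v j)" if "j < Suc n" for j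
  proof (cases "j < n")
    case True
    then show ?thesis unfolding U AU[OF vi[OF True]] using Aev[OF True] c by (simp add: u_def)
  next
    case False
    then have j: "j = n" using that by simp
    show ?thesis
    proof (cases "A e e = 0")
      case True
      \<comment> \<open>Both \<open>F\<close> and \<open>A u\<close> vanish on the isotropic
        \<open>e\<close>, so the new equation follows from the old ones, which hold on
        \<open>y\<close>.\<close>
      have "F (v n) = F e + F y" using linear_form_add[OF Suc.prems(2) e y] vney by simp
      also have "\<dots> = (\<Sum>i<n. d i * F (v i))"
        using Suc.prems(3)[OF e True] linear_form_sum[OF V Suc.prems(2), of "{..<n}" v d] vi
        by (simp add: y_def)
      also have "\<dots> = (\<Sum>i<n. d i * A u (v i))"
        by (rule sum.cong) (use c in \<open>auto simp: u_def\<close>)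
      also have "\<dots> = A u y"
        using linear_form_sum[OF V bilinear_right[OF A u], of "{..<n}" v d] vi by (simp add: y_def)
      also have "\<dots> = A u (v n)"
        using linear_form_add[OF bilinear_right[OF A u] e y] vney iso[OF e u True] by simp
      finally show ?thesis unfolding U AU[OF vn] j by (simp add: \<alpha>_def True)
    next
      case False
      then show ?thesis unfolding U j AU[OF vn] by (simp add: \<alpha>_def Aevn)
    qed
  qed
  then show ?case by blast
qed

text \<open>Each vector of \<open>V\<close> differs from the span of the \<open>v i\<close> by an
  isotropic vector. There both sides of the equation vanish, so the finite system decides all test
  functions.\<close>

lemma galerkin:
  assumes V: "lin_space V" and A: "bilinear_form_on V A"
    and iso: "\<And>e u. \<lbrakk>e \<in> V; u \<in> V; A e e = 0\<rbrakk> \<Longrightarrow> A u e = 0"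
    and v: "\<And>i. i < (n::nat) \<Longrightarrow> v i \<in> V"
    and F: "linear_form_on V F" "\<And>e. e \<in> V \<Longrightarrow> A e e = 0 \<Longrightarrow> F e = 0"
    and span: "\<And>w. w \<in> V \<Longrightarrow> \<exists>c. A (\<lambda>x. w x - (\<Sum>i<n. c i * v i x)) (\<lambda>x. w x - (\<Sum>i<n. c i * v i x)) = 0"
  shows "\<exists>u\<in>V. \<forall>w\<in>V. A u w = F w"
proof -
  obtain c where c: "\<forall>j<n. A (\<lambda>x. \<Sum>i<n. c i * v i x) (v j) = F (v j)"
    using galerkin_finite[where v=v and n=n, OF V A iso v F] by blast
  define u where "u = (\<lambda>x. \<Sum>i<n. c i * v i x)"
  have u: "u \<in> V" unfolding u_def by (intro lin_space_sum V; use v in auto)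
  have "A u w = F w" if w: "w \<in> V" for w
  proof -
    obtain d where d: "A (\<lambda>x. w x - (\<Sum>i<n. d i * v i x)) (\<lambda>x. w x - (\<Sum>i<n. d i * v i x)) = 0"
      using span[OF w] by blast
    define y where "y = (\<lambda>x. \<Sum>i<n. d i * v i x)"
    define e where "e = (\<lambda>x. w x - y x)"
    have y: "y \<in> V" unfolding y_def by (intro lin_space_sum V; use v in auto)
    have e: "e \<in> V" unfolding e_def by (intro lin_space_diff V w y)
    have ee: "A e e = 0" using d by (simp add: e_def y_def)
    have wey: "w = (\<lambda>x. e x + y x)" by (simp add: e_def)
    have "A u w = A u y"
      using linear_form_add[OF bilinear_right[OF A u] e y] wey iso[OF e u ee] by simp
    also have "\<dots> = (\<Sum>i<n. d i * A u (v i))"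
      using linear_form_sum[OF V bilinear_right[OF A u], of "{..<n}" v d] v by (simp add: y_def)
    also have "\<dots> = (\<Sum>i<n. d i * F (v i))"
      by (rule sum.cong) (use c in \<open>auto simp: u_def\<close>)
    also have "\<dots> = F y" using linear_form_sum[OF V F(1), of "{..<n}" v d] v by (simp add: y_def)
    also have "\<dots> = F w" using linear_form_add[OF F(1) e y] wey F(2)[OF e ee] by simp
    finally show ?thesis .
  qed
  then show ?thesis using u by blast
qed

section \<open>Elimination and dimension modulo a subspace\<close>

text \<open>\<open>kill d Q\<close>: a linear subspace \<open>Q\<close> of coefficient vectors has codimension less than \<open>d\<close>,
  in the form that any \<open>d\<close> coefficient vectors have a nontrivial combination in \<open>Q\<close>. Unlike dimension
  formulas, this can be combined for data attached to the vectors only through a relation.\<close>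

definition kill :: "nat \<Rightarrow> ((nat \<Rightarrow> real) \<Rightarrow> bool) \<Rightarrow> bool" where
  "kill d Q \<longleftrightarrow> (\<forall>C. \<exists>b. (\<exists>i<d. b i \<noteq> 0) \<and> Q (\<lambda>j. \<Sum>i<d. b i * C i j))"

text \<open>Required of the first condition in a conjunction: the combinations taken afterwards to
  reach the second condition must not leave it.\<close>

definition comb_closed :: "((nat \<Rightarrow> real) \<Rightarrow> bool) \<Rightarrow> bool" where
  "comb_closed Q \<longleftrightarrow> (\<forall>(d::nat) b C. (\<forall>i<d. Q (C i)) \<longrightarrow> Q (\<lambda>j. \<Sum>i<d. b i * C i j))"

lemma kill_mono: "kill d Q \<Longrightarrow> (\<And>c. Q c \<Longrightarrow> Q' c) \<Longrightarrow> kill d Q'"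
  unfolding kill_def by meson

lemma kill_True: "kill 1 (\<lambda>c. True)"
  unfolding kill_def by (auto intro: exI[of _ "\<lambda>_. 1"])

lemma sum_blocks:
  fixes f :: "nat \<Rightarrow> 'z::comm_monoid_add"
  shows "(\<Sum>i<d1 * d2. f i) = (\<Sum>b<d2. \<Sum>a<d1. f (a + d1 * b))"
proof (induction d2)
  case (Suc d2)
  have "(\<Sum>i<d1 * Suc d2. f i) = (\<Sum>i\<in>{0..<d1 * d2 + d1}. f i)"
    by (simp add: lessThan_atLeast0 add.commute)
  also have "\<dots> = (\<Sum>i\<in>{0..<d1*d2}. f i) + (\<Sum>i\<in>{d1*d2..<d1*d2+d1}. f i)"
    by (rule sum.atLeastLessThan_concat[symmetric]) auto
  also have "(\<Sum>i\<in>{d1*d2..<d1*d2+d1}. f i) = (\<Sum>a<d1. f (a + d1 * d2))"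
    using sum.shift_bounds_nat_ivl[of f 0 "d1*d2" d1] by (simp add: add.commute lessThan_atLeast0)
  finally show ?case using Suc by (simp add: lessThan_atLeast0)
qed simp

text \<open>The vectors are cut into \<open>d2\<close> blocks of length \<open>d1\<close>. Inside
  each block a combination reaches \<open>Q1\<close>; combining these \<open>d2\<close> results
  reaches \<open>Q2\<close> and stays in \<open>Q1\<close>. The product of the bounds is not sharp,
  but only finiteness matters.\<close>

lemma kill_conj:
  assumes k1: "kill d1 Q1" and k2: "kill d2 Q2" and cl: "comb_closed Q1"
  shows "kill (d1 * d2) (\<lambda>c. Q1 c \<and> Q2 c)"
  unfolding kill_def
proof
  fix C :: "nat \<Rightarrow> nat \<Rightarrow> real"
  define P where "P = (\<lambda>b \<beta>. (\<exists>i<d1. \<beta> i \<noteq> 0) \<and> Q1 (\<lambda>j. \<Sum>a<d1. \<beta> a * C (a + d1 * b) j))"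
  define \<beta> where "\<beta> = (\<lambda>b. SOME \<beta>. P b \<beta>)"
  have "\<exists>\<beta>. P b \<beta>" for b
    unfolding P_def by (rule k1[unfolded kill_def, THEN spec])
  then have "P b (\<beta> b)" for b unfolding \<beta>_def by (rule someI_ex)
  then have \<beta>: "\<exists>i<d1. \<beta> b i \<noteq> 0" "Q1 (\<lambda>j. \<Sum>a<d1. \<beta> b a * C (a + d1 * b) j)" for b
    unfolding P_def by simp_all
  obtain \<gamma> where \<gamma>: "\<exists>b<d2. \<gamma> b \<noteq> 0" "Q2 (\<lambda>j. \<Sum>b<d2. \<gamma> b * (\<Sum>a<d1. \<beta> b a * C (a + d1 * b) j))"
    using k2[unfolded kill_def, rule_format, of "\<lambda>b j. \<Sum>a<d1. \<beta> b a * C (a + d1 * b) j"] by blast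
  have d1: "d1 > 0" using \<beta>(1) by fastforce
  \<comment> \<open>The coefficient of the vector at place \<open>a\<close> of block
    \<open>b\<close>, that is, of index \<open>a + d1 * b\<close>.\<close>
  define g where "g = (\<lambda>i. \<gamma> (i div d1) * \<beta> (i div d1) (i mod d1))"
  have gab: "g (a + d1 * b) = \<gamma> b * \<beta> b a" if "a < d1" for a b
    using that d1 by (simp add: g_def)
  have eq: "(\<Sum>i<d1 * d2. g i * C i j) = (\<Sum>b<d2. \<gamma> b * (\<Sum>a<d1. \<beta> b a * C (a + d1 * b) j))" for j
    unfolding sum_blocks sum_distrib_left by (intro sum.cong refl) (simp add: gab mult.assoc)
  obtain b where b: "b < d2" "\<gamma> b \<noteq> 0" using \<gamma> by blast
  obtain a where a: "a < d1" "\<beta> b a \<noteq> 0" using \<beta> by blast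
  have "a + d1 * b < d1 * d2"
  proof -
    have "a + d1 * b < d1 * Suc b" using a by simp
    also have "\<dots> \<le> d1 * d2" using b by (intro mult_le_mono) auto
    finally show ?thesis .
  qed
  then have "\<exists>i<d1 * d2. g i \<noteq> 0" using gab[OF a(1), of b] a b by (metis mult_eq_0_iff)
  moreover have "Q1 (\<lambda>j. \<Sum>b<d2. \<gamma> b * (\<Sum>a<d1. \<beta> b a * C (a + d1 * b) j))"
    using cl[unfolded comb_closed_def, rule_format, of d2 "\<lambda>b j. \<Sum>a<d1. \<beta> b a * C (a + d1 * b) j" \<gamma>]
      \<beta>(2) by blast
  ultimately show "\<exists>b. (\<exists>i<d1*d2. b i \<noteq> 0) \<and> Q1 (\<lambda>j. \<Sum>i<d1*d2. b i * C i j)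
      \<and> Q2 (\<lambda>j. \<Sum>i<d1*d2. b i * C i j)"
    unfolding eq[symmetric] using \<gamma>(2)[folded eq] by blast
qed

lemma kill_ball:
  assumes "finite I" "\<And>i. i \<in> I \<Longrightarrow> kill (d i) (Q i)" "\<And>i. i \<in> I \<Longrightarrow> comb_closed (Q i)"
  shows "kill (\<Prod>i\<in>I. d i) (\<lambda>c. \<forall>i\<in>I. Q i c)"
  using assms
proof (induction I rule: finite_induct)
  case empty then show ?case using kill_True by simp
next
  case (insert i I)
  have "kill (d i * (\<Prod>i\<in>I. d i)) (\<lambda>c. Q i c \<and> (\<forall>i\<in>I. Q i c))"
    using insert by (intro kill_conj) auto
  then show ?case using insert by (auto elim: kill_mono)
qed

text \<open>Cross-multiplication: with the coefficients \<open>L (C 1)\<close> and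
  \<open>- L (C 0)\<close> two vectors are combined into the kernel of \<open>L\<close>. If both
  values vanish, any coefficients do.\<close>

lemma kill_linear: "kill 2 (\<lambda>c. (\<Sum>j<M. c j * l j) = (0::real))"
  unfolding kill_def
proof
  fix C :: "nat \<Rightarrow> nat \<Rightarrow> real"
  define L where "L = (\<lambda>c. \<Sum>j<M. c j * l j)"
  have L: "L (\<lambda>j. \<Sum>i<2. b i * C i j) = b 0 * L (C 0) + b 1 * L (C 1)" for b
    by (simp add: L_def numeral_2_eq_2 sum.distrib sum_distrib_left algebra_simps)
  show "\<exists>b. (\<exists>i<2. b i \<noteq> 0) \<and> (\<Sum>j<M. (\<Sum>i<2. b i * C i j) * l j) = 0"
  proof (cases "L (C 1) = 0 \<and> L (C 0) = 0")
    case True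
    then have "L (\<lambda>j. \<Sum>i<2. (\<lambda>_. 1) i * C i j) = 0" unfolding L by simp
    then show ?thesis unfolding L_def by (intro exI[of _ "\<lambda>_. 1"]) (auto intro: exI[of _ 0])
  next
    case False
    let ?b = "\<lambda>i::nat. if i = 0 then L (C 1) else - L (C 0)"
    have "(\<Sum>j<M. (\<Sum>i<2. ?b i * C i j) * l j) = 0"
      using L[of ?b] by (simp add: L_def)
    moreover have "\<exists>i<2. ?b i \<noteq> 0"
    proof (cases "L (C 1) = 0")
      case True then show ?thesis using False by (intro exI[of _ 1]) simp
    next
      case False then show ?thesis by (intro exI[of _ 0]) simp
    qed
    ultimately show ?thesis by (intro exI[of _ ?b] conjI)
  qed
qed

lemma comb_closed_linear: "comb_closed (\<lambda>c. (\<Sum>j<M. c j * l j) = (0::real))"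
  unfolding comb_closed_def
proof (intro allI impI)
  fix d :: nat and b C assume h: "\<forall>i<d. (\<Sum>j<M. C i j * l j) = 0"
  have "(\<Sum>j<M. (\<Sum>i<d. b i * C i j) * l j) = (\<Sum>i<d. b i * (\<Sum>j<M. C i j * l j))"
    unfolding sum_distrib_left sum_distrib_right by (subst sum.swap) (simp add: mult.assoc)
  then show "(\<Sum>j<M. (\<Sum>i<d. b i * C i j) * l j) = 0" using h by simp
qed

lemma comb_closed_in:
  assumes "lin_space N"
  shows "comb_closed (\<lambda>c. (\<lambda>x. \<Sum>j<(M::nat). c j * v j x) \<in> N)"
  unfolding comb_closed_def
proof (intro allI impI)
  fix d :: nat and b C assume h: "\<forall>i<d. (\<lambda>x. \<Sum>j<M. C i j * v j x) \<in> N"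
  have "(\<lambda>x. \<Sum>j<M. (\<Sum>i<d. b i * C i j) * v j x) = (\<lambda>x. \<Sum>i<d. b i * (\<Sum>j<M. C i j * v j x))"
    unfolding sum_distrib_left sum_distrib_right by (subst sum.swap) (simp add: mult.assoc)
  then show "(\<lambda>x. \<Sum>j<M. (\<Sum>i<d. b i * C i j) * v j x) \<in> N"
    using lin_space_sum[OF assms, of "{..<d}"] h by simp
qed

text \<open>Finite dimension of \<open>V\<close> modulo \<open>N\<close> as an elimination bound
  that is uniform over all finite families. It speaks of coefficient vectors only, so it can be
  derived family by family from data that do not depend linearly on the elements of
  \<open>V\<close>.\<close>

definition fin_dim_mod :: "('b \<Rightarrow> real) set \<Rightarrow> ('b \<Rightarrow> real) set \<Rightarrow> bool" where
  "fin_dim_mod V N \<longleftrightarrow> (\<exists>d. \<forall>v (M::nat). (\<forall>j<M. v j \<in> V) \<longrightarrow> kill d (\<lambda>c. (\<lambda>x. \<Sum>j<M. c j * v j x) \<in> N))"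

text \<open>A family of maximal length among those independent modulo \<open>N\<close>. The bound
  \<open>d\<close> limits the length, and adding one more element yields a relation whose last
  coefficient is nonzero.\<close>

lemma fin_dim_mod_basis:
  assumes N: "lin_space N" and fd: "fin_dim_mod V N" and V: "lin_space V"
  shows "\<exists>n v. (\<forall>i<n. v i \<in> V) \<and> (\<forall>w\<in>V. \<exists>c. (\<lambda>x. w x - (\<Sum>i<n. c i * v i x)) \<in> N)
     \<and> (\<forall>c. (\<lambda>x. \<Sum>i<(n::nat). c i * v i x) \<in> N \<longrightarrow> (\<forall>i<n. c i = 0))"
proof -
  obtain d where d: "\<And>v (M::nat). (\<forall>j<M. v j \<in> V) \<Longrightarrow> kill d (\<lambda>c. (\<lambda>x. \<Sum>j<M. c j * v j x) \<in> N)"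
    using fd unfolding fin_dim_mod_def by blast
  define P where "P = (\<lambda>n::nat. \<exists>v. (\<forall>i<n. v i \<in> V) \<and> (\<forall>c. (\<lambda>x. \<Sum>i<n. c i * v i x) \<in> N \<longrightarrow> (\<forall>i<n. c i = 0)))"
  have bound: "n \<le> d" if "P n" for n
  proof (rule ccontr)
    assume "\<not> n \<le> d"
    then have dn: "d < n" by simp
    obtain v where v: "\<forall>i<n. v i \<in> V" "\<forall>c. (\<lambda>x. \<Sum>i<n. c i * v i x) \<in> N \<longrightarrow> (\<forall>i<n. c i = 0)"
      using \<open>P n\<close> unfolding P_def by blast
    have "kill d (\<lambda>c. (\<lambda>x. \<Sum>j<n. c j * v j x) \<in> N)" using d v by blast
    \<comment> \<open>Elimination among the first \<open>d\<close> unit vectors gives a nontrivial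
      relation modulo \<open>N\<close> in a family that should be independent.\<close>
    from this[unfolded kill_def, THEN spec, of "\<lambda>i j. if i = j then 1 else 0"]
    obtain b where b': "(\<exists>i<d. b i \<noteq> 0) \<and>
        (\<lambda>x. \<Sum>j<n. (\<Sum>i<d. b i * (if i = j then 1 else 0)) * v j x) \<in> N"
      by (rule exE)
    note b = conjunct1[OF b'] conjunct2[OF b']
    have delta: "(\<Sum>i<d. b i * (if i = j then 1 else 0)) = b j" if "j < d" for j
      using that by (simp add: mult_delta_right)
    have "b j = 0" if "j < d" for j
      using mp[OF spec[OF v(2), of "\<lambda>j. \<Sum>i<d. b i * (if i = j then 1 else 0)"] b(2)]
        delta[OF that] that dn by simp
    then show False using b(1) by blast
  qed
  have "P 0" unfolding P_def by simp
  define n where "n = (GREATEST n. P n)"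
  have Pn: "P n" unfolding n_def by (rule GreatestI_nat[where P=P and k=0 and b=d]) (use bound \<open>P 0\<close> in auto)
  have max: "\<not> P (Suc n)"
    using Greatest_le_nat[where P=P and k="Suc n" and b=d] bound unfolding n_def by fastforce
  obtain v where v: "\<forall>i<n. v i \<in> V" "\<forall>c. (\<lambda>x. \<Sum>i<n. c i * v i x) \<in> N \<longrightarrow> (\<forall>i<n. c i = 0)"
    using Pn unfolding P_def by blast
  have "\<exists>c. (\<lambda>x. w x - (\<Sum>i<n. c i * v i x)) \<in> N" if w: "w \<in> V" for w
  proof -
    let ?v = "v(n := w)"
    have "\<forall>i<Suc n. ?v i \<in> V" using v w by auto
    then obtain c where c: "(\<lambda>x. \<Sum>i<Suc n. c i * ?v i x) \<in> N" "\<exists>i<Suc n. c i \<noteq> 0"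
      using max unfolding P_def by blast
    have c1: "(\<lambda>x. (\<Sum>i<n. c i * v i x) + c n * w x) \<in> N" using c(1) by simp
    have cn: "c n \<noteq> 0"
    proof
      assume "c n = 0"
      with c1 v(2) have "\<forall>i<n. c i = 0" by simp
      with \<open>c n = 0\<close> c(2) show False using less_Suc_eq by auto
    qed
    have "(\<lambda>x. inverse (c n) * ((\<Sum>i<n. c i * v i x) + c n * w x)) \<in> N"
      by (rule lin_space_scale[OF N c1])
    moreover have "inverse (c n) * ((\<Sum>i<n. c i * v i x) + c n * w x) = w x - (\<Sum>i<n. (- c i / c n) * v i x)" for x
      using cn by (simp add: distrib_left sum_distrib_left sum_negf divide_inverse mult_ac)
    ultimately show ?thesis by (intro exI[of _ "\<lambda>i. - c i / c n"]) simp
  qed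
  then show ?thesis using v by blast
qed

text \<open>Gram-Schmidt for a semidefinite form: a residual of zero energy is dropped instead of
  normalized, so the old vectors are recovered only up to isotropic ones.\<close>

lemma orthonormal_exists:
  assumes V: "lin_space V" and B: "psd_on V B" and v: "\<And>i. i < (n::nat) \<Longrightarrow> v i \<in> V"
  shows "\<exists>(m::nat) u. (\<forall>i<m. u i \<in> V) \<and> (\<forall>i<m. \<forall>j<m. B (u i) (u j) = (if i = j then 1 else 0)) \<and>
     (\<forall>i<n. \<exists>c. B (\<lambda>x. v i x - (\<Sum>j<m. c j * u j x)) (\<lambda>x. v i x - (\<Sum>j<m. c j * u j x)) = 0)"
  using v
proof (induction n)
  case 0 then show ?case by (intro exI[of _ 0]) auto
next
  case (Suc n)
  have bil: "bilinear_form_on V B" and sym: "\<And>u v. u \<in> V \<Longrightarrow> v \<in> V \<Longrightarrow> B v u = B u v"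
    and pos: "\<And>w. w \<in> V \<Longrightarrow> 0 \<le> B w w"
    using B by (auto simp: psd_on_def symmetric_on_def)
  obtain m :: nat and u where u: "\<forall>i<m. u i \<in> V" and on: "\<forall>i<m. \<forall>j<m. B (u i) (u j) = (if i = j then 1 else 0)"
    and sp: "\<forall>i<n. \<exists>c. B (\<lambda>x. v i x - (\<Sum>j<m. c j * u j x)) (\<lambda>x. v i x - (\<Sum>j<m. c j * u j x)) = 0"
    using Suc by auto
  have vn: "v n \<in> V" using Suc by auto
  define e where "e = (\<lambda>x. v n x - (\<Sum>j<m. B (v n) (u j) * u j x))"
  have s: "(\<lambda>x. \<Sum>j<m. B (v n) (u j) * u j x) \<in> V" by (rule lin_space_sum[OF V]) (use u in auto)
  have e: "e \<in> V" unfolding e_def by (intro lin_space_diff V vn s)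
  have orth: "B e (u i) = 0" if i: "i < m" for i
  proof -
    have ui: "u i \<in> V" using u i by auto
    have "B e (u i) = B (v n) (u i) - B (\<lambda>x. \<Sum>j<m. B (v n) (u j) * u j x) (u i)"
      unfolding e_def by (rule linear_form_diff[OF bilinear_left[OF bil ui] vn s])
    also have "B (\<lambda>x. \<Sum>j<m. B (v n) (u j) * u j x) (u i) = (\<Sum>j<m. B (v n) (u j) * B (u j) (u i))"
      by (rule linear_form_sum[OF V bilinear_left[OF bil ui]]) (use u in auto)
    also have "\<dots> = (\<Sum>j<m. B (v n) (u j) * (if j = i then 1 else 0))"
      by (rule sum.cong) (use on i in auto)
    also have "\<dots> = B (v n) (u i)" using i by (simp add: mult_delta_right)
    finally show ?thesis by simp
  qed
  show ?case
  proof (cases "B e e = 0")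
    case True
    then show ?thesis using u on sp unfolding e_def
      by (intro exI[of _ m] exI[of _ u]) (auto simp: less_Suc_eq)
  next
    case False
    then have p: "B e e > 0" using pos[OF e] by simp
    define w where "w = (\<lambda>x. (1 / sqrt (B e e)) * e x)"
    have w: "w \<in> V" unfolding w_def by (rule lin_space_scale[OF V e])
    have Bw: "B w y = (1 / sqrt (B e e)) * B e y" if "y \<in> V" for y
      unfolding w_def by (rule linear_form_scale[OF bilinear_left[OF bil that] e])
    have "B w w = (1 / sqrt (B e e)) * ((1 / sqrt (B e e)) * B e e)"
      unfolding Bw[OF w] using linear_form_scale[OF bilinear_right[OF bil e] e, of "1 / sqrt (B e e)"]
      by (simp add: w_def)
    then have ww: "B w w = 1" using p by (simp add: field_simps)
    define u' where "u' = u(m := w)"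
    have u'eq: "(\<Sum>j<Suc m. (c(m := t)) j * u' j x) = (\<Sum>j<m. c j * u j x) + t * w x" for c t x
      by (simp add: u'_def)
    have "B (u' i) (u' j) = (if i = j then 1 else 0)" if "i < Suc m" "j < Suc m" for i j
    proof -
      have 1: "B w (u i) = 0" if "i < m" for i using Bw[of "u i"] orth[OF that] u that by simp
      moreover have "B (u i) w = 0" if "i < m" for i using 1[OF that] sym[OF w, of "u i"] u that by simp
      ultimately show ?thesis using that on ww by (auto simp: u'_def less_Suc_eq)
    qed
    moreover have "\<exists>c. B (\<lambda>x. v i x - (\<Sum>j<Suc m. c j * u' j x)) (\<lambda>x. v i x - (\<Sum>j<Suc m. c j * u' j x)) = 0"
      if "i < Suc n" for i
    proof (cases "i < n")
      case True
      then obtain c where "B (\<lambda>x. v i x - (\<Sum>j<m. c j * u j x)) (\<lambda>x. v i x - (\<Sum>j<m. c j * u j x)) = 0"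
        using sp by blast
      then show ?thesis by (intro exI[of _ "c(m := 0)"]) (simp only: u'eq, simp)
    next
      case False
      then have i: "i = n" using that by simp
      let ?c = "(\<lambda>j. B (v n) (u j))(m := sqrt (B e e))"
      have "(\<lambda>x. v n x - (\<Sum>j<Suc m. ?c j * u' j x)) = (\<lambda>x. 0)"
        unfolding u'eq using p by (auto simp: w_def e_def)
      then have "B (\<lambda>x. v n x - (\<Sum>j<Suc m. ?c j * u' j x)) (\<lambda>x. v n x - (\<Sum>j<Suc m. ?c j * u' j x)) = 0"
        using linear_form_0[OF bilinear_left[OF bil lin_space_0[OF V]] V] by (simp only:)
      then show ?thesis unfolding i by (rule exI[of _ ?c])
    qed
    ultimately show ?thesis using u w
      by (intro exI[of _ "Suc m"] exI[of _ u']) (auto simp: u'_def less_Suc_eq)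
  qed
qed

text \<open>Riesz representation on a finitely spanned space, for a load vanishing on isotropic
  vectors: the symmetric case of the Galerkin lemma, from which the projections are
  obtained.\<close>

lemma riesz_psd:
  assumes V: "lin_space V" and B: "psd_on V B" and v: "\<And>i. i < (n::nat) \<Longrightarrow> v i \<in> V"
    and span: "\<And>w. w \<in> V \<Longrightarrow> \<exists>c. w = (\<lambda>x. \<Sum>i<n. c i * v i x)"
    and F: "linear_form_on V F" "\<And>e. e \<in> V \<Longrightarrow> B e e = 0 \<Longrightarrow> F e = 0"
  shows "\<exists>p\<in>V. \<forall>w\<in>V. B p w = F w"
proof (rule galerkin[where v=v and n=n, OF V _ _ v F])
  show bil: "bilinear_form_on V B" using B by (simp add: psd_on_def)
  have 0: "B (\<lambda>x. 0) (\<lambda>x. 0) = 0"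
    by (rule linear_form_0[OF bilinear_left[OF bil lin_space_0[OF V]] V])
  show "\<exists>c. B (\<lambda>x. w x - (\<Sum>i<n. c i * v i x)) (\<lambda>x. w x - (\<Sum>i<n. c i * v i x)) = 0" if w: "w \<in> V" for w
  proof -
    obtain c where "w = (\<lambda>x. \<Sum>i<n. c i * v i x)" using span[OF w] by (rule exE)
    then show ?thesis using 0 by (intro exI[of _ c]) simp
  qed
qed (rule psd_null(2)[OF V B])

section \<open>Extension of forms to tensor products\<close>

definition bilinear_map_on ::
    "('b \<Rightarrow> real) set \<Rightarrow> ('c \<Rightarrow> real) set \<Rightarrow> (('b \<Rightarrow> real) \<Rightarrow> ('c \<Rightarrow> real) \<Rightarrow> real) \<Rightarrow> bool" where
  "bilinear_map_on X Y L \<longleftrightarrow>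
     (\<forall>x\<in>X. linear_form_on Y (L x)) \<and> (\<forall>y\<in>Y. linear_form_on X (\<lambda>x. L x y))"

lemma bilinear_mapI:
  assumes "\<And>x y y' a b. \<lbrakk>x \<in> X; y \<in> Y; y' \<in> Y\<rbrakk> \<Longrightarrow> L x (\<lambda>s. a * y s + b * y' s) = a * L x y + b * L x y'"
    and "\<And>x x' y a b. \<lbrakk>x \<in> X; x' \<in> X; y \<in> Y\<rbrakk> \<Longrightarrow> L (\<lambda>z. a * x z + b * x' z) y = a * L x y + b * L x' y"
  shows "bilinear_map_on X Y L"
  using assms unfolding bilinear_map_on_def linear_form_on_def by simp

text \<open>If some \<open>y i\<close> does not vanish, evaluation at a point expresses \<open>x i\<close> through the other \<open>x j\<close>,
  which shortens the relation.\<close>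

lemma tensor_relation:
  assumes X: "lin_space X" and Y: "lin_space Y" and L: "bilinear_map_on X Y L"
    and "\<And>i. i < (m::nat) \<Longrightarrow> x i \<in> X" "\<And>i. i < m \<Longrightarrow> y i \<in> Y"
    and "\<And>z s. (\<Sum>i<m. x i z * y i s) = 0"
  shows "(\<Sum>i<m. L (x i) (y i)) = 0"
  using assms(4-6)
proof (induction m arbitrary: y)
  case 0 then show ?case by simp
next
  case (Suc m)
  have lx: "\<And>y. y \<in> Y \<Longrightarrow> linear_form_on X (\<lambda>x. L x y)" and ly: "\<And>x. x \<in> X \<Longrightarrow> linear_form_on Y (L x)"
    using L by (auto simp: bilinear_map_on_def)
  have xm: "x m \<in> X" and ym: "y m \<in> Y" and xi: "\<And>i. i < m \<Longrightarrow> x i \<in> X" and yi: "\<And>i. i < m \<Longrightarrow> y i \<in> Y"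
    using Suc.prems by auto
  show ?case
  proof (cases "\<exists>s. y m s \<noteq> 0")
    case False
    then have ym0: "y m = (\<lambda>s. 0)" by auto
    have rel: "(\<Sum>i<m. x i z * y i s) = 0" for z s using Suc.prems(3)[of z s] by (simp add: ym0)
    have "(\<Sum>i<m. L (x i) (y i)) = 0" by (rule Suc.IH[OF xi yi rel])
    moreover have "L (x m) (y m) = 0" unfolding ym0 by (rule linear_form_0[OF ly[OF xm] Y])
    ultimately show ?thesis by simp
  next
    case True
    then obtain s0 where s0: "y m s0 \<noteq> 0" ..
    define \<alpha> where "\<alpha> = (\<lambda>i. - y i s0 / y m s0)"
    have xmeq: "x m = (\<lambda>z. \<Sum>i<m. \<alpha> i * x i z)"
    proof
      fix z
      have "y m s0 * x m z = - (\<Sum>i<m. x i z * y i s0)" using Suc.prems(3)[of z s0] by (simp add: mult.commute)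
      then have "x m z = - (\<Sum>i<m. x i z * y i s0) / y m s0" using s0 by (simp add: field_simps)
      also have "\<dots> = (\<Sum>i<m. \<alpha> i * x i z)"
        unfolding \<alpha>_def by (simp add: sum_divide_distrib sum_negf[symmetric] mult.commute)
      finally show "x m z = (\<Sum>i<m. \<alpha> i * x i z)" .
    qed
    \<comment> \<open>Inserting the expression for \<open>x m\<close> into the relation merges its
      last term into the others. Only the second factors change, hence the induction over arbitrary
      \<open>y\<close>.\<close>
    define y' where "y' = (\<lambda>i s. 1 * y i s + \<alpha> i * y m s)"
    have y': "y' i \<in> Y" if "i < m" for i unfolding y'_def by (intro lin_space_comb Y yi that ym)
    have "(\<Sum>i<m. x i z * y' i s) = 0" for z s
    proof -
      have "(\<Sum>i<m. x i z * y' i s) = (\<Sum>i<m. x i z * y i s) + (\<Sum>i<m. \<alpha> i * x i z) * y m s"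
        by (simp add: y'_def sum_distrib_left sum_distrib_right sum.distrib distrib_left mult_ac)
      also have "(\<Sum>i<m. \<alpha> i * x i z) = x m z" by (simp only: xmeq)
      finally show ?thesis using Suc.prems(3)[of z s] by simp
    qed
    from Suc.IH[OF xi y' this] have "0 = (\<Sum>i<m. L (x i) (y' i))" by simp
    also have "\<dots> = (\<Sum>i<m. 1 * L (x i) (y i) + \<alpha> i * L (x i) (y m))"
      unfolding y'_def by (intro sum.cong refl linear_form_comb[OF ly] xi yi ym) auto
    also have "\<dots> = (\<Sum>i<m. L (x i) (y i)) + (\<Sum>i<m. \<alpha> i * L (x i) (y m))"
      by (simp add: sum.distrib)
    also have "(\<Sum>i<m. \<alpha> i * L (x i) (y m)) = L (\<lambda>z. \<Sum>i<m. \<alpha> i * x i z) (y m)"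
      by (rule linear_form_sum[OF X lx[OF ym], symmetric]) (use xi in auto)
    also have "\<dots> = L (x m) (y m)" by (simp only: xmeq[symmetric])
    finally show ?thesis by simp
  qed
qed

text \<open>Scalars are absorbed into the first factors, so a representation is a plain list of
  pairs.\<close>

definition tensor_rep :: "('b \<Rightarrow> real) set \<Rightarrow> ('c \<Rightarrow> real) set \<Rightarrow> ('b \<times> 'c \<Rightarrow> real) \<Rightarrow>
    nat \<Rightarrow> (nat \<Rightarrow> 'b \<Rightarrow> real) \<Rightarrow> (nat \<Rightarrow> 'c \<Rightarrow> real) \<Rightarrow> bool" where
  "tensor_rep X Y z m x y \<longleftrightarrow> (\<forall>i<m. x i \<in> X \<and> y i \<in> Y) \<and> z = (\<lambda>p. \<Sum>i<m. x i (fst p) * y i (snd p))"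

lemma tensor_space_rep:
  assumes "lin_space X"
  shows "z \<in> tensor_space X Y \<longleftrightarrow> (\<exists>m x y. tensor_rep X Y (z :: 'b \<times> real \<Rightarrow> real) m x y)"
proof
  assume "z \<in> tensor_space X Y"
  then obtain m :: nat and c v1 v2 where v: "\<forall>i<m. v1 i \<in> X \<and> v2 i \<in> Y"
      "z = (\<lambda>z. \<Sum>i<m. c i * tprod (v1 i) (v2 i) z)"
    unfolding tensor_space_def by auto
  have "tensor_rep X Y z m (\<lambda>i x. c i * v1 i x) v2"
    using v by (auto simp: tensor_rep_def tprod_def split_beta mult.assoc intro!: lin_space_scale[OF assms])
  then show "\<exists>m x y. tensor_rep X Y z m x y" by blast
next
  assume "\<exists>m x y. tensor_rep X Y z m x y"
  then obtain m x y where r: "tensor_rep X Y z m x y" by blast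
  then have "z = (\<lambda>z. \<Sum>i<m. 1 * tprod (x i) (y i) z)"
    by (simp add: tensor_rep_def tprod_def split_beta)
  then show "z \<in> tensor_space X Y" using r unfolding tensor_space_def tensor_rep_def
    by (intro CollectI exI[of _ m] exI[of _ "\<lambda>_. 1"] exI[of _ x] exI[of _ y] conjI) auto
qed

lemma sum_append:
  fixes f g :: "nat \<Rightarrow> real"
  shows "(\<Sum>i<m + n. if i < m then f i else g (i - m)) = (\<Sum>i<m. f i) + (\<Sum>i<n. g i)"
proof (induction n)
  case 0 then show ?case by (simp cong: sum.cong_simp)
qed simp

lemma tensor_rep_comb:
  assumes X: "lin_space X" and "tensor_rep X Y z m x y" "tensor_rep X Y z' m' x' y'"
  shows "tensor_rep X Y (\<lambda>p. a * z p + b * z' p) (m + m')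
     (\<lambda>i. if i < m then (\<lambda>w. a * x i w) else (\<lambda>w. b * x' (i - m) w)) (\<lambda>i. if i < m then y i else y' (i - m))"
proof -
  have "(\<Sum>i<m + m'. (if i < m then (\<lambda>w. a * x i w) else (\<lambda>w. b * x' (i - m) w)) (fst p) *
        (if i < m then y i else y' (i - m)) (snd p)) = a * z p + b * z' p" for p
  proof -
  have "(\<Sum>i<m + m'. (if i < m then (\<lambda>w. a * x i w) else (\<lambda>w. b * x' (i - m) w)) (fst p) *
        (if i < m then y i else y' (i - m)) (snd p))
      = (\<Sum>i<m + m'. if i < m then a * x i (fst p) * y i (snd p) else b * x' (i - m) (fst p) * y' (i - m) (snd p))"
    by (rule sum.cong) auto
  also have "\<dots> = (\<Sum>i<m. a * x i (fst p) * y i (snd p)) + (\<Sum>i<m'. b * x' i (fst p) * y' i (snd p))"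
    by (rule sum_append[of m "\<lambda>i. a * x i (fst p) * y i (snd p)" "\<lambda>i. b * x' i (fst p) * y' i (snd p)" m'])
  also have "\<dots> = a * z p + b * z' p"
    using assms by (simp add: tensor_rep_def sum_distrib_left mult.assoc)
  finally show ?thesis .
  qed
  then show ?thesis using assms
    unfolding tensor_rep_def by (auto intro: lin_space_scale)
qed

text \<open>Well-definedness of the extension: one representation followed by the negative of the
  other represents zero.\<close>

lemma tensor_rep_unique:
  assumes X: "lin_space X" and Y: "lin_space Y" and L: "bilinear_map_on X Y L"
    and r: "tensor_rep X Y z m x y" "tensor_rep X Y z m' x' y'"
  shows "(\<Sum>i<m. L (x i) (y i)) = (\<Sum>i<m'. L (x' i) (y' i))"
proof -
  let ?x = "\<lambda>i. if i < m then (\<lambda>w. 1 * x i w) else (\<lambda>w. (-1) * x' (i - m) w)"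
  let ?y = "\<lambda>i. if i < m then y i else y' (i - m)"
  have R: "tensor_rep X Y (\<lambda>p. 1 * z p + (-1) * z p) (m + m') ?x ?y"
    by (rule tensor_rep_comb[OF X r])
  have rel: "(\<Sum>i<m + m'. ?x i w * ?y i s) = 0" for w s
    using fun_cong[OF conjunct2[OF R[unfolded tensor_rep_def]], of "(w, s)"] by simp
  have "(\<Sum>i<m + m'. L (?x i) (?y i)) = 0"
    by (rule tensor_relation[OF X Y L _ _ rel]) (use R in \<open>auto simp: tensor_rep_def\<close>)
  moreover have "(\<Sum>i<m + m'. L (?x i) (?y i)) =
      (\<Sum>i<m + m'. if i < m then L (\<lambda>w. 1 * x i w) (y i) else L (\<lambda>w. (-1) * x' (i - m) w) (y' (i - m)))"
    by (rule sum.cong) auto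
  moreover have "L (\<lambda>w. (-1) * x' i w) (y' i) = - L (x' i) (y' i)" if "i < m'" for i
  proof -
    have "linear_form_on X (\<lambda>x. L x (y' i))" "x' i \<in> X"
      using L r that by (auto simp: bilinear_map_on_def tensor_rep_def)
    from linear_form_scale[OF this, of "-1"] show ?thesis by simp
  qed
  ultimately show ?thesis
    using sum_append[of m "\<lambda>i. L (\<lambda>w. 1 * x i w) (y i)" "\<lambda>i. L (\<lambda>w. (-1) * x' i w) (y' i)" m']
    by (simp add: sum_negf)
qed

definition tensor_ext :: "('b \<Rightarrow> real) set \<Rightarrow> ('c \<Rightarrow> real) set \<Rightarrow> (('b \<Rightarrow> real) \<Rightarrow> ('c \<Rightarrow> real) \<Rightarrow> real) \<Rightarrow>
    ('b \<times> 'c \<Rightarrow> real) \<Rightarrow> real" where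
  "tensor_ext X Y L z = (SOME l. \<exists>m x y. tensor_rep X Y z m x y \<and> l = (\<Sum>i<m. L (x i) (y i)))"

lemma tensor_ext_eq:
  assumes "lin_space X" "lin_space Y" "bilinear_map_on X Y L" "tensor_rep X Y z m x y"
  shows "tensor_ext X Y L z = (\<Sum>i<m. L (x i) (y i))"
proof -
  define P where "P = (\<lambda>l. \<exists>m x y. tensor_rep X Y z m x y \<and> l = (\<Sum>i<m. L (x i) (y i)))"
  have "P (\<Sum>i<m. L (x i) (y i))" unfolding P_def using assms(4) by blast
  then have "P (tensor_ext X Y L z)" unfolding tensor_ext_def P_def[symmetric] by (rule someI)
  then obtain m' x' y' where
    "tensor_rep X Y z m' x' y'" "tensor_ext X Y L z = (\<Sum>i<m'. L (x' i) (y' i))"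
    unfolding P_def by (elim exE conjE)
  then show ?thesis using tensor_rep_unique[OF assms(1-3) _ assms(4)] by simp
qed

lemma tensor_rep_tprod:
  "x \<in> X \<Longrightarrow> y \<in> Y \<Longrightarrow> tensor_rep X Y (tprod x y) 1 (\<lambda>_. x) (\<lambda>_. y)"
  by (auto simp: tensor_rep_def tprod_def split_beta)

lemma tprod_in_tensor: "lin_space X \<Longrightarrow> x \<in> X \<Longrightarrow> y \<in> Y \<Longrightarrow> tprod x y \<in> tensor_space X Y"
  unfolding tensor_space_rep by (intro exI) (rule tensor_rep_tprod)

lemma lin_space_tensor:
  assumes X: "lin_space X"
  shows "lin_space (tensor_space X Y)"
proof -
  have "tensor_rep X Y (\<lambda>p. 0) 0 x y" for x y by (simp add: tensor_rep_def)
  then have "(\<lambda>p. 0) \<in> tensor_space X Y" using tensor_space_rep[OF X] by blast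
  moreover have "(\<lambda>p. a * u p + b * v p) \<in> tensor_space X Y"
    if "u \<in> tensor_space X Y" "v \<in> tensor_space X Y" for u v a b
    using that tensor_rep_comb[OF X] unfolding tensor_space_rep[OF X] by blast
  ultimately show ?thesis by (simp add: lin_space_def)
qed

lemma linear_form_tensor_ext:
  fixes X :: "('b \<Rightarrow> real) set"
  assumes X: "lin_space X" and Y: "lin_space Y" and L: "bilinear_map_on X Y L"
  shows "linear_form_on (tensor_space X Y) (tensor_ext X Y L)"
  unfolding linear_form_on_def
proof (intro ballI allI)
  fix u v a b assume "u \<in> tensor_space X Y" "v \<in> tensor_space X Y"
  then obtain m x y m' x' y' where r: "tensor_rep X Y u m x y" "tensor_rep X Y v m' x' y'"
    unfolding tensor_space_rep[OF X] by blast
  have lx: "\<And>y. y \<in> Y \<Longrightarrow> linear_form_on X (\<lambda>x. L x y)" using L by (auto simp: bilinear_map_on_def)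
  let ?x = "\<lambda>i. if i < m then (\<lambda>w. a * x i w) else (\<lambda>w. b * x' (i - m) w)"
  let ?y = "\<lambda>i. if i < m then y i else y' (i - m)"
  have "tensor_ext X Y L (\<lambda>p. a * u p + b * v p) = (\<Sum>i<m + m'. L (?x i) (?y i))"
    by (rule tensor_ext_eq[OF X Y L tensor_rep_comb[OF X r]])
  also have "\<dots> = (\<Sum>i<m + m'. if i < m then a * L (x i) (y i) else b * L (x' (i - m)) (y' (i - m)))"
    using r linear_form_scale[OF lx] by (intro sum.cong) (auto simp: tensor_rep_def)
  also have "\<dots> = a * tensor_ext X Y L u + b * tensor_ext X Y L v"
    unfolding tensor_ext_eq[OF X Y L r(1)] tensor_ext_eq[OF X Y L r(2)]
    using sum_append[of m "\<lambda>i. a * L (x i) (y i)" "\<lambda>i. b * L (x' i) (y' i)" m']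
    by (simp add: sum_distrib_left)
  finally show "tensor_ext X Y L (\<lambda>p. a * u p + b * v p) = a * tensor_ext X Y L u + b * tensor_ext X Y L v" .
qed

text \<open>\<open>linear_ext\<close> is chosen by SOME, so nothing is known about it before one
  extension has been exhibited. After that, linearity and the values on products determine it on
  every representation.\<close>

lemma linear_ext_rep:
  assumes X: "lin_space X" and Y: "lin_space Y" and L: "bilinear_map_on X Y L"
  shows "linear_form_on (tensor_space X Y) (linear_ext X Y L)"
    and "tensor_rep X Y z m x y \<Longrightarrow> linear_ext X Y L z = (\<Sum>i<m. L (x i) (y i))"
proof -
  let ?P = "\<lambda>K. linear_form_on (tensor_space X Y) K \<and> (\<forall>w1\<in>X. \<forall>w2\<in>Y. K (tprod w1 w2) = L w1 w2)"
  have "?P (tensor_ext X Y L)"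
    using linear_form_tensor_ext[OF X Y L] tensor_ext_eq[OF X Y L tensor_rep_tprod] by simp
  then have K: "?P (linear_ext X Y L)" unfolding linear_ext_def by (rule someI[where P="?P"])
  then show lin: "linear_form_on (tensor_space X Y) (linear_ext X Y L)" by simp
  assume r: "tensor_rep X Y z m x y"
  then have z: "z = (\<lambda>p. \<Sum>i<m. 1 * tprod (x i) (y i) p)"
    by (simp add: tensor_rep_def tprod_def split_beta)
  have "linear_ext X Y L z = (\<Sum>i<m. 1 * linear_ext X Y L (tprod (x i) (y i)))"
    unfolding z by (rule linear_form_sum[OF lin_space_tensor[OF X] lin])
      (use r in \<open>auto simp: tensor_rep_def intro: tprod_in_tensor[OF X]\<close>)
  then show "linear_ext X Y L z = (\<Sum>i<m. L (x i) (y i))"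
    using r K by (simp add: tensor_rep_def)
qed

text \<open>The left argument is extended first, with a product fixed on the right. The result
  \<open>l\<close> is bilinear in the factors of that product and is extended in turn.\<close>

lemma bilinear_ext_rep:
  assumes X: "lin_space X" and Y: "lin_space Y"
    and b1: "\<And>w1 w2. w1 \<in> X \<Longrightarrow> w2 \<in> Y \<Longrightarrow> bilinear_map_on X Y (\<lambda>v1 v2. b v1 v2 w1 w2)"
    and b2: "\<And>v1 v2. v1 \<in> X \<Longrightarrow> v2 \<in> Y \<Longrightarrow> bilinear_map_on X Y (b v1 v2)"
  shows "bilinear_form_on (tensor_space X Y) (bilinear_ext X Y b)"
    and "tensor_rep X Y u m x y \<Longrightarrow> tensor_rep X Y w m' x' y' \<Longrightarrow>
      bilinear_ext X Y b u w = (\<Sum>i<m. \<Sum>j<m'. b (x i) (y i) (x' j) (y' j))"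
proof -
  let ?P = "\<lambda>B. bilinear_form_on (tensor_space X Y) B \<and>
     (\<forall>v1\<in>X. \<forall>v2\<in>Y. \<forall>w1\<in>X. \<forall>w2\<in>Y. B (tprod v1 v2) (tprod w1 w2) = b v1 v2 w1 w2)"
  define l where "l = (\<lambda>w1 w2. tensor_ext X Y (\<lambda>v1 v2. b v1 v2 w1 w2))"
  define B where "B = (\<lambda>v. tensor_ext X Y (\<lambda>w1 w2. l w1 w2 v))"
  have l_rep: "l w1 w2 v = (\<Sum>i<m. b (x i) (y i) w1 w2)"
    if "tensor_rep X Y v m x y" "w1 \<in> X" "w2 \<in> Y" for w1 w2 v m x y
    unfolding l_def by (rule tensor_ext_eq[OF X Y b1 that(1)]) (use that in auto)
  have lbil: "bilinear_map_on X Y (\<lambda>w1 w2. l w1 w2 v)" if "v \<in> tensor_space X Y" for v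
  proof -
    obtain m x y where r: "tensor_rep X Y v m x y" using \<open>v \<in> _\<close> tensor_space_rep[OF X] by blast
    have bm: "\<And>i. i < m \<Longrightarrow> bilinear_map_on X Y (b (x i) (y i))"
      using r b2 by (auto simp: tensor_rep_def)
    show ?thesis
    proof (rule bilinear_mapI)
      fix w1 w2 w2' a c assume "w1 \<in> X" "w2 \<in> Y" "w2' \<in> Y"
      moreover from this have "(\<lambda>s. a * w2 s + c * w2' s) \<in> Y" by (intro lin_space_comb Y)
      moreover have "b (x i) (y i) w1 (\<lambda>s. a * w2 s + c * w2' s)
          = a * b (x i) (y i) w1 w2 + c * b (x i) (y i) w1 w2'" if "i < m" for i
        using bm[OF that] calculation unfolding bilinear_map_on_def linear_form_on_def by blast
      ultimately show "l w1 (\<lambda>s. a * w2 s + c * w2' s) v = a * l w1 w2 v + c * l w1 w2' v"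
        by (simp add: l_rep[OF r] sum_distrib_left sum.distrib[symmetric])
    next
      fix w1 w1' w2 a c assume "w1 \<in> X" "w1' \<in> X" "w2 \<in> Y"
      moreover from this have "(\<lambda>s. a * w1 s + c * w1' s) \<in> X" by (intro lin_space_comb X)
      moreover have "b (x i) (y i) (\<lambda>s. a * w1 s + c * w1' s) w2
          = a * b (x i) (y i) w1 w2 + c * b (x i) (y i) w1' w2" if "i < m" for i
        using bm[OF that] calculation unfolding bilinear_map_on_def linear_form_on_def by blast
      ultimately show "l (\<lambda>s. a * w1 s + c * w1' s) w2 v = a * l w1 w2 v + c * l w1' w2 v"
        by (simp add: l_rep[OF r] sum_distrib_left sum.distrib[symmetric])
    qed
  qed
  have B_rep: "B u w = (\<Sum>i<m. \<Sum>j<m'. b (x i) (y i) (x' j) (y' j))"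
    if u: "tensor_rep X Y u m x y" and w: "tensor_rep X Y w m' x' y'" for u m x y w m' x' y'
  proof -
    have "u \<in> tensor_space X Y" using u tensor_space_rep[OF X] by blast
    then have "B u w = (\<Sum>j<m'. l (x' j) (y' j) u)"
      unfolding B_def by (rule tensor_ext_eq[OF X Y lbil w])
    also have "\<dots> = (\<Sum>j<m'. \<Sum>i<m. b (x i) (y i) (x' j) (y' j))"
      using w by (intro sum.cong refl l_rep[OF u]) (auto simp: tensor_rep_def)
    also have "\<dots> = (\<Sum>i<m. \<Sum>j<m'. b (x i) (y i) (x' j) (y' j))" by (rule sum.swap)
    finally show ?thesis .
  qed
  have "bilinear_form_on (tensor_space X Y) B"
  proof (rule bilinear_formI)
    fix u v w :: "'a \<times> real \<Rightarrow> real" and a c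
    assume u: "u \<in> tensor_space X Y" and v: "v \<in> tensor_space X Y" and w: "w \<in> tensor_space X Y"
    show "B u (\<lambda>x. a * v x + c * w x) = a * B u v + c * B u w"
      unfolding B_def by (rule linear_form_comb[OF linear_form_tensor_ext[OF X Y lbil[OF u]] v w])
    have vw: "(\<lambda>x. a * v x + c * w x) \<in> tensor_space X Y"
      by (rule lin_space_comb[OF lin_space_tensor[OF X] v w])
    obtain m x y where r: "tensor_rep X Y u m x y" using u tensor_space_rep[OF X] by blast
    have "l (x j) (y j) (\<lambda>x. a * v x + c * w x) = a * l (x j) (y j) v + c * l (x j) (y j) w" if "j < m" for j
      unfolding l_def by (rule linear_form_comb[OF linear_form_tensor_ext[OF X Y b1] v w])
        (use r that in \<open>auto simp: tensor_rep_def\<close>)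
    then show "B (\<lambda>x. a * v x + c * w x) u = a * B v u + c * B w u"
      unfolding B_def tensor_ext_eq[OF X Y lbil[OF vw] r] tensor_ext_eq[OF X Y lbil[OF v] r]
        tensor_ext_eq[OF X Y lbil[OF w] r]
      by (simp add: sum_distrib_left sum.distrib)
  qed
  moreover have "B (tprod v1 v2) (tprod w1 w2) = b v1 v2 w1 w2"
    if "v1 \<in> X" "v2 \<in> Y" "w1 \<in> X" "w2 \<in> Y" for v1 v2 w1 w2
    using B_rep[OF tensor_rep_tprod[OF that(1,2)] tensor_rep_tprod[OF that(3,4)]] by simp
  ultimately have "?P B" by simp
  then have K: "?P (bilinear_ext X Y b)" unfolding bilinear_ext_def by (rule someI[where P="?P"])
  then show bil: "bilinear_form_on (tensor_space X Y) (bilinear_ext X Y b)" by simp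
  let ?B = "bilinear_ext X Y b"
  assume u: "tensor_rep X Y u m x y" and w: "tensor_rep X Y w m' x' y'"
  have ueq: "u = (\<lambda>p. \<Sum>i<m. 1 * tprod (x i) (y i) p)" and weq: "w = (\<lambda>p. \<Sum>i<m'. 1 * tprod (x' i) (y' i) p)"
    using u w by (simp_all add: tensor_rep_def tprod_def split_beta)
  have uT: "u \<in> tensor_space X Y" and wT: "w \<in> tensor_space X Y" using u w tensor_space_rep[OF X] by blast+
  have ui: "\<And>i. i < m \<Longrightarrow> tprod (x i) (y i) \<in> tensor_space X Y" and wi: "\<And>i. i < m' \<Longrightarrow> tprod (x' i) (y' i) \<in> tensor_space X Y"
    using u w by (auto simp: tensor_rep_def intro: tprod_in_tensor[OF X])
  have "?B u w = (\<Sum>i<m. 1 * ?B (tprod (x i) (y i)) w)"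
    unfolding ueq by (rule linear_form_sum[OF lin_space_tensor[OF X] bilinear_left[OF bil wT]]) (use ui in auto)
  also have "\<dots> = (\<Sum>i<m. \<Sum>j<m'. b (x i) (y i) (x' j) (y' j))"
  proof (rule sum.cong[OF refl])
    fix i assume "i \<in> {..<m}"
    then have i: "i < m" by simp
    have "?B (tprod (x i) (y i)) w = (\<Sum>j<m'. 1 * ?B (tprod (x i) (y i)) (tprod (x' j) (y' j)))"
      unfolding weq by (rule linear_form_sum[OF lin_space_tensor[OF X] bilinear_right[OF bil ui[OF i]]]) (use wi in auto)
    also have "\<dots> = (\<Sum>j<m'. b (x i) (y i) (x' j) (y' j))"
      using K u w i by (intro sum.cong) (auto simp: tensor_rep_def)
    finally show "1 * ?B (tprod (x i) (y i)) w = (\<Sum>j<m'. b (x i) (y i) (x' j) (y' j))" by simp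
  qed
  finally show "?B u w = (\<Sum>i<m. \<Sum>j<m'. b (x i) (y i) (x' j) (y' j))" .
qed

section \<open>Square integrable functions modulo null sets\<close>

definition zae :: "'a::euclidean_space set \<Rightarrow> ('a \<Rightarrow> real) set" where
  "zae E = {w. AE x in lebesgue. x \<in> E \<longrightarrow> w x = 0}"

lemma lin_space_zae: "lin_space (zae E)"
  unfolding lin_space_def zae_def by auto

lemma L2_iff: "w \<in> L2 E \<longleftrightarrow> (\<lambda>x. indicator E x * w x) \<in> borel_measurable lebesgue \<and>
    integrable lebesgue (\<lambda>x. indicator E x * (w x)\<^sup>2)"
  by (simp add: L2_def set_borel_measurable_def set_integrable_def)

lemma L2_measurable: "w \<in> L2 E \<Longrightarrow> (\<lambda>x. indicator E x * w x) \<in> borel_measurable lebesgue"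
  by (simp add: L2_iff)

lemma L2_prod_measurable:
  assumes "v \<in> L2 E" "w \<in> L2 E"
  shows "(\<lambda>x. indicator E x * (v x * w x)) \<in> borel_measurable lebesgue"
proof -
  have "(\<lambda>x. (indicator E x * v x) * (indicator E x * w x)) \<in> borel_measurable lebesgue"
    by (rule borel_measurable_times[OF L2_measurable[OF assms(1)] L2_measurable[OF assms(2)]])
  then show ?thesis by (rule back_subst[of "\<lambda>f. f \<in> _"]) (auto simp: indicator_def)
qed

lemma L2_prod_integrable:
  assumes "v \<in> L2 E" "w \<in> L2 E"
  shows "integrable lebesgue (\<lambda>x. indicator E x * (v x * w x))"
proof (rule Bochner_Integration.integrable_bound)
  show "integrable lebesgue (\<lambda>x. indicator E x * (v x)\<^sup>2 + indicator E x * (w x)\<^sup>2)"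
    using assms by (intro Bochner_Integration.integrable_add) (auto simp: L2_iff)
  show "(\<lambda>x. indicator E x * (v x * w x)) \<in> borel_measurable lebesgue"
    by (rule L2_prod_measurable[OF assms])
  show "AE x in lebesgue. norm (indicator E x * (v x * w x)) \<le> norm (indicator E x * (v x)\<^sup>2 + indicator E x * (w x)\<^sup>2)"
  proof (rule AE_I2)
    fix x
    have "2 * (\<bar>v x\<bar> * \<bar>w x\<bar>) \<le> (v x)\<^sup>2 + (w x)\<^sup>2"
      using sum_squares_bound[of "\<bar>v x\<bar>" "\<bar>w x\<bar>"] by simp
    moreover have "0 \<le> \<bar>v x\<bar> * \<bar>w x\<bar>" by simp
    ultimately have "\<bar>v x\<bar> * \<bar>w x\<bar> \<le> (v x)\<^sup>2 + (w x)\<^sup>2" by linarith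
    then show "norm (indicator E x * (v x * w x)) \<le> norm (indicator E x * (v x)\<^sup>2 + indicator E x * (w x)\<^sup>2)"
      by (auto simp: indicator_def abs_mult)
  qed
qed

lemma ip_eq: "ip E v w = (LINT x|lebesgue. indicator E x * (v x * w x))"
  by (simp add: ip_def set_lebesgue_integral_def)

lemma ip_commute: "ip E v w = ip E w v"
  by (simp add: ip_def mult.commute)

lemma lin_space_L2: "lin_space (L2 E)"
  unfolding lin_space_def
proof (intro conjI ballI allI)
  show "(\<lambda>x. 0) \<in> L2 E" by (simp add: L2_iff)
next
  fix u v a b assume u: "u \<in> L2 E" and v: "v \<in> L2 E"
  have "(\<lambda>x. a * (indicator E x * u x) + b * (indicator E x * v x)) \<in> borel_measurable lebesgue"
    using borel_measurable_times[OF borel_measurable_const L2_measurable[OF u]]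
      borel_measurable_times[OF borel_measurable_const L2_measurable[OF v]] by (rule borel_measurable_add)
  moreover have "(\<lambda>x. a * (indicator E x * u x) + b * (indicator E x * v x)) = (\<lambda>x. indicator E x * (a * u x + b * v x))"
    by (auto simp: indicator_def)
  moreover have "integrable lebesgue (\<lambda>x. a\<^sup>2 * (indicator E x * (u x)\<^sup>2) + (2 * a * b) * (indicator E x * (u x * v x))
     + b\<^sup>2 * (indicator E x * (v x)\<^sup>2))"
    using u v L2_prod_integrable[OF u v]
    by (intro Bochner_Integration.integrable_add integrable_mult_right) (auto simp: L2_iff)
  moreover have "(\<lambda>x. a\<^sup>2 * (indicator E x * (u x)\<^sup>2) + (2 * a * b) * (indicator E x * (u x * v x))
     + b\<^sup>2 * (indicator E x * (v x)\<^sup>2)) = (\<lambda>x. indicator E x * (a * u x + b * v x)\<^sup>2)"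
    by (auto simp: indicator_def power2_eq_square algebra_simps)
  ultimately show "(\<lambda>x. a * u x + b * v x) \<in> L2 E" unfolding L2_iff by simp
qed

lemma ip_comb_left:
  assumes "u \<in> L2 E" "v \<in> L2 E" "w \<in> L2 E"
  shows "ip E (\<lambda>x. a * u x + b * v x) w = a * ip E u w + b * ip E v w"
proof -
  have "ip E (\<lambda>x. a * u x + b * v x) w
     = (LINT x|lebesgue. a * (indicator E x * (u x * w x)) + b * (indicator E x * (v x * w x)))"
    unfolding ip_eq by (rule Bochner_Integration.integral_cong) (auto simp: algebra_simps)
  also have "\<dots> = a * ip E u w + b * ip E v w"
    unfolding ip_eq using assms L2_prod_integrable
    by (subst Bochner_Integration.integral_add) auto
  finally show ?thesis .
qed

lemma ip_comb_right:
  assumes "u \<in> L2 E" "v \<in> L2 E" "w \<in> L2 E"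
  shows "ip E w (\<lambda>x. a * u x + b * v x) = a * ip E w u + b * ip E w v"
  using ip_comb_left[OF assms] by (simp add: ip_commute)

lemma ip_nonneg: "0 \<le> ip E v v"
  unfolding ip_eq by (rule Bochner_Integration.integral_nonneg) simp

lemma psd_ip: "psd_on (L2 E) (ip E)"
  unfolding psd_on_def symmetric_on_def
  by (auto simp: ip_nonneg intro!: bilinear_formI ip_comb_left ip_comb_right ip_commute)

lemmas ip_diff_left = linear_form_diff[OF bilinear_left[OF conjunct1[OF psd_ip[unfolded psd_on_def]]]]
lemmas ip_diff_right = linear_form_diff[OF bilinear_right[OF conjunct1[OF psd_ip[unfolded psd_on_def]]]]
lemmas ip_abs_le = psd_abs_le[OF lin_space_L2 psd_ip]

lemma ip_zero_iff:
  assumes "w \<in> L2 E"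
  shows "ip E w w = 0 \<longleftrightarrow> w \<in> zae E"
proof -
  have "integrable lebesgue (\<lambda>x. indicator E x * (w x * w x))" using L2_prod_integrable[OF assms assms] .
  then have "ip E w w = 0 \<longleftrightarrow> (AE x in lebesgue. indicator E x * (w x * w x) = 0)"
    unfolding ip_eq by (intro integral_nonneg_eq_0_iff_AE) auto
  also have "\<dots> \<longleftrightarrow> (AE x in lebesgue. x \<in> E \<longrightarrow> w x = 0)"
    by (rule AE_cong) (auto simp: indicator_def)
  finally show ?thesis by (simp add: zae_def)
qed

text \<open>Lebesgue measure is complete, so measurability passes to almost everywhere equal
  functions; every change of representative rests on this.\<close>

lemma L2_AE_cong:
  assumes "u \<in> L2 E" "AE x in lebesgue. x \<in> E \<longrightarrow> u x = v x"
  shows "v \<in> L2 E"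
  unfolding L2_iff
proof
  have m: "AE x in lebesgue. indicator E x * u x = indicator E x * v x"
    using assms(2) by (rule AE_mp) (auto simp: indicator_def)
  then show mv: "(\<lambda>x. indicator E x * v x) \<in> borel_measurable lebesgue"
    by (rule borel_measurable_AE[OF L2_measurable[OF assms(1)]])
  have "(\<lambda>x. (indicator E x * v x) * (indicator E x * v x)) \<in> borel_measurable lebesgue"
    by (rule borel_measurable_times[OF mv mv])
  then have mv2: "(\<lambda>x. indicator E x * (v x)\<^sup>2) \<in> borel_measurable lebesgue"
    by (rule back_subst[of "\<lambda>f. f \<in> _"]) (auto simp: indicator_def power2_eq_square)
  show "integrable lebesgue (\<lambda>x. indicator E x * (v x)\<^sup>2)"
  proof (rule integrable_cong_AE_imp)
    show "integrable lebesgue (\<lambda>x. indicator E x * (u x)\<^sup>2)" using assms(1) by (simp add: L2_iff)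
    show "AE x in lebesgue. indicator E x * (u x)\<^sup>2 = indicator E x * (v x)\<^sup>2"
      using assms(2) by (rule AE_mp) (auto simp: indicator_def)
  qed (rule mv2)
qed

lemma zae_subset_L2: "zae E \<subseteq> L2 E"
proof
  fix w assume "w \<in> zae E"
  then show "w \<in> L2 E"
    by (intro L2_AE_cong[OF lin_space_0[OF lin_space_L2]]) (auto simp: zae_def)
qed

lemma ip_cong_AE:
  assumes "v \<in> L2 E" "w \<in> L2 E" "AE x in lebesgue. x \<in> E \<longrightarrow> v x = v' x"
  shows "ip E v w = ip E v' w"
proof -
  have v': "v' \<in> L2 E" using L2_AE_cong[OF assms(1,3)] .
  show ?thesis unfolding ip_eq
  proof (rule integral_cong_AE)
    show "AE x in lebesgue. indicator E x * (v x * w x) = indicator E x * (v' x * w x)"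
      using assms(3) by (rule AE_mp) (auto simp: indicator_def)
  qed (auto intro!: L2_prod_measurable assms v')
qed

lemma ip_zae_left:
  assumes "v \<in> zae E" "w \<in> L2 E" shows "ip E v w = 0"
proof -
  have "ip E v w = ip E (\<lambda>x. 0) w"
    by (rule ip_cong_AE) (use assms zae_subset_L2 in \<open>auto simp: zae_def\<close>)
  then show ?thesis by (simp add: ip_eq)
qed

lemma ip_cong:
  "(\<And>x. x \<in> E \<Longrightarrow> v x * w x = v' x * w' x) \<Longrightarrow> ip E v w = ip E v' w'"
  unfolding ip_eq by (rule Bochner_Integration.integral_cong) (auto simp: indicator_def)

lemma L2_cong:
  "(\<And>x. x \<in> E \<Longrightarrow> v x = w x) \<Longrightarrow> v \<in> L2 E \<longleftrightarrow> w \<in> L2 E"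
  by (auto intro: L2_AE_cong)

lemma L2_subset:
  assumes "w \<in> L2 E" "F \<subseteq> E" "F \<in> sets lebesgue"
  shows "w \<in> L2 F"
proof -
  have "(\<lambda>x. indicator F x * (indicator E x * w x)) \<in> borel_measurable lebesgue"
    by (rule borel_measurable_times[OF borel_measurable_indicator[OF assms(3)] L2_measurable[OF assms(1)]])
  moreover have "(\<lambda>x. indicator F x * (indicator E x * w x)) = (\<lambda>x. indicator F x * w x)"
    using assms(2) by (intro ext) (auto simp: indicator_def)
  moreover have "integrable lebesgue (\<lambda>x. indicator F x *\<^sub>R (indicator E x * (w x)\<^sup>2))"
    using assms by (intro integrable_mult_indicator) (auto simp: L2_iff)
  moreover have "(\<lambda>x. indicator F x *\<^sub>R (indicator E x * (w x)\<^sup>2)) = (\<lambda>x. indicator F x * (w x)\<^sup>2)"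
    using assms(2) by (intro ext) (auto simp: indicator_def)
  ultimately show ?thesis unfolding L2_iff by simp
qed

lemma bounded_integrable:
  fixes g :: "'a::euclidean_space \<Rightarrow> real"
  assumes "E \<in> sets lebesgue" "bounded E" "(\<lambda>x. indicator E x * g x) \<in> borel_measurable lebesgue"
    and "\<And>x. x \<in> E \<Longrightarrow> \<bar>g x\<bar> \<le> C"
  shows "integrable lebesgue (\<lambda>x. indicator E x * g x)"
proof (rule Bochner_Integration.integrable_bound)
  show "integrable lebesgue (\<lambda>x. C * indicator E x)"
    using lmeasurable_iff_integrable bounded_set_imp_lmeasurable[OF assms(2,1)]
    by (intro integrable_mult_right) auto
  show "AE x in lebesgue. norm (indicator E x * g x) \<le> norm (C * indicator E x)"
    using assms(4) by (intro AE_I2) (fastforce simp: indicator_def)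
qed fact

lemma L2_bounded:
  fixes g :: "'a::euclidean_space \<Rightarrow> real"
  assumes "E \<in> sets lebesgue" "bounded E" "(\<lambda>x. indicator E x * g x) \<in> borel_measurable lebesgue"
    and "\<And>x. x \<in> E \<Longrightarrow> \<bar>g x\<bar> \<le> C"
  shows "g \<in> L2 E"
  unfolding L2_iff
proof
  have "(\<lambda>x. (indicator E x * g x) * (indicator E x * g x)) \<in> borel_measurable lebesgue"
    by (rule borel_measurable_times[OF assms(3) assms(3)])
  then have m: "(\<lambda>x. indicator E x * (g x)\<^sup>2) \<in> borel_measurable lebesgue"
    by (rule back_subst[of "\<lambda>f. f \<in> _"]) (auto simp: indicator_def power2_eq_square)
  show "integrable lebesgue (\<lambda>x. indicator E x * (g x)\<^sup>2)"
  proof (rule bounded_integrable[OF assms(1,2) m])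
    fix x assume "x \<in> E"
    then have "\<bar>g x\<bar> * \<bar>g x\<bar> \<le> C * C" using assms(4)[of x] by (intro mult_mono) auto
    then show "\<bar>(g x)\<^sup>2\<bar> \<le> C * C" by (simp add: power2_eq_square)
  qed
qed fact

lemma continuous_lebesgue_measurable:
  fixes g :: "'a::euclidean_space \<Rightarrow> real"
  assumes "continuous_on UNIV g" shows "g \<in> borel_measurable lebesgue"
  using borel_measurable_continuous_onI[OF assms] by (intro measurable_completion) auto

lemma L2_continuous:
  fixes g :: "'a::euclidean_space \<Rightarrow> real"
  assumes "E \<in> sets lebesgue" "bounded E" "continuous_on UNIV g"
  shows "g \<in> L2 E"
proof -
  have "compact (g ` closure E)"
    using assms by (intro compact_continuous_image) (auto intro: continuous_on_subset)
  then obtain C where "\<And>y. y \<in> g ` closure E \<Longrightarrow> \<bar>y\<bar> \<le> C"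
    using compact_imp_bounded bounded_iff real_norm_def by metis
  then have "\<bar>g x\<bar> \<le> C" if "x \<in> E" for x using that closure_subset by blast
  moreover have "(\<lambda>x. indicator E x * g x) \<in> borel_measurable lebesgue"
    by (rule borel_measurable_times[OF borel_measurable_indicator[OF assms(1)] continuous_lebesgue_measurable[OF assms(3)]])
  ultimately show ?thesis by (intro L2_bounded[OF assms(1,2)])
qed

lemma L2_mult_bounded:
  assumes w: "w \<in> L2 E" and E: "E \<in> sets lebesgue" "bounded E" and g: "continuous_on UNIV g"
  shows "(\<lambda>x. g x * w x) \<in> L2 E"
proof -
  have "compact (g ` closure E)"
    using E g by (intro compact_continuous_image) (auto intro: continuous_on_subset)
  then obtain C where "\<And>y. y \<in> g ` closure E \<Longrightarrow> \<bar>y\<bar> \<le> C"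
    using compact_imp_bounded bounded_iff real_norm_def by metis
  then have C: "\<bar>g x\<bar> \<le> C" if "x \<in> E" for x using that closure_subset by blast
  have gm: "g \<in> borel_measurable lebesgue" by (rule continuous_lebesgue_measurable[OF g])
  show ?thesis unfolding L2_iff
  proof
    have "(\<lambda>x. g x * (indicator E x * w x)) \<in> borel_measurable lebesgue"
      by (rule borel_measurable_times[OF gm L2_measurable[OF w]])
    then show m: "(\<lambda>x. indicator E x * (g x * w x)) \<in> borel_measurable lebesgue"
      by (simp add: mult.left_commute)
    have "(\<lambda>x. (indicator E x * (g x * w x)) * (indicator E x * (g x * w x))) \<in> borel_measurable lebesgue"
      by (rule borel_measurable_times[OF m m])
    then have m2: "(\<lambda>x. indicator E x * (g x * w x)\<^sup>2) \<in> borel_measurable lebesgue"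
      by (rule back_subst[of "\<lambda>f. f \<in> _"]) (auto simp: indicator_def power2_eq_square)
    show "integrable lebesgue (\<lambda>x. indicator E x * (g x * w x)\<^sup>2)"
    proof (rule Bochner_Integration.integrable_bound)
      show "integrable lebesgue (\<lambda>x. C\<^sup>2 * (indicator E x * (w x)\<^sup>2))"
        using w by (intro integrable_mult_right) (auto simp: L2_iff)
      show "AE x in lebesgue. norm (indicator E x * (g x * w x)\<^sup>2) \<le> norm (C\<^sup>2 * (indicator E x * (w x)\<^sup>2))"
      proof (rule AE_I2)
        fix x
        have "(g x)\<^sup>2 \<le> C\<^sup>2" if "x \<in> E" using C[OF that] by (simp add: abs_le_square_iff[symmetric])
        then show "norm (indicator E x * (g x * w x)\<^sup>2) \<le> norm (C\<^sup>2 * (indicator E x * (w x)\<^sup>2))"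
          by (auto simp: indicator_def power_mult_distrib intro!: mult_right_mono)
      qed
    qed (rule m2)
  qed
qed

lemma ip_restrict:
  assumes "F \<subseteq> E" "\<And>x. x \<in> E - F \<Longrightarrow> v x * w x = 0"
  shows "ip E v w = ip F v w"
  unfolding ip_eq using assms by (intro Bochner_Integration.integral_cong refl) (auto simp: indicator_def)

text \<open>The set where \<open>g\<close> does not vanish is open and negligible, hence
  empty.\<close>

lemma continuous_AE_zero:
  fixes g :: "'a::euclidean_space \<Rightarrow> real"
  assumes "open E" "continuous_on E g" "g \<in> zae E" "x \<in> E"
  shows "g x = 0"
proof (rule ccontr)
  assume n: "g x \<noteq> 0"
  have "open (E \<inter> g -` (- {0}))"
    by (rule continuous_open_preimage[OF assms(2,1)]) auto
  moreover have "negligible (E \<inter> g -` (- {0}))"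
  proof -
    have "{y. \<not> (y \<in> E \<longrightarrow> g y = 0)} \<in> null_sets lebesgue"
      using assms(3) by (simp add: zae_def completion.AE_iff_null_sets null_sets_def AE_iff_null)
    moreover have "{y. \<not> (y \<in> E \<longrightarrow> g y = 0)} = E \<inter> g -` (- {0})" by auto
    ultimately show ?thesis by (simp add: negligible_iff_null_sets)
  qed
  ultimately have "E \<inter> g -` (- {0}) = {}" using open_not_negligible by blast
  then show False using n assms(4) by auto
qed

section \<open>Calculus of smooth functions\<close>

lemma smooth_coinduct:
  assumes "f \<in> C" "\<And>g. g \<in> C \<Longrightarrow> g differentiable_on UNIV"
    "\<And>g i. g \<in> C \<Longrightarrow> i \<in> Basis \<Longrightarrow> partial i g \<in> C"
  shows "smooth f"
proof -
  \<comment> \<open>Every iterated partial derivative stays in \<open>C\<close>. Smoothness is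
    therefore proved by exhibiting a class of differentiable functions stable under partial
    derivatives.\<close>
  have "foldr partial is f \<in> C" if "is \<in> lists Basis" for "is"
    using that by (induction "is") (use assms in auto)
  then show ?thesis unfolding smooth_def using assms(2) by blast
qed

lemma partial_delta: "i \<in> Basis \<Longrightarrow> (\<Sum>j\<in>Basis. (i \<bullet> j) * c j) = (c i :: real)"
  by (simp add: inner_Basis mult_delta_left)

lemma smooth_differentiable_on: "smooth f \<Longrightarrow> f differentiable_on UNIV"
  unfolding smooth_def by (drule bspec[of _ _ "[]"]) auto

lemma smooth_partial:
  assumes "smooth f" "i \<in> Basis" shows "smooth (partial i f)"
  unfolding smooth_def
proof
  fix "is" :: "'a list" assume "is \<in> lists Basis"
  then have "is @ [i] \<in> lists Basis" using assms(2) by auto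
  with assms(1) have "foldr partial (is @ [i]) f differentiable_on UNIV" unfolding smooth_def by blast
  then show "foldr partial is (partial i f) differentiable_on UNIV" by simp
qed

lemma partial_eq: "(f has_derivative f') (at x) \<Longrightarrow> partial i f x = f' i"
  using frechet_derivative_at[of f f' x] by (simp add: partial_def)

lemma differentiable_has_derivative_partial:
  fixes f :: "'a::euclidean_space \<Rightarrow> real"
  assumes "f differentiable_on UNIV"
  shows "(f has_derivative (\<lambda>h. \<Sum>i\<in>Basis. (h \<bullet> i) * partial i f x)) (at x)"
proof -
  let ?D = "frechet_derivative f (at x)"
  have d: "(f has_derivative ?D) (at x)"
    using assms by (simp add: differentiable_on_def frechet_derivative_works)
  then have lin: "linear ?D" using has_derivative_linear by blast
  have "?D h = (\<Sum>i\<in>Basis. (h \<bullet> i) * partial i f x)" for h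
  proof -
    have "?D h = ?D (\<Sum>i\<in>Basis. (h \<bullet> i) *\<^sub>R i)" by (simp add: euclidean_representation)
    also have "\<dots> = (\<Sum>i\<in>Basis. (h \<bullet> i) * partial i f x)"
      using lin by (simp add: linear_sum linear_scale partial_def)
    finally show ?thesis .
  qed
  then have "?D = (\<lambda>h. \<Sum>i\<in>Basis. (h \<bullet> i) * partial i f x)" by (rule ext)
  then show ?thesis using d by simp
qed

lemmas smooth_has_derivative = differentiable_has_derivative_partial[OF smooth_differentiable_on]

lemma smooth_continuous: "smooth f \<Longrightarrow> continuous_on A f"
  using smooth_differentiable_on differentiable_imp_continuous_on continuous_on_subset by blast

lemma has_derivative_imp_diff_on:
  "(\<And>x. (f has_derivative f' x) (at x)) \<Longrightarrow> f differentiable_on UNIV"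
  by (auto simp: differentiable_on_def differentiable_def)

text \<open>A witness class for the coinduction. The derivative of a product is a sum of products
  and that of a composite is a product, so closure under all operations is taken at once. In the end
  the class consists of the smooth functions.\<close>

inductive_set smooth_alg :: "('a::euclidean_space \<Rightarrow> real) set" where
  base: "smooth f \<Longrightarrow> f \<in> smooth_alg"
| const: "(\<lambda>x. c) \<in> smooth_alg"
| add: "f \<in> smooth_alg \<Longrightarrow> g \<in> smooth_alg \<Longrightarrow> (\<lambda>x. f x + g x) \<in> smooth_alg"
| mult: "f \<in> smooth_alg \<Longrightarrow> g \<in> smooth_alg \<Longrightarrow> (\<lambda>x. f x * g x) \<in> smooth_alg"
| comp: "smooth (F :: real \<Rightarrow> real) \<Longrightarrow> g \<in> smooth_alg \<Longrightarrow> (\<lambda>x. F (g x)) \<in> smooth_alg"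

lemma smooth_alg_derivative:
  assumes "f \<in> smooth_alg"
  shows "f differentiable_on UNIV \<and> (\<forall>i\<in>Basis. partial i f \<in> smooth_alg)"
  using assms
proof induction
  case (base f) then show ?case by (auto simp: smooth_differentiable_on smooth_partial intro: smooth_alg.base)
next
  case (const c)
  have "partial i (\<lambda>x. c) = (\<lambda>x. 0)" for i :: 'a by (rule ext, rule partial_eq) auto
  then show ?case by (auto intro: smooth_alg.const)
next
  case (add f g)
  note d = differentiable_has_derivative_partial[of f] differentiable_has_derivative_partial[of g]
  have D: "((\<lambda>x. f x + g x) has_derivative (\<lambda>h. (\<Sum>i\<in>Basis. (h \<bullet> i) * partial i f x) + (\<Sum>i\<in>Basis. (h \<bullet> i) * partial i g x))) (at x)" for x
    using add by (intro has_derivative_add d) auto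
  have "partial i (\<lambda>x. f x + g x) = (\<lambda>x. partial i f x + partial i g x)" if "i \<in> Basis" for i
    by (rule ext, subst partial_eq[OF D]) (simp add: partial_delta that)
  then show ?case using has_derivative_imp_diff_on[OF D] add by (auto intro: smooth_alg.add)
next
  case (mult f g)
  note d = differentiable_has_derivative_partial[of f] differentiable_has_derivative_partial[of g]
  have D: "((\<lambda>x. f x * g x) has_derivative (\<lambda>h. f x * (\<Sum>i\<in>Basis. (h \<bullet> i) * partial i g x) + (\<Sum>i\<in>Basis. (h \<bullet> i) * partial i f x) * g x)) (at x)" for x
    using mult by (intro has_derivative_mult d) auto
  have "partial i (\<lambda>x. f x * g x) = (\<lambda>x. f x * partial i g x + partial i f x * g x)" if "i \<in> Basis" for i
    by (rule ext, subst partial_eq[OF D]) (simp add: partial_delta that)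
  then show ?case using has_derivative_imp_diff_on[OF D] mult
    by (auto intro!: smooth_alg.add smooth_alg.mult)
next
  case (comp F g)
  note d = differentiable_has_derivative_partial[of g]
  have DF: "(F has_derivative (\<lambda>h. h * partial 1 F y)) (at y)" for y
    using smooth_has_derivative[OF comp(1), of y] by simp
  have D: "((\<lambda>x. F (g x)) has_derivative (\<lambda>h. (\<Sum>i\<in>Basis. (h \<bullet> i) * partial i g x) * partial 1 F (g x))) (at x)" for x
    using has_derivative_compose[OF d DF, of x] comp by simp
  have P: "partial i (\<lambda>x. F (g x)) = (\<lambda>x. partial i g x * partial 1 F (g x))" if "i \<in> Basis" for i
    by (rule ext, subst partial_eq[OF D]) (simp add: partial_delta that)
  have "smooth (partial 1 F)" using smooth_partial[OF comp(1), of 1] by simp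
  then have "(\<lambda>x. partial i g x * partial 1 F (g x)) \<in> smooth_alg" if "i \<in> Basis" for i
    by (intro smooth_alg.mult smooth_alg.comp[of "partial 1 F" g]) (use comp that in auto)
  then show ?case using has_derivative_imp_diff_on[OF D] P by simp
qed

lemma smooth_alg_iff: "f \<in> smooth_alg \<longleftrightarrow> smooth f"
proof
  assume "f \<in> smooth_alg"
  then show "smooth f" by (rule smooth_coinduct) (simp_all add: smooth_alg_derivative)
qed (rule smooth_alg.base)

lemmas smooth_const = smooth_alg.const[unfolded smooth_alg_iff]
lemmas smooth_add = smooth_alg.add[unfolded smooth_alg_iff]
lemmas smooth_mult = smooth_alg.mult[unfolded smooth_alg_iff]
lemmas smooth_comp = smooth_alg.comp[unfolded smooth_alg_iff]

lemma partial_const: "partial i (\<lambda>x. c) = (\<lambda>x. 0)"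
  by (rule ext, rule partial_eq) auto

lemma partial_add:
  assumes "smooth f" "smooth g" "i \<in> Basis"
  shows "partial i (\<lambda>x. f x + g x) = (\<lambda>x. partial i f x + partial i g x)"
  by (rule ext, subst partial_eq[OF has_derivative_add[OF smooth_has_derivative smooth_has_derivative]])
    (simp_all add: assms partial_delta)

lemma partial_mult:
  assumes "smooth f" "smooth g" "i \<in> Basis"
  shows "partial i (\<lambda>x. f x * g x) = (\<lambda>x. f x * partial i g x + partial i f x * g x)"
  by (rule ext, subst partial_eq[OF has_derivative_mult[OF smooth_has_derivative smooth_has_derivative]])
    (simp_all add: assms partial_delta)

lemma partial_comp:
  assumes "smooth (F :: real \<Rightarrow> real)" "smooth g" "i \<in> Basis"
  shows "partial i (\<lambda>x. F (g x)) = (\<lambda>x. partial i g x * partial 1 F (g x))"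
  by (rule ext, subst partial_eq[OF has_derivative_compose[OF smooth_has_derivative smooth_has_derivative]])
    (simp_all add: assms partial_delta)

lemma smooth_comb: "smooth f \<Longrightarrow> smooth g \<Longrightarrow> smooth (\<lambda>x. a * f x + b * g x)"
  by (intro smooth_add smooth_mult smooth_const)

lemma smooth_power: "smooth f \<Longrightarrow> smooth (\<lambda>x. f x ^ n)"
  by (induction n) (auto intro: smooth_const smooth_mult)

lemma smooth_prod: "finite I \<Longrightarrow> (\<And>i. i \<in> I \<Longrightarrow> smooth (f i)) \<Longrightarrow> smooth (\<lambda>x. \<Prod>i\<in>I. f i x)"
  by (induction I rule: finite_induct) (auto intro: smooth_const smooth_mult)

lemma partial_inner: "partial i (\<lambda>x. x \<bullet> b) = (\<lambda>x. i \<bullet> b)"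
  by (rule ext, rule partial_eq) (auto intro: derivative_eq_intros)

lemma smooth_inner: "smooth (\<lambda>x. x \<bullet> b)"
proof (rule smooth_coinduct[where C = "insert (\<lambda>x. x \<bullet> b) (range (\<lambda>c x. c))"])
  show "g differentiable_on UNIV" if "g \<in> insert (\<lambda>x. x \<bullet> b) (range (\<lambda>c x. c))" for g :: "'a \<Rightarrow> real"
    using that bounded_linear_imp_differentiable_on[OF bounded_linear_inner_left] by auto
qed (auto simp: partial_inner partial_const)

text \<open>The witness class carries a scalar factor because every differentiation changes the
  sign.\<close>

lemma smooth_reflect:
  assumes "smooth f" shows "smooth (\<lambda>y. f (x - y))"
    and "i \<in> Basis \<Longrightarrow> partial i (\<lambda>y. f (x - y)) = (\<lambda>y. - partial i f (x - y))"
proof -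
  have D: "((\<lambda>y. c * g (x - y)) has_derivative (\<lambda>h. c * (\<Sum>i\<in>Basis. ((- h) \<bullet> i) * partial i g (x - y)))) (at y)"
    if "smooth g" for c y and g :: "'a \<Rightarrow> real"
  proof -
    have "((\<lambda>y. x - y) has_derivative (\<lambda>h. - h)) (at y)" by (auto intro!: derivative_eq_intros)
    from has_derivative_compose[OF this smooth_has_derivative[OF that]]
    show ?thesis by (intro has_derivative_mult_right) auto
  qed
  have P: "partial i (\<lambda>y. c * g (x - y)) = (\<lambda>y. (-c) * partial i g (x - y))" if "smooth g" "i \<in> Basis" for i c g
    by (rule ext, subst partial_eq[OF D[OF that(1)]])
      (use partial_delta[OF that(2)] in \<open>simp add: sum_negf\<close>)
  show "smooth (\<lambda>y. f (x - y))"
  proof (rule smooth_coinduct[where C = "{\<lambda>y. c * g (x - y) | c g. smooth g}"])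
    show "(\<lambda>y. f (x - y)) \<in> {\<lambda>y. c * g (x - y) | c g. smooth g}"
      using assms by (intro CollectI exI[of _ 1] exI[of _ f]) simp
    show "g differentiable_on UNIV" if "g \<in> {\<lambda>y. c * g (x - y) | c g. smooth g}" for g
      using that has_derivative_imp_diff_on[OF D] by auto
    show "partial i g \<in> {\<lambda>y. c * g (x - y) | c g. smooth g}"
      if g: "g \<in> {\<lambda>y. c * g (x - y) | c g. smooth g}" and i: "i \<in> Basis" for g i
    proof -
      obtain c h where "g = (\<lambda>y. c * h (x - y))" "smooth h" using g by blast
      then show ?thesis using P[of h i c] smooth_partial i
        by (intro CollectI exI[of _ "-c"] exI[of _ "partial i h"]) auto
    qed
  qed
  show "partial i (\<lambda>y. f (x - y)) = (\<lambda>y. - partial i f (x - y))" if "i \<in> Basis"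
    using P[OF assms that, of 1] by simp
qed

section \<open>Bump functions\<close>

text \<open>The flat function exp(-1/s) times a power of 1/s. The whole family is introduced because
  differentiation raises the exponent \<open>m\<close> by one and by two.\<close>

definition exp_bump :: "nat \<Rightarrow> real \<Rightarrow> real" where
  "exp_bump m s = (if s > 0 then inverse s ^ m * exp (- inverse s) else 0)"

lemma exp_bump_at_0: "((\<lambda>s. exp_bump m s) \<longlongrightarrow> 0) (at 0)"
proof -
  have "((\<lambda>s. exp_bump m s) \<longlongrightarrow> 0) (at_left 0)"
    by (rule Lim_transform_eventually[OF tendsto_const])
      (auto simp: exp_bump_def eventually_at_filter)
  moreover have "((\<lambda>s. exp_bump m s) \<longlongrightarrow> 0) (at_right 0)"
  proof (rule Lim_transform_eventually)
    show "((\<lambda>s. inverse s ^ m / exp (inverse s)) \<longlongrightarrow> 0) (at_right (0::real))"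
      by (rule filterlim_compose[OF tendsto_power_div_exp_0 filterlim_inverse_at_top_right])
    show "\<forall>\<^sub>F s in at_right 0. inverse s ^ m / exp (inverse s) = exp_bump m s"
      by (auto simp: exp_bump_def eventually_at_filter exp_minus divide_inverse)
  qed
  ultimately show ?thesis by (simp add: filterlim_split_at)
qed

lemma exp_bump_derivative:
  "(exp_bump m has_real_derivative (exp_bump (m + 2) s - m * exp_bump (m + 1) s)) (at s)"
proof -
  consider "s > 0" | "s < 0" | "s = 0" by linarith
  then show ?thesis
  proof cases
    case 1
    have "((\<lambda>s. inverse s ^ m * exp (- inverse s)) has_real_derivative
       (exp_bump (m + 2) s - m * exp_bump (m + 1) s)) (at s)"
      using 1 by (auto intro!: derivative_eq_intros simp: exp_bump_def power2_eq_square algebra_simps)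
        (cases m; simp add: power_Suc algebra_simps)
    then show ?thesis
      by (rule has_field_derivative_transform_within_open[of _ _ _ "{0<..}"])
        (use 1 in \<open>auto simp: exp_bump_def\<close>)
  next
    case 2
    have "((\<lambda>s. 0) has_real_derivative (exp_bump (m + 2) s - m * exp_bump (m + 1) s)) (at s)"
      using 2 by (simp add: exp_bump_def)
    then show ?thesis
      by (rule has_field_derivative_transform_within_open[of _ _ _ "{..<0}"])
        (use 2 in \<open>auto simp: exp_bump_def\<close>)
  next
    case 3
    have "((\<lambda>h. (exp_bump m h - exp_bump m 0) / (h - 0)) \<longlongrightarrow> 0) (at 0)"
    \<comment> \<open>At 0 the difference quotient of \<open>exp_bump m\<close> is the member of
      index \<open>Suc m\<close>, which tends to 0.\<close>
    proof (rule Lim_transform_eventually[OF exp_bump_at_0[of "Suc m"]])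
      show "\<forall>\<^sub>F h in at 0. exp_bump (Suc m) h = (exp_bump m h - exp_bump m 0) / (h - 0)"
        by (auto simp: exp_bump_def eventually_at_filter divide_inverse)
    qed
    then show ?thesis using 3 by (simp add: has_field_derivative_iff exp_bump_def)
  qed
qed

inductive_set exp_bump_span :: "(real \<Rightarrow> real) set" where
  base: "exp_bump m \<in> exp_bump_span"
| comb: "f \<in> exp_bump_span \<Longrightarrow> g \<in> exp_bump_span \<Longrightarrow> (\<lambda>s. a * f s + b * g s) \<in> exp_bump_span"

lemma partial_real: "(f has_real_derivative D) (at s) \<Longrightarrow> partial 1 f s = D"
  using partial_eq[of f "(*) D" s 1] by (simp add: has_field_derivative_def)

lemma smooth_exp_bump: "smooth (exp_bump m)"
proof (rule smooth_coinduct[where C = exp_bump_span])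
  have "\<exists>f'. f' \<in> exp_bump_span \<and> (\<forall>s. (f has_real_derivative f' s) (at s))" if "f \<in> exp_bump_span" for f
    using that
  proof induction
    case (base m)
    have "(\<lambda>s. 1 * exp_bump (m + 2) s + (- real m) * exp_bump (m + 1) s) \<in> exp_bump_span"
      by (intro exp_bump_span.intros)
    then show ?case using exp_bump_derivative[of m] by (intro exI conjI) auto
  next
    case (comb f g a b)
    then obtain f' g' where "f' \<in> exp_bump_span" "g' \<in> exp_bump_span"
      "\<And>s. (f has_real_derivative f' s) (at s)" "\<And>s. (g has_real_derivative g' s) (at s)" by metis
    then show ?case
      by (intro exI[of _ "\<lambda>s. a * f' s + b * g' s"]) (auto intro!: exp_bump_span.comb derivative_eq_intros)
  qed
  then obtain d where d: "\<And>f. f \<in> exp_bump_span \<Longrightarrow> d f \<in> exp_bump_span \<and> (\<forall>s. (f has_real_derivative d f s) (at s))"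
    by metis
  fix g assume g: "g \<in> exp_bump_span"
  show "g differentiable_on UNIV"
    using d[OF g] by (intro has_derivative_imp_diff_on[of g "\<lambda>x. (*) (d g x)"]) (simp add: has_field_derivative_def)
  fix i :: real assume "i \<in> Basis"
  then have "partial i g = d g" using partial_real d[OF g] by auto
  then show "partial i g \<in> exp_bump_span" using d[OF g] by simp
qed (rule exp_bump_span.base)

lemma exp_bump_0: "0 \<le> exp_bump 0 s" "exp_bump 0 s \<le> 1" "exp_bump 0 s > 0 \<longleftrightarrow> s > 0" "exp_bump 0 s = 0 \<longleftrightarrow> s \<le> 0"
  by (auto simp: exp_bump_def)

text \<open>One factor for each of the two bounds in every coordinate, so that the function is
  positive precisely in the open box.\<close>

definition box_bump :: "'a::euclidean_space \<Rightarrow> 'a \<Rightarrow> 'a \<Rightarrow> real" where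
  "box_bump a b x = (\<Prod>i\<in>Basis. exp_bump 0 (x \<bullet> i - a \<bullet> i) * exp_bump 0 (b \<bullet> i - x \<bullet> i))"

lemma smooth_box_bump: "smooth (box_bump a b)"
proof -
  have "smooth (\<lambda>x. x \<bullet> i + - (a \<bullet> i))" "smooth (\<lambda>x. b \<bullet> i + (-1) * (x \<bullet> i))" for i
    by (intro smooth_add smooth_mult smooth_inner smooth_const)+
  then have "smooth (\<lambda>x. \<Prod>i\<in>Basis. exp_bump 0 (x \<bullet> i + - (a \<bullet> i)) * exp_bump 0 (b \<bullet> i + (-1) * (x \<bullet> i)))"
    by (intro smooth_prod smooth_mult smooth_comp[OF smooth_exp_bump]) auto
  then show ?thesis unfolding box_bump_def[abs_def] by simp
qed

lemma box_bump_nonneg: "0 \<le> box_bump a b x"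
  unfolding box_bump_def by (intro prod_nonneg) (simp add: exp_bump_0)

lemma box_bump_le_1: "box_bump a b x \<le> 1"
  unfolding box_bump_def
  by (intro prod_le_1) (auto simp: exp_bump_0 intro!: mult_le_one)

lemma box_bump_pos_iff: "box_bump a b x \<noteq> 0 \<longleftrightarrow> x \<in> box a b"
  by (auto simp: box_bump_def exp_bump_0 mem_box not_le)

section \<open>Test functions\<close>

lemma testD:
  assumes "\<phi> \<in> test_functions E"
  shows "smooth \<phi>" "compact (closure {x. \<phi> x \<noteq> 0})" "closure {x. \<phi> x \<noteq> 0} \<subseteq> E"
    "x \<notin> E \<Longrightarrow> \<phi> x = 0"
  using assms closure_subset[of "{x. \<phi> x \<noteq> 0}"] by (auto simp: test_functions_def)

lemma testI:
  assumes "smooth \<phi>" "compact K" "{x. \<phi> x \<noteq> 0} \<subseteq> K" "K \<subseteq> E"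
  shows "\<phi> \<in> test_functions E"
proof -
  have c: "closure {x. \<phi> x \<noteq> 0} \<subseteq> K" using assms by (intro closure_minimal compact_imp_closed)
  then have "compact (closure {x. \<phi> x \<noteq> 0})"
    using assms(2) bounded_subset compact_imp_bounded by (auto simp: compact_eq_bounded_closed)
  then show ?thesis using c assms by (auto simp: test_functions_def)
qed

lemma test_mono: "\<phi> \<in> test_functions F \<Longrightarrow> F \<subseteq> E \<Longrightarrow> \<phi> \<in> test_functions E"
  by (auto simp: test_functions_def)

lemma lin_space_test: "lin_space (test_functions E)"
  unfolding lin_space_def
proof (intro conjI ballI allI)
  show "(\<lambda>x. 0) \<in> test_functions E" by (rule testI[of _ "{}"]) (auto intro: smooth_const)
  fix u v a b assume u: "u \<in> test_functions E" and v: "v \<in> test_functions E"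
  show "(\<lambda>x. a * u x + b * v x) \<in> test_functions E"
  proof (rule testI[of _ "closure {x. u x \<noteq> 0} \<union> closure {x. v x \<noteq> 0}"])
    show "{x. a * u x + b * v x \<noteq> 0} \<subseteq> closure {x. u x \<noteq> 0} \<union> closure {x. v x \<noteq> 0}"

    proof (rule subsetI, rule ccontr)
      fix x assume x: "x \<in> {x. a * u x + b * v x \<noteq> 0}" "x \<notin> closure {x. u x \<noteq> 0} \<union> closure {x. v x \<noteq> 0}"
      have "u x = 0" using x(2) closure_subset[of "{x. u x \<noteq> 0}"] by auto
      moreover have "v x = 0" using x(2) closure_subset[of "{x. v x \<noteq> 0}"] by auto
      ultimately show False using x(1) by simp
    qed
  qed (use testD[OF u] testD[OF v] in \<open>simp_all add: smooth_comb compact_Un\<close>)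
qed

lemma test_mult: "smooth g \<Longrightarrow> \<phi> \<in> test_functions E \<Longrightarrow> (\<lambda>x. g x * \<phi> x) \<in> test_functions E"
  using closure_subset[of "{x. \<phi> x \<noteq> 0}"]
  by (intro testI[of _ "closure {x. \<phi> x \<noteq> 0}"]) (auto intro: smooth_mult dest: testD)

lemma partial_zero_open:
  assumes "open A" "\<And>y. y \<in> A \<Longrightarrow> f y = 0" "x \<in> A"
  shows "partial i f x = 0"
proof -
  have "((\<lambda>x. 0) has_derivative (\<lambda>h. 0)) (at x)" by simp
  from has_derivative_transform_within_open[OF this assms(1,3)] assms(2)
  have "(f has_derivative (\<lambda>h. 0)) (at x)" by auto
  from partial_eq[OF this] show ?thesis .
qed

lemma test_partial:
  assumes "\<phi> \<in> test_functions E" "i \<in> Basis" shows "partial i \<phi> \<in> test_functions E"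
proof (rule testI[of _ "closure {x. \<phi> x \<noteq> 0}"])
  have "partial i \<phi> x = 0" if "x \<notin> closure {x. \<phi> x \<noteq> 0}" for x
    by (rule partial_zero_open[of "- closure {x. \<phi> x \<noteq> 0}"])
      (use that closure_subset[of "{x. \<phi> x \<noteq> 0}"] in auto)
  then show "{x. partial i \<phi> x \<noteq> 0} \<subseteq> closure {x. \<phi> x \<noteq> 0}" by blast
qed (use testD[OF assms(1)] assms(2) in \<open>auto intro: smooth_partial\<close>)

lemma test_L2: "E \<in> sets lebesgue \<Longrightarrow> bounded E \<Longrightarrow> smooth \<phi> \<Longrightarrow> \<phi> \<in> L2 E"
  by (intro L2_continuous smooth_continuous)

text \<open>The partial derivatives have compact support and are therefore bounded. The estimate
  will dominate difference quotients.\<close>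

lemma test_lipschitz:
  fixes \<phi> :: "'a::euclidean_space \<Rightarrow> real"
  assumes "\<phi> \<in> test_functions E"
  shows "\<exists>B. \<forall>x y. \<bar>\<phi> x - \<phi> y\<bar> \<le> B * norm (x - y)"
proof -
  have "\<exists>B. \<forall>x. \<bar>partial i \<phi> x\<bar> \<le> B" if "i \<in> Basis" for i
  proof -
    have t: "partial i \<phi> \<in> test_functions E" using test_partial[OF assms that] .
    let ?K = "closure {x. partial i \<phi> x \<noteq> 0}"
    have "compact (partial i \<phi> ` ?K)"
      by (intro compact_continuous_image smooth_continuous testD[OF t])
    then obtain B where "\<And>y. y \<in> partial i \<phi> ` ?K \<Longrightarrow> \<bar>y\<bar> \<le> B"
      using compact_imp_bounded bounded_iff real_norm_def by metis
    then have "\<bar>partial i \<phi> x\<bar> \<le> max B 0" for x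
      using closure_subset[of "{x. partial i \<phi> x \<noteq> 0}"] by (cases "partial i \<phi> x = 0") (auto simp: le_max_iff_disj)
    then show ?thesis by blast
  qed
  then obtain B where B: "\<And>i x. i \<in> Basis \<Longrightarrow> \<bar>partial i \<phi> x\<bar> \<le> B i" by metis
  have "\<bar>\<phi> x - \<phi> y\<bar> \<le> (\<Sum>i\<in>Basis. B i) * norm (x - y)" for x y
  proof -
    have "norm (\<phi> x - \<phi> y) \<le> (\<Sum>i\<in>Basis. B i) * norm (x - y)"
    proof (rule differentiable_bound[OF convex_UNIV])
      show "(\<phi> has_derivative (\<lambda>h. \<Sum>i\<in>Basis. (h \<bullet> i) * partial i \<phi> z)) (at z within UNIV)" for z
        using smooth_has_derivative[OF testD(1)[OF assms], of z] by simp
      show "onorm (\<lambda>h. \<Sum>i\<in>Basis. (h \<bullet> i) * partial i \<phi> z) \<le> (\<Sum>i\<in>Basis. B i)" for z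
      proof (rule onorm_le)
        fix h :: 'a
        have "norm (\<Sum>i\<in>Basis. (h \<bullet> i) * partial i \<phi> z) \<le> (\<Sum>i\<in>Basis. norm h * B i)"
        proof (rule sum_norm_le)
          fix i :: 'a assume "i \<in> Basis"
          then show "norm ((h \<bullet> i) * partial i \<phi> z) \<le> norm h * B i"
            using Basis_le_norm[of i h] B[of i z] by (auto simp: abs_mult intro!: mult_mono)
        qed
        also have "\<dots> = (\<Sum>i\<in>Basis. B i) * norm h" by (simp add: sum_distrib_left mult.commute)
        finally show "norm (\<Sum>i\<in>Basis. (h \<bullet> i) * partial i \<phi> z) \<le> (\<Sum>i\<in>Basis. B i) * norm h" .
      qed
    qed auto
    then show ?thesis by simp
  qed
  then show ?thesis by blast
qed

section \<open>Integration by parts against test functions\<close>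

lemma lborel_integral_translation:
  fixes f :: "'a::euclidean_space \<Rightarrow> real"
  assumes "f \<in> borel_measurable borel"
  shows "(LINT x|lborel. f (c + x)) = (LINT x|lborel. f x)"
proof -
  have "(LINT x|lborel. f x) = (LINT x|distr lborel borel ((+) c). f x)" by (simp add: lborel_distr_plus)
  also have "\<dots> = (LINT x|lborel. f (c + x))"
    by (rule integral_distr) (use assms in auto)
  finally show ?thesis by simp
qed

lemma continuous_compact_support_integrable:
  fixes f :: "'a::euclidean_space \<Rightarrow> real"
  assumes "continuous_on UNIV f" "bounded {x. f x \<noteq> 0}"
  shows "integrable lborel f"
proof -
  obtain r where r: "{x. f x \<noteq> 0} \<subseteq> cball 0 r" using assms(2) by (force simp: bounded_iff)
  have "set_integrable lborel (cball 0 r) f"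
    unfolding set_integrable_def by (rule borel_integrable_compact) (auto intro: continuous_on_subset[OF assms(1)])
  moreover have "(\<lambda>x. indicator (cball 0 r) x *\<^sub>R f x) = f"
    using r by (intro ext) (auto simp: indicator_def)
  ultimately show ?thesis by (simp add: set_integrable_def)
qed

text \<open>The derivative is a limit of difference quotients, each of which has integral 0 by
  translation invariance.\<close>

lemma integral_partial_test:
  fixes \<phi> :: "'a::euclidean_space \<Rightarrow> real"
  assumes \<phi>: "\<phi> \<in> test_functions E" and i: "i \<in> Basis"
  shows "(LINT x|lborel. partial i \<phi> x) = 0"
proof -
  have sm: "smooth \<phi>" using testD[OF \<phi>] by simp
  have cont: "continuous_on UNIV \<phi>" by (rule smooth_continuous[OF sm])
  have meas: "\<phi> \<in> borel_measurable borel" by (rule borel_measurable_continuous_onI[OF cont])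
  have bd: "bounded {x. \<phi> x \<noteq> 0}" using compact_imp_bounded[OF testD(2)[OF \<phi>]] closure_subset bounded_subset by blast
  obtain r where r: "{x. \<phi> x \<noteq> 0} \<subseteq> cball 0 r" using bd by (force simp: bounded_iff)
  obtain B where B: "\<And>x y. \<bar>\<phi> x - \<phi> y\<bar> \<le> B * norm (x - y)" using test_lipschitz[OF \<phi>] by blast
  define D where "D = (\<lambda>j x. real (Suc j) * (\<phi> ((1 / real (Suc j)) *\<^sub>R i + x) - \<phi> x))"
  have "(\<lambda>j. LINT x|lborel. D j x) \<longlonglongrightarrow> (LINT x|lborel. partial i \<phi> x)"
  \<comment> \<open>The steps \<open>1 / real (Suc j)\<close> are at most 1, so all quotients vanish
    off a ball of radius \<open>r + 1\<close>, and on it the Lipschitz constant bounds them.\<close>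
  proof (rule integral_dominated_convergence[where w = "\<lambda>x. B * indicator (cball 0 (r + 1)) x"])
    show "partial i \<phi> \<in> borel_measurable lborel"
      using borel_measurable_continuous_onI[OF smooth_continuous[OF smooth_partial[OF sm i]]] by simp
    show "D j \<in> borel_measurable lborel" for j unfolding D_def using meas by measurable
    have "emeasure lborel (cball (0::'a) (r + 1)) < \<infinity>"
      by (rule emeasure_bounded_finite) simp
    then show "integrable lborel (\<lambda>x. B * indicator (cball (0::'a) (r + 1)) x :: real)"
      by (intro integrable_mult_right integrable_real_indicator) auto
    show "AE x in lborel. (\<lambda>j. D j x) \<longlonglongrightarrow> partial i \<phi> x"
    proof (rule AE_I2)
      fix x
      have "((\<lambda>s. \<phi> (x + s *\<^sub>R i)) has_vector_derivative partial i \<phi> x) (at 0)"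
      proof -
        have "((\<lambda>s::real. x + s *\<^sub>R i) has_derivative (\<lambda>s. s *\<^sub>R i)) (at 0)"
          by (auto intro!: derivative_eq_intros)
        from has_derivative_compose[OF this, of \<phi> "\<lambda>h. \<Sum>i\<in>Basis. (h \<bullet> i) * partial i \<phi> x"] smooth_has_derivative[OF sm, of x]
        have "((\<lambda>s. \<phi> (x + s *\<^sub>R i)) has_derivative (\<lambda>s. \<Sum>j\<in>Basis. ((s *\<^sub>R i) \<bullet> j) * partial j \<phi> x)) (at 0)"
          by simp
        moreover have "(\<Sum>j\<in>Basis. ((s *\<^sub>R i) \<bullet> j) * partial j \<phi> x) = s *\<^sub>R partial i \<phi> x" for s
          using partial_delta[OF i, of "\<lambda>j. partial j \<phi> x"] by (simp add: sum_distrib_left[symmetric] mult.assoc)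
        ultimately show ?thesis by (simp add: has_vector_derivative_def)
      qed
      then have "((\<lambda>s. \<phi> (x + s *\<^sub>R i)) has_real_derivative partial i \<phi> x) (at 0)"
        by (simp add: has_real_derivative_iff_has_vector_derivative)
      then have "((\<lambda>s. (\<phi> (x + s *\<^sub>R i) - \<phi> x) / s) \<longlongrightarrow> partial i \<phi> x) (at 0)"
        by (simp add: has_field_derivative_iff)
      moreover have "filterlim (\<lambda>j. 1 / real (Suc j)) (at 0) sequentially"
      proof (rule filterlim_atI)
        show "(\<lambda>j. 1 / real (Suc j)) \<longlonglongrightarrow> 0" using LIMSEQ_inverse_real_of_nat by (simp add: inverse_eq_divide)
      qed auto
      ultimately have "(\<lambda>j. (\<phi> (x + (1 / real (Suc j)) *\<^sub>R i) - \<phi> x) / (1 / real (Suc j))) \<longlonglongrightarrow> partial i \<phi> x"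
        by (rule filterlim_compose)
      moreover have "(\<phi> (x + (1 / real (Suc j)) *\<^sub>R i) - \<phi> x) / (1 / real (Suc j)) = D j x" for j
        by (simp add: D_def add.commute mult.commute)
      ultimately show "(\<lambda>j. D j x) \<longlonglongrightarrow> partial i \<phi> x" by simp
    qed
    show "AE x in lborel. norm (D j x) \<le> B * indicator (cball 0 (r + 1)) x" for j
    proof (rule AE_I2)
      fix x :: 'a
      have n1: "norm ((1 / real (Suc j)) *\<^sub>R i) \<le> 1" using i by (simp add: norm_Basis)
      show "norm (D j x) \<le> B * indicator (cball 0 (r + 1)) x"
      proof (cases "x \<in> cball 0 (r + 1)")
        case True
        have "norm (D j x) = real (Suc j) * \<bar>\<phi> ((1 / real (Suc j)) *\<^sub>R i + x) - \<phi> x\<bar>"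
          by (simp add: D_def abs_mult)
        also have "\<dots> \<le> real (Suc j) * (B * norm ((1 / real (Suc j)) *\<^sub>R i))"
          using B[of "(1 / real (Suc j)) *\<^sub>R i + x" x] by (intro mult_left_mono) auto
        also have "\<dots> = B" using i by (simp add: norm_Basis)
        finally show ?thesis using True by simp
      next
        case False
        then have nx: "norm x > r + 1" by simp
        then have "\<phi> x = 0" using r by (force simp: subset_iff)
        moreover have "norm x - norm ((1 / real (Suc j)) *\<^sub>R i) \<le> norm ((1 / real (Suc j)) *\<^sub>R i + x)"
          by (metis add.commute norm_diff_ineq)
        then have "norm ((1 / real (Suc j)) *\<^sub>R i + x) > r" using n1 nx by linarith
        then have "\<phi> ((1 / real (Suc j)) *\<^sub>R i + x) = 0" using r by (force simp: subset_iff)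
        ultimately show ?thesis using False by (simp add: D_def)
      qed
    qed
  qed
  moreover have "(LINT x|lborel. D j x) = 0" for j
  proof -
    have int: "integrable lborel \<phi>" by (rule continuous_compact_support_integrable[OF cont bd])
    have int': "integrable lborel (\<lambda>x. \<phi> (c + x))" for c
    proof -
      have "integrable (distr lborel borel ((+) c)) \<phi>" using int by (simp add: lborel_distr_plus)
      then show ?thesis using meas by (subst (asm) integrable_distr_eq) auto
    qed
    show ?thesis unfolding D_def
      using int int' lborel_integral_translation[OF meas] by simp
  qed
  ultimately show ?thesis by (simp add: LIMSEQ_const_iff)
qed

text \<open>The product of \<open>g\<close> and \<phi> is again a test function, so its derivative
  has integral 0; the product rule does the rest.\<close>

lemma ip_partial_test:
  fixes \<phi> :: "'a::euclidean_space \<Rightarrow> real"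
  assumes E: "E \<in> sets lebesgue" "bounded E" and g: "smooth g" and \<phi>: "\<phi> \<in> test_functions E" and i: "i \<in> Basis"
  shows "ip E g (partial i \<phi>) = - ip E (partial i g) \<phi>"
proof -
  have g\<phi>: "(\<lambda>x. g x * \<phi> x) \<in> test_functions E" by (rule test_mult[OF g \<phi>])
  have p: "partial i (\<lambda>x. g x * \<phi> x) = (\<lambda>x. g x * partial i \<phi> x + partial i g x * \<phi> x)"
    by (rule partial_mult[OF g testD(1)[OF \<phi>] i])
  have m: "partial i (\<lambda>x. g x * \<phi> x) \<in> borel_measurable lborel"
    using borel_measurable_continuous_onI[OF smooth_continuous[OF testD(1)[OF test_partial[OF g\<phi> i]]]] by simp
  have "ip E g (partial i \<phi>) + ip E (partial i g) \<phi>
      = (LINT x|lebesgue. indicator E x * (g x * partial i \<phi> x) + indicator E x * (partial i g x * \<phi> x))"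
    unfolding ip_eq using E g \<phi> i
    by (intro Bochner_Integration.integral_add[symmetric] L2_prod_integrable test_L2) (auto dest: testD intro: smooth_partial)
  also have "\<dots> = (LINT x|lebesgue. partial i (\<lambda>x. g x * \<phi> x) x)"
    using testD(4)[OF \<phi>] testD(4)[OF test_partial[OF \<phi> i]]
    by (intro Bochner_Integration.integral_cong refl) (auto simp: p indicator_def)
  also have "\<dots> = (LINT x|lborel. partial i (\<lambda>x. g x * \<phi> x) x)"
    by (rule integral_completion[OF m])
  also have "\<dots> = 0" by (rule integral_partial_test[OF g\<phi> i])
  finally show ?thesis by simp
qed

section \<open>Density of test functions\<close>

definition test_closure :: "'a::euclidean_space set \<Rightarrow> ('a \<Rightarrow> real) set" where
  "test_closure E = {w \<in> L2 E. \<forall>e>0. \<exists>\<zeta>\<in>test_functions E. ip E (\<lambda>x. w x - \<zeta> x) (\<lambda>x. w x - \<zeta> x) < e}"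

lemma ip_square_comb_le:
  assumes "u \<in> L2 E" "v \<in> L2 E"
  shows "ip E (\<lambda>x. a * u x + b * v x) (\<lambda>x. a * u x + b * v x) \<le> 2 * (a\<^sup>2 * ip E u u) + 2 * (b\<^sup>2 * ip E v v)"
  by (rule psd_parallelogram[OF lin_space_L2 psd_ip assms])

lemma test_closure_closed:
  assumes E: "E \<in> sets lebesgue" "bounded E" and w: "w \<in> L2 E"
    and ap: "\<And>e. e > 0 \<Longrightarrow> \<exists>v\<in>test_closure E. ip E (\<lambda>x. w x - v x) (\<lambda>x. w x - v x) < e"
  shows "w \<in> test_closure E"
  unfolding test_closure_def
proof (intro CollectI conjI allI impI w)
  fix e :: real assume "e > 0"
  \<comment> \<open>Squared distances satisfy the triangle inequality only with a factor 2, hence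
    the quarters of \<open>e\<close>.\<close>
  then obtain v where v: "v \<in> test_closure E" "ip E (\<lambda>x. w x - v x) (\<lambda>x. w x - v x) < e / 4"
    using ap[of "e / 4"] by auto
  obtain \<zeta> where \<zeta>: "\<zeta> \<in> test_functions E" "ip E (\<lambda>x. v x - \<zeta> x) (\<lambda>x. v x - \<zeta> x) < e / 4"
    using v(1) \<open>e > 0\<close> unfolding test_closure_def by (auto dest!: spec[of _ "e / 4"])
  have vL: "v \<in> L2 E" using v(1) by (simp add: test_closure_def)
  have "ip E (\<lambda>x. 1 * (w x - v x) + 1 * (v x - \<zeta> x)) (\<lambda>x. 1 * (w x - v x) + 1 * (v x - \<zeta> x)) < e"
    using ip_square_comb_le[OF lin_space_diff[OF lin_space_L2 w vL] lin_space_diff[OF lin_space_L2 vL test_L2[OF E testD(1)[OF \<zeta>(1)]]], of 1 1]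
      v(2) \<zeta>(2) by simp
  then show "\<exists>\<zeta>\<in>test_functions E. ip E (\<lambda>x. w x - \<zeta> x) (\<lambda>x. w x - \<zeta> x) < e"
    using \<zeta>(1) by (intro bexI[of _ \<zeta>]) simp_all
qed

lemma test_in_closure: "E \<in> sets lebesgue \<Longrightarrow> bounded E \<Longrightarrow> \<phi> \<in> test_functions E \<Longrightarrow> \<phi> \<in> test_closure E"
  unfolding test_closure_def
  by (auto intro!: bexI[of _ \<phi>] test_L2 dest: testD simp: ip_eq)

lemma lin_space_test_closure:
  assumes E: "E \<in> sets lebesgue" "bounded E"
  shows "lin_space (test_closure E)"
  unfolding lin_space_def
proof (intro conjI ballI allI)
  show "(\<lambda>x. 0) \<in> test_closure E" by (rule test_in_closure[OF E lin_space_0[OF lin_space_test]])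
  fix u v a b assume u: "u \<in> test_closure E" and v: "v \<in> test_closure E"
  have uL: "u \<in> L2 E" and vL: "v \<in> L2 E" using u v by (auto simp: test_closure_def)
  show "(\<lambda>x. a * u x + b * v x) \<in> test_closure E"
  proof (rule test_closure_closed[OF E lin_space_comb[OF lin_space_L2 uL vL]])
    fix e :: real assume e: "e > 0"
    \<comment> \<open>Makes \<open>2 * (a\<^sup>2 + b\<^sup>2) * d\<close> at most
      \<open>e / 2\<close>; the summand 1 keeps the denominator positive.\<close>
    define d where "d = e / (4 * (a\<^sup>2 + b\<^sup>2 + 1))"
    have ab: "a\<^sup>2 + b\<^sup>2 + 1 > 0" by (simp add: add_nonneg_pos)
    have d: "d > 0" using e ab by (simp add: d_def)
    obtain \<zeta> \<psi> where \<zeta>: "\<zeta> \<in> test_functions E" "ip E (\<lambda>x. u x - \<zeta> x) (\<lambda>x. u x - \<zeta> x) < d"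
      and \<psi>: "\<psi> \<in> test_functions E" "ip E (\<lambda>x. v x - \<psi> x) (\<lambda>x. v x - \<psi> x) < d"
      using u v d unfolding test_closure_def by blast
    let ?\<theta> = "\<lambda>x. a * \<zeta> x + b * \<psi> x"
    have "ip E (\<lambda>x. a * (u x - \<zeta> x) + b * (v x - \<psi> x)) (\<lambda>x. a * (u x - \<zeta> x) + b * (v x - \<psi> x))
        \<le> 2 * (a\<^sup>2 * ip E (\<lambda>x. u x - \<zeta> x) (\<lambda>x. u x - \<zeta> x)) + 2 * (b\<^sup>2 * ip E (\<lambda>x. v x - \<psi> x) (\<lambda>x. v x - \<psi> x))"
      by (intro ip_square_comb_le lin_space_diff[OF lin_space_L2] uL vL test_L2[OF E] testD(1)[OF \<zeta>(1)] testD(1)[OF \<psi>(1)])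
    also have "\<dots> \<le> 2 * (a\<^sup>2 * d) + 2 * (b\<^sup>2 * d)"
      using \<zeta>(2) \<psi>(2) by (intro add_mono mult_left_mono) auto
    also have "\<dots> \<le> 2 * ((a\<^sup>2 + b\<^sup>2 + 1) * d)" using d by (simp add: algebra_simps)
    also have "\<dots> = e / 2" using ab by (simp add: d_def field_simps)
    also have "\<dots> < e" using e by simp
    finally have "ip E (\<lambda>x. (a * u x + b * v x) - ?\<theta> x) (\<lambda>x. (a * u x + b * v x) - ?\<theta> x) < e"
      by (simp add: algebra_simps)
    then show "\<exists>w\<in>test_closure E. ip E (\<lambda>x. a * u x + b * v x - w x) (\<lambda>x. a * u x + b * v x - w x) < e"
      using test_in_closure[OF E lin_space_comb[OF lin_space_test \<zeta>(1) \<psi>(1)], of a b] by (intro bexI[of _ ?\<theta>])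
  qed
qed

lemma L2_dominated:
  fixes v :: "nat \<Rightarrow> 'a::euclidean_space \<Rightarrow> real"
  assumes v: "\<And>n. v n \<in> L2 E" and w: "w \<in> L2 E" and g: "g \<in> L2 E"
    and bd: "\<And>n x. x \<in> E \<Longrightarrow> \<bar>w x - v n x\<bar> \<le> \<bar>g x\<bar>"
    and lim: "\<And>x. x \<in> E \<Longrightarrow> (\<lambda>n. v n x) \<longlonglongrightarrow> w x"
  shows "(\<lambda>n. ip E (\<lambda>x. w x - v n x) (\<lambda>x. w x - v n x)) \<longlonglongrightarrow> 0"
proof -
  have d: "(\<lambda>x. w x - v n x) \<in> L2 E" for n by (intro lin_space_diff[OF lin_space_L2] v w)
  have "(\<lambda>n. LINT x|lebesgue. indicator E x * ((w x - v n x) * (w x - v n x))) \<longlonglongrightarrow> (LINT x|lebesgue. (\<lambda>x::'a. 0::real) x)"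
  proof (rule integral_dominated_convergence[where w = "\<lambda>x. indicator E x * (g x * g x)" and f = "\<lambda>x. 0"
        and s = "\<lambda>n x. indicator E x * ((w x - v n x) * (w x - v n x))"])
    show "(\<lambda>x. indicator E x * ((w x - v n x) * (w x - v n x))) \<in> borel_measurable lebesgue" for n
      by (rule L2_prod_measurable[OF d d])
    show "integrable lebesgue (\<lambda>x. indicator E x * (g x * g x))" by (rule L2_prod_integrable[OF g g])
    show "AE x in lebesgue. (\<lambda>n. indicator E x * ((w x - v n x) * (w x - v n x))) \<longlonglongrightarrow> 0"
    proof (rule AE_I2)
      fix x show "(\<lambda>n. indicator E x * ((w x - v n x) * (w x - v n x))) \<longlonglongrightarrow> 0"
      proof (cases "x \<in> E")
        case True
        have "(\<lambda>n. w x - v n x) \<longlonglongrightarrow> w x - w x" by (intro tendsto_intros lim True)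
        from tendsto_mult[OF this this] show ?thesis using True by simp
      qed simp
    qed
    show "AE x in lebesgue. norm (indicator E x * ((w x - v n x) * (w x - v n x))) \<le> indicator E x * (g x * g x)" for n
    proof (rule AE_I2)
      fix x
      have "\<bar>w x - v n x\<bar> * \<bar>w x - v n x\<bar> \<le> \<bar>g x\<bar> * \<bar>g x\<bar>" if "x \<in> E" using bd[OF that, of n] by (intro mult_mono) auto
      then show "norm (indicator E x * ((w x - v n x) * (w x - v n x))) \<le> indicator E x * (g x * g x)"
        by (auto simp: indicator_def abs_mult)
    qed
  qed simp
  then show ?thesis by (simp add: ip_eq)
qed

lemma L2_indicator:
  assumes "E \<in> sets lebesgue" "bounded E" "A \<in> sets lebesgue"
  shows "indicator A \<in> L2 E"
proof (rule L2_bounded[OF assms(1,2), of _ 1])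
  show "(\<lambda>x. indicator E x * indicator A x :: real) \<in> borel_measurable lebesgue"
    by (rule borel_measurable_times) (use assms in auto)
qed (auto simp: indicator_def)

text \<open>The open set is a countable union of boxes. The product \<open>q n\<close> of the
  factors 1 minus bump equals 1 outside and is eventually bounded by some number below 1 at each
  inner point. Its growing powers tend to 0 there, so \<open>\<psi> n\<close> tends to the indicator
  while staying between 0 and 1.\<close>

lemma open_indicator_test_closure:
  assumes E: "E \<in> sets lebesgue" "bounded E" and U: "open U" "U \<subseteq> E"
  shows "indicator U \<in> test_closure E"
proof -
  define \<F> where "\<F> = {box a b | a b. cbox a b \<subseteq> U}"
  obtain \<D> where D: "\<D> \<subseteq> \<F>" "countable \<D>" "\<Union>\<D> = \<Union>\<F>"
    using Lindelof[of \<F>] unfolding \<F>_def by (auto simp: open_box)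
  have UF: "\<Union>\<F> = U"
  proof
    show "\<Union>\<F> \<subseteq> U" unfolding \<F>_def using box_subset_cbox by blast
    show "U \<subseteq> \<Union>\<F>"
    proof
      fix x assume "x \<in> U"
      then obtain a b where "x \<in> box a b" "cbox a b \<subseteq> U"
        using open_contains_cbox[OF U(1), of x] by metis
      then show "x \<in> \<Union>\<F>" unfolding \<F>_def by blast
    qed
  qed
  show ?thesis
  proof (cases "\<D> = {}")
    case True
    then have "U = {}" using D UF by auto
    then show ?thesis using lin_space_0[OF lin_space_test_closure[OF E]] by (simp add: indicator_def[abs_def])
  next
    case False
    define X where "X = from_nat_into \<D>"
    have X: "range X = \<D>" unfolding X_def using range_from_nat_into[OF False D(2)] .
    have "\<exists>a b. X n = box a b \<and> cbox a b \<subseteq> U" for n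
      using D(1) X unfolding \<F>_def by blast
    then obtain a b where ab: "\<And>n. X n = box (a n) (b n)" "\<And>n. cbox (a n) (b n) \<subseteq> U" by metis
    have Uab: "U = (\<Union>n. box (a n) (b n))" using X D(3) UF ab(1) by auto
    define q where "q = (\<lambda>n x. \<Prod>m<n. (1 - box_bump (a m) (b m) x))"
    have q01: "0 \<le> q n x" "q n x \<le> 1" for n x
      unfolding q_def using box_bump_nonneg box_bump_le_1 by (auto intro!: prod_nonneg prod_le_1)
    define \<psi> where "\<psi> = (\<lambda>n x. 1 - q n x ^ n)"
    have \<psi>01: "0 \<le> \<psi> n x" "\<psi> n x \<le> 1" for n x
      unfolding \<psi>_def using q01 by (auto intro: power_le_one)
    have \<psi>t: "\<psi> n \<in> test_functions E" for n
    proof (rule testI[of _ "\<Union>m<n. cbox (a m) (b m)"])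
      have "smooth (\<lambda>x. 1 + (-1) * (\<Prod>m<n. (1 + (-1) * box_bump (a m) (b m) x)) ^ n)"
        by (intro smooth_add smooth_const smooth_mult smooth_power smooth_prod smooth_box_bump) auto
      then show "smooth (\<psi> n)" unfolding \<psi>_def q_def by simp
      show "{x. \<psi> n x \<noteq> 0} \<subseteq> (\<Union>m<n. cbox (a m) (b m))"
      proof (rule ccontr)
        assume "\<not> ?thesis"
        then obtain x where x: "\<psi> n x \<noteq> 0" "\<And>m. m < n \<Longrightarrow> x \<notin> cbox (a m) (b m)" by blast
        then have "box_bump (a m) (b m) x = 0" if "m < n" for m
          using box_bump_pos_iff box_subset_cbox that by blast
        then have "q n x = 1" by (simp add: q_def)
        then show False using x(1) by (simp add: \<psi>_def)
      qed
      show "(\<Union>m<n. cbox (a m) (b m)) \<subseteq> E" using ab(2) U(2) by blast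
    qed (auto intro: compact_UN)
    have "indicator U \<in> L2 E" using E U by (intro L2_indicator) auto
    moreover have lim: "(\<lambda>n. \<psi> n x) \<longlonglongrightarrow> indicator U x" for x
    proof (cases "x \<in> U")
      case True
      then obtain k where k: "x \<in> box (a k) (b k)" using Uab by blast
      define s where "s = 1 - box_bump (a k) (b k) x"
      have s: "0 \<le> s" "s < 1"
        using box_bump_pos_iff[of "a k" "b k" x] box_bump_le_1[of "a k" "b k" x] box_bump_nonneg[of "a k" "b k" x] k
        unfolding s_def by linarith+
      have "q n x \<le> s" if "k < n" for n
      proof -
        have "q n x = s * (\<Prod>m\<in>{..<n} - {k}. (1 - box_bump (a m) (b m) x))"
          unfolding q_def s_def using that by (subst prod.remove[of _ k]) auto
        also have "\<dots> \<le> s * 1"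
          using s box_bump_nonneg box_bump_le_1 by (intro mult_left_mono prod_le_1) auto
        finally show ?thesis by simp
      qed
      then have "\<forall>\<^sub>F n in sequentially. q n x ^ n \<le> s ^ n"
        using q01 by (intro eventually_sequentiallyI[of "Suc k"] power_mono) auto
      then have "(\<lambda>n. q n x ^ n) \<longlonglongrightarrow> 0"
        using q01 s LIMSEQ_realpow_zero[of s]
        by (intro tendsto_sandwich[of "\<lambda>_. 0" "\<lambda>n. q n x ^ n" sequentially "\<lambda>n. s ^ n"]) auto
      then have "(\<lambda>n. 1 - q n x ^ n) \<longlonglongrightarrow> 1 - 0" by (intro tendsto_intros)
      then show ?thesis using True by (simp add: \<psi>_def)
    next
      case False
      then have "box_bump (a m) (b m) x = 0" for m
        using box_bump_pos_iff ab(2) box_subset_cbox by blast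
      then show ?thesis using False by (simp add: \<psi>_def q_def)
    qed
    ultimately have "(\<lambda>n. ip E (\<lambda>x. indicator U x - \<psi> n x) (\<lambda>x. indicator U x - \<psi> n x)) \<longlonglongrightarrow> 0"
    proof (intro L2_dominated[where g = "\<lambda>x. 1"])
      show "\<psi> n \<in> L2 E" for n using test_L2[OF E] testD(1)[OF \<psi>t] by blast
      show "(\<lambda>x. 1) \<in> L2 E" using test_L2[OF E smooth_const] .
      show "\<bar>indicator U x - \<psi> n x\<bar> \<le> \<bar>1::real\<bar>" for n x
        using \<psi>01[of n x] by (auto simp: indicator_def)
    qed auto
    then have "\<exists>n. ip E (\<lambda>x. indicator U x - \<psi> n x) (\<lambda>x. indicator U x - \<psi> n x) < e" if "e > 0" for e
      using order_tendstoD(2)[OF _ that] eventually_happens' sequentially_bot by blast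
    then show ?thesis
      using \<psi>t \<open>indicator U \<in> L2 E\<close> unfolding test_closure_def by blast
  qed
qed

text \<open>Outer regularity: an open superset exceeds \<open>A\<close> by a set of measure less
  than \<open>e\<close>, and it is cut down to \<open>E\<close>.\<close>

lemma indicator_test_closure:
  assumes E: "open E" "bounded E" and A: "A \<in> sets lebesgue" "A \<subseteq> E"
  shows "indicator A \<in> test_closure E"
proof -
  have El: "E \<in> sets lebesgue" using E by auto
  show ?thesis
  proof (rule test_closure_closed[OF El E(2) L2_indicator[OF El E(2) A(1)]])
    fix e :: real assume "e > 0"
    then obtain T where T: "open T" "A \<subseteq> T" "T - A \<in> lmeasurable" "emeasure lebesgue (T - A) < ennreal e"
      using sets_lebesgue_outer_open[OF A(1)] by blast
    let ?U = "T \<inter> E"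
    have "ip E (\<lambda>x. indicator A x - indicator ?U x) (\<lambda>x. indicator A x - indicator ?U x)
        = (LINT x|lebesgue. indicator (?U - A) x)"
      unfolding ip_eq using T(2) A(2) by (intro Bochner_Integration.integral_cong) (auto simp: indicator_def)
    also have "\<dots> = measure lebesgue (?U - A)" by simp
    also have "\<dots> \<le> measure lebesgue (T - A)"
      using T E A by (intro measure_mono_fmeasurable) auto
    also have "\<dots> < e" using T(3,4) \<open>e > 0\<close> by (simp add: emeasure_eq_measure2 ennreal_less_iff)
    finally show "\<exists>v\<in>test_closure E. ip E (\<lambda>x. indicator A x - v x) (\<lambda>x. indicator A x - v x) < e"
      using open_indicator_test_closure[OF El E(2), of ?U] T E by (intro bexI[of _ "indicator ?U"]) auto
  qed
qed

lemma test_closure_cong: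
  assumes "w \<in> test_closure E" "\<And>x. x \<in> E \<Longrightarrow> w x = v x"
  shows "v \<in> test_closure E"
proof -
  have "ip E (\<lambda>x. v x - \<zeta> x) (\<lambda>x. v x - \<zeta> x) = ip E (\<lambda>x. w x - \<zeta> x) (\<lambda>x. w x - \<zeta> x)" for \<zeta>
    by (rule ip_cong) (simp add: assms)
  then show ?thesis using assms L2_cong[of E w v] by (simp add: test_closure_def)
qed

text \<open>Simple functions converge to \<open>w\<close> with a common bound, and on
  \<open>E\<close> each of them is a combination of indicators.\<close>

lemma test_dense_L2:
  assumes E: "open E" "bounded E" and w: "w \<in> L2 E"
  shows "w \<in> test_closure E"
proof -
  have El: "E \<in> sets lebesgue" using E by auto
  let ?f = "\<lambda>x. indicator E x * w x"
  from borel_measurable_implies_sequence_metric[OF L2_measurable[OF w], of 0]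
  obtain F where F: "\<And>i. simple_function lebesgue (F i)" "\<And>x. (\<lambda>i. F i x) \<longlonglongrightarrow> ?f x"
    "\<And>i x. \<bar>F i x\<bar> \<le> 2 * \<bar>?f x\<bar>" by (auto simp: dist_real_def)
  have Fc: "F i \<in> test_closure E" for i
  proof (rule test_closure_cong)
    have fin: "finite (range (F i))" using simple_functionD(1)[OF F(1), of i] by simp
    show "(\<lambda>x. \<Sum>y\<in>range (F i). y * indicator (F i -` {y} \<inter> E) x) \<in> test_closure E"
      using simple_functionD(2)[OF F(1), of i] El
      by (intro lin_space_sum[OF lin_space_test_closure[OF El E(2)]] indicator_test_closure[OF E]) auto
    show "(\<Sum>y\<in>range (F i). y * indicator (F i -` {y} \<inter> E) x) = F i x" if "x \<in> E" for x
    proof -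
      have "(\<Sum>y\<in>range (F i). y * indicator (F i -` {y} \<inter> E) x) = (\<Sum>y\<in>range (F i). if y = F i x then y else 0)"
        using that by (intro sum.cong) (auto simp: indicator_def)
      then show ?thesis using fin by simp
    qed
  qed
  have "(\<lambda>i. ip E (\<lambda>x. w x - F i x) (\<lambda>x. w x - F i x)) \<longlonglongrightarrow> 0"
  \<comment> \<open>The simple functions are bounded by twice the absolute value of
    \<open>w\<close>, whence the 3 for the differences.\<close>
  proof (rule L2_dominated[where g = "\<lambda>x. 3 * w x"])
    show "F i \<in> L2 E" for i using Fc by (simp add: test_closure_def)
    show "(\<lambda>x. 3 * w x) \<in> L2 E" by (rule lin_space_scale[OF lin_space_L2 w])
    show "\<bar>w x - F i x\<bar> \<le> \<bar>3 * w x\<bar>" if "x \<in> E" for i x using F(3)[of i x] that by auto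
    show "(\<lambda>i. F i x) \<longlonglongrightarrow> w x" if "x \<in> E" for x using F(2)[of x] that by simp
  qed (rule w)
  then have "\<exists>i. ip E (\<lambda>x. w x - F i x) (\<lambda>x. w x - F i x) < e" if "e > 0" for e
    using order_tendstoD(2)[OF _ that] eventually_happens' sequentially_bot by blast
  then show ?thesis by (intro test_closure_closed[OF El E(2) w]) (use Fc in blast)
qed

text \<open>The fundamental lemma of the calculus of variations. Orthogonality turns the squared
  distance from \<open>w\<close> to a test function into a sum of two squares, so the norm of
  \<open>w\<close> is below every such distance.\<close>

lemma test_separates:
  assumes E: "open E" "bounded E" and w: "w \<in> L2 E"
    and orth: "\<And>\<phi>. \<phi> \<in> test_functions E \<Longrightarrow> ip E w \<phi> = 0"
  shows "w \<in> zae E"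
proof -
  have El: "E \<in> sets lebesgue" using E by auto
  have "ip E w w \<le> e" if "e > 0" for e
  proof -
    obtain \<zeta> where \<zeta>: "\<zeta> \<in> test_functions E" "ip E (\<lambda>x. w x - \<zeta> x) (\<lambda>x. w x - \<zeta> x) < e"
      using test_dense_L2[OF E w] \<open>e > 0\<close> unfolding test_closure_def by blast
    have cL: "\<zeta> \<in> L2 E" using test_L2[OF El E(2)] testD(1)[OF \<zeta>(1)] by blast
    have d: "(\<lambda>x. w x - \<zeta> x) \<in> L2 E" by (intro lin_space_diff[OF lin_space_L2] w cL)
    have "ip E (\<lambda>x. w x - \<zeta> x) (\<lambda>x. w x - \<zeta> x) = ip E w w - 2 * ip E w \<zeta> + ip E \<zeta> \<zeta>"
      using ip_diff_left[OF d w cL] ip_diff_right[OF w w cL] ip_diff_right[OF cL w cL] ip_commute[of E \<zeta> w] by simp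
    then show ?thesis using \<zeta> orth[OF \<zeta>(1)] ip_nonneg[of E \<zeta>] by simp
  qed
  then have "ip E w w \<le> 0" by (rule field_le_epsilon[of _ 0, simplified])
  then show ?thesis using ip_zero_iff[OF w] ip_nonneg[of E w] by simp
qed

section \<open>Weak gradients\<close>

text \<open>\<open>grad\<close> is a choice, so these components, and their linear dependence on
  \<open>w\<close>, are only determined up to null sets.\<close>

definition pgrad :: "'a::euclidean_space set \<Rightarrow> 'a \<Rightarrow> ('a \<Rightarrow> real) \<Rightarrow> 'a \<Rightarrow> real" where
  "pgrad E i w = (\<lambda>x. grad E w x \<bullet> i)"

lemma psd_add: "psd_on V A \<Longrightarrow> psd_on V B \<Longrightarrow> psd_on V (\<lambda>u v. A u v + B u v)"
  unfolding psd_on_def symmetric_on_def by (auto intro: bilinear_form_add)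

text \<open>Used both for mesh cells and for the whole domain. Boundedness makes smooth functions
  square integrable.\<close>

locale bounded_open =
  fixes E :: "'a::euclidean_space set"
  assumes open_E: "open E" and bounded_E: "bounded E"
begin

lemma sets_E: "E \<in> sets lebesgue"
  using open_E by auto

lemma smooth_L2: "smooth p \<Longrightarrow> p \<in> L2 E"
  by (rule test_L2[OF sets_E bounded_E])

lemma testfun_L2: "\<phi> \<in> test_functions E \<Longrightarrow> \<phi> \<in> L2 E"
  by (intro smooth_L2 testD)

lemma test_partial_L2: "\<phi> \<in> test_functions E \<Longrightarrow> i \<in> Basis \<Longrightarrow> partial i \<phi> \<in> L2 E"
  by (intro testfun_L2 test_partial)

lemma weak_gradient_unique:
  assumes g: "is_weak_gradient E w g" "is_weak_gradient E w h" and i: "i \<in> Basis"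
  shows "(\<lambda>x. g x \<bullet> i - h x \<bullet> i) \<in> zae E"
proof (rule test_separates[OF open_E bounded_E])
  have L: "(\<lambda>x. g x \<bullet> i) \<in> L2 E" "(\<lambda>x. h x \<bullet> i) \<in> L2 E"
    using g i by (auto simp: is_weak_gradient_def)
  then show "(\<lambda>x. g x \<bullet> i - h x \<bullet> i) \<in> L2 E" by (rule lin_space_diff[OF lin_space_L2])
  fix \<phi> assume \<phi>: "\<phi> \<in> test_functions E"
  have "ip E (\<lambda>x. g x \<bullet> i) \<phi> = ip E (\<lambda>x. h x \<bullet> i) \<phi>"
    using g \<phi> i unfolding is_weak_gradient_def by (metis add.inverse_inverse)
  then show "ip E (\<lambda>x. g x \<bullet> i - h x \<bullet> i) \<phi> = 0"
    using ip_diff_left[OF testfun_L2[OF \<phi>] L] by simp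
qed

lemma weak_gradient_comb:
  assumes "u \<in> L2 E" "v \<in> L2 E" and g: "is_weak_gradient E u g" "is_weak_gradient E v h"
  shows "is_weak_gradient E (\<lambda>x. a * u x + b * v x) (\<lambda>x. a *\<^sub>R g x + b *\<^sub>R h x)"
  unfolding is_weak_gradient_def
proof (intro conjI ballI)
  fix i :: 'a assume i: "i \<in> Basis"
  have L: "(\<lambda>x. g x \<bullet> i) \<in> L2 E" "(\<lambda>x. h x \<bullet> i) \<in> L2 E"
    using g i by (auto simp: is_weak_gradient_def)
  show "(\<lambda>x. (a *\<^sub>R g x + b *\<^sub>R h x) \<bullet> i) \<in> L2 E"
    using lin_space_comb[OF lin_space_L2 L, of a b] by (simp add: inner_add_left)
  fix \<phi> assume \<phi>: "\<phi> \<in> test_functions E"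
  show "ip E (\<lambda>x. a * u x + b * v x) (partial i \<phi>) = - ip E (\<lambda>x. (a *\<^sub>R g x + b *\<^sub>R h x) \<bullet> i) \<phi>"
    using ip_comb_left[OF assms(1,2) test_partial_L2[OF \<phi> i], of a b] ip_comb_left[OF L testfun_L2[OF \<phi>], of a b] g \<phi> i
    by (simp add: is_weak_gradient_def inner_add_left)
qed

lemma H1_L2: "w \<in> H1 E \<Longrightarrow> w \<in> L2 E"
  by (simp add: H1_def)

lemma grad_weak: "w \<in> H1 E \<Longrightarrow> is_weak_gradient E w (grad E w)"
proof -
  assume "w \<in> H1 E"
  then have "\<exists>g. is_weak_gradient E w g" by (simp add: H1_def)
  then show "is_weak_gradient E w (grad E w)" unfolding grad_def by (rule someI_ex)
qed

lemma pgrad_L2: "w \<in> H1 E \<Longrightarrow> i \<in> Basis \<Longrightarrow> pgrad E i w \<in> L2 E"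
  using grad_weak unfolding is_weak_gradient_def pgrad_def by blast

lemma ip_pgrad: "w \<in> H1 E \<Longrightarrow> i \<in> Basis \<Longrightarrow> \<phi> \<in> test_functions E \<Longrightarrow> ip E w (partial i \<phi>) = - ip E (pgrad E i w) \<phi>"
  using grad_weak unfolding is_weak_gradient_def pgrad_def by blast

lemma pgrad_eqI:
  "w \<in> H1 E \<Longrightarrow> is_weak_gradient E w g \<Longrightarrow> i \<in> Basis \<Longrightarrow> (\<lambda>x. pgrad E i w x - g x \<bullet> i) \<in> zae E"
  unfolding pgrad_def by (rule weak_gradient_unique[OF grad_weak])

lemma lin_space_H1: "lin_space (H1 E)"
  unfolding lin_space_def
proof (intro conjI ballI allI)
  have "is_weak_gradient E (\<lambda>x. 0) (\<lambda>x. 0)"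
    using lin_space_0[OF lin_space_L2] by (auto simp: is_weak_gradient_def ip_eq)
  then show "(\<lambda>x. 0) \<in> H1 E" using lin_space_0[OF lin_space_L2] unfolding H1_def by blast
  fix u v a b assume "u \<in> H1 E" "v \<in> H1 E"
  then show "(\<lambda>x. a * u x + b * v x) \<in> H1 E"
    using weak_gradient_comb[OF _ _ grad_weak grad_weak, of u v a b] lin_space_comb[OF lin_space_L2, of u E v a b]
    by (auto simp: H1_def)
qed

lemma pgrad_comb:
  assumes u: "u \<in> H1 E" and v: "v \<in> H1 E" and i: "i \<in> Basis"
  shows "(\<lambda>x. pgrad E i (\<lambda>x. a * u x + b * v x) x - (a * pgrad E i u x + b * pgrad E i v x)) \<in> zae E"
  using pgrad_eqI[OF lin_space_comb[OF lin_space_H1 u v] weak_gradient_comb[OF H1_L2[OF u] H1_L2[OF v] grad_weak[OF u] grad_weak[OF v]] i, of a b]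
  by (simp add: inner_add_left pgrad_def)

lemma ip_zae_diff:
  assumes "(\<lambda>x. u x - v x) \<in> zae E" "v \<in> L2 E" "w \<in> L2 E"
  shows "ip E u w = ip E v w"
proof -
  have u: "u \<in> L2 E"
    using lin_space_add[OF lin_space_L2 subsetD[OF zae_subset_L2 assms(1)] assms(2)] by simp
  show ?thesis using ip_zae_left[OF assms(1,3)] ip_diff_left[OF assms(3) u assms(2)] by simp
qed

lemma aE_eq_sum:
  assumes "v \<in> H1 E" "w \<in> H1 E"
  shows "aE E v w = (\<Sum>i\<in>Basis. ip E (pgrad E i v) (pgrad E i w))"
proof -
  have "aE E v w = (LINT x|lebesgue. (\<Sum>i\<in>Basis. indicator E x * (pgrad E i v x * pgrad E i w x)))"
    unfolding aE_def set_lebesgue_integral_def pgrad_def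
    by (rule Bochner_Integration.integral_cong[OF refl], subst euclidean_inner) (simp add: sum_distrib_left)
  also have "\<dots> = (\<Sum>i\<in>Basis. ip E (pgrad E i v) (pgrad E i w))"
    unfolding ip_eq using assms
    by (intro Bochner_Integration.integral_sum L2_prod_integrable pgrad_L2)
  finally show ?thesis .
qed

lemma aE_comb_left:
  assumes u: "u \<in> H1 E" and v: "v \<in> H1 E" and w: "w \<in> H1 E"
  shows "aE E (\<lambda>x. a * u x + b * v x) w = a * aE E u w + b * aE E v w"
proof -
  have uv: "(\<lambda>x. a * u x + b * v x) \<in> H1 E" by (rule lin_space_comb[OF lin_space_H1 u v])
  have "ip E (pgrad E i (\<lambda>x. a * u x + b * v x)) (pgrad E i w)
      = a * ip E (pgrad E i u) (pgrad E i w) + b * ip E (pgrad E i v) (pgrad E i w)" if i: "i \<in> Basis" for i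
  proof -
    have "ip E (pgrad E i (\<lambda>x. a * u x + b * v x)) (pgrad E i w)
        = ip E (\<lambda>x. a * pgrad E i u x + b * pgrad E i v x) (pgrad E i w)"
      by (rule ip_zae_diff[OF pgrad_comb[OF u v i] lin_space_comb[OF lin_space_L2 pgrad_L2[OF u i] pgrad_L2[OF v i]] pgrad_L2[OF w i]])
    also have "\<dots> = a * ip E (pgrad E i u) (pgrad E i w) + b * ip E (pgrad E i v) (pgrad E i w)"
      by (intro ip_comb_left pgrad_L2 u v w i)
    finally show ?thesis .
  qed
  then show ?thesis
    unfolding aE_eq_sum[OF uv w] aE_eq_sum[OF u w] aE_eq_sum[OF v w]
    by (simp add: sum.distrib sum_distrib_left)
qed

lemma aE_commute: "aE E v w = aE E w v"
  by (simp add: aE_def inner_commute)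

lemma psd_aE: "psd_on (H1 E) (aE E)"
  unfolding psd_on_def symmetric_on_def
proof (intro conjI ballI)
  show "bilinear_form_on (H1 E) (aE E)"
  proof (rule bilinear_formI)
    fix u v w a b assume h: "u \<in> H1 E" "v \<in> H1 E" "w \<in> H1 E"
    show "aE E (\<lambda>x. a * v x + b * w x) u = a * aE E v u + b * aE E w u" using h by (intro aE_comb_left)
    then show "aE E u (\<lambda>x. a * v x + b * w x) = a * aE E u v + b * aE E u w" by (simp only: aE_commute[of u])
  qed
  show "aE E v w = aE E w v" for v w by (rule aE_commute)
  show "0 \<le> aE E v v" for v
    unfolding aE_def set_lebesgue_integral_def by (rule Bochner_Integration.integral_nonneg) simp
qed

lemma aE_nonneg: "v \<in> H1 E \<Longrightarrow> 0 \<le> aE E v v"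
  using psd_aE by (simp add: psd_on_def)

lemma aE_zero_iff:
  assumes "w \<in> H1 E"
  shows "aE E w w = 0 \<longleftrightarrow> (\<forall>i\<in>Basis. pgrad E i w \<in> zae E)"
  unfolding aE_eq_sum[OF assms assms]
  by (subst sum_nonneg_eq_0_iff) (auto simp: ip_nonneg ip_zero_iff[OF pgrad_L2[OF assms]])

lemma weak_gradient_zae: "w \<in> zae E \<Longrightarrow> is_weak_gradient E w (\<lambda>x. 0)"
  using lin_space_0[OF lin_space_L2] ip_zae_left[of w E] test_partial_L2
  by (auto simp: is_weak_gradient_def ip_eq[of E "\<lambda>x. 0"])

lemma zae_H1: "w \<in> zae E \<Longrightarrow> w \<in> H1 E"
  using weak_gradient_zae zae_subset_L2 unfolding H1_def by blast

lemma aE_zae: "w \<in> zae E \<Longrightarrow> aE E w w = 0"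
  using pgrad_eqI[OF zae_H1 weak_gradient_zae] by (simp add: aE_zero_iff[OF zae_H1])

lemma weak_gradient_smooth:
  assumes "smooth p"
  shows "is_weak_gradient E p (\<lambda>x. \<Sum>i\<in>Basis. partial i p x *\<^sub>R i)"
  unfolding is_weak_gradient_def using assms
  by (auto intro: smooth_L2 smooth_partial ip_partial_test[OF sets_E bounded_E])

lemma smooth_H1: "smooth p \<Longrightarrow> p \<in> H1 E"
  using weak_gradient_smooth smooth_L2 unfolding H1_def by blast

lemma pgrad_smooth:
  assumes "smooth p" "i \<in> Basis"
  shows "(\<lambda>x. pgrad E i p x - partial i p x) \<in> zae E"
  using pgrad_eqI[OF smooth_H1[OF assms(1)] weak_gradient_smooth[OF assms(1)] assms(2)] assms(2) by simp

lemma ip_pgrad_smooth: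
  assumes "smooth p" "i \<in> Basis" "w \<in> L2 E"
  shows "ip E (pgrad E i p) w = ip E (partial i p) w"
  by (rule ip_zae_diff[OF pgrad_smooth]) (use assms in \<open>auto intro: smooth_L2 smooth_partial\<close>)

lemma aE_smooth:
  assumes "smooth p" "w \<in> H1 E"
  shows "aE E p w = (\<Sum>i\<in>Basis. ip E (partial i p) (pgrad E i w))"
  unfolding aE_eq_sum[OF smooth_H1[OF assms(1)] assms(2)]
  by (intro sum.cong refl ip_pgrad_smooth pgrad_L2 assms)

lemma test_H1: "\<phi> \<in> test_functions E \<Longrightarrow> \<phi> \<in> H1 E"
  by (intro smooth_H1 testD)

abbreviation "H1_form u v \<equiv> ip E u v + aE E u v"

lemma psd_H1_form: "psd_on (H1 E) H1_form"
  by (intro psd_add psd_aE psd_on_subset[OF psd_ip]) (auto intro: H1_L2)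

text \<open>Replaces the norm by its square, a semidefinite form to which the parallelogram estimate
  applies.\<close>

lemma H10_iff:
  "w \<in> H10 E \<longleftrightarrow> w \<in> H1 E \<and> (\<exists>\<phi>. (\<forall>j::nat. \<phi> j \<in> test_functions E) \<and>
     (\<lambda>j. H1_form (\<lambda>x. w x - \<phi> j x) (\<lambda>x. w x - \<phi> j x)) \<longlonglongrightarrow> 0)"
proof -
  have "(\<lambda>j. H1_norm E (\<lambda>x. w x - \<phi> j x)) \<longlonglongrightarrow> 0 \<longleftrightarrow> (\<lambda>j. H1_form (\<lambda>x. w x - \<phi> j x) (\<lambda>x. w x - \<phi> j x)) \<longlonglongrightarrow> 0"
    if w: "w \<in> H1 E" and \<phi>: "\<And>j. \<phi> j \<in> test_functions E" for \<phi> :: "nat \<Rightarrow> _"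
  proof
    let ?v = "\<lambda>j x. w x - \<phi> j x"
    have v: "?v j \<in> H1 E" for j by (intro lin_space_diff[OF lin_space_H1] w test_H1 \<phi>)
    have nn: "0 \<le> H1_form (?v j) (?v j)" for j using psd_H1_form v by (simp add: psd_on_def)
    { assume "(\<lambda>j. H1_norm E (?v j)) \<longlonglongrightarrow> 0"
      then have "(\<lambda>j. (H1_norm E (?v j))\<^sup>2) \<longlonglongrightarrow> 0\<^sup>2" by (rule tendsto_power)
      then show "(\<lambda>j. H1_form (?v j) (?v j)) \<longlonglongrightarrow> 0" using nn by (simp add: H1_norm_def) }
    { assume "(\<lambda>j. H1_form (?v j) (?v j)) \<longlonglongrightarrow> 0"
      then have "(\<lambda>j. sqrt (H1_form (?v j) (?v j))) \<longlonglongrightarrow> sqrt 0" by (rule tendsto_real_sqrt)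
      then show "(\<lambda>j. H1_norm E (?v j)) \<longlonglongrightarrow> 0" by (simp add: H1_norm_def) }
  qed
  then show ?thesis unfolding H10_def by (auto simp: )
qed

lemma H10_H1: "w \<in> H10 E \<Longrightarrow> w \<in> H1 E"
  by (simp add: H10_iff)

lemma lin_space_H10: "lin_space (H10 E)"
  unfolding lin_space_def
proof (intro conjI ballI allI)
  have "H1_form (\<lambda>x. 0) (\<lambda>x. 0) = 0"
    using ip_zae_left[OF lin_space_0[OF lin_space_zae] lin_space_0[OF lin_space_L2]] aE_zae[OF lin_space_0[OF lin_space_zae]] by simp
  then show "(\<lambda>x. 0) \<in> H10 E" unfolding H10_iff
    using lin_space_0[OF lin_space_H1] lin_space_0[OF lin_space_test]
    by (intro conjI exI[of _ "\<lambda>j x. 0"]) simp_all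
  fix u v a b assume u: "u \<in> H10 E" and v: "v \<in> H10 E"
  obtain \<phi> where \<phi>: "\<And>j::nat. \<phi> j \<in> test_functions E" "(\<lambda>j. H1_form (\<lambda>x. u x - \<phi> j x) (\<lambda>x. u x - \<phi> j x)) \<longlonglongrightarrow> 0"
    using u unfolding H10_iff by auto
  obtain \<psi> where \<psi>: "\<And>j::nat. \<psi> j \<in> test_functions E" "(\<lambda>j. H1_form (\<lambda>x. v x - \<psi> j x) (\<lambda>x. v x - \<psi> j x)) \<longlonglongrightarrow> 0"
    using v unfolding H10_iff by auto
  have uH: "u \<in> H1 E" and vH: "v \<in> H1 E" using u v by (auto intro: H10_H1)
  have du: "(\<lambda>x. u x - \<phi> j x) \<in> H1 E" and dv: "(\<lambda>x. v x - \<psi> j x) \<in> H1 E" for j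
    by (intro lin_space_diff[OF lin_space_H1] uH vH test_H1 \<phi> \<psi>)+
  let ?w = "\<lambda>j x. (a * u x + b * v x) - (a * \<phi> j x + b * \<psi> j x)"
  have "(\<lambda>j. H1_form (?w j) (?w j)) \<longlonglongrightarrow> 0"
  proof (rule tendsto_sandwich[OF _ _ tendsto_const])
    have weq: "?w j = (\<lambda>x. a * (u x - \<phi> j x) + b * (v x - \<psi> j x))" for j by (auto simp: algebra_simps)
    show "\<forall>\<^sub>F j in sequentially. H1_form (?w j) (?w j) \<le> 2 * (a\<^sup>2 * H1_form (\<lambda>x. u x - \<phi> j x) (\<lambda>x. u x - \<phi> j x)) +
        2 * (b\<^sup>2 * H1_form (\<lambda>x. v x - \<psi> j x) (\<lambda>x. v x - \<psi> j x))"
      unfolding weq by (intro always_eventually allI psd_parallelogram[OF lin_space_H1 psd_H1_form du dv])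
    show "\<forall>\<^sub>F j in sequentially. 0 \<le> H1_form (?w j) (?w j)"
      unfolding weq using psd_H1_form lin_space_comb[OF lin_space_H1 du dv]
      by (intro always_eventually allI) (simp add: psd_on_def)
    show "(\<lambda>j. 2 * (a\<^sup>2 * H1_form (\<lambda>x. u x - \<phi> j x) (\<lambda>x. u x - \<phi> j x)) +
        2 * (b\<^sup>2 * H1_form (\<lambda>x. v x - \<psi> j x) (\<lambda>x. v x - \<psi> j x))) \<longlonglongrightarrow> 0"
      using tendsto_add[OF tendsto_mult_left[OF tendsto_mult_left[OF \<phi>(2), of "a\<^sup>2"], of 2]
        tendsto_mult_left[OF tendsto_mult_left[OF \<psi>(2), of "b\<^sup>2"], of 2]] by simp
  qed
  moreover have "(\<lambda>x. a * \<phi> j x + b * \<psi> j x) \<in> test_functions E" for j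
    by (intro lin_space_comb[OF lin_space_test] \<phi> \<psi>)
  ultimately show "(\<lambda>x. a * u x + b * v x) \<in> H10 E"
    unfolding H10_iff using lin_space_comb[OF lin_space_H1 uH vH]
    by (intro conjI exI[of _ "\<lambda>j x. a * \<phi> j x + b * \<psi> j x"]) auto
qed

text \<open>A test function on the smaller set is one on the larger set, and the integrands vanish
  off the smaller set.\<close>

lemma weak_gradient_restrict:
  assumes w: "w \<in> H1 E" and F: "open F" "F \<subseteq> E"
  shows "is_weak_gradient F w (grad E w)"
  unfolding is_weak_gradient_def
proof (intro conjI ballI)
  have Fs: "F \<in> sets lebesgue" using F by auto
  fix i :: 'a assume i: "i \<in> Basis"
  show "(\<lambda>x. grad E w x \<bullet> i) \<in> L2 F"
    using L2_subset[OF pgrad_L2[OF w i] F(2) Fs] by (simp add: pgrad_def)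
  fix \<phi> assume \<phi>: "\<phi> \<in> test_functions F"
  then have "ip E w (partial i \<phi>) = - ip E (pgrad E i w) \<phi>"
    using ip_pgrad[OF w i] test_mono F by blast
  moreover have "ip E w (partial i \<phi>) = ip F w (partial i \<phi>)"
    by (rule ip_restrict[OF F(2)]) (use testD(4)[OF test_partial[OF \<phi> i]] in auto)
  moreover have "ip E (pgrad E i w) \<phi> = ip F (pgrad E i w) \<phi>"
    by (rule ip_restrict[OF F(2)]) (use testD(4)[OF \<phi>] in auto)
  ultimately show "ip F w (partial i \<phi>) = - ip F (\<lambda>x. grad E w x \<bullet> i) \<phi>" by (simp add: pgrad_def)
qed

end

section \<open>Polynomials\<close>

text \<open>An inductive counterpart of \<open>Pk\<close>: products, derivatives and affine
  substitutions are handled by induction instead of multi-indices.\<close>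

inductive poly_fun :: "nat \<Rightarrow> ('a::euclidean_space \<Rightarrow> real) \<Rightarrow> bool" where
  const: "poly_fun k (\<lambda>x. c)"
| add: "poly_fun k p \<Longrightarrow> poly_fun k q \<Longrightarrow> poly_fun k (\<lambda>x. p x + q x)"
| mult_coord: "poly_fun k p \<Longrightarrow> b \<in> Basis \<Longrightarrow> poly_fun (Suc k) (\<lambda>x. (x \<bullet> b) * p x)"

lemma poly_fun_mono: "poly_fun k p \<Longrightarrow> k \<le> l \<Longrightarrow> poly_fun l p"
proof (induction arbitrary: l rule: poly_fun.induct)
  case (mult_coord k p b)
  then obtain l' where "l = Suc l'" "k \<le> l'" by (cases l) auto
  then show ?case using mult_coord by (auto intro: poly_fun.mult_coord)
qed (auto intro: poly_fun.const poly_fun.add)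

lemma poly_fun_scale: "poly_fun k p \<Longrightarrow> poly_fun k (\<lambda>x. c * p x)"
proof (induction rule: poly_fun.induct)
  case (add k p q)
  from poly_fun.add[OF add.IH] show ?case by (simp add: algebra_simps)
next
  case (mult_coord k p b)
  from poly_fun.mult_coord[OF mult_coord.IH mult_coord.hyps(2)] show ?case by (simp add: mult.left_commute)
qed (rule poly_fun.const)

lemma poly_fun_mult: "poly_fun k p \<Longrightarrow> poly_fun l q \<Longrightarrow> poly_fun (k + l) (\<lambda>x. p x * q x)"
proof (induction rule: poly_fun.induct)
  case (const k c)
  then show ?case using poly_fun_mono[OF poly_fun_scale[OF const], of "k + l" c] by simp
next
  case (add k p q')
  from poly_fun.add[OF add.IH[OF add.prems]] show ?case by (simp add: algebra_simps)
next
  case (mult_coord k p b)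
  from poly_fun.mult_coord[OF mult_coord.IH[OF mult_coord.prems] mult_coord.hyps(2)] show ?case by (simp add: mult.assoc)
qed

lemma poly_fun_sum: "finite I \<Longrightarrow> (\<And>i. i \<in> I \<Longrightarrow> poly_fun k (f i)) \<Longrightarrow> poly_fun k (\<lambda>x. \<Sum>i\<in>I. f i x)"
  by (induction I rule: finite_induct) (auto intro: poly_fun.const poly_fun.add)

lemma poly_fun_coord: "b \<in> Basis \<Longrightarrow> poly_fun 1 (\<lambda>x. x \<bullet> b)"
  using poly_fun.mult_coord[OF poly_fun.const[of 0 1], of b] by simp

lemma poly_fun_power: "poly_fun k p \<Longrightarrow> poly_fun (n * k) (\<lambda>x. p x ^ n)"
proof (induction n)
  case 0 then show ?case using poly_fun.const[of 0 1] by simp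
next
  case (Suc n) then show ?case using poly_fun_mult[OF Suc.prems Suc.IH] by simp
qed

lemma poly_fun_prod:
  "finite I \<Longrightarrow> (\<And>i. i \<in> I \<Longrightarrow> poly_fun (k i) (f i)) \<Longrightarrow> poly_fun (\<Sum>i\<in>I. k i) (\<lambda>x. \<Prod>i\<in>I. f i x)"
  by (induction I rule: finite_induct) (auto intro: poly_fun.const poly_fun_mult)

definition multi_index :: "nat \<Rightarrow> ('a::euclidean_space \<Rightarrow> nat) set" where
  "multi_index k = {\<alpha>. \<alpha> \<in> Basis \<rightarrow>\<^sub>E UNIV \<and> (\<Sum>b\<in>Basis. \<alpha> b) \<le> k}"

definition monomial :: "('a::euclidean_space \<Rightarrow> nat) \<Rightarrow> 'a \<Rightarrow> real" where
  "monomial \<alpha> x = (\<Prod>b\<in>Basis. (x \<bullet> b) ^ \<alpha> b)"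

lemma Pk_eq: "Pk k = {q. \<exists>c. q = (\<lambda>x. \<Sum>\<alpha>\<in>multi_index k. c \<alpha> * monomial \<alpha> x)}"
  unfolding Pk_def multi_index_def monomial_def by simp

lemma finite_multi_index: "finite (multi_index k :: ('a::euclidean_space \<Rightarrow> nat) set)"
proof (rule finite_subset)
  show "multi_index k \<subseteq> Pi\<^sub>E (Basis :: 'a set) (\<lambda>_. {..k})"
    unfolding multi_index_def using member_le_sum[of _ "Basis :: 'a set"]
    by (force simp: PiE_iff intro: order_trans[OF member_le_sum[of _ "Basis :: 'a set"]])
qed (auto intro: finite_PiE)

lemma lin_space_Pk: "lin_space (Pk k)"
  unfolding lin_space_def
proof (intro conjI ballI allI)
  show "(\<lambda>x. 0) \<in> Pk k" unfolding Pk_eq by (intro CollectI exI[of _ "\<lambda>_. 0"]) simp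
  fix u v :: "'a \<Rightarrow> real" and a b assume "u \<in> Pk k" "v \<in> Pk k"
  then obtain c d where "u = (\<lambda>x. \<Sum>\<alpha>\<in>multi_index k. c \<alpha> * monomial \<alpha> x)" "v = (\<lambda>x. \<Sum>\<alpha>\<in>multi_index k. d \<alpha> * monomial \<alpha> x)"
    unfolding Pk_eq by auto
  then show "(\<lambda>x. a * u x + b * v x) \<in> Pk k"
    unfolding Pk_eq by (intro CollectI exI[of _ "\<lambda>\<alpha>. a * c \<alpha> + b * d \<alpha>"])
      (simp add: sum.distrib sum_distrib_left algebra_simps)
qed

lemma monomial_Pk: "\<alpha> \<in> multi_index k \<Longrightarrow> monomial \<alpha> \<in> Pk k"
  unfolding Pk_eq
  by (intro CollectI exI[of _ "\<lambda>\<beta>. if \<beta> = \<alpha> then 1 else 0"] ext) (simp add: mult_delta_left finite_multi_index)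

lemma Pk_mult_coord:
  assumes "p \<in> Pk k" "b \<in> Basis" shows "(\<lambda>x. (x \<bullet> b) * p x) \<in> Pk (Suc k)"
proof -
  obtain c where p: "p = (\<lambda>x. \<Sum>\<alpha>\<in>multi_index k. c \<alpha> * monomial \<alpha> x)" using assms(1) unfolding Pk_eq by auto
  have m: "(x \<bullet> b) * monomial \<alpha> x = monomial (\<alpha>(b := Suc (\<alpha> b))) x" for \<alpha> x
    using assms(2) unfolding monomial_def by (simp add: prod.remove[of Basis b])
  have "\<alpha>(b := Suc (\<alpha> b)) \<in> multi_index (Suc k)" if "\<alpha> \<in> multi_index k" for \<alpha>
    using that assms(2) unfolding multi_index_def by (auto simp: PiE_iff extensional_def sum.remove[of Basis b])
  then have "(\<lambda>x. \<Sum>\<alpha>\<in>multi_index k. c \<alpha> * monomial (\<alpha>(b := Suc (\<alpha> b))) x) \<in> Pk (Suc k)"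
    by (intro lin_space_sum[OF lin_space_Pk] monomial_Pk)
  then show ?thesis unfolding p by (simp add: sum_distrib_left m[symmetric] mult.left_commute)
qed

lemma Pk_iff:
  fixes p :: "'a::euclidean_space \<Rightarrow> real"
  shows "p \<in> Pk k \<longleftrightarrow> poly_fun k p"
proof
  assume "p \<in> Pk k"
  then obtain c where p: "p = (\<lambda>x. \<Sum>\<alpha>\<in>multi_index k. c \<alpha> * monomial \<alpha> x)" unfolding Pk_eq by auto
  have "poly_fun k (monomial \<alpha>)" if "\<alpha> \<in> multi_index k" for \<alpha> :: "'a \<Rightarrow> nat"
  proof -
    have "poly_fun (\<Sum>b\<in>Basis. \<alpha> b * 1) (\<lambda>x. \<Prod>b\<in>Basis. (x \<bullet> b) ^ \<alpha> b)"
      by (intro poly_fun_prod poly_fun_power poly_fun_coord) auto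
    then show ?thesis using that poly_fun_mono unfolding monomial_def[abs_def] multi_index_def by auto
  qed
  then show "poly_fun k p" unfolding p by (intro poly_fun_sum poly_fun_scale finite_multi_index)
next
  assume "poly_fun k p"
  then show "p \<in> Pk k"
  proof induction
    case (const k c)
    have "monomial (\<lambda>b\<in>(Basis :: 'a set). 0) \<in> Pk k" by (rule monomial_Pk) (auto simp: multi_index_def)
    moreover have "monomial (\<lambda>b\<in>(Basis :: 'a set). 0) = (\<lambda>x. 1)" by (auto simp: monomial_def)
    ultimately have "(\<lambda>x::'a. 1) \<in> Pk k" by simp
    from lin_space_scale[OF lin_space_Pk this, of c] show ?case by simp
  next
    case (add k p q) then show ?case by (intro lin_space_add[OF lin_space_Pk])
  qed (rule Pk_mult_coord)
qed

lemma Pk_const: "(\<lambda>x. c) \<in> Pk k"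
  by (simp add: Pk_iff poly_fun.const)

lemma Pk_span:
  "\<exists>(n::nat) v. (\<forall>i<n. v i \<in> (Pk k :: ('a::euclidean_space \<Rightarrow> real) set)) \<and> (\<forall>w\<in>Pk k. \<exists>c. w = (\<lambda>x. \<Sum>i<n. c i * v i x))"
proof -
  obtain h where h: "bij_betw h {0..<card (multi_index k :: ('a \<Rightarrow> nat) set)} (multi_index k :: ('a \<Rightarrow> nat) set)"
    using ex_bij_betw_nat_finite[OF finite_multi_index[of k, where 'a = 'a]] by blast
  let ?n = "card (multi_index k :: ('a \<Rightarrow> nat) set)"
  have "\<exists>c. w = (\<lambda>x. \<Sum>i<?n. c i * monomial (h i) x)" if w: "w \<in> Pk k" for w
  proof -
    obtain c where "w = (\<lambda>x. \<Sum>\<alpha>\<in>multi_index k. c \<alpha> * monomial \<alpha> x)" using w unfolding Pk_eq by auto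
    then have "w = (\<lambda>x. \<Sum>i<?n. c (h i) * monomial (h i) x)"
      using sum.reindex_bij_betw[OF h, of "\<lambda>\<alpha>. c \<alpha> * monomial \<alpha> _"] by (simp add: lessThan_atLeast0)
    then show ?thesis by (rule exI[of _ "\<lambda>i. c (h i)"])
  qed
  moreover have "monomial (h i) \<in> Pk k" if "i < ?n" for i
    using h that by (intro monomial_Pk) (auto simp: bij_betw_def)
  ultimately show ?thesis by (intro exI[of _ ?n] exI[of _ "\<lambda>i. monomial (h i)"]) blast
qed

lemma poly_fun_smooth: "poly_fun k p \<Longrightarrow> smooth p"
  by (induction rule: poly_fun.induct) (auto intro: smooth_const smooth_add smooth_mult smooth_inner)

lemma poly_fun_partial:
  "poly_fun k p \<Longrightarrow> i \<in> Basis \<Longrightarrow> poly_fun k (partial i p)"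
proof (induction rule: poly_fun.induct)
  case (const k c) then show ?case by (simp add: partial_const poly_fun.const)
next
  case (add k p q) then show ?case by (simp add: partial_add poly_fun_smooth poly_fun.add)
next
  case (mult_coord k p b)
  have "partial i (\<lambda>x. (x \<bullet> b) * p x) = (\<lambda>x. (x \<bullet> b) * partial i p x + (i \<bullet> b) * p x)"
    using partial_mult[OF smooth_inner poly_fun_smooth[OF mult_coord.hyps(1)] mult_coord.prems, of b]
    by (simp add: partial_inner)
  moreover have "poly_fun (Suc k) (\<lambda>x. (x \<bullet> b) * partial i p x)"
    by (intro poly_fun.mult_coord mult_coord)
  moreover have "poly_fun (Suc k) (\<lambda>x. (i \<bullet> b) * p x)"
    by (rule poly_fun_mono[OF poly_fun_scale[OF mult_coord.hyps(1)]]) simp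
  ultimately show ?case by (simp add: poly_fun.add)
qed

lemma poly_fun_line:
  "poly_fun k p \<Longrightarrow> \<exists>P::real poly. degree P \<le> k \<and> (\<forall>s. p (a + s *\<^sub>R v) = poly P s)"
proof (induction rule: poly_fun.induct)
  case (const k c) show ?case by (rule exI[of _ "[:c:]"]) simp
next
  case (add k p q)
  then obtain P Q :: "real poly" where "degree P \<le> k" "\<forall>s. p (a + s *\<^sub>R v) = poly P s"
    "degree Q \<le> k" "\<forall>s. q (a + s *\<^sub>R v) = poly Q s" by blast
  then show ?case by (intro exI[of _ "P + Q"]) (auto intro: degree_add_le)
next
  case (mult_coord k p b)
  then obtain P :: "real poly" where P: "degree P \<le> k" "\<forall>s. p (a + s *\<^sub>R v) = poly P s" by blast
  have "degree ([:a \<bullet> b, v \<bullet> b:] * P) \<le> Suc k"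
    using degree_mult_le[of "[:a \<bullet> b, v \<bullet> b:]" P] P(1) by (simp split: if_splits)
  then show ?case using P by (intro exI[of _ "[:a \<bullet> b, v \<bullet> b:] * P"]) (auto simp: inner_add_left algebra_simps)
qed

lemma poly_fun_compose:
  assumes "\<And>b. b \<in> Basis \<Longrightarrow> poly_fun 1 (\<lambda>x. \<psi> x \<bullet> b)"
  shows "poly_fun k p \<Longrightarrow> poly_fun k (\<lambda>x. p (\<psi> x))"
proof (induction rule: poly_fun.induct)
  case (mult_coord k p b)
  from poly_fun_mult[OF assms[OF mult_coord.hyps(2)] mult_coord.IH] show ?case by simp
qed (auto intro: poly_fun.const poly_fun.add)

lemma Pk_smooth: "p \<in> Pk k \<Longrightarrow> smooth p"
  by (simp add: Pk_iff poly_fun_smooth)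

text \<open>On the line through \<open>z\<close> and \<open>x\<close> the function is a univariate
  polynomial that vanishes on an interval, hence has infinitely many zeros.\<close>

lemma poly_fun_eq_zero:
  assumes p: "poly_fun k p" and A: "open A" "z \<in> A" "\<And>y. y \<in> A \<Longrightarrow> p y = 0"
  shows "p x = 0"
proof -
  obtain P :: "real poly" where P: "\<And>s. p (z + s *\<^sub>R (x - z)) = poly P s"
    using poly_fun_line[OF p, of z "x - z"] by blast
  obtain e where e: "e > 0" "ball z e \<subseteq> A" using A openE by blast
  \<comment> \<open>Parameters below \<open>d\<close> keep the point within distance
    \<open>e\<close> of \<open>z\<close>; adding 1 covers the case \<open>x = z\<close>.\<close>
  define d where "d = e / (norm (x - z) + 1)"
  have d: "d > 0" using e by (simp add: d_def add_nonneg_pos)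
  have "poly P s = 0" if s: "s \<in> {0<..<d}" for s
  proof -
    have "norm (s *\<^sub>R (x - z)) \<le> s * (norm (x - z) + 1)" using s by (auto intro: mult_left_mono)
    also have "\<dots> < d * (norm (x - z) + 1)" using s by (intro mult_strict_right_mono) (auto intro: add_nonneg_pos)
    also have "\<dots> = e" by (simp add: d_def add_nonneg_eq_0_iff)
    finally have "z + s *\<^sub>R (x - z) \<in> ball z e" by (simp add: dist_norm)
    then show ?thesis using A(3) e P[of s] by auto
  qed
  then have "{0<..<d} \<subseteq> {s. poly P s = 0}" by blast
  then have "P = 0" using d poly_roots_finite[of P] infinite_Ioo[of 0 d] finite_subset by blast
  then show ?thesis using P[of 1] by simp
qed

lemma poly_fun_const_if_partial_zero:
  assumes p: "poly_fun k p" and 0: "\<And>i x. i \<in> Basis \<Longrightarrow> partial i p x = 0"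
  shows "p x = p y"
proof -
  have "\<And>z. (p has_derivative (\<lambda>h. 0)) (at z within UNIV)"
    using smooth_has_derivative[OF poly_fun_smooth[OF p]] 0 by simp
  then show ?thesis by (intro has_derivative_zero_unique[of UNIV]) auto
qed

section \<open>Weak limits of test functions\<close>

context bounded_open
begin

text \<open>A weakened form of \<open>H10 E\<close> that also contains the continuous functions vanishing on the boundary, for
  which only bounds on the approximating gradients are available.\<close>

definition weakly_H10 :: "('a \<Rightarrow> real) \<Rightarrow> bool" where
  "weakly_H10 w \<longleftrightarrow> w \<in> H1 E \<and> (\<exists>\<Phi>. (\<forall>j::nat. \<Phi> j \<in> test_functions E) \<and>
     (\<forall>\<psi>\<in>L2 E. (\<lambda>j. ip E \<psi> (\<Phi> j)) \<longlonglongrightarrow> ip E \<psi> w \<and>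
        (\<forall>i\<in>Basis. (\<lambda>j. ip E \<psi> (partial i (\<Phi> j))) \<longlonglongrightarrow> ip E \<psi> (pgrad E i w))))"

lemma weakly_H10_add:
  assumes u: "weakly_H10 u" and v: "weakly_H10 v"
  shows "weakly_H10 (\<lambda>x. u x + v x)"
proof -
  have uH: "u \<in> H1 E" and vH: "v \<in> H1 E" using u v by (auto simp: weakly_H10_def)
  obtain \<Phi> where \<Phi>: "\<And>j::nat. \<Phi> j \<in> test_functions E"
    "\<And>\<psi>. \<psi> \<in> L2 E \<Longrightarrow> (\<lambda>j. ip E \<psi> (\<Phi> j)) \<longlonglongrightarrow> ip E \<psi> u"
    "\<And>\<psi> i. \<psi> \<in> L2 E \<Longrightarrow> i \<in> Basis \<Longrightarrow> (\<lambda>j. ip E \<psi> (partial i (\<Phi> j))) \<longlonglongrightarrow> ip E \<psi> (pgrad E i u)"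
    using u unfolding weakly_H10_def by blast
  obtain \<Psi> where \<Psi>: "\<And>j::nat. \<Psi> j \<in> test_functions E"
    "\<And>\<psi>. \<psi> \<in> L2 E \<Longrightarrow> (\<lambda>j. ip E \<psi> (\<Psi> j)) \<longlonglongrightarrow> ip E \<psi> v"
    "\<And>\<psi> i. \<psi> \<in> L2 E \<Longrightarrow> i \<in> Basis \<Longrightarrow> (\<lambda>j. ip E \<psi> (partial i (\<Psi> j))) \<longlonglongrightarrow> ip E \<psi> (pgrad E i v)"
    using v unfolding weakly_H10_def by blast
  have ipadd: "ip E \<psi> (\<lambda>x. f x + g x) = ip E \<psi> f + ip E \<psi> g" if "\<psi> \<in> L2 E" "f \<in> L2 E" "g \<in> L2 E" for \<psi> f g
    using ip_comb_right[OF that(2,3,1), of 1 1] by simp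
  have gradadd: "ip E \<psi> (pgrad E i (\<lambda>x. u x + v x)) = ip E \<psi> (pgrad E i u) + ip E \<psi> (pgrad E i v)"
    if "\<psi> \<in> L2 E" "i \<in> Basis" for \<psi> i
  proof -
    have "(\<lambda>x. pgrad E i (\<lambda>x. u x + v x) x - (pgrad E i u x + pgrad E i v x)) \<in> zae E"
      using pgrad_comb[OF uH vH that(2), of 1 1] by simp
    from ip_zae_diff[OF this lin_space_add[OF lin_space_L2 pgrad_L2[OF uH that(2)] pgrad_L2[OF vH that(2)]] that(1)]
    show ?thesis using ipadd[OF that(1) pgrad_L2[OF uH that(2)] pgrad_L2[OF vH that(2)]] by (simp add: ip_commute)
  qed
  have "(\<lambda>j. ip E \<psi> (\<lambda>x. \<Phi> j x + \<Psi> j x)) \<longlonglongrightarrow> ip E \<psi> (\<lambda>x. u x + v x)" if "\<psi> \<in> L2 E" for \<psi>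
    unfolding ipadd[OF that testfun_L2[OF \<Phi>(1)] testfun_L2[OF \<Psi>(1)]] ipadd[OF that H1_L2[OF uH] H1_L2[OF vH]]
    by (intro tendsto_add \<Phi> \<Psi> that)
  moreover have "(\<lambda>j. ip E \<psi> (partial i (\<lambda>x. \<Phi> j x + \<Psi> j x))) \<longlonglongrightarrow> ip E \<psi> (pgrad E i (\<lambda>x. u x + v x))"
    if "\<psi> \<in> L2 E" "i \<in> Basis" for \<psi> i
    unfolding gradadd[OF that] partial_add[OF testD(1)[OF \<Phi>(1)] testD(1)[OF \<Psi>(1)] that(2)]
      ipadd[OF that(1) test_partial_L2[OF \<Phi>(1) that(2)] test_partial_L2[OF \<Psi>(1) that(2)]]
    by (intro tendsto_add \<Phi> \<Psi> that)
  ultimately show ?thesis unfolding weakly_H10_def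
    using lin_space_add[OF lin_space_H1 uH vH] lin_space_add[OF lin_space_test \<Phi>(1) \<Psi>(1)]
    by (intro conjI exI[of _ "\<lambda>j x. \<Phi> j x + \<Psi> j x"]) auto
qed

lemma ip_pgrad_minus_test:
  assumes w: "w \<in> H1 E" and \<phi>: "\<phi> \<in> test_functions E" and i: "i \<in> Basis" and \<psi>: "\<psi> \<in> L2 E"
  shows "ip E \<psi> (pgrad E i (\<lambda>x. w x - \<phi> x)) = ip E \<psi> (pgrad E i w) - ip E \<psi> (partial i \<phi>)"
proof -
  have L: "pgrad E i w \<in> L2 E" "pgrad E i \<phi> \<in> L2 E" by (intro pgrad_L2 w test_H1 \<phi> i)+
  have "(\<lambda>x. pgrad E i (\<lambda>x. w x - \<phi> x) x - (pgrad E i w x - pgrad E i \<phi> x)) \<in> zae E"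
    using pgrad_comb[OF w test_H1[OF \<phi>] i, of 1 "-1"] by simp
  from ip_zae_diff[OF this lin_space_diff[OF lin_space_L2 L] \<psi>]
  have "ip E \<psi> (pgrad E i (\<lambda>x. w x - \<phi> x)) = ip E \<psi> (pgrad E i w) - ip E \<psi> (pgrad E i \<phi>)"
    using ip_diff_right[OF \<psi> L] by (simp add: ip_commute)
  then show ?thesis using ip_pgrad_smooth[OF testD(1)[OF \<phi>] i \<psi>] by (simp add: ip_commute)
qed

text \<open>By Cauchy-Schwarz, convergence in norm implies weak convergence of the functions and of
  all their partial derivatives.\<close>

lemma H10_weakly_H10:
  assumes "w \<in> H10 E" shows "weakly_H10 w"
proof -
  have w: "w \<in> H1 E" using assms by (rule H10_H1)
  obtain \<Phi> where \<Phi>: "\<And>j::nat. \<Phi> j \<in> test_functions E" and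
    lim: "(\<lambda>j. H1_form (\<lambda>x. w x - \<Phi> j x) (\<lambda>x. w x - \<Phi> j x)) \<longlonglongrightarrow> 0"
    using assms unfolding H10_iff by auto
  let ?d = "\<lambda>j x. w x - \<Phi> j x"
  have d: "?d j \<in> H1 E" for j by (intro lin_space_diff[OF lin_space_H1] w test_H1 \<Phi>)
  have 1: "(\<lambda>j. sqrt (ip E (?d j) (?d j))) \<longlonglongrightarrow> sqrt 0"
    by (intro tendsto_real_sqrt tendsto_sandwich[OF _ _ tendsto_const lim])
      (auto simp: ip_nonneg aE_nonneg[OF d])
  have 2: "(\<lambda>j. sqrt (ip E (pgrad E i (?d j)) (pgrad E i (?d j)))) \<longlonglongrightarrow> sqrt 0" if i: "i \<in> Basis" for i
  proof (intro tendsto_real_sqrt tendsto_sandwich[OF _ _ tendsto_const lim] always_eventually allI)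
    fix j
    have "ip E (pgrad E i (?d j)) (pgrad E i (?d j)) \<le> aE E (?d j) (?d j)"
      unfolding aE_eq_sum[OF d d] by (rule member_le_sum) (auto simp: i ip_nonneg)
    then show "ip E (pgrad E i (?d j)) (pgrad E i (?d j)) \<le> H1_form (?d j) (?d j)" using ip_nonneg[of E "?d j"] by simp
  qed (rule ip_nonneg)
  have squeeze: "a \<longlonglongrightarrow> l" if "s \<longlonglongrightarrow> sqrt 0" "\<And>j. \<bar>l - a j\<bar> \<le> C * s j" for a s :: "nat \<Rightarrow> real" and l C
  proof -
    have "(\<lambda>j. C * s j) \<longlonglongrightarrow> C * sqrt 0" by (intro tendsto_mult_left that)
    then have "(\<lambda>j. l - a j) \<longlonglongrightarrow> 0" using that(2) by (intro Lim_null_comparison[of "\<lambda>j. l - a j" "\<lambda>j. C * s j"]) auto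
    from tendsto_diff[OF tendsto_const[of l] this] show ?thesis by simp
  qed
  have "(\<lambda>j. ip E \<psi> (\<Phi> j)) \<longlonglongrightarrow> ip E \<psi> w" if \<psi>: "\<psi> \<in> L2 E" for \<psi>
    using ip_abs_le[OF \<psi> H1_L2[OF d]] ip_diff_right[OF \<psi> H1_L2[OF w] testfun_L2[OF \<Phi>]]
    by (intro squeeze[OF 1]) simp
  moreover have "(\<lambda>j. ip E \<psi> (partial i (\<Phi> j))) \<longlonglongrightarrow> ip E \<psi> (pgrad E i w)" if \<psi>: "\<psi> \<in> L2 E" and i: "i \<in> Basis" for \<psi> i
    using ip_abs_le[OF \<psi> pgrad_L2[OF d i]] ip_pgrad_minus_test[OF w \<Phi> i \<psi>]
    by (intro squeeze[OF 2[OF i]]) simp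
  ultimately show ?thesis unfolding weakly_H10_def using w \<Phi> by blast
qed

text \<open>Testing \<open>grad w = 0\<close> with \<open>x\<^sub>i \<Phi>\<close> turns \<open>(w, \<Phi>)\<close> into \<open>-(x\<^sub>i w, \<partial>\<^sub>i \<Phi>)\<close>, which tends to \<open>0\<close>.\<close>

lemma weakly_H10_null:
  assumes "weakly_H10 w" "aE E w w = 0"
  shows "w \<in> zae E"
proof -
  have w: "w \<in> H1 E" using assms by (simp add: weakly_H10_def)
  obtain \<Phi> where \<Phi>: "\<And>j::nat. \<Phi> j \<in> test_functions E"
    "\<And>\<psi>. \<psi> \<in> L2 E \<Longrightarrow> (\<lambda>j. ip E \<psi> (\<Phi> j)) \<longlonglongrightarrow> ip E \<psi> w"
    "\<And>\<psi> i. \<psi> \<in> L2 E \<Longrightarrow> i \<in> Basis \<Longrightarrow> (\<lambda>j. ip E \<psi> (partial i (\<Phi> j))) \<longlonglongrightarrow> ip E \<psi> (pgrad E i w)"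
    using assms(1) unfolding weakly_H10_def by blast
  obtain i :: 'a where i: "i \<in> Basis" using nonempty_Basis by blast
  have z: "pgrad E i w \<in> zae E" using assms(2) aE_zero_iff[OF w] i by blast
  have xw: "(\<lambda>x. (x \<bullet> i) * w x) \<in> L2 E"
    by (rule L2_mult_bounded[OF H1_L2[OF w] sets_E bounded_E]) (intro continuous_intros)
  have "ip E w (\<Phi> j) = - ip E (\<lambda>x. (x \<bullet> i) * w x) (partial i (\<Phi> j))" for j
  proof -
    have t: "(\<lambda>x. (x \<bullet> i) * \<Phi> j x) \<in> test_functions E" by (rule test_mult[OF smooth_inner \<Phi>(1)])
    have p: "partial i (\<lambda>x. (x \<bullet> i) * \<Phi> j x) = (\<lambda>x. (x \<bullet> i) * partial i (\<Phi> j) x + \<Phi> j x)"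
      using partial_mult[OF smooth_inner testD(1)[OF \<Phi>(1)] i, of i j] i by (simp add: partial_inner)
    have t2: "(\<lambda>x. (x \<bullet> i) * partial i (\<Phi> j) x) \<in> test_functions E"
      by (rule test_mult[OF smooth_inner test_partial[OF \<Phi>(1) i]])
    have "ip E w (\<lambda>x. 1 * ((x \<bullet> i) * partial i (\<Phi> j) x) + 1 * \<Phi> j x) = 0"
      using ip_pgrad[OF w i t] ip_zae_left[OF z testfun_L2[OF t]] unfolding p by simp
    then have "ip E w (\<lambda>x. (x \<bullet> i) * partial i (\<Phi> j) x) + ip E w (\<Phi> j) = 0"
      unfolding ip_comb_right[OF testfun_L2[OF t2] testfun_L2[OF \<Phi>(1)] H1_L2[OF w]] by simp
    moreover have "ip E w (\<lambda>x. (x \<bullet> i) * partial i (\<Phi> j) x) = ip E (\<lambda>x. (x \<bullet> i) * w x) (partial i (\<Phi> j))"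
      by (rule ip_cong) simp
    ultimately show ?thesis by simp
  qed
  moreover have "(\<lambda>j. - ip E (\<lambda>x. (x \<bullet> i) * w x) (partial i (\<Phi> j))) \<longlonglongrightarrow> - ip E (\<lambda>x. (x \<bullet> i) * w x) (pgrad E i w)"
    by (intro tendsto_minus \<Phi>(3) xw i)
  moreover have "ip E (\<lambda>x. (x \<bullet> i) * w x) (pgrad E i w) = 0"
    using ip_zae_left[OF z xw] by (simp add: ip_commute)
  ultimately have "(\<lambda>j. ip E w (\<Phi> j)) \<longlonglongrightarrow> 0" by simp
  then have "ip E w w = 0" using \<Phi>(2)[OF H1_L2[OF w]] LIMSEQ_unique by blast
  then show ?thesis using ip_zero_iff[OF H1_L2[OF w]] by simp
qed

lemma weak_laplacian_aE_test:
  assumes w: "w \<in> H1 E" and \<phi>: "\<phi> \<in> test_functions E" and l: "has_weak_laplacian E w q"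
  shows "(\<Sum>i\<in>Basis. ip E (pgrad E i w) (partial i \<phi>)) = - ip E q \<phi>"
proof -
  have "ip E q \<phi> = ip E w (\<lambda>x. \<Sum>i\<in>Basis. 1 * partial i (partial i \<phi>) x)"
    using l \<phi> by (simp add: has_weak_laplacian_def)
  also have "\<dots> = (\<Sum>i\<in>Basis. 1 * ip E w (partial i (partial i \<phi>)))"
    by (rule linear_form_sum[OF lin_space_L2 bilinear_right[OF _ H1_L2[OF w]]])
      (use psd_ip in \<open>auto simp: psd_on_def intro!: testfun_L2 test_partial \<phi>\<close>)
  also have "\<dots> = (\<Sum>i\<in>Basis. - ip E (pgrad E i w) (partial i \<phi>))"
    by (intro sum.cong refl) (simp add: ip_pgrad[OF w _ test_partial[OF \<phi>]])
  finally show ?thesis by (simp add: sum_negf)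
qed

text \<open>Testing harmonicity with the approximating functions and passing to the weak limit gives
  zero energy, which leaves only null functions.\<close>

lemma weakly_H10_harmonic:
  assumes "weakly_H10 w" "has_weak_laplacian E w (\<lambda>x. 0)"
  shows "w \<in> zae E"
proof (rule weakly_H10_null[OF assms(1)])
  have w: "w \<in> H1 E" using assms by (simp add: weakly_H10_def)
  obtain \<Phi> where \<Phi>: "\<And>j::nat. \<Phi> j \<in> test_functions E"
    "\<And>\<psi> i. \<psi> \<in> L2 E \<Longrightarrow> i \<in> Basis \<Longrightarrow> (\<lambda>j. ip E \<psi> (partial i (\<Phi> j))) \<longlonglongrightarrow> ip E \<psi> (pgrad E i w)"
    using assms(1) unfolding weakly_H10_def by blast
  have "(\<lambda>j. \<Sum>i\<in>Basis. ip E (pgrad E i w) (partial i (\<Phi> j))) \<longlonglongrightarrow> (\<Sum>i\<in>Basis. ip E (pgrad E i w) (pgrad E i w))"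
    by (intro tendsto_sum \<Phi>(2) pgrad_L2 w)
  moreover have "(\<Sum>i\<in>Basis. ip E (pgrad E i w) (partial i (\<Phi> j))) = 0" for j
    using weak_laplacian_aE_test[OF w \<Phi>(1) assms(2), of j] by (simp add: ip_eq)
  ultimately show "aE E w w = 0" unfolding aE_eq_sum[OF w w] by (simp add: LIMSEQ_const_iff)
qed

text \<open>Bounded gradients converge weakly once they do so against a dense set. Against a test
  function the derivative is moved to that function, where convergence of the
  \<open>\<Phi> j\<close> themselves suffices.\<close>

lemma weakly_H10I:
  assumes w: "w \<in> H1 E" and \<Phi>: "\<And>j::nat. \<Phi> j \<in> test_functions E"
    and lim: "(\<lambda>j. ip E (\<lambda>x. w x - \<Phi> j x) (\<lambda>x. w x - \<Phi> j x)) \<longlonglongrightarrow> 0"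
    and bd: "\<And>i j. i \<in> Basis \<Longrightarrow> ip E (partial i (\<Phi> j)) (partial i (\<Phi> j)) \<le> C i"
  shows "weakly_H10 w"
proof -
  have d: "(\<lambda>x. w x - \<Phi> j x) \<in> L2 E" for j by (intro lin_space_diff[OF lin_space_L2] H1_L2[OF w] testfun_L2 \<Phi>)
  have 1: "(\<lambda>j. ip E \<psi> (\<Phi> j)) \<longlonglongrightarrow> ip E \<psi> w" if \<psi>: "\<psi> \<in> L2 E" for \<psi>
  proof -
    have "(\<lambda>j. sqrt (ip E \<psi> \<psi>) * sqrt (ip E (\<lambda>x. w x - \<Phi> j x) (\<lambda>x. w x - \<Phi> j x))) \<longlonglongrightarrow> sqrt (ip E \<psi> \<psi>) * sqrt 0"
      by (intro tendsto_mult_left tendsto_real_sqrt lim)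
    then have "(\<lambda>j. ip E \<psi> (\<lambda>x. w x - \<Phi> j x)) \<longlonglongrightarrow> 0"
      using ip_abs_le[OF \<psi> d] by (intro Lim_null_comparison[of "\<lambda>j. ip E \<psi> (\<lambda>x. w x - \<Phi> j x)"
        "\<lambda>j. sqrt (ip E \<psi> \<psi>) * sqrt (ip E (\<lambda>x. w x - \<Phi> j x) (\<lambda>x. w x - \<Phi> j x))"]) auto
    from tendsto_diff[OF tendsto_const[of "ip E \<psi> w"] this] show ?thesis
      using ip_diff_right[OF \<psi> H1_L2[OF w] testfun_L2[OF \<Phi>]] by simp
  qed
  have 2: "(\<lambda>j. ip E \<psi> (partial i (\<Phi> j))) \<longlonglongrightarrow> ip E \<psi> (pgrad E i w)" if \<psi>: "\<psi> \<in> L2 E" and i: "i \<in> Basis" for \<psi> i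
  proof -
    let ?g = "pgrad E i w"
    define e where "e = (\<lambda>j x. partial i (\<Phi> j) x - ?g x)"
    have g: "?g \<in> L2 E" by (rule pgrad_L2[OF w i])
    have p: "partial i (\<Phi> j) \<in> L2 E" for j by (rule test_partial_L2[OF \<Phi> i])
    have e: "e j \<in> L2 E" for j unfolding e_def by (intro lin_space_diff[OF lin_space_L2] p g)
    define M where "M = 2 * C i + 2 * ip E ?g ?g"
    have eM: "ip E (e j) (e j) \<le> M" for j
      using ip_square_comb_le[OF p g, of 1 j "-1"] bd[OF i, of j] by (simp add: e_def M_def)
    have M: "M \<ge> 0" using eM[of 0] ip_nonneg[of E "e 0"] by simp
    have test: "(\<lambda>j. ip E \<zeta> (e j)) \<longlonglongrightarrow> 0" if \<zeta>: "\<zeta> \<in> test_functions E" for \<zeta>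
    proof -
      have "ip E \<zeta> (e j) = ip E (partial i \<zeta>) w - ip E (partial i \<zeta>) (\<Phi> j)" for j
        using ip_diff_right[OF testfun_L2[OF \<zeta>] p g, of j] ip_partial_test[OF sets_E bounded_E testD(1)[OF \<zeta>] \<Phi> i, of j]
          ip_pgrad[OF w i \<zeta>] by (simp add: e_def ip_commute)
      moreover have "(\<lambda>j. ip E (partial i \<zeta>) w - ip E (partial i \<zeta>) (\<Phi> j)) \<longlonglongrightarrow> ip E (partial i \<zeta>) w - ip E (partial i \<zeta>) w"
        by (intro tendsto_diff tendsto_const 1 test_partial_L2 \<zeta> i)
      ultimately show ?thesis by simp
    qed
    have "(\<lambda>j. ip E \<psi> (e j)) \<longlonglongrightarrow> 0"
    proof (rule LIMSEQ_I)
      fix r :: real assume r: "r > 0"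
      \<comment> \<open>So small that \<open>sqrt t * sqrt M\<close> is at most
        \<open>r / 2\<close>; the added 1 allows \<open>M = 0\<close>.\<close>
      define t where "t = (r / (2 * (sqrt M + 1)))\<^sup>2"
      have sM: "sqrt M + 1 > 0" using M by (simp add: add_nonneg_pos)
      have "t > 0" using r sM by (simp add: t_def)
      then obtain \<zeta> where \<zeta>: "\<zeta> \<in> test_functions E" "ip E (\<lambda>x. \<psi> x - \<zeta> x) (\<lambda>x. \<psi> x - \<zeta> x) < t"
        using test_dense_L2[OF open_E bounded_E \<psi>] unfolding test_closure_def by blast
      obtain N where N: "\<And>j. j \<ge> N \<Longrightarrow> norm (ip E \<zeta> (e j) - 0) < r / 2"
        using LIMSEQ_D[OF test[OF \<zeta>(1)], of "r / 2"] r by auto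
      have "norm (ip E \<psi> (e j) - 0) < r" if j: "j \<ge> N" for j
      proof -
        have dz: "(\<lambda>x. \<psi> x - \<zeta> x) \<in> L2 E" by (intro lin_space_diff[OF lin_space_L2] \<psi> testfun_L2 \<zeta>)
        have "\<bar>ip E (\<lambda>x. \<psi> x - \<zeta> x) (e j)\<bar> \<le> sqrt (ip E (\<lambda>x. \<psi> x - \<zeta> x) (\<lambda>x. \<psi> x - \<zeta> x)) * sqrt (ip E (e j) (e j))"
          by (rule ip_abs_le[OF dz e])
        also have "\<dots> \<le> sqrt t * sqrt M"
          using \<zeta>(2) eM[of j] ip_nonneg \<open>t > 0\<close> by (intro mult_mono real_sqrt_le_mono) auto
        also have "\<dots> = r / (2 * (sqrt M + 1)) * sqrt M" using r sM by (simp add: t_def real_sqrt_abs)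
        also have "\<dots> \<le> r / 2" using r sM M by (simp add: field_simps)
        finally have "\<bar>ip E (\<lambda>x. \<psi> x - \<zeta> x) (e j)\<bar> \<le> r / 2" .
        then show ?thesis using ip_diff_left[OF e \<psi> testfun_L2[OF \<zeta>(1)], of j] N[OF j]
            unfolding real_norm_def diff_0_right by linarith
      qed
      then show "\<exists>N. \<forall>j\<ge>N. norm (ip E \<psi> (e j) - 0) < r" by blast
    qed
    from tendsto_add[OF this tendsto_const[of "ip E \<psi> ?g"]] show ?thesis
      using ip_diff_right[OF \<psi> p g] by (simp add: e_def)
  qed
  show ?thesis unfolding weakly_H10_def using w \<Phi> 1 2 by blast
qed

end

section \<open>Mollification\<close>

text \<open>Differentiation under the integral sign over a fixed compact box. The derivatives fall
  on the smooth factor only, so the convolutions of \<open>G\<close> with smooth functions form a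
  class for the coinduction.\<close>

lemma smooth_convolution:
  fixes G :: "'a::euclidean_space \<Rightarrow> real"
  assumes G: "continuous_on UNIV G" and \<phi>: "smooth \<phi>"
  shows "smooth (\<lambda>x. integral (cbox a b) (\<lambda>y. G y * \<phi> (x - y)))"
    and "i \<in> Basis \<Longrightarrow> partial i (\<lambda>x. integral (cbox a b) (\<lambda>y. G y * \<phi> (x - y)))
       = (\<lambda>x. integral (cbox a b) (\<lambda>y. G y * partial i \<phi> (x - y)))"
proof -
  let ?F = "\<lambda>\<phi> x. integral (cbox a b) (\<lambda>y. G y * \<phi> (x - y))"
  have main: "\<exists>D. (?F \<phi> has_derivative D) (at x) \<and> (\<forall>i\<in>Basis. D i = ?F (partial i \<phi>) x)"
    if \<phi>: "smooth \<phi>" for \<phi> x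
  proof -
    define fx where "fx = (\<lambda>x t. \<Sum>i\<in>Basis. (G t * partial i \<phi> (x - t)) *\<^sub>R blinfun_inner_left i)"
    have cp: "continuous_on UNIV (partial i \<phi>)" if "i \<in> Basis" for i
      by (rule smooth_continuous[OF smooth_partial[OF \<phi> that]])
    have cfx: "continuous_on A (\<lambda>(x, t). fx x t)" for A
      unfolding fx_def split_beta
      by (intro continuous_intros continuous_on_compose2[OF G] continuous_on_compose2[OF cp]) auto
    have D: "((\<lambda>x. integral (cbox a b) (\<lambda>y. G y * \<phi> (x - y))) has_derivative integral (cbox a b) (fx x)) (at x within UNIV)"
    proof (rule leibniz_rule[OF _ _ cfx])
      fix x t :: 'a
      have "((\<lambda>x. x - t) has_derivative (\<lambda>h. h)) (at x)" by (auto intro!: derivative_eq_intros)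
      from has_derivative_compose[OF this smooth_has_derivative[OF \<phi>]]
      have "((\<lambda>x. G t * \<phi> (x - t)) has_derivative (\<lambda>h. G t * (\<Sum>i\<in>Basis. (h \<bullet> i) * partial i \<phi> (x - t)))) (at x)"
        by (rule has_derivative_mult_right)
      moreover have "(\<lambda>h. G t * (\<Sum>i\<in>Basis. (h \<bullet> i) * partial i \<phi> (x - t))) = blinfun_apply (fx x t)"
        unfolding fx_def by (rule ext) (simp add: blinfun.sum_left blinfun.scaleR_left sum_distrib_left mult_ac inner_commute)
      ultimately show "((\<lambda>x. G t * \<phi> (x - t)) has_derivative blinfun_apply (fx x t)) (at x within UNIV)" by simp
    next
      fix x
      show "(\<lambda>y. G y * \<phi> (x - y)) integrable_on cbox a b"
        by (intro integrable_continuous continuous_intros continuous_on_compose2[OF G]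
            continuous_on_compose2[OF smooth_continuous[OF \<phi>, of UNIV]]) auto
    qed auto
    have "blinfun_apply (integral (cbox a b) (fx x)) i = ?F (partial i \<phi>) x" if i: "i \<in> Basis" for i
    proof -
      have "continuous_on (cbox a b) (fx x)"
        unfolding fx_def
        by (intro continuous_intros continuous_on_compose2[OF G] continuous_on_compose2[OF cp]) auto
      then have "fx x integrable_on cbox a b" by (rule integrable_continuous)
      from integral_linear[OF this blinfun.bounded_linear_left[of i]]
      have "blinfun_apply (integral (cbox a b) (fx x)) i = integral (cbox a b) (\<lambda>t. blinfun_apply (fx x t) i)"
        by (simp add: o_def)
      also have "(\<lambda>t. blinfun_apply (fx x t) i) = (\<lambda>t. G t * partial i \<phi> (x - t))"
      proof
        fix t
        have "blinfun_apply (fx x t) i = (\<Sum>j\<in>Basis. (i \<bullet> j) * (G t * partial j \<phi> (x - t)))"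
          unfolding fx_def by (simp add: blinfun.sum_left blinfun.scaleR_left mult_ac inner_commute)
        then show "blinfun_apply (fx x t) i = G t * partial i \<phi> (x - t)" by (simp only: partial_delta[OF i])
      qed
      finally show ?thesis .
    qed
    then show ?thesis using D by auto
  qed
  have P: "partial i (?F \<phi>) = ?F (partial i \<phi>)" if sm: "smooth \<phi>" and i: "i \<in> Basis" for \<phi> i
  proof
    fix x
    from main[OF sm, of x] obtain D where
      "(?F \<phi> has_derivative D) (at x) \<and> (\<forall>i\<in>Basis. D i = ?F (partial i \<phi>) x)" by (rule exE)
    then show "partial i (?F \<phi>) x = ?F (partial i \<phi>) x" using partial_eq[of "?F \<phi>" D x i] i by simp
  qed
  show "smooth (?F \<phi>)"
  proof (rule smooth_coinduct[where C = "?F ` Collect smooth"])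
    show "g differentiable_on UNIV" if "g \<in> ?F ` Collect smooth" for g
    proof -
      obtain \<theta> where t: "g = ?F \<theta>" "smooth \<theta>" using \<open>g \<in> _\<close> by blast
      show ?thesis unfolding t(1) differentiable_on_def differentiable_def using main[OF t(2)] by auto
    qed
    show "partial i g \<in> ?F ` Collect smooth" if "g \<in> ?F ` Collect smooth" "i \<in> Basis" for g i
    proof -
      obtain \<theta> where t: "g = ?F \<theta>" "smooth \<theta>" using \<open>g \<in> _\<close> by blast
      show ?thesis unfolding t(1) P[OF t(2) that(2)] using smooth_partial[OF t(2) that(2)] by (intro imageI) simp
    qed
  qed (use \<phi> in blast)
  show "partial i (?F \<phi>) = ?F (partial i \<phi>)" if "i \<in> Basis" by (rule P[OF \<phi> that])
qed

lemma lborel_distr_reflect: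
  fixes x :: "'a::euclidean_space"
  shows "distr lborel borel (\<lambda>y. x - y) = lborel"
  using lborel_affine[of "-1" x] by (simp add: density_1)

lemma lborel_integral_reflect:
  fixes f :: "'a::euclidean_space \<Rightarrow> real"
  assumes "f \<in> borel_measurable borel"
  shows "(LINT y|lborel. f (x - y)) = (LINT y|lborel. f y)"
proof -
  have "(LINT y|lborel. f y) = (LINT y|distr lborel borel (\<lambda>y. x - y). f y)" by (simp add: lborel_distr_reflect)
  also have "\<dots> = (LINT y|lborel. f (x - y))" by (rule integral_distr) (use assms in auto)
  finally show ?thesis by simp
qed

lemma mollifier_exists:
  assumes "d > 0"
  shows "\<exists>\<rho> :: 'a::euclidean_space \<Rightarrow> real. smooth \<rho> \<and> (\<forall>x. 0 \<le> \<rho> x) \<and> (\<forall>x. \<rho> x \<noteq> 0 \<longrightarrow> norm x < d)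
     \<and> (LINT x|lborel. \<rho> x) = 1"
proof -
  \<comment> \<open>The bump lives in a cube of half-width \<delta>; the norm is at most the sum of
    the absolute coordinates, hence below \<open>d\<close>.\<close>
  define \<delta> where "\<delta> = d / real DIM('a)"
  have \<delta>: "\<delta> > 0" using assms by (simp add: \<delta>_def)
  let ?a = "- (\<delta> *\<^sub>R One) :: 'a" and ?b = "\<delta> *\<^sub>R One :: 'a"
  let ?\<beta> = "box_bump ?a ?b"
  have sm: "smooth ?\<beta>" by (rule smooth_box_bump)
  have cont: "continuous_on UNIV ?\<beta>" by (rule smooth_continuous[OF sm])
  have supp: "{x. ?\<beta> x \<noteq> 0} \<subseteq> box ?a ?b" using box_bump_pos_iff by blast
  have int: "integrable lborel ?\<beta>"
    by (rule continuous_compact_support_integrable[OF cont bounded_subset[OF bounded_box supp]])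
  have "(LINT x|lborel. ?\<beta> x) \<noteq> 0"
  proof
    assume "(LINT x|lborel. ?\<beta> x) = 0"
    then have "AE x in lborel. ?\<beta> x = 0"
      using integral_nonneg_eq_0_iff_AE[OF int] box_bump_nonneg by auto
    then have "?\<beta> \<in> zae UNIV" by (simp add: zae_def AE_completion)
    then have "?\<beta> 0 = 0" using continuous_AE_zero[OF open_UNIV cont] by blast
    moreover have "0 \<in> box ?a ?b" using \<delta> by (simp add: mem_box inner_sum_left_Basis)
    ultimately show False using box_bump_pos_iff by blast
  qed
  moreover have "(LINT x|lborel. ?\<beta> x) \<ge> 0" by (intro Bochner_Integration.integral_nonneg box_bump_nonneg)
  ultimately have c: "(LINT x|lborel. ?\<beta> x) > 0" by simp
  define \<rho> where "\<rho> = (\<lambda>x. (1 / (LINT x|lborel. ?\<beta> x)) * ?\<beta> x)"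
  have "norm x < d" if "\<rho> x \<noteq> 0" for x
  proof -
    have "x \<in> box ?a ?b" using that box_bump_pos_iff[of ?a ?b x] by (auto simp: \<rho>_def)
    then have "\<bar>x \<bullet> i\<bar> < \<delta>" if "i \<in> Basis" for i
      using that by (auto simp: mem_box abs_less_iff inner_sum_left_Basis minus_less_iff)
    then have "(\<Sum>i\<in>Basis. \<bar>x \<bullet> i\<bar>) < (\<Sum>i\<in>(Basis::'a set). \<delta>)" by (intro sum_strict_mono) auto
    then show ?thesis using norm_le_l1[of x] by (simp add: \<delta>_def)
  qed
  moreover have "smooth \<rho>" unfolding \<rho>_def by (intro smooth_mult smooth_const sm)
  moreover have "0 \<le> \<rho> x" for x using c box_bump_nonneg[of ?a ?b x] by (simp add: \<rho>_def)
  moreover have "(LINT x|lborel. \<rho> x) = 1" using c by (simp add: \<rho>_def)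
  ultimately show ?thesis by blast
qed

text \<open>A smooth soft threshold: small values are set to 0, and the slope bound will keep
  gradients from growing. The profile \<open>u\<close> is \<open>v * exp (- inverse v)\<close> for
  positive \<open>v\<close>, whose slope lies between 0 and 1 and which stays within 1 of
  \<open>v\<close>; it is used once for each sign, rescaled by \<open>e\<close>.\<close>

lemma cutoff_exists:
  assumes e: "e > 0"
  shows "\<exists>\<eta> :: real \<Rightarrow> real. smooth \<eta> \<and> (\<forall>s. \<bar>\<eta> s - s\<bar> \<le> 2 * e) \<and> (\<forall>s. \<bar>s\<bar> \<le> e \<longrightarrow> \<eta> s = 0 \<and> partial 1 \<eta> s = 0)
     \<and> (\<forall>s. \<bar>partial 1 \<eta> s\<bar> \<le> 1)"
proof -
  define u where "u = (\<lambda>v::real. v * exp_bump 0 v)"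
  define u' where "u' = (\<lambda>v::real. exp_bump 0 v + v * exp_bump 2 v)"
  have id: "smooth (\<lambda>s::real. s)" using smooth_inner[of "1::real"] by simp
  have smu: "smooth u" unfolding u_def by (intro smooth_mult id smooth_exp_bump)
  have du: "(u has_real_derivative u' v) (at v)" for v
    unfolding u_def u'_def using exp_bump_derivative[of 0 v]
    by (auto intro!: derivative_eq_intros simp: numeral_2_eq_2)
  have u0: "u v = 0" "u' v = 0" if "v \<le> 0" for v using that by (auto simp: u_def u'_def exp_bump_def)
  have u'1: "0 \<le> u' v" "u' v \<le> 1" for v
  proof -
    have "u' v = (1 + inverse v) * exp (- inverse v)" if "v > 0"
      using that by (simp add: u'_def exp_bump_def field_simps power2_eq_square)
    \<comment> \<open>The slope is at most 1 because 1 + y is at most exp y.\<close>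
    moreover have "(1 + inverse v) * exp (- inverse v) \<le> exp (inverse v) * exp (- inverse v)" if "v > 0"
      by (intro mult_right_mono exp_ge_add_one_self) auto
    moreover have "exp (inverse v) * exp (- inverse v) = 1" by (simp add: exp_minus)
    ultimately show "0 \<le> u' v" "u' v \<le> 1" using u0(2)[of v] by (cases "v > 0"; simp)+
  qed
  have ud: "0 \<le> v - u v \<and> v - u v \<le> 1" if "v > 0" for v
  proof -
    have "u v = v * exp (- inverse v)" using that by (simp add: u_def exp_bump_def)
    moreover have "1 - inverse v \<le> exp (- inverse v)" using exp_ge_add_one_self[of "- inverse v"] by simp
    then have "v * (1 - inverse v) \<le> v * exp (- inverse v)" using that by (intro mult_left_mono) auto
    moreover have "v * (1 - inverse v) = v - 1" using that by (simp add: field_simps)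
    moreover have "v * exp (- inverse v) \<le> v * 1" using that by (intro mult_left_mono) auto
    ultimately show ?thesis by simp
  qed
  \<comment> \<open>Affine maps sending \<open>s > e\<close> and \<open>s < - e\<close>,
    respectively, to positive arguments, so that never both profiles are active.\<close>
  define l1 where "l1 = (\<lambda>s::real. (1 / e) * s + (-1))"
  define l2 where "l2 = (\<lambda>s::real. (-1 / e) * s + (-1))"
  define \<eta> where "\<eta> = (\<lambda>s. e * u (l1 s) + (- e) * u (l2 s))"
  have sml: "smooth l1" "smooth l2" unfolding l1_def l2_def by (intro smooth_add smooth_mult smooth_const id)+
  have sm: "smooth \<eta>" unfolding \<eta>_def
    by (intro smooth_comb smooth_comp[OF smu] sml)
  have "(\<eta> has_real_derivative u' (l1 s) + u' (l2 s)) (at s)" for s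
  proof -
    have d1: "(l1 has_real_derivative 1 / e) (at s)" and d2: "(l2 has_real_derivative (-1 / e)) (at s)"
      unfolding l1_def l2_def using e by (auto intro!: derivative_eq_intros)
    have "(\<eta> has_real_derivative e * (u' (l1 s) * (1 / e)) + (- e) * (u' (l2 s) * (-1 / e))) (at s)"
      unfolding \<eta>_def by (intro DERIV_add DERIV_cmult DERIV_chain2[OF du d1] DERIV_chain2[OF du d2])
    then show ?thesis using e by simp
  qed
  then have p\<eta>: "partial 1 \<eta> s = u' (l1 s) + u' (l2 s)" for s by (rule partial_real)
  have cases: "l1 s > 0 \<longleftrightarrow> s > e" "l2 s > 0 \<longleftrightarrow> s < - e" for s
    using e by (auto simp: l1_def l2_def field_simps)
  have "\<bar>\<eta> s - s\<bar> \<le> 2 * e" for s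
  proof -
    consider "s > e" | "s < - e" | "\<bar>s\<bar> \<le> e" by linarith
    then show ?thesis
    proof cases
      case 1
      then have "l1 s > 0" "l2 s \<le> 0" using cases[of s] e by auto
      then have "\<eta> s - s = - e - e * (l1 s - u (l1 s))" using e u0 by (simp add: \<eta>_def l1_def field_simps)
      moreover have "0 \<le> e * (l1 s - u (l1 s))" "e * (l1 s - u (l1 s)) \<le> e * 1"
        using ud[OF \<open>l1 s > 0\<close>] e by (intro mult_nonneg_nonneg mult_left_mono; simp)+
      ultimately show ?thesis using e by simp
    next
      case 2
      then have "l2 s > 0" "l1 s \<le> 0" using cases[of s] e by auto
      then have "\<eta> s - s = e + e * (l2 s - u (l2 s))" using e u0 by (simp add: \<eta>_def l2_def field_simps)
      moreover have "0 \<le> e * (l2 s - u (l2 s))" "e * (l2 s - u (l2 s)) \<le> e * 1"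
        using ud[OF \<open>l2 s > 0\<close>] e by (intro mult_nonneg_nonneg mult_left_mono; simp)+
      ultimately show ?thesis using e by simp
    next
      case 3
      then have "l1 s \<le> 0" "l2 s \<le> 0" using cases[of s] by auto
      then show ?thesis using 3 e u0 by (simp add: \<eta>_def)
    qed
  qed
  moreover have "\<eta> s = 0 \<and> partial 1 \<eta> s = 0" if "\<bar>s\<bar> \<le> e" for s
  proof -
    have "l1 s \<le> 0" "l2 s \<le> 0" using that cases[of s] by auto
    then show ?thesis unfolding p\<eta> using u0 by (simp add: \<eta>_def)
  qed
  moreover have "\<bar>partial 1 \<eta> s\<bar> \<le> 1" for s
  proof -
    have "u' (l1 s) = 0 \<or> u' (l2 s) = 0" using cases[of s] u0 e by (cases "s > e") auto
    then show ?thesis using u'1[of "l1 s"] u'1[of "l2 s"] unfolding p\<eta> by auto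
  qed
  ultimately show ?thesis using sm by blast
qed

lemma integral_cbox_lborel:
  fixes f :: "'a::euclidean_space \<Rightarrow> real"
  assumes "continuous_on UNIV f" "\<And>x. x \<notin> cbox a b \<Longrightarrow> f x = 0"
  shows "integral (cbox a b) f = (LINT x|lborel. f x)"
proof -
  have "set_integrable lborel (cbox a b) f"
    unfolding set_integrable_def by (rule borel_integrable_compact) (auto intro: continuous_on_subset[OF assms(1)])
  from set_borel_integral_eq_integral(2)[OF this]
  have "integral (cbox a b) f = (LINT x:cbox a b|lborel. f x)" by simp
  also have "\<dots> = (LINT x|lborel. f x)"
    unfolding set_lebesgue_integral_def using assms(2)
    by (intro Bochner_Integration.integral_cong) (auto simp: indicator_def)
  finally show ?thesis .
qed

context bounded_open
begin

text \<open>Young's inequality for a probability density: with the square root of \<rho> split off,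
  Cauchy-Schwarz bounds the squared average by the average of squares, and Tonelli integrates the
  shifted density to 1. The function \<open>p\<close> need only be dominated by the average where it
  is nonzero, which leaves room for a cutoff.\<close>

lemma convolution_bound:
  assumes g: "g \<in> L2 E" and \<rho>: "smooth \<rho>" "\<And>x. 0 \<le> \<rho> x" "\<And>x. \<rho> x \<noteq> 0 \<Longrightarrow> norm x < d"
    and one: "(LINT x|lborel. \<rho> x) = 1"
    and p: "p \<in> L2 E" "\<And>x. x \<in> E \<Longrightarrow> p x = 0 \<or> (cball x d \<subseteq> E \<and> \<bar>p x\<bar> \<le> \<bar>ip E g (\<lambda>y. \<rho> (x - y))\<bar>)"
  shows "ip E p p \<le> ip E g g"
proof -
  have c\<rho>: "continuous_on UNIV \<rho>" by (rule smooth_continuous[OF \<rho>(1)])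
  have m\<rho>[measurable]: "\<rho> \<in> borel_measurable borel" by (rule borel_measurable_continuous_onI[OF c\<rho>])
  have int\<rho>: "integrable lborel \<rho>"
    by (rule continuous_compact_support_integrable[OF c\<rho> bounded_subset[OF bounded_ball[of 0 d]]])
      (use \<rho>(3) in auto)
  \<comment> \<open>A Borel representative, so that Tonelli applies on the product of the Borel
    measures.\<close>
  obtain h where h[measurable]: "h \<in> borel_measurable lborel" and gh: "AE x in lborel. indicator E x * g x = h x"
    using completion_ex_borel_measurable_real[OF L2_measurable[OF g]] by blast
  have pointwise: "ennreal (indicator E x * (p x * p x)) \<le> (\<integral>\<^sup>+y. ennreal ((h y)\<^sup>2) * ennreal (\<rho> (x - y)) \<partial>lborel)" for x
  proof (cases "x \<in> E \<and> p x \<noteq> 0")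
    case True
    then have x: "cball x d \<subseteq> E" "\<bar>p x\<bar> \<le> \<bar>ip E g (\<lambda>y. \<rho> (x - y))\<bar>" using p(2)[of x] by auto
    let ?s = "\<lambda>y. sqrt (\<rho> (x - y))"
    have cs: "continuous_on UNIV ?s"
      by (intro continuous_intros continuous_on_compose2[OF c\<rho>]) auto
    have sL: "?s \<in> L2 E" by (rule L2_continuous[OF sets_E bounded_E cs])
    have sgL: "(\<lambda>y. ?s y * g y) \<in> L2 E" by (rule L2_mult_bounded[OF g sets_E bounded_E cs])
    have s2: "?s y * ?s y = \<rho> (x - y)" for y using \<rho>(2) by simp
    have "ip E g (\<lambda>y. \<rho> (x - y)) = ip E (\<lambda>y. ?s y * g y) ?s"
    proof (rule ip_cong)
      fix y
      have "(?s y * g y) * ?s y = g y * (?s y * ?s y)" by (simp only: mult_ac)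
      then show "g y * \<rho> (x - y) = (?s y * g y) * ?s y" by (simp only: s2)
    qed
    then have "\<bar>p x\<bar>\<^sup>2 \<le> (ip E (\<lambda>y. ?s y * g y) ?s)\<^sup>2" using x(2) by (simp add: abs_le_square_iff)
    also have "\<dots> \<le> ip E (\<lambda>y. ?s y * g y) (\<lambda>y. ?s y * g y) * ip E ?s ?s"
      by (rule psd_cauchy_schwarz[OF lin_space_L2 psd_ip sgL sL])
    also have "ip E ?s ?s = (LINT y|lebesgue. \<rho> (x - y))"
      unfolding ip_eq s2
    proof (intro Bochner_Integration.integral_cong refl)
      fix y
      have "y \<in> E" if "\<rho> (x - y) \<noteq> 0" using \<rho>(3)[OF that] x(1) by (auto simp: dist_norm)
      then show "indicator E y * \<rho> (x - y) = \<rho> (x - y)" by (auto simp: indicator_def)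
    qed
    also have "\<dots> = (LINT y|lborel. \<rho> (x - y))" by (rule integral_completion) measurable
    also have "\<dots> = 1" using lborel_integral_reflect[OF m\<rho>, of x] one by simp
    finally have px: "p x * p x \<le> ip E (\<lambda>y. ?s y * g y) (\<lambda>y. ?s y * g y)" by (simp add: power2_eq_square)
    have "ennreal (ip E (\<lambda>y. ?s y * g y) (\<lambda>y. ?s y * g y))
        = (\<integral>\<^sup>+y. ennreal (indicator E y * ((?s y * g y) * (?s y * g y))) \<partial>lebesgue)"
      unfolding ip_eq by (rule nn_integral_eq_integral[symmetric, OF L2_prod_integrable[OF sgL sgL]]) simp
    also have "\<dots> = (\<integral>\<^sup>+y. ennreal (indicator E y * ((?s y * g y) * (?s y * g y))) \<partial>lborel)"
      by (rule nn_integral_completion)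
    also have "\<dots> = (\<integral>\<^sup>+y. ennreal ((h y)\<^sup>2) * ennreal (\<rho> (x - y)) \<partial>lborel)"
    proof (rule nn_integral_cong_AE)
      show "AE y in lborel. ennreal (indicator E y * ((?s y * g y) * (?s y * g y))) = ennreal ((h y)\<^sup>2) * ennreal (\<rho> (x - y))"
        using gh
      proof eventually_elim
        fix y assume hy: "indicator E y * g y = h y"
        have "indicator E y * ((?s y * g y) * (?s y * g y)) = (?s y * ?s y) * (indicator E y * g y) * (indicator E y * g y)"
          by (simp add: indicator_def)
        also have "\<dots> = (h y)\<^sup>2 * \<rho> (x - y)" unfolding s2 hy by (simp add: power2_eq_square)
        finally show "ennreal (indicator E y * ((?s y * g y) * (?s y * g y))) = ennreal ((h y)\<^sup>2) * ennreal (\<rho> (x - y))"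
          by (simp add: ennreal_mult \<rho>(2))
      qed
    qed
    finally show ?thesis using True ennreal_leI[OF px] by simp
  next
    case False
    then show ?thesis by (auto simp: indicator_def)
  qed
  have "ennreal (ip E p p) = (\<integral>\<^sup>+x. ennreal (indicator E x * (p x * p x)) \<partial>lebesgue)"
    unfolding ip_eq by (rule nn_integral_eq_integral[symmetric, OF L2_prod_integrable[OF p(1) p(1)]]) simp
  also have "\<dots> = (\<integral>\<^sup>+x. ennreal (indicator E x * (p x * p x)) \<partial>lborel)" by (rule nn_integral_completion)
  also have "\<dots> \<le> (\<integral>\<^sup>+x. (\<integral>\<^sup>+y. ennreal ((h y)\<^sup>2) * ennreal (\<rho> (x - y)) \<partial>lborel) \<partial>lborel)"
    by (rule nn_integral_mono) (rule pointwise)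
  also have "\<dots> = (\<integral>\<^sup>+y. (\<integral>\<^sup>+x. ennreal ((h y)\<^sup>2) * ennreal (\<rho> (x - y)) \<partial>lborel) \<partial>lborel)"
    by (rule lborel_pair.Fubini'[symmetric]) measurable
  also have "\<dots> = (\<integral>\<^sup>+y. ennreal ((h y)\<^sup>2) \<partial>lborel)"
  proof (rule nn_integral_cong)
    fix y
    have "(\<integral>\<^sup>+x. ennreal (\<rho> (x - y)) \<partial>lborel) = (\<integral>\<^sup>+x. ennreal (\<rho> x) \<partial>distr lborel borel ((+) (- y)))"
      by (subst nn_integral_distr) (auto simp: algebra_simps)
    also have "\<dots> = ennreal 1"
      unfolding lborel_distr_plus one[symmetric] by (rule nn_integral_eq_integral[OF int\<rho>]) (simp add: \<rho>(2))
    finally show "(\<integral>\<^sup>+x. ennreal ((h y)\<^sup>2) * ennreal (\<rho> (x - y)) \<partial>lborel) = ennreal ((h y)\<^sup>2)"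
      by (subst nn_integral_cmult) auto
  qed
  also have "\<dots> = (\<integral>\<^sup>+y. ennreal (indicator E y * (g y * g y)) \<partial>lborel)"
  proof (rule nn_integral_cong_AE)
    show "AE y in lborel. ennreal ((h y)\<^sup>2) = ennreal (indicator E y * (g y * g y))"
      using gh
    proof eventually_elim
      fix y assume "indicator E y * g y = h y"
      then show "ennreal ((h y)\<^sup>2) = ennreal (indicator E y * (g y * g y))"
        by (simp add: indicator_def power2_eq_square split: if_splits flip: \<open>_ = h y\<close>)
    qed
  qed
  also have "\<dots> = (\<integral>\<^sup>+y. ennreal (indicator E y * (g y * g y)) \<partial>lebesgue)"
    by (rule nn_integral_completion[symmetric])
  also have "\<dots> = ennreal (ip E g g)"
    unfolding ip_eq by (rule nn_integral_eq_integral[OF L2_prod_integrable[OF g g]]) simp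
  finally show ?thesis using ip_nonneg[of E g] by simp
qed

lemma uniformly_continuous_extension:
  assumes G: "continuous_on UNIV G" "\<And>x. x \<notin> E \<Longrightarrow> G x = (0::real)" and e: "e > 0"
  shows "\<exists>d>0. \<forall>x y. dist x y < d \<longrightarrow> \<bar>G x - G y\<bar> < e"
proof -
  obtain r where r: "E \<subseteq> cball 0 r" using bounded_E by (force simp: bounded_iff)
  have "uniformly_continuous_on (cball 0 (r + 1)) G"
    by (intro compact_uniformly_continuous continuous_on_subset[OF G(1)]) auto
  then obtain d where d: "d > 0" "\<And>x y. \<lbrakk>x \<in> cball 0 (r + 1); y \<in> cball 0 (r + 1); dist y x < d\<rbrakk> \<Longrightarrow> dist (G y) (G x) < e"
    using e unfolding uniformly_continuous_on_def by metis
  have "\<bar>G x - G y\<bar> < e" if xy: "dist x y < min d 1" for x y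
  proof (cases "x \<in> E \<or> y \<in> E")
    case True
    then have "norm x \<le> r \<or> norm y \<le> r" using r by auto
    moreover have "norm x \<le> norm y + dist x y" "norm y \<le> norm x + dist x y"
      using norm_triangle_sub[of x y] norm_triangle_sub[of y x] by (auto simp: dist_norm norm_minus_commute)
    ultimately have "x \<in> cball 0 (r + 1)" "y \<in> cball 0 (r + 1)" using xy by auto
    from d(2)[OF this(2,1)] xy show ?thesis by (simp add: dist_real_def)
  qed (use G(2) e in auto)
  then show ?thesis using d(1) by (intro exI[of _ "min d 1"]) auto
qed

text \<open>Mollify the extension of \<open>G\<close> by zero, then apply the soft threshold. The
  mollified \<open>M\<close> is within \<open>e / 2\<close> of the extension, so where it exceeds
  \<open>e\<close> the extension is at least \<open>e / 2\<close>. This confines the support to a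
  compact set \<open>K\<close> inside \<open>E\<close>, and on \<open>K\<close> the derivative of
  \<open>M\<close> is an average of the weak gradient of \<open>G\<close>. The error is at most
  \<open>e / 2 + 2 * e\<close>.\<close>

lemma zero_boundary_approx:
  assumes G: "G \<in> H1 E" "continuous_on (closure E) G" "\<And>x. x \<in> frontier E \<Longrightarrow> G x = 0" and e: "e > 0"
  shows "\<exists>\<Phi>\<in>test_functions E. (\<forall>x\<in>E. \<bar>G x - \<Phi> x\<bar> \<le> 3 * e) \<and>
     (\<forall>i\<in>Basis. ip E (partial i \<Phi>) (partial i \<Phi>) \<le> ip E (pgrad E i G) (pgrad E i G))"
proof -
  define G0 where "G0 = (\<lambda>x. if x \<in> E then G x else 0)"
  have E_cl: "E \<subseteq> closure E" by (rule closure_subset)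
  have fr: "x \<in> frontier E" if "x \<in> closure E" "x \<notin> E" for x
    using that open_E by (simp add: frontier_def interior_open)
  have cG0: "continuous_on UNIV G0"
  proof -
    have 1: "continuous_on (closure E) G0"
      by (rule continuous_on_eq[OF G(2)]) (use fr G(3) in \<open>auto simp: G0_def\<close>)
    have 2: "continuous_on (- E) G0"
      by (rule continuous_on_eq[OF continuous_on_const[of _ 0]]) (auto simp: G0_def)
    have "continuous_on (closure E \<union> - E) G0"
      by (rule continuous_on_closed_Un[OF _ _ 1 2]) (use open_E in auto)
    moreover have "closure E \<union> - E = UNIV" using E_cl by auto
    ultimately show ?thesis by simp
  qed
  have G0out: "\<And>x. x \<notin> E \<Longrightarrow> G0 x = 0" by (simp add: G0_def)
  define K where "K = {x. \<bar>G0 x\<bar> \<ge> e / 2}"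
  have KE: "K \<subseteq> E" using G0out e by (force simp: K_def)
  have "closed K" unfolding K_def by (intro closed_Collect_le continuous_intros cG0)
  then have cK: "compact K" using bounded_subset[OF bounded_E KE] by (simp add: compact_eq_bounded_closed)
  obtain d0 where d0: "d0 > 0" "(\<Union>x\<in>K. cball x d0) \<subseteq> E"
    using compact_subset_open_imp_cball_epsilon_subset[OF cK open_E KE] by blast
  obtain d1 where d1: "d1 > 0" "\<And>x y. dist x y < d1 \<Longrightarrow> \<bar>G0 x - G0 y\<bar> < e / 2"
    using uniformly_continuous_extension[OF cG0 G0out, of "e / 2"] e by auto
  \<comment> \<open>Balls of this radius around points of \<open>K\<close> stay in \<open>E\<close>,
    and over this distance the extension varies by less than \<open>e / 2\<close>.\<close>
  define d where "d = min d0 d1"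
  have d: "d > 0" "d \<le> d0" "d \<le> d1" using d0 d1 by (auto simp: d_def)
  obtain \<rho> :: "'a \<Rightarrow> real" where \<rho>: "smooth \<rho>" "\<And>x. 0 \<le> \<rho> x" "\<And>x. \<rho> x \<noteq> 0 \<Longrightarrow> norm x < d" and one: "(LINT x|lborel. \<rho> x) = 1"
    using mollifier_exists[OF d(1)] by blast
  have c\<rho>: "continuous_on UNIV \<rho>" by (rule smooth_continuous[OF \<rho>(1)])
  have m\<rho>: "\<rho> \<in> borel_measurable borel" by (rule borel_measurable_continuous_onI[OF c\<rho>])
  obtain a where ab: "E \<subseteq> cbox (- a) a" using bounded_subset_cbox_symmetric[OF bounded_E] by blast
  define M where "M = (\<lambda>x. integral (cbox (- a) a) (\<lambda>y. G0 y * \<rho> (x - y)))"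
  have smM: "smooth M" unfolding M_def by (rule smooth_convolution[OF cG0 \<rho>(1)])
  have crho: "continuous_on UNIV (\<lambda>y. \<rho> (x - y))" for x
    by (intro continuous_on_compose2[OF c\<rho>] continuous_intros) auto
  have Meq: "M x = (LINT y|lborel. G0 y * \<rho> (x - y))" for x
    unfolding M_def by (rule integral_cbox_lborel) (use ab G0out in \<open>auto intro!: continuous_intros cG0 crho\<close>)
  have MG: "\<bar>M x - G0 x\<bar> \<le> e / 2" for x
  proof -
    have i1: "integrable lborel (\<lambda>y. \<rho> (x - y))"
      by (rule continuous_compact_support_integrable[OF crho bounded_subset[OF bounded_ball[of x d]]])
        (use \<rho>(3) in \<open>auto simp: dist_norm\<close>)
    have i2: "integrable lborel (\<lambda>y. G0 y * \<rho> (x - y))"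
      by (rule continuous_compact_support_integrable[OF _ bounded_subset[OF bounded_ball[of x d]]])
        (use \<rho>(3) in \<open>auto simp: dist_norm intro!: continuous_intros cG0 crho\<close>)
    have one': "(LINT y|lborel. \<rho> (x - y)) = 1" using lborel_integral_reflect[OF m\<rho>, of x] one by simp
    have "M x - G0 x = (LINT y|lborel. G0 y * \<rho> (x - y)) - (LINT y|lborel. G0 x * \<rho> (x - y))"
      by (simp add: Meq one')
    also have "\<dots> = (LINT y|lborel. G0 y * \<rho> (x - y) - G0 x * \<rho> (x - y))"
      using i1 i2 by (intro Bochner_Integration.integral_diff[symmetric]) auto
    also have "\<bar>\<dots>\<bar> \<le> (LINT y|lborel. (e / 2) * \<rho> (x - y))"
      unfolding real_norm_def[symmetric]
    proof (rule Bochner_Integration.integral_norm_bound_integral)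
      show "integrable lborel (\<lambda>y. G0 y * \<rho> (x - y) - G0 x * \<rho> (x - y))"
        using i1 i2 by (intro Bochner_Integration.integrable_diff) auto
      show "integrable lborel (\<lambda>y. (e / 2) * \<rho> (x - y))" using i1 by simp
      fix y
      show "norm (G0 y * \<rho> (x - y) - G0 x * \<rho> (x - y)) \<le> e / 2 * \<rho> (x - y)"
      proof (cases "\<rho> (x - y) = 0")
        case False
        then have "\<bar>G0 y - G0 x\<bar> < e / 2" using \<rho>(3)[OF False] d(3) by (intro d1(2)) (simp add: dist_norm norm_minus_commute)
        then have "\<bar>G0 y - G0 x\<bar> * \<rho> (x - y) \<le> e / 2 * \<rho> (x - y)" using \<rho>(2) by (intro mult_right_mono) auto
        moreover have "norm (G0 y * \<rho> (x - y) - G0 x * \<rho> (x - y)) = \<bar>G0 y - G0 x\<bar> * \<rho> (x - y)"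
          using \<rho>(2)[of "x - y"] by (simp add: left_diff_distrib[symmetric] abs_mult)
        ultimately show ?thesis by simp
      qed simp
    qed
    also have "\<dots> = e / 2" by (simp add: one')
    finally show ?thesis .
  qed
  obtain \<eta> :: "real \<Rightarrow> real" where \<eta>: "smooth \<eta>" "\<And>s. \<bar>\<eta> s - s\<bar> \<le> 2 * e" "\<And>s. \<bar>s\<bar> \<le> e \<Longrightarrow> \<eta> s = 0 \<and> partial 1 \<eta> s = 0"
     "\<And>s. \<bar>partial 1 \<eta> s\<bar> \<le> 1" using cutoff_exists[OF e] by blast
  define \<Phi> where "\<Phi> = (\<lambda>x. \<eta> (M x))"
  have MK: "x \<in> K" if "\<bar>M x\<bar> > e" for x
  proof -
    have "\<bar>M x\<bar> \<le> \<bar>G0 x\<bar> + \<bar>M x - G0 x\<bar>" by linarith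
    then show ?thesis using that MG[of x] unfolding K_def mem_Collect_eq by linarith
  qed
  have \<Phi>t: "\<Phi> \<in> test_functions E"
  proof (rule testI[OF _ cK _ KE])
    show "smooth \<Phi>" unfolding \<Phi>_def by (rule smooth_comp[OF \<eta>(1) smM])
    show "{x. \<Phi> x \<noteq> 0} \<subseteq> K" using MK \<eta>(3) unfolding \<Phi>_def by force
  qed
  have "\<bar>G x - \<Phi> x\<bar> \<le> 3 * e" if "x \<in> E" for x
  proof -
    have "G x = G0 x" using that by (simp add: G0_def)
    then have "\<bar>G x - \<Phi> x\<bar> \<le> \<bar>M x - G0 x\<bar> + \<bar>\<eta> (M x) - M x\<bar>" unfolding \<Phi>_def by linarith
    then show ?thesis using MG[of x] \<eta>(2)[of "M x"] e by linarith
  qed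
  moreover have "ip E (partial i \<Phi>) (partial i \<Phi>) \<le> ip E (pgrad E i G) (pgrad E i G)" if i: "i \<in> Basis" for i
  proof (rule convolution_bound[OF pgrad_L2[OF G(1) i] \<rho> one test_partial_L2[OF \<Phi>t i]])
    fix x assume "x \<in> E"
    have p\<Phi>: "partial i \<Phi> x = partial i M x * partial 1 \<eta> (M x)"
      unfolding \<Phi>_def partial_comp[OF \<eta>(1) smM i] ..
    show "partial i \<Phi> x = 0 \<or> cball x d \<subseteq> E \<and> \<bar>partial i \<Phi> x\<bar> \<le> \<bar>ip E (pgrad E i G) (\<lambda>y. \<rho> (x - y))\<bar>"
    proof (cases "\<bar>M x\<bar> \<le> e")
      case True then show ?thesis using \<eta>(3) p\<Phi> by simp
    next
      case False
      then have "x \<in> K" by (intro MK) simp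
      then have cb: "cball x d \<subseteq> E" using d0(2) d(2) by (force simp: subset_iff)
      have t: "(\<lambda>y. \<rho> (x - y)) \<in> test_functions E"
        by (rule testI[OF smooth_reflect(1)[OF \<rho>(1)] compact_cball[of x d] _ cb])
          (use \<rho>(3) in \<open>force simp: dist_norm\<close>)
      have cp: "continuous_on UNIV (\<lambda>y. partial i \<rho> (x - y))"
        by (intro continuous_on_compose2[OF smooth_continuous[OF smooth_partial[OF \<rho>(1) i], of UNIV]] continuous_intros) auto
      have cGp: "continuous_on UNIV (\<lambda>y. G0 y * partial i \<rho> (x - y))" by (intro continuous_intros cG0 cp)
      \<comment> \<open>The derivative first falls on the mollifier. Around \<open>x\<close> the
        reflected mollifier is a test function of \<open>E\<close>, so the definition of the weak
        gradient moves the derivative to \<open>G\<close>.\<close>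
      have "partial i M x = integral (cbox (- a) a) (\<lambda>y. G0 y * partial i \<rho> (x - y))"
        unfolding M_def smooth_convolution(2)[OF cG0 \<rho>(1) i] ..
      also have "\<dots> = (LINT y|lborel. G0 y * partial i \<rho> (x - y))"
        by (rule integral_cbox_lborel[OF cGp]) (use ab G0out in auto)
      also have "\<dots> = (LINT y|lebesgue. G0 y * partial i \<rho> (x - y))"
        using borel_measurable_continuous_onI[OF cGp] by (intro integral_completion[symmetric]) simp
      also have "\<dots> = ip E G (\<lambda>y. partial i \<rho> (x - y))"
        unfolding ip_eq by (intro Bochner_Integration.integral_cong) (auto simp: G0_def indicator_def)
      also have "\<dots> = - ip E G (partial i (\<lambda>y. \<rho> (x - y)))"
        unfolding smooth_reflect(2)[OF \<rho>(1) i] by (simp add: ip_eq)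
      also have "\<dots> = ip E (pgrad E i G) (\<lambda>y. \<rho> (x - y))"
        using ip_pgrad[OF G(1) i t] by simp
      finally have "partial i M x = ip E (pgrad E i G) (\<lambda>y. \<rho> (x - y))" .
      moreover have "\<bar>partial i M x * partial 1 \<eta> (M x)\<bar> \<le> \<bar>partial i M x\<bar> * 1"
        unfolding abs_mult using \<eta>(4) by (intro mult_left_mono) auto
      ultimately show ?thesis using cb p\<Phi> by simp
    qed
  qed
  ultimately show ?thesis using \<Phi>t by blast
qed

lemma zero_boundary_weakly_H10:
  assumes G: "G \<in> H1 E" "continuous_on (closure E) G" "\<And>x. x \<in> frontier E \<Longrightarrow> G x = 0"
  shows "weakly_H10 G"
proof -
  define P where "P = (\<lambda>j \<Phi>. \<Phi> \<in> test_functions E \<and> (\<forall>x\<in>E. \<bar>G x - \<Phi> x\<bar> \<le> 3 * (1 / real (Suc j))) \<and>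
     (\<forall>i\<in>Basis. ip E (partial i \<Phi>) (partial i \<Phi>) \<le> ip E (pgrad E i G) (pgrad E i G)))"
  define \<Phi> where "\<Phi> = (\<lambda>j. SOME \<Phi>. P j \<Phi>)"
  have "\<exists>\<Phi>. P j \<Phi>" for j
    using zero_boundary_approx[OF G, of "1 / real (Suc j)"] unfolding P_def by auto
  then have P: "P j (\<Phi> j)" for j unfolding \<Phi>_def by (rule someI_ex)
  have \<Phi>: "\<Phi> j \<in> test_functions E" and close: "\<And>x. x \<in> E \<Longrightarrow> \<bar>G x - \<Phi> j x\<bar> \<le> 3 * (1 / real (Suc j))"
    and bd: "\<And>i. i \<in> Basis \<Longrightarrow> ip E (partial i (\<Phi> j)) (partial i (\<Phi> j)) \<le> ip E (pgrad E i G) (pgrad E i G)" for j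
    using P[of j] unfolding P_def by auto
  have lim: "(\<lambda>j. ip E (\<lambda>x. G x - \<Phi> j x) (\<lambda>x. G x - \<Phi> j x)) \<longlonglongrightarrow> 0"
  proof (rule L2_dominated[where g = "\<lambda>x. 3"])
    show "\<bar>G x - \<Phi> n x\<bar> \<le> \<bar>3\<bar>" if "x \<in> E" for n x
      using close[OF that, of n] by (rule order_trans) (simp add: field_simps)
    show "(\<lambda>n. \<Phi> n x) \<longlonglongrightarrow> G x" if "x \<in> E" for x
    proof -
      have "(\<lambda>n. 3 * (1 / real (Suc n))) \<longlonglongrightarrow> 3 * 0"
        by (intro tendsto_mult_left) (use LIMSEQ_inverse_real_of_nat in \<open>simp add: inverse_eq_divide\<close>)
      then have "(\<lambda>n. G x - \<Phi> n x) \<longlonglongrightarrow> 0"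
        using close[OF that] by (intro Lim_null_comparison[of "\<lambda>n. G x - \<Phi> n x" "\<lambda>n. 3 * (1 / real (Suc n))"]) auto
      from tendsto_diff[OF tendsto_const[of "G x"] this] show ?thesis by simp
    qed
  qed (auto intro: testfun_L2 \<Phi> H1_L2 G(1) smooth_L2 smooth_const)
  show ?thesis by (rule weakly_H10I[OF G(1) \<Phi> lim bd])
qed

text \<open>The boundary condition provides a continuous \<open>G\<close> vanishing on the frontier.
  Both \<open>w - G\<close> and \<open>G\<close> are weak limits of test functions, hence so is
  their sum \<open>w\<close>.\<close>

lemma zero_boundary_harmonic:
  assumes "has_boundary_values E w g" "\<And>x. x \<in> frontier E \<Longrightarrow> g x = 0" "has_weak_laplacian E w (\<lambda>x. 0)"
  shows "w \<in> zae E"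
proof -
  obtain G where G: "G \<in> H1 E" "continuous_on (closure E) G" "\<forall>x\<in>frontier E. G x = g x" "(\<lambda>x. w x - G x) \<in> H10 E"
    using assms(1) unfolding has_boundary_values_def by blast
  have "weakly_H10 G" by (rule zero_boundary_weakly_H10[OF G(1,2)]) (use G(3) assms(2) in auto)
  from weakly_H10_add[OF H10_weakly_H10[OF G(4)] this] have "weakly_H10 w" by simp
  then show ?thesis by (rule weakly_H10_harmonic[OF _ assms(3)])
qed

end

lemma bilinear_ip: "bilinear_form_on (L2 E) (ip E)"
  by (rule conjunct1[OF psd_ip[unfolded psd_on_def]])

section \<open>Orthogonal projections and stabilized forms\<close>

text \<open>Abstracts both polynomial projections. The form may have isotropic vectors in
  \<open>V\<close>, but on \<open>P\<close> it separates functions exactly, so the description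
  operator has a unique candidate.\<close>

locale orth_proj =
  fixes V P :: "('b \<Rightarrow> real) set" and B :: "('b \<Rightarrow> real) \<Rightarrow> ('b \<Rightarrow> real) \<Rightarrow> real"
  assumes lin_V: "lin_space V" and lin_P: "lin_space P" and P_V: "P \<subseteq> V" and psd_B: "psd_on V B"
    and definite: "\<And>p. p \<in> P \<Longrightarrow> B p p = 0 \<Longrightarrow> p = (\<lambda>x. 0)"
    and span_P: "\<exists>(n::nat) v. (\<forall>i<n. v i \<in> P) \<and> (\<forall>w\<in>P. \<exists>c. w = (\<lambda>x. \<Sum>i<n. c i * v i x))"
begin

lemma bil_B: "bilinear_form_on V B"
  using psd_B by (simp add: psd_on_def)

definition proj :: "('b \<Rightarrow> real) \<Rightarrow> 'b \<Rightarrow> real" where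
  "proj w = (THE p. p \<in> P \<and> (\<forall>q\<in>P. B (\<lambda>x. w x - p x) q = 0))"

lemma residual_eq:
  "w \<in> V \<Longrightarrow> p \<in> P \<Longrightarrow> q \<in> P \<Longrightarrow> B (\<lambda>x. w x - p x) q = B w q - B p q"
  using linear_form_diff[OF bilinear_left[OF bil_B]] P_V by blast

lemma proj_unique:
  assumes "w \<in> V" "p \<in> P" "p' \<in> P" "\<And>q. q \<in> P \<Longrightarrow> B p q = B w q" "\<And>q. q \<in> P \<Longrightarrow> B p' q = B w q"
  shows "p = p'"
proof -
  have d: "(\<lambda>x. p x - p' x) \<in> P" by (rule lin_space_diff[OF lin_P assms(2,3)])
  have "B (\<lambda>x. p x - p' x) (\<lambda>x. p x - p' x) = 0"
    using residual_eq[of p p' "\<lambda>x. p x - p' x"] assms d P_V by auto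
  from definite[OF d this] show ?thesis by (auto simp: fun_eq_iff)
qed

lemma projI:
  assumes w: "w \<in> V" and p: "p \<in> P" "\<And>q. q \<in> P \<Longrightarrow> B p q = B w q"
  shows "proj w = p"
  unfolding proj_def
proof (rule the_equality)
  show "p \<in> P \<and> (\<forall>q\<in>P. B (\<lambda>x. w x - p x) q = 0)" using p residual_eq[OF w p(1)] by simp
  fix p' assume p': "p' \<in> P \<and> (\<forall>q\<in>P. B (\<lambda>x. w x - p' x) q = 0)"
  then have "B p' q = B w q" if "q \<in> P" for q using residual_eq[OF w _ that, of p'] that by simp
  then show "p' = p" using proj_unique[OF w _ p(1) _ p(2)] p' by blast
qed

lemma proj_props:
  assumes w: "w \<in> V"
  shows "proj w \<in> P" and "q \<in> P \<Longrightarrow> B (proj w) q = B w q"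
proof -
  obtain n :: nat and v where v: "\<And>i. i < n \<Longrightarrow> v i \<in> P" "\<And>w. w \<in> P \<Longrightarrow> \<exists>c. w = (\<lambda>x. \<Sum>i<n. c i * v i x)"
    using span_P by blast
  have "linear_form_on P (B w)"
    using bilinear_right[OF bil_B w] P_V unfolding linear_form_on_def by blast
  moreover have "B w e = 0" if "e \<in> P" "B e e = 0" for e
    using psd_null(2)[OF lin_V psd_B, of e w] w that P_V by auto
  ultimately obtain p where p: "p \<in> P" "\<forall>q\<in>P. B p q = B w q"
    using riesz_psd[OF lin_P psd_on_subset[OF psd_B P_V], of n v "B w"] v by blast
  then have "proj w = p" by (intro projI[OF w]) auto
  then show "proj w \<in> P" and "q \<in> P \<Longrightarrow> B (proj w) q = B w q" using p by auto
qed

lemma proj_V: "w \<in> V \<Longrightarrow> proj w \<in> V"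
  using proj_props(1) P_V by blast

lemma proj_comb:
  assumes u: "u \<in> V" and v: "v \<in> V"
  shows "proj (\<lambda>x. a * u x + b * v x) = (\<lambda>x. a * proj u x + b * proj v x)"
proof (rule projI)
  show "(\<lambda>x. a * u x + b * v x) \<in> V" by (rule lin_space_comb[OF lin_V u v])
  show "(\<lambda>x. a * proj u x + b * proj v x) \<in> P" by (intro lin_space_comb[OF lin_P] proj_props u v)
  fix q assume q: "q \<in> P"
  then have qV: "q \<in> V" using P_V by blast
  show "B (\<lambda>x. a * proj u x + b * proj v x) q = B (\<lambda>x. a * u x + b * v x) q"
    unfolding linear_form_comb[OF bilinear_left[OF bil_B qV] u v]
      linear_form_comb[OF bilinear_left[OF bil_B qV] proj_V[OF u] proj_V[OF v]]
    by (simp add: proj_props(2)[OF u q] proj_props(2)[OF v q])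
qed

lemma proj_id: "p \<in> P \<Longrightarrow> proj p = p"
  using P_V by (intro projI) auto

text \<open>An isotropic \<open>w\<close> is orthogonal to everything, so 0 qualifies as its
  projection.\<close>

lemma proj_null:
  assumes "w \<in> V" "B w w = 0" shows "proj w = (\<lambda>x. 0)"
proof (rule projI[OF assms(1) lin_space_0[OF lin_P]])
  fix q assume "q \<in> P"
  then have q: "q \<in> V" using P_V by blast
  show "B (\<lambda>x. 0) q = B w q"
    using psd_null(1)[OF lin_V psd_B, of w q, OF assms(1) q assms(2)] linear_form_0[OF bilinear_left[OF bil_B q] lin_V] by simp
qed

lemma proj_residual: "w \<in> V \<Longrightarrow> proj (\<lambda>x. w x - proj w x) = (\<lambda>x. 0)"
  using proj_comb[of w "proj w" 1 "-1"] proj_V proj_id[OF proj_props(1)] by simp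

end

text \<open>Two forms are kept apart: \<open>B\<close> defines the projection and \<open>B0\<close>
  is the energy being stabilized. For the stiffness form these are \<open>mean_form\<close> and
  \<open>aE\<close>; for the mass form both are \<open>ip\<close>.\<close>

locale stab_form = orth_proj V P B for V P :: "('b \<Rightarrow> real) set" and B +
  fixes B0 S :: "('b \<Rightarrow> real) \<Rightarrow> ('b \<Rightarrow> real) \<Rightarrow> real" and W :: "('b \<Rightarrow> real) set" and c1 c2 :: real
  assumes psd_B0: "psd_on V B0" and lin_W: "lin_space W" and P_W: "P \<subseteq> W" and W_V: "W \<subseteq> V"
    and bil_S: "bilinear_form_on W S" and sym_S: "symmetric_on W S" and c1: "c1 > 0"
    and equiv: "\<And>v. v \<in> W \<Longrightarrow> proj v = (\<lambda>x. 0) \<Longrightarrow> B0 v v \<le> c1 * S v v \<and> S v v \<le> c2 * B0 v v"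
begin

definition res :: "('b \<Rightarrow> real) \<Rightarrow> 'b \<Rightarrow> real" where
  "res v = (\<lambda>x. v x - proj v x)"

definition form :: "('b \<Rightarrow> real) \<Rightarrow> ('b \<Rightarrow> real) \<Rightarrow> real" where
  "form v w = B0 (proj v) (proj w) + S (res v) (res w)"

lemma res_W: "v \<in> W \<Longrightarrow> res v \<in> W"
  unfolding res_def using P_W W_V proj_props(1) by (intro lin_space_diff[OF lin_W]) auto

lemma proj_res: "v \<in> W \<Longrightarrow> proj (res v) = (\<lambda>x. 0)"
  unfolding res_def using W_V by (intro proj_residual) auto

lemma res_comb:
  "u \<in> W \<Longrightarrow> v \<in> W \<Longrightarrow> res (\<lambda>x. a * u x + b * v x) = (\<lambda>x. a * res u x + b * res v x)"
  unfolding res_def proj_comb[OF subsetD[OF W_V] subsetD[OF W_V]] by (simp add: algebra_simps)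

text \<open>Positivity of \<open>S\<close> is known only on the kernel of the projection, which is
  where residuals lie.\<close>

lemma S_res_nonneg: "v \<in> W \<Longrightarrow> 0 \<le> S (res v) (res v)"
proof -
  assume v: "v \<in> W"
  have "0 \<le> B0 (res v) (res v)" using psd_B0 res_W[OF v] W_V by (auto simp: psd_on_def)
  also have "\<dots> \<le> c1 * S (res v) (res v)" using equiv[OF res_W[OF v] proj_res[OF v]] by simp
  finally show ?thesis using c1 by (simp add: zero_le_mult_iff)
qed

lemma psd_form: "psd_on W form"
  unfolding psd_on_def symmetric_on_def
proof (intro conjI ballI)
  have b0: "bilinear_form_on V B0" using psd_B0 by (simp add: psd_on_def)
  show "bilinear_form_on W form"
  proof (rule bilinear_formI)
    fix u v w a b assume h: "u \<in> W" "v \<in> W" "w \<in> W"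
    then have hV: "proj u \<in> V" "proj v \<in> V" "proj w \<in> V" using proj_V W_V by auto
    have pc: "proj (\<lambda>x. a * v x + b * w x) = (\<lambda>x. a * proj v x + b * proj w x)"
      using h W_V by (intro proj_comb) auto
    show "form u (\<lambda>x. a * v x + b * w x) = a * form u v + b * form u w"
      unfolding form_def res_comb[OF h(2,3)] pc
        linear_form_comb[OF bilinear_right[OF b0 hV(1)] hV(2,3)]
        linear_form_comb[OF bilinear_right[OF bil_S res_W[OF h(1)]] res_W[OF h(2)] res_W[OF h(3)]]
      by (simp add: algebra_simps)
    show "form (\<lambda>x. a * v x + b * w x) u = a * form v u + b * form w u"
      unfolding form_def res_comb[OF h(2,3)] pc
        linear_form_comb[OF bilinear_left[OF b0 hV(1)] hV(2,3)]
        linear_form_comb[OF bilinear_left[OF bil_S res_W[OF h(1)]] res_W[OF h(2)] res_W[OF h(3)]]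
      by (simp add: algebra_simps)
  qed
  fix v w assume vw: "v \<in> W" "w \<in> W"
  then have "proj v \<in> V" "proj w \<in> V" using proj_V W_V by auto
  then have "B0 (proj v) (proj w) = B0 (proj w) (proj v)"
    using psd_B0 by (simp add: psd_on_def symmetric_on_def)
  moreover have "S (res v) (res w) = S (res w) (res v)"
    using sym_S res_W vw by (simp add: symmetric_on_def)
  ultimately show "form v w = form w v" by (simp add: form_def)
next
  fix v assume v: "v \<in> W"
  then have "proj v \<in> V" using proj_V W_V by auto
  then show "0 \<le> form v v" using psd_B0 S_res_nonneg[OF v] by (simp add: form_def psd_on_def)
qed

text \<open>The polynomial part and the stabilizing part are nonnegative, so both vanish. Then
  \<open>B0\<close> vanishes on \<open>proj v\<close> and on \<open>res v\<close>, hence on their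
  sum.\<close>

lemma form_zeroD:
  assumes v: "v \<in> W" and z: "form v v = 0" shows "B0 v v = 0"
proof -
  have pV: "proj v \<in> V" and rV: "res v \<in> V" using v proj_V res_W W_V by auto
  have n0: "0 \<le> B0 (proj v) (proj v)" "0 \<le> B0 (res v) (res v)" "0 \<le> B0 v v"
    using psd_B0 pV rV v W_V by (auto simp: psd_on_def)
  have 1: "B0 (proj v) (proj v) = 0" "S (res v) (res v) = 0"
    using z n0 S_res_nonneg[OF v] by (auto simp: form_def)
  have 2: "B0 (res v) (res v) = 0" using equiv[OF res_W[OF v] proj_res[OF v]] 1(2) n0 by simp
  have "(\<lambda>x. 1 * proj v x + 1 * res v x) = v" by (simp add: res_def)
  then have "B0 v v \<le> 0"
    using psd_parallelogram[OF lin_V psd_B0 pV rV, of 1 1] 1 2 by simp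
  then show ?thesis using n0 by simp
qed

text \<open>Isotropy for \<open>B\<close> makes the projection 0, so only the stabilizing part
  remains, and it is controlled by \<open>B0 v v\<close>.\<close>

lemma form_null:
  assumes v: "v \<in> W" and z: "B v v = 0" "B0 v v = 0" shows "form v v = 0"
proof -
  have vV: "v \<in> V" using v W_V by auto
  have p: "proj v = (\<lambda>x. 0)" by (rule proj_null[OF vV z(1)])
  have r: "res v = v" by (simp add: res_def p)
  have "B0 (\<lambda>x. 0) (\<lambda>x. 0) = 0"
    using psd_B0 linear_form_0[OF bilinear_left[OF _ lin_space_0[OF lin_V]] lin_V] by (auto simp: psd_on_def)
  moreover have "S v v = 0" using equiv[OF v p] S_res_nonneg[OF v] z r by simp
  ultimately show ?thesis by (simp add: form_def p r)
qed

end

section \<open>The projections onto polynomials\<close>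

locale element_domain = bounded_open +
  assumes nonempty_E: "E \<noteq> {}"
begin

text \<open>The energy form completed by the product of the integrals. With it the gradient
  projection with prescribed integral becomes an orthogonal projection, and the form is definite on
  polynomials.\<close>

definition mean_form :: "('a \<Rightarrow> real) \<Rightarrow> ('a \<Rightarrow> real) \<Rightarrow> real" where
  "mean_form u v = aE E u v + ip E u (\<lambda>x. 1) * ip E v (\<lambda>x. 1)"

lemma one_L2: "(\<lambda>x. 1) \<in> L2 E"
  by (intro smooth_L2 smooth_const)

lemma psd_mean_form: "psd_on (H1 E) mean_form"
proof -
  have "psd_on (H1 E) (\<lambda>u v. ip E u (\<lambda>x. 1) * ip E v (\<lambda>x. 1))"
    unfolding psd_on_def symmetric_on_def
    by (intro conjI ballI bilinear_formI) (auto simp: ip_comb_left[OF H1_L2 H1_L2 one_L2] algebra_simps)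
  from psd_add[OF psd_aE this] show ?thesis by (simp add: mean_form_def[abs_def])
qed

lemma Pk_H1: "Pk k \<subseteq> H1 E"
  using Pk_smooth smooth_H1 by blast

lemma Pk_zae:
  assumes "p \<in> Pk k" "p \<in> zae E" shows "p = (\<lambda>x. 0)"
proof
  fix x
  obtain z where z: "z \<in> E" using nonempty_E by blast
  have "p y = 0" if "y \<in> E" for y
    by (rule continuous_AE_zero[OF open_E smooth_continuous[OF Pk_smooth[OF assms(1)]] assms(2) that])
  then show "p x = 0" using poly_fun_eq_zero[OF _ open_E z, of k p] assms(1) by (simp add: Pk_iff)
qed

lemma Pk_aE_zero:
  assumes p: "p \<in> Pk k" and z: "aE E p p = 0" shows "p x = p y"
proof (rule poly_fun_const_if_partial_zero[of k p])
  show "poly_fun k p" using p by (simp add: Pk_iff)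
  fix i x assume i: "i \<in> (Basis :: 'a set)"
  have sm: "smooth p" by (rule Pk_smooth[OF p])
  have "pgrad E i p \<in> zae E" using z i aE_zero_iff[OF smooth_H1[OF sm]] by blast
  from lin_space_diff[OF lin_space_zae this pgrad_smooth[OF sm i]] have "partial i p \<in> zae E" by simp
  moreover have "partial i p \<in> Pk k" using p poly_fun_partial i by (auto simp: Pk_iff)
  ultimately show "partial i p x = 0" using Pk_zae by (auto simp: fun_eq_iff)
qed

text \<open>Zero energy makes the polynomial constant, and its zero integral removes the
  constant.\<close>

lemma Pk_mean_form_zero:
  assumes p: "p \<in> Pk k" and z: "mean_form p p = 0" shows "p = (\<lambda>x. 0)"
proof -
  have pH: "p \<in> H1 E" using p Pk_H1 by blast
  have a: "aE E p p = 0" and m: "ip E p (\<lambda>x. 1) = 0"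
    using z aE_nonneg[OF pH] by (auto simp: mean_form_def add_nonneg_eq_0_iff)
  obtain z where z: "z \<in> E" using nonempty_E by blast
  have const: "p = (\<lambda>x. p z)" using Pk_aE_zero[OF p a] by (auto simp: fun_eq_iff)
  have "ip E p p = p z * ip E p (\<lambda>x. 1)"
    using linear_form_scale[OF bilinear_right[OF bilinear_ip H1_L2[OF pH]] one_L2, of "p z"]
    by (subst (2) const) simp
  then have "p \<in> zae E" using m ip_zero_iff[OF H1_L2[OF pH]] by simp
  then show ?thesis by (rule Pk_zae[OF p])
qed

sublocale grad_proj: orth_proj "H1 E" "Pk k" mean_form for k
  by unfold_locales (rule lin_space_H1 lin_space_Pk Pk_H1 psd_mean_form Pk_mean_form_zero Pk_span; assumption?)+

sublocale L2_proj: orth_proj "L2 E" "Pk k" "ip E" for k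
proof unfold_locales
  show PL: "Pk k \<subseteq> L2 E" using Pk_H1 H1_L2 by blast
  show "p = (\<lambda>x. 0)" if "p \<in> Pk k" "ip E p p = 0" for p
    using Pk_zae[OF that(1)] ip_zero_iff[of p] PL that by blast
qed (rule lin_space_L2 lin_space_Pk psd_ip Pk_span)+

lemma proj_L2_eq: "proj_L2 k E = L2_proj.proj k"
  by (simp add: proj_L2_def L2_proj.proj_def fun_eq_iff)

lemma proj_grad_eq:
  assumes w: "w \<in> H1 E" shows "proj_grad k E w = grad_proj.proj k w"
proof -
  have "(p \<in> Pk k \<and> (\<forall>q\<in>Pk k. aE E q (\<lambda>x. w x - p x) = 0) \<and> (LINT x:E|lebesgue. p x) = (LINT x:E|lebesgue. w x))
     \<longleftrightarrow> (p \<in> Pk k \<and> (\<forall>q\<in>Pk k. mean_form (\<lambda>x. w x - p x) q = 0))" (is "?l \<longleftrightarrow> ?r") for p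
  proof (cases "p \<in> Pk k")
    case p: True
    have pH: "p \<in> H1 E" using p Pk_H1 by blast
    have d: "(\<lambda>x. w x - p x) \<in> H1 E" by (rule lin_space_diff[OF lin_space_H1 w pH])
    have int: "(LINT x:E|lebesgue. u x) = ip E u (\<lambda>x. 1)" for u by (simp add: ip_def)
    have m: "ip E (\<lambda>x. w x - p x) (\<lambda>x. 1) = ip E w (\<lambda>x. 1) - ip E p (\<lambda>x. 1)"
      by (rule ip_diff_left[OF one_L2 H1_L2[OF w] H1_L2[OF pH]])
    show ?thesis
    proof
      assume ?l
      then show ?r using m by (auto simp: mean_form_def int aE_commute[of _ "\<lambda>x. w x - p x"])
    next
      assume r: ?r
      \<comment> \<open>Testing with the constant 1 isolates the integral condition, since the
        energy form does not see constants.\<close>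
      have 1: "(\<lambda>x. 1) \<in> Pk k" by (rule Pk_const)
      have c: "aE E (\<lambda>x. w x - p x) (\<lambda>x. 1) = 0"
        using aE_smooth[OF smooth_const[of 1] d] by (simp add: partial_const aE_commute[of "\<lambda>x. w x - p x"] ip_eq)
      have ne: "ip E (\<lambda>x. 1) (\<lambda>x. 1) \<noteq> 0"
        using Pk_zae[OF 1] ip_zero_iff[OF one_L2] by (auto simp: fun_eq_iff)
      have "ip E (\<lambda>x. w x - p x) (\<lambda>x. 1) * ip E (\<lambda>x. 1) (\<lambda>x. 1) = 0"
        using r 1 c by (auto simp: mean_form_def)
      then have "ip E (\<lambda>x. w x - p x) (\<lambda>x. 1) = 0" using ne by simp
      then show ?l using r m by (simp add: mean_form_def int aE_commute[of _ "\<lambda>x. w x - p x"])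
    qed
  qed simp
  then show ?thesis unfolding proj_grad_def grad_proj.proj_def by simp
qed

lemma mean_form_zae: "w \<in> zae E \<Longrightarrow> mean_form w w = 0"
  using ip_zae_left[OF _ one_L2] by (simp add: mean_form_def aE_zae)

section \<open>Local virtual element spaces\<close>

lemma has_boundary_values_comb:
  assumes "has_boundary_values E u g" "has_boundary_values E v h"
  shows "has_boundary_values E (\<lambda>x. a * u x + b * v x) (\<lambda>x. a * g x + b * h x)"
proof -
  obtain G where G: "G \<in> H1 E" "continuous_on (closure E) G" "\<forall>x\<in>frontier E. G x = g x" "(\<lambda>x. u x - G x) \<in> H10 E"
    using assms(1) unfolding has_boundary_values_def by blast
  obtain H where H: "H \<in> H1 E" "continuous_on (closure E) H" "\<forall>x\<in>frontier E. H x = h x" "(\<lambda>x. v x - H x) \<in> H10 E"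
    using assms(2) unfolding has_boundary_values_def by blast
  have "(\<lambda>x. (a * u x + b * v x) - (a * G x + b * H x)) \<in> H10 E"
    using lin_space_comb[OF lin_space_H10 G(4) H(4), of a b] by (simp add: algebra_simps)
  then show ?thesis unfolding has_boundary_values_def
    using lin_space_comb[OF lin_space_H1 G(1) H(1), of a b] G H
    by (intro bexI[of _ "\<lambda>x. a * G x + b * H x"]) (auto intro!: continuous_intros)
qed

lemma has_boundary_values_self:
  assumes "p \<in> H1 E" "continuous_on (closure E) p"
  shows "has_boundary_values E p p"
  unfolding has_boundary_values_def using assms lin_space_0[OF lin_space_H10]
  by (intro bexI[of _ p]) simp_all

lemma has_boundary_values_sum:
  "(\<And>j. j < (M::nat) \<Longrightarrow> has_boundary_values E (v j) (g j)) \<Longrightarrow>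
     has_boundary_values E (\<lambda>x. \<Sum>j<M. c j * v j x) (\<lambda>x. \<Sum>j<M. c j * g j x)"
proof (induction M)
  case 0
  show ?case using has_boundary_values_self[OF lin_space_0[OF lin_space_H1]] by simp
next
  case (Suc M)
  have "has_boundary_values E (\<lambda>x. 1 * (\<Sum>j<M. c j * v j x) + c M * v M x) (\<lambda>x. 1 * (\<Sum>j<M. c j * g j x) + c M * g M x)"
    by (intro has_boundary_values_comb Suc.IH Suc.prems) auto
  then show ?case by simp
qed

lemma laplacian_L2: "\<phi> \<in> test_functions E \<Longrightarrow> (\<lambda>x. \<Sum>i\<in>Basis. partial i (partial i \<phi>) x) \<in> L2 E"
  using lin_space_sum[OF lin_space_L2, of Basis "\<lambda>i. partial i (partial i \<phi>)" E "\<lambda>_. 1"]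
  by (simp add: test_partial_L2 test_partial)

lemma has_weak_laplacian_sum:
  assumes "\<And>j. j < (M::nat) \<Longrightarrow> v j \<in> L2 E" "\<And>j. j < M \<Longrightarrow> q j \<in> L2 E" "\<And>j. j < M \<Longrightarrow> has_weak_laplacian E (v j) (q j)"
  shows "has_weak_laplacian E (\<lambda>x. \<Sum>j<M. c j * v j x) (\<lambda>x. \<Sum>j<M. c j * q j x)"
  unfolding has_weak_laplacian_def
proof
  fix \<phi> assume \<phi>: "\<phi> \<in> test_functions E"
  note bil = bilinear_ip[of E]
  show "ip E (\<lambda>x. \<Sum>j<M. c j * v j x) (\<lambda>x. \<Sum>i\<in>Basis. partial i (partial i \<phi>) x) = ip E (\<lambda>x. \<Sum>j<M. c j * q j x) \<phi>"
    using assms \<phi> linear_form_sum[OF lin_space_L2 bilinear_left[OF bil laplacian_L2[OF \<phi>]], of "{..<M}" v c]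
      linear_form_sum[OF lin_space_L2 bilinear_left[OF bil testfun_L2[OF \<phi>]], of "{..<M}" q c]
    by (simp add: has_weak_laplacian_def)
qed

lemma Pk_L2: "p \<in> Pk k \<Longrightarrow> p \<in> L2 E"
  by (intro smooth_L2 Pk_smooth)

lemma V_loc_H1: "v \<in> V_loc k B E \<Longrightarrow> v \<in> H1 E"
  by (simp add: V_loc_def)

lemma lin_space_V_loc:
  assumes B: "lin_space B" shows "lin_space (V_loc k B E)"
  unfolding lin_space_def
proof (intro conjI ballI allI)
  have "has_boundary_values E (\<lambda>x. 0) (\<lambda>x. 0)"
    by (rule has_boundary_values_self[OF lin_space_0[OF lin_space_H1]]) simp
  moreover have "has_weak_laplacian E (\<lambda>x. 0) (\<lambda>x. 0)" by (simp add: has_weak_laplacian_def ip_eq)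
  ultimately show "(\<lambda>x. 0) \<in> V_loc k B E"
    using lin_space_0[OF lin_space_H1] lin_space_0[OF B] Pk_const[of 0 k] unfolding V_loc_def by blast
  fix u v a b assume u: "u \<in> V_loc k B E" and v: "v \<in> V_loc k B E"
  obtain g p where g: "g \<in> B" "has_boundary_values E u g" "p \<in> Pk k" "has_weak_laplacian E u p"
    using u unfolding V_loc_def by blast
  obtain h q where h: "h \<in> B" "has_boundary_values E v h" "q \<in> Pk k" "has_weak_laplacian E v q"
    using v unfolding V_loc_def by blast
  have "has_weak_laplacian E (\<lambda>x. a * u x + b * v x) (\<lambda>x. a * p x + b * q x)"
    unfolding has_weak_laplacian_def
  proof
    fix \<phi> assume \<phi>: "\<phi> \<in> test_functions E"
    show "ip E (\<lambda>x. a * u x + b * v x) (\<lambda>x. \<Sum>i\<in>Basis. partial i (partial i \<phi>) x) = ip E (\<lambda>x. a * p x + b * q x) \<phi>"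
      unfolding ip_comb_left[OF H1_L2[OF V_loc_H1[OF u]] H1_L2[OF V_loc_H1[OF v]] laplacian_L2[OF \<phi>]]
        ip_comb_left[OF Pk_L2[OF g(3)] Pk_L2[OF h(3)] testfun_L2[OF \<phi>]]
      using g(4) h(4) \<phi> by (simp add: has_weak_laplacian_def)
  qed
  then show "(\<lambda>x. a * u x + b * v x) \<in> V_loc k B E"
    unfolding V_loc_def using lin_space_comb[OF lin_space_H1 V_loc_H1[OF u] V_loc_H1[OF v]]
      has_boundary_values_comb[OF g(2) h(2)] lin_space_comb[OF B g(1) h(1)] lin_space_comb[OF lin_space_Pk g(3) h(3)]
    by blast
qed

lemma lin_space_W_loc:
  assumes B: "lin_space B" shows "lin_space (W_loc k B E)"
  unfolding lin_space_def
proof (intro conjI ballI allI)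
  have "proj_grad k E (\<lambda>x. 0) = (\<lambda>x. 0)"
    unfolding proj_grad_eq[OF lin_space_0[OF lin_space_H1]] by (rule grad_proj.proj_id[OF Pk_const])
  then show "(\<lambda>x. 0) \<in> W_loc k B E"
    using lin_space_0[OF lin_space_V_loc[OF B]] by (simp add: W_loc_def ip_eq)
  fix u v a b assume u: "u \<in> W_loc k B E" and v: "v \<in> W_loc k B E"
  have uV: "u \<in> V_loc k B E" and vV: "v \<in> V_loc k B E" using u v by (auto simp: W_loc_def)
  have uH: "u \<in> H1 E" and vH: "v \<in> H1 E" using uV vV V_loc_H1 by auto
  have pL: "grad_proj.proj k u \<in> L2 E" "grad_proj.proj k v \<in> L2 E"
    using grad_proj.proj_V[OF uH] grad_proj.proj_V[OF vH] H1_L2 by auto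
  have eq: "(\<lambda>x. (a * u x + b * v x) - proj_grad k E (\<lambda>x. a * u x + b * v x) x)
      = (\<lambda>x. a * (u x - proj_grad k E u x) + b * (v x - proj_grad k E v x))"
    unfolding proj_grad_eq[OF lin_space_comb[OF lin_space_H1 uH vH]] proj_grad_eq[OF uH] proj_grad_eq[OF vH]
      grad_proj.proj_comb[OF uH vH] by (auto simp: algebra_simps)
  have "ip E (\<lambda>x. a * (u x - proj_grad k E u x) + b * (v x - proj_grad k E v x)) q = 0" if q: "q \<in> Pk_quot k E" for q
  proof -
    have "q \<in> L2 E" using q Pk_L2 by (auto simp: Pk_quot_def)
    moreover have "(\<lambda>x. u x - proj_grad k E u x) \<in> L2 E" "(\<lambda>x. v x - proj_grad k E v x) \<in> L2 E"
      unfolding proj_grad_eq[OF uH] proj_grad_eq[OF vH]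
      by (rule lin_space_diff[OF lin_space_L2 H1_L2[OF uH] pL(1)], rule lin_space_diff[OF lin_space_L2 H1_L2[OF vH] pL(2)])
    ultimately show ?thesis using u v q by (simp add: ip_comb_left W_loc_def)
  qed
  then show "(\<lambda>x. a * u x + b * v x) \<in> W_loc k B E"
    unfolding W_loc_def eq using lin_space_comb[OF lin_space_V_loc[OF B] uV vV] eq by simp
qed

text \<open>A polynomial is its own projection, so it meets the enhancement constraint trivially.
  Because of this, residuals of virtual functions stay virtual.\<close>

lemma Pk_W_loc:
  assumes "p \<in> Pk k" "p \<in> B" shows "p \<in> W_loc k B E"
proof -
  have sm: "smooth p" by (rule Pk_smooth[OF assms(1)])
  have H: "p \<in> H1 E" by (rule smooth_H1[OF sm])
  have "(\<lambda>x. \<Sum>i\<in>Basis. partial i (partial i p) x) \<in> Pk k"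
    using assms(1) unfolding Pk_iff by (intro poly_fun_sum poly_fun_partial) auto
  moreover have "has_weak_laplacian E p (\<lambda>x. \<Sum>i\<in>Basis. partial i (partial i p) x)"
    unfolding has_weak_laplacian_def
  proof
    fix \<phi> assume \<phi>: "\<phi> \<in> test_functions E"
    note bil = bilinear_ip[of E]
    have sp: "smooth (partial i p)" "smooth (partial i (partial i p))" if "i \<in> Basis" for i
      using sm that by (auto intro: smooth_partial)
    have "ip E p (\<lambda>x. \<Sum>i\<in>Basis. 1 * partial i (partial i \<phi>) x) = (\<Sum>i\<in>Basis. 1 * ip E p (partial i (partial i \<phi>)))"
      by (rule linear_form_sum[OF lin_space_L2 bilinear_right[OF bil H1_L2[OF H]]])
        (auto intro: test_partial_L2 test_partial \<phi>)
    also have "\<dots> = (\<Sum>i\<in>Basis. 1 * ip E (partial i (partial i p)) \<phi>)"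
      using ip_partial_test[OF sets_E bounded_E sm test_partial[OF \<phi>]] ip_partial_test[OF sets_E bounded_E sp(1) \<phi>]
      by (intro sum.cong refl) simp
    also have "\<dots> = ip E (\<lambda>x. \<Sum>i\<in>Basis. 1 * partial i (partial i p) x) \<phi>"
      by (rule linear_form_sum[OF lin_space_L2 bilinear_left[OF bil testfun_L2[OF \<phi>]], symmetric])
        (auto intro: smooth_L2 sp)
    finally show "ip E p (\<lambda>x. \<Sum>i\<in>Basis. partial i (partial i \<phi>) x) = ip E (\<lambda>x. \<Sum>i\<in>Basis. partial i (partial i p) x) \<phi>"
      by simp
  qed
  moreover have "has_boundary_values E p p"
    by (rule has_boundary_values_self[OF H smooth_continuous[OF sm]])
  ultimately have "p \<in> V_loc k B E" unfolding V_loc_def using H assms by blast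
  moreover have "proj_grad k E p = p" unfolding proj_grad_eq[OF H] by (rule grad_proj.proj_id[OF assms(1)])
  ultimately show ?thesis by (simp add: W_loc_def ip_eq)
qed

end

section \<open>Finite dimension of the local spaces\<close>

lemma fin_dim_Pk: "fin_dim_mod (Pk k :: ('a::euclidean_space \<Rightarrow> real) set) {\<lambda>x. 0}"
proof -
  obtain n :: nat and b where b: "\<And>w. w \<in> (Pk k :: ('a \<Rightarrow> real) set) \<Longrightarrow> \<exists>c. w = (\<lambda>x. \<Sum>i<n. c i * b i x)"
    using Pk_span[of k] by blast
  show ?thesis unfolding fin_dim_mod_def
  proof (intro exI allI impI)
    fix v :: "nat \<Rightarrow> 'a \<Rightarrow> real" and M :: nat assume v: "\<forall>j<M. v j \<in> Pk k"
    define a where "a = (\<lambda>j. SOME c. v j = (\<lambda>x. \<Sum>i<n. c i * b i x))"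
    have a: "v j = (\<lambda>x. \<Sum>i<n. a j i * b i x)" if "j < M" for j
      unfolding a_def by (rule someI_ex[OF b]) (use v that in blast)
    have "kill (\<Prod>i\<in>{..<n}. 2) (\<lambda>c. \<forall>i\<in>{..<n}. (\<Sum>j<M. c j * a j i) = 0)"
      by (rule kill_ball) (auto intro: kill_linear comb_closed_linear)
    then show "kill (\<Prod>i\<in>{..<n}. 2) (\<lambda>c. (\<lambda>x. \<Sum>j<M. c j * v j x) \<in> {\<lambda>x. 0})"
    proof (rule kill_mono)
      fix c :: "nat \<Rightarrow> real" assume c: "\<forall>i\<in>{..<n}. (\<Sum>j<M. c j * a j i) = 0"
      have "(\<Sum>j<M. c j * v j x) = (\<Sum>i<n. (\<Sum>j<M. c j * a j i) * b i x)" for x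
      proof -
        have "(\<Sum>j<M. c j * v j x) = (\<Sum>j<M. \<Sum>i<n. c j * a j i * b i x)"
          by (rule sum.cong) (auto simp: a sum_distrib_left mult.assoc)
        then show ?thesis by (subst (asm) sum.swap) (simp add: sum_distrib_right)
      qed
      then show "(\<lambda>x. \<Sum>j<M. c j * v j x) \<in> {\<lambda>x. 0}" using c by simp
    qed
  qed
qed

text \<open>One linear condition per point, each eliminated at the cost of a factor 2.\<close>

lemma fin_dim_points:
  assumes "finite Pts" "lin_space B" "\<And>g. g \<in> B \<Longrightarrow> \<forall>x\<in>Pts. g x = 0 \<Longrightarrow> g \<in> N"
  shows "fin_dim_mod B N"
  unfolding fin_dim_mod_def
proof (intro exI allI impI)
  fix v and M :: nat assume v: "\<forall>j<M. v j \<in> B"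
  have "kill (\<Prod>x\<in>Pts. 2) (\<lambda>c. \<forall>x\<in>Pts. (\<Sum>j<M. c j * v j x) = 0)"
    by (rule kill_ball[OF assms(1)]) (auto intro: kill_linear comb_closed_linear)
  then show "kill (\<Prod>x\<in>Pts. 2) (\<lambda>c. (\<lambda>x. \<Sum>j<M. c j * v j x) \<in> N)"
  proof (rule kill_mono)
    fix c :: "nat \<Rightarrow> real" assume "\<forall>x\<in>Pts. (\<Sum>j<M. c j * v j x) = 0"
    then show "(\<lambda>x. \<Sum>j<M. c j * v j x) \<in> N"
      by (intro assms(3) lin_space_sum[OF assms(2)]) (use v in auto)
  qed
qed

lemma fin_dim_mod_subset: "fin_dim_mod V N \<Longrightarrow> U \<subseteq> V \<Longrightarrow> fin_dim_mod U N"
  unfolding fin_dim_mod_def by (meson subsetD)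

lemma lin_space_zero_on: "lin_space {g. \<forall>x\<in>A. g x = 0}"
  by (simp add: lin_space_def)

text \<open>A boundary function and a Laplacian are chosen for each member of the family. Any
  combination of the family has the same combination of the chosen data; if both combinations of
  data vanish, the function is harmonic with zero boundary values.\<close>

lemma (in element_domain) fin_dim_V_loc:
  assumes B: "fin_dim_mod B {g. \<forall>x\<in>frontier E. g x = 0}"
  shows "fin_dim_mod (V_loc k B E) (zae E)"
proof -
  obtain d1 where d1: "\<And>v (M::nat). (\<forall>j<M. v j \<in> B) \<Longrightarrow> kill d1 (\<lambda>c. (\<lambda>x. \<Sum>j<M. c j * v j x) \<in> {g. \<forall>x\<in>frontier E. g x = 0})"
    using B unfolding fin_dim_mod_def by blast
  obtain d2 where d2: "\<And>v (M::nat). (\<forall>j<M. v j \<in> Pk k) \<Longrightarrow> kill d2 (\<lambda>c. (\<lambda>x. \<Sum>j<M. c j * v j x) \<in> {\<lambda>x::'a. 0})"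
    using fin_dim_Pk[of k, where 'a = 'a] unfolding fin_dim_mod_def by blast
  show ?thesis unfolding fin_dim_mod_def
  proof (intro exI allI impI)
    fix v and M :: nat assume v: "\<forall>j<M. v j \<in> V_loc k B E"
    define g where "g = (\<lambda>j. SOME g. g \<in> B \<and> has_boundary_values E (v j) g)"
    define q where "q = (\<lambda>j. SOME q. q \<in> Pk k \<and> has_weak_laplacian E (v j) q)"
    have g: "g j \<in> B \<and> has_boundary_values E (v j) (g j)" if "j < M" for j
    proof -
      have "\<exists>g. g \<in> B \<and> has_boundary_values E (v j) g" using v that unfolding V_loc_def by blast
      then show ?thesis unfolding g_def by (rule someI_ex)
    qed
    have q: "q j \<in> Pk k \<and> has_weak_laplacian E (v j) (q j)" if "j < M" for j
    proof -
      have "\<exists>q. q \<in> Pk k \<and> has_weak_laplacian E (v j) q" using v that unfolding V_loc_def by blast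
      then show ?thesis unfolding q_def by (rule someI_ex)
    qed
    have k1: "kill d1 (\<lambda>c. (\<lambda>x. \<Sum>j<M. c j * g j x) \<in> {g. \<forall>x\<in>frontier E. g x = 0})"
      by (rule d1) (use g in blast)
    have k2: "kill d2 (\<lambda>c. (\<lambda>x. \<Sum>j<M. c j * q j x) \<in> {\<lambda>x::'a. 0})"
      by (rule d2) (use q in blast)
    show "kill (d1 * d2) (\<lambda>c. (\<lambda>x. \<Sum>j<M. c j * v j x) \<in> zae E)"
    proof (rule kill_mono[OF kill_conj[OF k1 k2 comb_closed_in[OF lin_space_zero_on]]], elim conjE)
      fix c :: "nat \<Rightarrow> real"
      assume c1: "(\<lambda>x. \<Sum>j<M. c j * g j x) \<in> {g. \<forall>x\<in>frontier E. g x = 0}"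
        and c2: "(\<lambda>x. \<Sum>j<M. c j * q j x) \<in> {\<lambda>x. 0}"
      have "has_boundary_values E (\<lambda>x. \<Sum>j<M. c j * v j x) (\<lambda>x. \<Sum>j<M. c j * g j x)"
        by (rule has_boundary_values_sum) (use g in blast)
      moreover have "has_weak_laplacian E (\<lambda>x. \<Sum>j<M. c j * v j x) (\<lambda>x. \<Sum>j<M. c j * q j x)"
        by (rule has_weak_laplacian_sum) (use q v V_loc_H1 H1_L2 Pk_L2 in blast)+
      ultimately show "(\<lambda>x. \<Sum>j<M. c j * v j x) \<in> zae E"
        using zero_boundary_harmonic c1 c2 by simp
    qed
  qed
qed

lemma W_loc_V_loc: "W_loc k B E \<subseteq> V_loc k B E"
  by (auto simp: W_loc_def)

section \<open>Boundary spaces and elements\<close>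

lemma skeleton_element_domain: "skeleton_ok K \<Longrightarrow> element_domain (cell K)"
  by unfold_locales (auto simp: skeleton_ok_def)

lemma finite_edges:
  assumes "skeleton_ok K" shows "finite (edges K)"
proof (rule finite_subset)
  show "edges K \<subseteq> (\<lambda>(a, b). open_segment a b) ` (verts K \<times> verts K)"
    using assms unfolding skeleton_ok_def by fast
  show "finite ((\<lambda>(a, b). open_segment a b) ` (verts K \<times> verts K))"
    using assms by (auto simp: skeleton_ok_def)
qed

lemma frontier_edges:
  assumes "faces K = {}"
  shows "frontier (cell K) \<subseteq> verts K \<union> \<Union> (edges K)"
  using Union_components[of "frontier (cell K) - verts K"] assms by (auto simp: edges_def)

lemma lin_space_B_edges: "lin_space (B_edges k K)"
  unfolding lin_space_def
proof (intro conjI ballI allI)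
  show "(\<lambda>x. 0) \<in> B_edges k K" unfolding B_edges_def by (auto intro!: exI[of _ 0])
  fix u v a b assume u: "u \<in> B_edges k K" and v: "v \<in> B_edges k K"
  show "(\<lambda>x. a * u x + b * v x) \<in> B_edges k K"
    unfolding B_edges_def
  proof (intro CollectI conjI allI impI)
    show "continuous_on (frontier (cell K)) (\<lambda>x. a * u x + b * v x)"
      using u v unfolding B_edges_def by (auto intro!: continuous_intros)
    fix c d assume e: "open_segment c d \<in> edges K"
    obtain p :: "real poly" where p: "degree p \<le> k" "\<forall>s\<in>{0..1}. u (c + s *\<^sub>R (d - c)) = poly p s"
      using u e unfolding B_edges_def by blast
    obtain q :: "real poly" where q: "degree q \<le> k" "\<forall>s\<in>{0..1}. v (c + s *\<^sub>R (d - c)) = poly q s"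
      using v e unfolding B_edges_def by blast
    have "degree (smult a p + smult b q) \<le> k" using p(1) q(1)
      by (intro degree_add_le) (auto intro: order_trans[OF degree_smult_le])
    then show "\<exists>p::real poly. degree p \<le> k \<and> (\<forall>s\<in>{0..1}. a * u (c + s *\<^sub>R (d - c)) + b * v (c + s *\<^sub>R (d - c)) = poly p s)"
      using p q by (intro exI[of _ "smult a p + smult b q"]) auto
  qed
qed

lemma Pk_B_edges: "p \<in> Pk k \<Longrightarrow> p \<in> B_edges k K"
  unfolding B_edges_def using poly_fun_line[of k p] smooth_continuous[OF Pk_smooth] by (fastforce simp: Pk_iff)

text \<open>A polynomial of degree at most \<open>k\<close> is determined by \<open>k + 1\<close>
  nodes on its edge; vertices and edges exhaust the frontier.\<close>

lemma fin_dim_B_edges: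
  fixes K :: "('a::euclidean_space) element"
  assumes "skeleton_ok K" "faces K = {}"
  shows "fin_dim_mod (B_edges k K) {g. \<forall>x\<in>frontier (cell K). g x = 0}"
proof -
  define ab where "ab = (\<lambda>e. SOME ab. e = open_segment (fst ab) (snd ab :: 'a))"
  have ab: "e = open_segment (fst (ab e)) (snd (ab e))" if "e \<in> edges K" for e
  proof -
    have "\<exists>ab. e = open_segment (fst ab) (snd ab)" using assms(1) that unfolding skeleton_ok_def by fastforce
    then show ?thesis unfolding ab_def by (rule someI_ex)
  qed
  \<comment> \<open>For \<open>l\<close> up to \<open>k\<close> these parameters are distinct and
    lie in the unit interval, where the edge polynomial represents \<open>g\<close>.\<close>
  define node where "node = (\<lambda>l. real l / real (Suc k))"
  define pt where "pt = (\<lambda>e l. fst (ab e) + node l *\<^sub>R (snd (ab e) - fst (ab e)))"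
  show ?thesis
  proof (rule fin_dim_points[of "verts K \<union> (\<Union>e\<in>edges K. pt e ` {..k})"])
    show "finite (verts K \<union> (\<Union>e\<in>edges K. pt e ` {..k}))"
      using assms(1) finite_edges[OF assms(1)] by (simp add: skeleton_ok_def)
    fix g assume g: "g \<in> B_edges k K" and z: "\<forall>x\<in>verts K \<union> (\<Union>e\<in>edges K. pt e ` {..k}). g x = 0"
    have "g x = 0" if x: "x \<in> e" and e: "e \<in> edges K" for x e
    proof -
      let ?a = "fst (ab e)" and ?b = "snd (ab e)"
      have "open_segment ?a ?b \<in> edges K" by (subst ab[OF e, symmetric]) (rule e)
      then obtain p :: "real poly" where p: "degree p \<le> k" "\<forall>s\<in>{0..1}. g (?a + s *\<^sub>R (?b - ?a)) = poly p s"
        using g unfolding B_edges_def by blast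
      have "p = 0"
      proof (rule ccontr)
        assume "p \<noteq> 0"
        have "poly p (node l) = 0" if "l \<le> k" for l
        proof -
          have "node l \<in> {0..1}" using that by (auto simp: node_def field_simps)
          moreover have "g (pt e l) = 0" using z e that by blast
          ultimately show ?thesis using p(2) by (auto simp: pt_def)
        qed
        then have "node ` {..k} \<subseteq> {s. poly p s = 0}" by auto
        then have "card (node ` {..k}) \<le> card {s. poly p s = 0}"
          by (intro card_mono poly_roots_finite \<open>p \<noteq> 0\<close>)
        also have "\<dots> \<le> degree p" by (rule card_poly_roots_bound[OF \<open>p \<noteq> 0\<close>])
        also have "\<dots> \<le> k" by (rule p(1))
        finally have "card (node ` {..k}) \<le> k" .
        moreover have "inj_on node {..k}" by (auto simp: inj_on_def node_def)
        ultimately show False by (simp add: card_image)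
      qed
      moreover have "x \<in> open_segment ?a ?b" by (subst ab[OF e, symmetric]) (rule x)
      then obtain s where "0 < s" "s < 1" "x = (1 - s) *\<^sub>R ?a + s *\<^sub>R ?b"
        unfolding in_segment by blast
      then have "s \<in> {0..1}" "x = ?a + s *\<^sub>R (?b - ?a)"
        by (auto simp: algebra_simps)
      ultimately show ?thesis using p(2) by simp
    qed
    then have "\<forall>x\<in>frontier (cell K). g x = 0" using frontier_edges[OF assms(2)] z by blast
    then show "g \<in> {g. \<forall>x\<in>frontier (cell K). g x = 0}" by simp
  qed (rule lin_space_B_edges)
qed

subsection \<open>Charts of faces\<close>

text \<open>After subtracting its value at 0 the map preserves norms of differences and fixes the
  origin, hence preserves inner products. Expanding the squared defects of additivity and
  homogeneity then gives 0.\<close>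

lemma isometry_affine:
  fixes \<psi> :: "'b::euclidean_space \<Rightarrow> 'a::euclidean_space"
  assumes "\<And>x y. dist (\<psi> x) (\<psi> y) = dist x y"
  shows "linear (\<lambda>x. \<psi> x - \<psi> 0)"
proof -
  define f where "f = (\<lambda>x. \<psi> x - \<psi> 0)"
  have n: "norm (f x - f y) = norm (x - y)" for x y
    using assms[of x y] by (simp add: f_def dist_norm)
  have f0: "f 0 = 0" by (simp add: f_def)
  have ip: "f x \<bullet> f y = x \<bullet> y" for x y
    using n[of x y] n[of x 0] n[of y 0] f0 by (simp add: dot_norm_neg)
  have "f (x + y) = f x + f y" for x y
  proof -
    have "(f (x + y) - (f x + f y)) \<bullet> (f (x + y) - (f x + f y)) = 0"
      by (simp add: inner_diff inner_add ip)
    then show ?thesis by simp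
  qed
  moreover have "f (c *\<^sub>R x) = c *\<^sub>R f x" for c x
  proof -
    have "(f (c *\<^sub>R x) - c *\<^sub>R f x) \<bullet> (f (c *\<^sub>R x) - c *\<^sub>R f x) = 0"
      by (simp add: inner_diff ip)
    then show ?thesis by simp
  qed
  ultimately show ?thesis unfolding f_def[symmetric] by (intro linearI) auto
qed

lemma is_chart_linear: "is_chart F \<psi> \<Longrightarrow> linear (\<lambda>x. \<psi> x - \<psi> 0)"
  by (rule isometry_affine) (simp add: is_chart_def)

text \<open>Charts are affine, so polynomials on the ambient space pull back to polynomials of no
  higher degree on a face.\<close>

lemma is_chart_coord:
  assumes "is_chart F \<psi>" "b \<in> Basis" shows "poly_fun 1 (\<lambda>x. \<psi> x \<bullet> b)"
proof -
  let ?f = "\<lambda>x. \<psi> x - \<psi> 0"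
  have lin: "linear ?f" by (rule is_chart_linear[OF assms(1)])
  have eq: "\<psi> x \<bullet> b = (\<Sum>i\<in>Basis. (?f i \<bullet> b) * (x \<bullet> i)) + \<psi> 0 \<bullet> b" for x
  proof -
    have "?f (\<Sum>i\<in>Basis. (x \<bullet> i) *\<^sub>R i) = (\<Sum>i\<in>Basis. ?f ((x \<bullet> i) *\<^sub>R i))"
      by (rule linear_sum[OF lin])
    also have "\<dots> = (\<Sum>i\<in>Basis. (x \<bullet> i) *\<^sub>R ?f i)"
      by (intro sum.cong refl linear_scale[OF lin])
    finally have "?f x = (\<Sum>i\<in>Basis. (x \<bullet> i) *\<^sub>R ?f i)" by (simp add: euclidean_representation)
    then have "?f x \<bullet> b = (\<Sum>i\<in>Basis. (x \<bullet> i) *\<^sub>R ?f i) \<bullet> b" by simp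
    then show ?thesis by (simp add: inner_sum_left inner_diff_left mult.commute)
  qed
  have "poly_fun 1 (\<lambda>x. (\<Sum>i\<in>Basis. (?f i \<bullet> b) * (x \<bullet> i)) + \<psi> 0 \<bullet> b)"
    by (intro poly_fun.add poly_fun_sum poly_fun_scale poly_fun_coord poly_fun.const) auto
  then show ?thesis by (rule back_subst[of "poly_fun 1"]) (rule ext, rule eq[symmetric])
qed

lemma is_chart_continuous: "is_chart F \<psi> \<Longrightarrow> continuous_on A \<psi>"
  by (auto simp: is_chart_def continuous_on_iff)

text \<open>The range of the chart is a closed affine image of a plane, hence contains the closure
  of the face and is negligible in dimension three.\<close>

lemma is_chart_closure_negligible:
  fixes F :: "'a::euclidean_space set"
  assumes c: "is_chart F \<psi>" and "DIM('a) = 3"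
  shows "negligible (closure F)"
proof -
  let ?f = "\<lambda>x. \<psi> x - \<psi> 0"
  have lin: "linear ?f" by (rule is_chart_linear[OF c])
  have r: "range \<psi> = (+) (\<psi> 0) ` range ?f" by (auto simp: image_image)
  have "closed (range \<psi>)" unfolding r
    by (intro closed_translation closed_subspace linear_subspace_image[OF lin] subspace_UNIV)
  then have cl: "closure F \<subseteq> range \<psi>" using c by (intro closure_minimal) (auto simp: is_chart_def)
  have "(\<lambda>x. ?f x + \<psi> 0) differentiable_on UNIV"
    by (intro differentiable_on_add differentiable_on_const linear_imp_differentiable_on lin)
  then have "\<psi> differentiable_on UNIV" by simp
  then have "negligible (range \<psi>)" by (intro negligible_differentiable_image_lowdim) (use assms(2) in auto)
  then show ?thesis using cl negligible_subset by blast
qed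

lemma chart_is_chart: "\<exists>\<psi>. is_chart F \<psi> \<Longrightarrow> is_chart F (chart F)"
  unfolding chart_def by (rule someI_ex[of "is_chart F"])

text \<open>Applied to the faces of polyhedra, which become polygonal elements through their
  charts.\<close>

lemma W_loc_edges:
  assumes "polygonal K"
  shows "lin_space (W_loc k (B_edges k K) (cell K))" "p \<in> Pk k \<Longrightarrow> p \<in> W_loc k (B_edges k K) (cell K)"
    "fin_dim_mod (W_loc k (B_edges k K) (cell K)) (zae (cell K))"
proof -
  interpret element_domain "cell K" using assms skeleton_element_domain by (auto simp: polygonal_def)
  show "lin_space (W_loc k (B_edges k K) (cell K))" by (rule lin_space_W_loc[OF lin_space_B_edges])
  show "p \<in> Pk k \<Longrightarrow> p \<in> W_loc k (B_edges k K) (cell K)" by (rule Pk_W_loc[OF _ Pk_B_edges])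
  show "fin_dim_mod (W_loc k (B_edges k K) (cell K)) (zae (cell K))"
    by (rule fin_dim_mod_subset[OF fin_dim_V_loc[OF fin_dim_B_edges] W_loc_V_loc])
      (use assms in \<open>auto simp: polygonal_def\<close>)
qed

context
  fixes K :: "('a::euclidean_space) element"
  assumes ph: "polyhedral K"
begin

lemma face_polygonal: "F \<in> faces K \<Longrightarrow> polygonal (face_element K F)"
  and face_chart: "F \<in> faces K \<Longrightarrow> is_chart F (chart F)"
  and face_frontier: "F \<in> faces K \<Longrightarrow> closure F \<subseteq> frontier (cell K)"
  using ph chart_is_chart unfolding polyhedral_def by blast+

lemma lin_space_B_faces: "lin_space (B_faces k K)"
  unfolding lin_space_def
proof (intro conjI ballI allI)
  show "(\<lambda>x. 0) \<in> B_faces k K"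
    unfolding B_faces_def using lin_space_0[OF W_loc_edges(1)[OF face_polygonal]] by (auto simp: o_def)
  fix u v a b assume u: "u \<in> B_faces k K" and v: "v \<in> B_faces k K"
  show "(\<lambda>x. a * u x + b * v x) \<in> B_faces k K"
    unfolding B_faces_def
  proof (intro CollectI conjI ballI)
    show "continuous_on (frontier (cell K)) (\<lambda>x. a * u x + b * v x)"
      using u v unfolding B_faces_def by (auto intro!: continuous_intros)
    fix F assume F: "F \<in> faces K"
    have "u \<circ> chart F \<in> W_loc k (B_edges k (face_element K F)) (cell (face_element K F))"
      "v \<circ> chart F \<in> W_loc k (B_edges k (face_element K F)) (cell (face_element K F))"
      using u v F by (auto simp: B_faces_def)
    from lin_space_comb[OF W_loc_edges(1)[OF face_polygonal[OF F]] this, of a b]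
    show "(\<lambda>x. a * u x + b * v x) \<circ> chart F \<in> W_loc k (B_edges k (face_element K F)) (cell (face_element K F))"
      by (simp add: o_def)
  qed
qed

lemma Pk_B_faces:
  assumes "p \<in> Pk k" shows "p \<in> B_faces k K"
  unfolding B_faces_def
proof (intro CollectI conjI ballI)
  show "continuous_on (frontier (cell K)) p" by (rule smooth_continuous[OF Pk_smooth[OF assms]])
  fix F assume F: "F \<in> faces K"
  have "poly_fun k (\<lambda>x. p (chart F x))"
    by (rule poly_fun_compose[OF is_chart_coord[OF face_chart[OF F]]]) (use assms in \<open>auto simp: Pk_iff\<close>)
  then show "p \<circ> chart F \<in> W_loc k (B_edges k (face_element K F)) (cell (face_element K F))"
    by (intro W_loc_edges(2)[OF face_polygonal[OF F]]) (simp add: Pk_iff o_def)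
qed

text \<open>A pulled back combination that vanishes almost everywhere on its face vanishes, by
  continuity, on the face and on its closure; these closures fill the frontier.\<close>

lemma fin_dim_B_faces: "fin_dim_mod (B_faces k K) {g. \<forall>x\<in>frontier (cell K). g x = 0}"
proof -
  let ?W = "\<lambda>F. W_loc k (B_edges k (face_element K F)) (cell (face_element K F))"
  define d where "d = (\<lambda>F. SOME d. \<forall>v (M::nat). (\<forall>j<M. v j \<in> ?W F) \<longrightarrow>
      kill d (\<lambda>c. (\<lambda>x. \<Sum>j<M. c j * v j x) \<in> zae (cell (face_element K F))))"
  have d: "kill (d F) (\<lambda>c. (\<lambda>x. \<Sum>j<M. c j * v j x) \<in> zae (cell (face_element K F)))"
    if F: "F \<in> faces K" and v: "\<forall>j<M. v j \<in> ?W F" for F v and M :: nat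
  proof -
    have "\<forall>v (M::nat). (\<forall>j<M. v j \<in> ?W F) \<longrightarrow>
      kill (d F) (\<lambda>c. (\<lambda>x. \<Sum>j<M. c j * v j x) \<in> zae (cell (face_element K F)))"
      unfolding d_def by (rule someI_ex) (rule W_loc_edges(3)[OF face_polygonal[OF F], unfolded fin_dim_mod_def])
    then show ?thesis using v by blast
  qed
  show ?thesis unfolding fin_dim_mod_def
  proof (intro exI allI impI)
    fix v :: "nat \<Rightarrow> 'a \<Rightarrow> real" and M :: nat assume v: "\<forall>j<M. v j \<in> B_faces k K"
    have "kill (\<Prod>F\<in>faces K. d F) (\<lambda>c. \<forall>F\<in>faces K.
        (\<lambda>x. \<Sum>j<M. c j * (v j \<circ> chart F) x) \<in> zae (cell (face_element K F)))"
    proof (rule kill_ball)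
      show "finite (faces K)" using ph by (simp add: polyhedral_def)
      show "kill (d F) (\<lambda>c. (\<lambda>x. \<Sum>j<M. c j * (v j \<circ> chart F) x) \<in> zae (cell (face_element K F)))" if "F \<in> faces K" for F
        by (rule d[OF that]) (use v that in \<open>unfold B_faces_def, blast\<close>)
      show "comb_closed (\<lambda>c. (\<lambda>x. \<Sum>j<M. c j * (v j \<circ> chart F) x) \<in> zae (cell (face_element K F)))" for F
        by (rule comb_closed_in[OF lin_space_zae])
    qed
    then show "kill (\<Prod>F\<in>faces K. d F) (\<lambda>c. (\<lambda>x. \<Sum>j<M. c j * v j x) \<in> {g. \<forall>x\<in>frontier (cell K). g x = 0})"
    proof (rule kill_mono)
      fix c :: "nat \<Rightarrow> real"
      assume h: "\<forall>F\<in>faces K. (\<lambda>x. \<Sum>j<M. c j * (v j \<circ> chart F) x) \<in> zae (cell (face_element K F))"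
      define g where "g = (\<lambda>x. \<Sum>j<M. c j * v j x)"
      have gc: "continuous_on (frontier (cell K)) g"
        unfolding g_def using v by (intro continuous_intros) (auto simp: B_faces_def)
      have "g x = 0" if F: "F \<in> faces K" and x: "x \<in> closure F" for F x
      proof -
        have cellF: "cell (face_element K F) = chart F -` F" by (simp add: face_element_def)
        have op: "open (chart F -` F)"
          using face_polygonal[OF F] unfolding polygonal_def skeleton_ok_def cellF by blast
        have FK: "F \<subseteq> frontier (cell K)" using face_frontier[OF F] closure_subset by blast
        have gF: "g y = 0" if y: "y \<in> F" for y
        proof -
          obtain z where z: "y = chart F z" using face_chart[OF F] y unfolding is_chart_def by blast
          have "(g \<circ> chart F) z = 0"
          proof (rule continuous_AE_zero[OF op])
            show "continuous_on (chart F -` F) (g \<circ> chart F)"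
              by (rule continuous_on_compose[OF is_chart_continuous[OF face_chart[OF F]]])
                (rule continuous_on_subset[OF gc], use FK in auto)
            show "g \<circ> chart F \<in> zae (chart F -` F)" using h F unfolding cellF[symmetric] by (simp add: g_def o_def)
            show "z \<in> chart F -` F" using y z by simp
          qed
          then show ?thesis by (simp add: z)
        qed
        show ?thesis
          by (rule continuous_constant_on_closure[OF continuous_on_subset[OF gc face_frontier[OF F]] gF x])
      qed
      moreover have "frontier (cell K) = (\<Union>F\<in>faces K. closure F)" using ph by (simp add: polyhedral_def)
      ultimately show "(\<lambda>x. \<Sum>j<M. c j * v j x) \<in> {g. \<forall>x\<in>frontier (cell K). g x = 0}"
        unfolding g_def[symmetric] by auto
    qed
  qed
qed

end

section \<open>Meshes\<close>

definition elem_ok :: "('a::euclidean_space) element \<Rightarrow> bool" where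
  "elem_ok K \<longleftrightarrow> (if DIM('a) = 2 then polygonal K else polyhedral K)"

lemma elem_domain: "elem_ok K \<Longrightarrow> element_domain (cell K)"
  by (rule skeleton_element_domain) (auto simp: elem_ok_def polygonal_def polyhedral_def split: if_splits)

lemma W_elem_props:
  fixes K :: "('a::euclidean_space) element"
  assumes "elem_ok K"
  shows "lin_space (W_elem k K)" "Pk k \<subseteq> W_elem k K" "fin_dim_mod (W_elem k K) (zae (cell K))"
    "W_elem k K \<subseteq> H1 (cell K)"
proof -
  interpret element_domain "cell K" by (rule elem_domain[OF assms])
  have B: "lin_space (B_bdry k K) \<and> Pk k \<subseteq> B_bdry k K \<and> fin_dim_mod (B_bdry k K) {g. \<forall>x\<in>frontier (cell K). g x = 0}"
    using assms lin_space_B_edges[of k K] Pk_B_edges[of _ k K] fin_dim_B_edges[of K k]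
      lin_space_B_faces[of K k] Pk_B_faces[of K _ k] fin_dim_B_faces[of K k]
    unfolding B_bdry_def elem_ok_def polygonal_def by (auto split: if_splits)
  show "lin_space (W_elem k K)" unfolding W_elem_def by (rule lin_space_W_loc) (use B in simp)
  show "Pk k \<subseteq> W_elem k K" unfolding W_elem_def
    by (rule subsetI, rule Pk_W_loc) (use B in auto)
  show "fin_dim_mod (W_elem k K) (zae (cell K))" unfolding W_elem_def
    by (rule fin_dim_mod_subset[OF fin_dim_V_loc W_loc_V_loc]) (use B in simp)
  show "W_elem k K \<subseteq> H1 (cell K)" unfolding W_elem_def W_loc_def V_loc_def by blast
qed

lemma negligible_open_segment:
  fixes a b :: "'a::euclidean_space"
  assumes "DIM('a) \<ge> 2" shows "negligible (open_segment a b)"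
proof -
  have "negligible ((\<lambda>s::real. a + s *\<^sub>R (b - a)) ` UNIV)"
    by (rule negligible_differentiable_image_lowdim)
      (use assms in \<open>auto intro!: derivative_intros simp: differentiable_on_def\<close>)
  moreover have "open_segment a b \<subseteq> (\<lambda>s::real. a + s *\<^sub>R (b - a)) ` UNIV"
    by (auto simp: in_segment algebra_simps image_iff)
  ultimately show ?thesis using negligible_subset by blast
qed

text \<open>Segments are negligible in the plane and planes are negligible in space. This makes the
  cells fill the domain up to a null set.\<close>

lemma negligible_frontier_elem:
  fixes K :: "('a::euclidean_space) element"
  assumes dim: "DIM('a) = 2 \<or> DIM('a) = 3" and "elem_ok K"
  shows "negligible (frontier (cell K))"
proof (cases "DIM('a) = 2")
  case True
  then have K: "skeleton_ok K" "faces K = {}" using assms by (auto simp: elem_ok_def polygonal_def)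
  have "negligible e" if e: "e \<in> edges K" for e
  proof -
    obtain a b where "e = open_segment a b" using K(1) e unfolding skeleton_ok_def by blast
    then show ?thesis using negligible_open_segment[of a b] True by simp
  qed
  then have "negligible (verts K \<union> \<Union> (edges K))"
    using K(1) finite_edges[OF K(1)]
    by (intro negligible_Un[OF negligible_finite negligible_Union]) (auto simp: skeleton_ok_def)
  then show ?thesis using frontier_edges[OF K(2)] negligible_subset by blast
next
  case False
  then have K: "polyhedral K" and d: "DIM('a) = 3" using assms by (auto simp: elem_ok_def)
  have "negligible (\<Union>F\<in>faces K. closure F)"
    using K is_chart_closure_negligible[OF _ d] by (intro negligible_Union) (auto simp: polyhedral_def)
  then show ?thesis using K by (simp add: polyhedral_def)
qed

lemma psd_sum: "(\<And>i. i \<in> I \<Longrightarrow> psd_on V (B i)) \<Longrightarrow> psd_on V (\<lambda>u v. \<Sum>i\<in>I. B i u v)"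
  unfolding psd_on_def symmetric_on_def by (auto intro!: bilinear_form_sum sum.cong sum_nonneg)

lemma psd_on_cong:
  assumes V: "lin_space V" and B: "psd_on V B" and eq: "\<And>u v. u \<in> V \<Longrightarrow> v \<in> V \<Longrightarrow> A u v = B u v"
  shows "psd_on V A"
proof -
  have bil: "bilinear_form_on V B" using B by (simp add: psd_on_def)
  have "bilinear_form_on V A"
  proof (rule bilinear_formI)
    fix u v w a b assume h: "u \<in> V" "v \<in> V" "w \<in> V"
    show "A u (\<lambda>x. a * v x + b * w x) = a * A u v + b * A u w"
      using linear_form_comb[OF bilinear_right[OF bil h(1)] h(2,3)] lin_space_comb[OF V h(2,3)] eq h by simp
    show "A (\<lambda>x. a * v x + b * w x) u = a * A v u + b * A w u"
      using linear_form_comb[OF bilinear_left[OF bil h(1)] h(2,3)] lin_space_comb[OF V h(2,3)] eq h by simp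
  qed
  then show ?thesis using B eq by (auto simp: psd_on_def symmetric_on_def)
qed

locale vem_mesh =
  fixes k :: nat and \<Omega> :: "'a::euclidean_space set" and Th :: "'a element set"
  assumes dim: "DIM('a) = 2 \<or> DIM('a) = 3" and open_\<Omega>: "open \<Omega>" and bounded_\<Omega>: "bounded \<Omega>"
    and finite_Th: "finite Th" and cell_\<Omega>: "\<And>K. K \<in> Th \<Longrightarrow> cell K \<subseteq> \<Omega>"
    and cover: "closure \<Omega> = (\<Union>K\<in>Th. closure (cell K))"
    and elem: "\<And>K. K \<in> Th \<Longrightarrow> elem_ok K"
begin

sublocale \<Omega>: bounded_open \<Omega>
  by unfold_locales (rule open_\<Omega> bounded_\<Omega>)+

text \<open>A point of the domain that avoids all cell frontiers lies in one of the open
  cells.\<close>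

lemma zae_mesh_iff: "w \<in> zae \<Omega> \<longleftrightarrow> (\<forall>K\<in>Th. w \<in> zae (cell K))"
proof
  assume w: "w \<in> zae \<Omega>"
  show "\<forall>K\<in>Th. w \<in> zae (cell K)"
  proof
    fix K assume "K \<in> Th"
    then have "cell K \<subseteq> \<Omega>" by (rule cell_\<Omega>)
    then show "w \<in> zae (cell K)" using w unfolding zae_def by (auto elim!: AE_mp)
  qed
next
  assume w: "\<forall>K\<in>Th. w \<in> zae (cell K)"
  have "negligible (\<Union>K\<in>Th. frontier (cell K))"
    using finite_Th negligible_frontier_elem[OF dim elem] by (intro negligible_Union) auto
  then have "AE x in lebesgue. x \<notin> (\<Union>K\<in>Th. frontier (cell K))"
    by (auto simp: eventually_ae_filter_negligible)
  moreover have "AE x in lebesgue. \<forall>K\<in>Th. x \<in> cell K \<longrightarrow> w x = 0"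
    using w finite_Th by (intro AE_finite_allI) (auto simp: zae_def)
  ultimately have "AE x in lebesgue. x \<in> \<Omega> \<longrightarrow> w x = 0"
  proof eventually_elim
    fix x assume h: "x \<notin> (\<Union>K\<in>Th. frontier (cell K))" "\<forall>K\<in>Th. x \<in> cell K \<longrightarrow> w x = 0"
    show "x \<in> \<Omega> \<longrightarrow> w x = 0"
    proof
      assume "x \<in> \<Omega>"
      then have "x \<in> closure \<Omega>" using closure_subset by blast
      then obtain K where K: "K \<in> Th" "x \<in> closure (cell K)" unfolding cover by blast
      then have "x \<in> cell K"
        using h(1) by (auto simp: frontier_def dest: subsetD[OF interior_subset])
      then show "w x = 0" using h(2) K by blast
    qed
  qed
  then show "w \<in> zae \<Omega>" by (simp add: zae_def)
qed

abbreviation "X \<equiv> W_h k \<Omega> Th"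

lemma X_elem: "v \<in> X \<Longrightarrow> K \<in> Th \<Longrightarrow> v \<in> W_elem k K"
  by (simp add: W_h_def)

lemma X_H10: "v \<in> X \<Longrightarrow> v \<in> H10 \<Omega>"
  by (simp add: W_h_def)

lemma X_L2: "v \<in> X \<Longrightarrow> v \<in> L2 \<Omega>"
  using X_H10 \<Omega>.H10_H1 \<Omega>.H1_L2 by blast

lemma lin_space_X: "lin_space X"
  unfolding lin_space_def W_h_def
  using lin_space_0[OF \<Omega>.lin_space_H10] lin_space_comb[OF \<Omega>.lin_space_H10]
    lin_space_0[OF W_elem_props(1)[OF elem]] lin_space_comb[OF W_elem_props(1)[OF elem]] by simp

text \<open>A global function is null as soon as it is null on each cell, so the local eliminations
  are combined over the finite mesh.\<close>

lemma fin_dim_X: "fin_dim_mod X (zae \<Omega>)"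
proof -
  define d where "d = (\<lambda>K :: 'a element. SOME d. \<forall>v (M::nat). (\<forall>j<M. v j \<in> W_elem k K) \<longrightarrow>
      kill d (\<lambda>c. (\<lambda>x. \<Sum>j<M. c j * v j x) \<in> zae (cell K)))"
  have d: "kill (d K) (\<lambda>c. (\<lambda>x. \<Sum>j<M. c j * v j x) \<in> zae (cell K))"
    if K: "K \<in> Th" and v: "\<forall>j<M. v j \<in> W_elem k K" for K v and M :: nat
  proof -
    have "\<forall>v (M::nat). (\<forall>j<M. v j \<in> W_elem k K) \<longrightarrow> kill (d K) (\<lambda>c. (\<lambda>x. \<Sum>j<M. c j * v j x) \<in> zae (cell K))"
      unfolding d_def by (rule someI_ex) (rule W_elem_props(3)[OF elem[OF K], unfolded fin_dim_mod_def])
    then show ?thesis using v by blast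
  qed
  show ?thesis unfolding fin_dim_mod_def
  proof (intro exI allI impI)
    fix v and M :: nat assume v: "\<forall>j<M. v j \<in> X"
    have "kill (\<Prod>K\<in>Th. d K) (\<lambda>c. \<forall>K\<in>Th. (\<lambda>x. \<Sum>j<M. c j * v j x) \<in> zae (cell K))"
      by (rule kill_ball[OF finite_Th]) (use d v X_elem comb_closed_in[OF lin_space_zae] in blast)+
    then show "kill (\<Prod>K\<in>Th. d K) (\<lambda>c. (\<lambda>x. \<Sum>j<M. c j * v j x) \<in> zae \<Omega>)"
      by (rule kill_mono) (simp add: zae_mesh_iff)
  qed
qed

section \<open>The stabilized forms on the mesh\<close>

lemma stab_a_local:
  assumes "stabilizes_a k Th S" "K \<in> Th"
  shows "\<exists>c1 c2. stab_form (H1 (cell K)) (Pk k) (element_domain.mean_form (cell K)) (aE (cell K)) (S K) (W_elem k K) c1 c2"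
proof -
  interpret K: element_domain "cell K" by (rule elem_domain[OF elem[OF assms(2)]])
  note W = W_elem_props[OF elem[OF assms(2)], of k]
  obtain c1 c2 where c: "c1 > 0" "\<And>v. v \<in> W_elem k K \<Longrightarrow> proj_grad k (cell K) v = (\<lambda>x. 0) \<Longrightarrow>
        aE (cell K) v v \<le> c1 * S K v v \<and> S K v v \<le> c2 * aE (cell K) v v"
    using assms unfolding stabilizes_a_def by blast
  have "stab_form (H1 (cell K)) (Pk k) K.mean_form (aE (cell K)) (S K) (W_elem k K) c1 c2"
  proof unfold_locales
    show "bilinear_form_on (W_elem k K) (S K)" "symmetric_on (W_elem k K) (S K)"
      using assms by (auto simp: stabilizes_a_def)
    show "aE (cell K) v v \<le> c1 * S K v v \<and> S K v v \<le> c2 * aE (cell K) v v"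
      if "v \<in> W_elem k K" "K.grad_proj.proj k v = (\<lambda>x. 0)" for v
      using c(2)[OF that(1)] that K.proj_grad_eq[of v k] W(4) by auto
  qed (use K.psd_aE W c(1) in auto)
  then show ?thesis by blast
qed

lemma stab_m_local:
  assumes "stabilizes_m k Th R" "K \<in> Th"
  shows "\<exists>c1 c2. stab_form (L2 (cell K)) (Pk k) (ip (cell K)) (ip (cell K)) (R K) (W_elem k K) c1 c2"
proof -
  interpret K: element_domain "cell K" by (rule elem_domain[OF elem[OF assms(2)]])
  note W = W_elem_props[OF elem[OF assms(2)], of k]
  obtain c1 c2 where c: "c1 > 0" "\<And>v. v \<in> W_elem k K \<Longrightarrow> proj_L2 k (cell K) v = (\<lambda>x. 0) \<Longrightarrow>
        ip (cell K) v v \<le> c1 * R K v v \<and> R K v v \<le> c2 * ip (cell K) v v"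
    using assms unfolding stabilizes_m_def by blast
  have "stab_form (L2 (cell K)) (Pk k) (ip (cell K)) (ip (cell K)) (R K) (W_elem k K) c1 c2"
  proof unfold_locales
    show "bilinear_form_on (W_elem k K) (R K)" "symmetric_on (W_elem k K) (R K)"
      using assms by (auto simp: stabilizes_m_def)
    show "ip (cell K) v v \<le> c1 * R K v v \<and> R K v v \<le> c2 * ip (cell K) v v"
      if "v \<in> W_elem k K" "K.L2_proj.proj k v = (\<lambda>x. 0)" for v
      using c(2)[OF that(1)] that K.proj_L2_eq[of k] by auto
    show "W_elem k K \<subseteq> L2 (cell K)" using W(4) K.H1_L2 by blast
  qed (use psd_ip W c(1) in auto)
  then show ?thesis by blast
qed

text \<open>Zero discrete energy makes the weak gradient null on every cell. As \<open>v\<close> is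
  in \<open>H1\<close> of the whole domain, its global gradient restricts to the cellwise ones, so
  it is null as well, and membership in \<open>H10\<close> leaves only null functions.\<close>

lemma a_h_props:
  assumes S: "stabilizes_a k Th S"
  shows "psd_on X (a_h k Th S)" "v \<in> X \<Longrightarrow> a_h k Th S v v = 0 \<longleftrightarrow> v \<in> zae \<Omega>"
proof -
  define b where "b = (\<lambda>K v w. aE (cell K) (proj_grad k (cell K) v) (proj_grad k (cell K) w)
     + S K (\<lambda>x. v x - proj_grad k (cell K) v x) (\<lambda>x. w x - proj_grad k (cell K) w x))"
  have ah: "a_h k Th S v w = (\<Sum>K\<in>Th. b K v w)" for v w by (simp add: a_h_def b_def)
  have loc: "psd_on X (b K) \<and> (\<forall>v\<in>X. (b K v v = 0 \<longrightarrow> aE (cell K) v v = 0) \<and> (v \<in> zae (cell K) \<longrightarrow> b K v v = 0))"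
    if K: "K \<in> Th" for K
  proof -
    interpret K: element_domain "cell K" by (rule elem_domain[OF elem[OF K]])
    note W = W_elem_props[OF elem[OF K], of k]
    obtain c1 c2 where "stab_form (H1 (cell K)) (Pk k) K.mean_form (aE (cell K)) (S K) (W_elem k K) c1 c2"
      using stab_a_local[OF S K] by blast
    then interpret s: stab_form "H1 (cell K)" "Pk k" K.mean_form "aE (cell K)" "S K" "W_elem k K" c1 c2 .
    have XW: "X \<subseteq> W_elem k K" using X_elem[OF _ K] by blast
    have eq: "b K v w = s.form v w" if "v \<in> W_elem k K" "w \<in> W_elem k K" for v w
      unfolding b_def s.form_def s.res_def K.proj_grad_eq[OF subsetD[OF W(4) that(1)]] K.proj_grad_eq[OF subsetD[OF W(4) that(2)]] ..
    have "psd_on X (b K)"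
      by (rule psd_on_cong[OF lin_space_X psd_on_subset[OF s.psd_form XW]]) (use eq XW in auto)
    moreover have "b K v v = 0 \<longrightarrow> aE (cell K) v v = 0" "v \<in> zae (cell K) \<longrightarrow> b K v v = 0" if "v \<in> X" for v
      using eq[of v v] s.form_zeroD[of v] s.form_null[of v] K.mean_form_zae[of v] K.aE_zae[of v] XW that by auto
    ultimately show ?thesis by blast
  qed
  show psd: "psd_on X (a_h k Th S)"
    by (rule psd_on_cong[OF lin_space_X psd_sum[of Th X b]]) (use loc ah in auto)
  assume v: "v \<in> X"
  have nn: "0 \<le> b K v v" if "K \<in> Th" for K using loc[OF that] v by (auto simp: psd_on_def)
  have z: "a_h k Th S v v = 0 \<longleftrightarrow> (\<forall>K\<in>Th. b K v v = 0)"
    unfolding ah by (rule sum_nonneg_eq_0_iff[OF finite_Th nn])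
  show "a_h k Th S v v = 0 \<longleftrightarrow> v \<in> zae \<Omega>"
  proof
    assume "v \<in> zae \<Omega>"
    then show "a_h k Th S v v = 0" unfolding z zae_mesh_iff using loc v by blast
  next
    assume "a_h k Th S v v = 0"
    then have a0: "aE (cell K) v v = 0" if "K \<in> Th" for K using loc[OF that] v that z by blast
    have vH: "v \<in> H1 \<Omega>" using X_H10[OF v] \<Omega>.H10_H1 by blast
    have "pgrad \<Omega> i v \<in> zae \<Omega>" if i: "i \<in> Basis" for i
      unfolding zae_mesh_iff
    proof
      fix K assume K: "K \<in> Th"
      interpret K: element_domain "cell K" by (rule elem_domain[OF elem[OF K]])
      have vK: "v \<in> H1 (cell K)" using X_elem[OF v K] W_elem_props(4)[OF elem[OF K]] by blast
      \<comment> \<open>The gradients on the cell and on the domain are independent choices;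
        uniqueness on the cell identifies them up to a null set.\<close>
      have "(\<lambda>x. pgrad (cell K) i v x - grad \<Omega> v x \<bullet> i) \<in> zae (cell K)"
        by (rule K.pgrad_eqI[OF vK \<Omega>.weak_gradient_restrict[OF vH K.open_E cell_\<Omega>[OF K]] i])
      moreover have "pgrad (cell K) i v \<in> zae (cell K)" using K.aE_zero_iff[OF vK] a0[OF K] i by blast
      ultimately show "pgrad \<Omega> i v \<in> zae (cell K)"
        using lin_space_diff[OF lin_space_zae, of "pgrad (cell K) i v" "cell K" "\<lambda>x. pgrad (cell K) i v x - grad \<Omega> v x \<bullet> i"]
        by (simp add: pgrad_def)
    qed
    then have "aE \<Omega> v v = 0" using \<Omega>.aE_zero_iff[OF vH] by blast
    then show "v \<in> zae \<Omega>" by (rule \<Omega>.weakly_H10_null[OF \<Omega>.H10_weakly_H10[OF X_H10[OF v]]])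
  qed
qed

lemma m_h_props:
  assumes R: "stabilizes_m k Th R"
  shows "psd_on X (m_h k Th R)" "v \<in> X \<Longrightarrow> m_h k Th R v v = 0 \<longleftrightarrow> v \<in> zae \<Omega>"
proof -
  define b where "b = (\<lambda>K v w. ip (cell K) (proj_L2 k (cell K) v) (proj_L2 k (cell K) w)
     + R K (\<lambda>x. v x - proj_L2 k (cell K) v x) (\<lambda>x. w x - proj_L2 k (cell K) w x))"
  have mh: "m_h k Th R v w = (\<Sum>K\<in>Th. b K v w)" for v w by (simp add: m_h_def b_def)
  have loc: "psd_on X (b K) \<and> (\<forall>v\<in>X. b K v v = 0 \<longleftrightarrow> v \<in> zae (cell K))" if K: "K \<in> Th" for K
  proof -
    interpret K: element_domain "cell K" by (rule elem_domain[OF elem[OF K]])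
    obtain c1 c2 where "stab_form (L2 (cell K)) (Pk k) (ip (cell K)) (ip (cell K)) (R K) (W_elem k K) c1 c2"
      using stab_m_local[OF R K] by blast
    then interpret s: stab_form "L2 (cell K)" "Pk k" "ip (cell K)" "ip (cell K)" "R K" "W_elem k K" c1 c2 .
    have XW: "X \<subseteq> W_elem k K" using X_elem[OF _ K] by blast
    have eq: "b K v w = s.form v w" for v w
      by (simp add: b_def s.form_def s.res_def K.proj_L2_eq)
    have "psd_on X (b K)"
      by (rule psd_on_cong[OF lin_space_X psd_on_subset[OF s.psd_form XW]]) (use eq in auto)
    moreover have "b K v v = 0 \<longleftrightarrow> v \<in> zae (cell K)" if "v \<in> X" for v
    proof -
      have vW: "v \<in> W_elem k K" using that XW by blast
      then have "v \<in> L2 (cell K)" using s.W_V by blast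
      then show ?thesis using eq[of v v] s.form_zeroD[OF vW] s.form_null[OF vW] ip_zero_iff[of v "cell K"] by auto
    qed
    ultimately show ?thesis by blast
  qed
  show psd: "psd_on X (m_h k Th R)"
    by (rule psd_on_cong[OF lin_space_X psd_sum[of Th X b]]) (use loc mh in auto)
  assume v: "v \<in> X"
  have nn: "0 \<le> b K v v" if "K \<in> Th" for K using loc[OF that] v by (auto simp: psd_on_def)
  have "m_h k Th R v v = 0 \<longleftrightarrow> (\<forall>K\<in>Th. b K v v = 0)"
    unfolding mh by (rule sum_nonneg_eq_0_iff[OF finite_Th nn])
  also have "\<dots> \<longleftrightarrow> v \<in> zae \<Omega>" unfolding zae_mesh_iff using loc v by blast
  finally show "m_h k Th R v v = 0 \<longleftrightarrow> v \<in> zae \<Omega>" .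
qed

end

section \<open>Time discretization\<close>

lemma pderiv_sum: "pderiv (\<Sum>i\<in>I. f i) = (\<Sum>i\<in>I. pderiv (f i))"
  by (induction I rule: infinite_finite_induct) (auto simp: pderiv_add)

locale time_grid =
  fixes N :: nat and t :: "nat \<Rightarrow> real" and r :: "nat \<Rightarrow> nat" and T :: real
  assumes t0: "t 0 = 0" and tN: "t N = T" and t_less: "\<And>n. n < N \<Longrightarrow> t n < t (Suc n)" and T_pos: "T > 0"
begin

abbreviation "Y \<equiv> W_tau N t r"

text \<open>The piece of \<open>v\<close> on slab \<open>n\<close>. Two polynomials agreeing on a
  slab are equal, so for members of \<open>Y\<close> the choice is unique.\<close>

definition pp :: "nat \<Rightarrow> (real \<Rightarrow> real) \<Rightarrow> real poly" where
  "pp n v = (SOME p. degree p \<le> r n \<and> (\<forall>s\<in>slab t n. v s = poly p s))"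

lemma N_pos: "N \<ge> 1"
  using t0 tN T_pos by (cases N) auto

lemma slab_less: "n \<in> {1..N} \<Longrightarrow> t (n - 1) < t n"
  using t_less[of "n - 1"] by auto

lemma pp_props:
  assumes "v \<in> Y" "n \<in> {1..N}"
  shows "degree (pp n v) \<le> r n" "s \<in> slab t n \<Longrightarrow> v s = poly (pp n v) s"
proof -
  have "\<exists>p::real poly. degree p \<le> r n \<and> (\<forall>s\<in>slab t n. v s = poly p s)"
    using assms unfolding W_tau_def by blast
  from someI_ex[OF this] have "degree (pp n v) \<le> r n \<and> (\<forall>s\<in>slab t n. v s = poly (pp n v) s)"
    unfolding pp_def .
  then show "degree (pp n v) \<le> r n" "s \<in> slab t n \<Longrightarrow> v s = poly (pp n v) s" by auto
qed

lemma poly_eq_on_slab: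
  assumes "n \<in> {1..N}" "\<And>s. s \<in> slab t n \<Longrightarrow> poly p s = poly q s"
  shows "p = (q :: real poly)"
proof (rule ccontr)
  assume "p \<noteq> q"
  then have "finite {s. poly (p - q) s = 0}" by (intro poly_roots_finite) simp
  moreover have "slab t n \<subseteq> {s. poly (p - q) s = 0}" using assms(2) by auto
  moreover have "infinite (slab t n)" unfolding slab_def using slab_less[OF assms(1)] by (rule infinite_Ioc)
  ultimately show False using finite_subset by blast
qed

lemma pp_eqI:
  assumes "v \<in> Y" "n \<in> {1..N}" "\<And>s. s \<in> slab t n \<Longrightarrow> v s = poly p s"
  shows "pp n v = p"
  by (rule poly_eq_on_slab[OF assms(2)]) (use assms(3) pp_props(2)[OF assms(1,2)] in simp)

lemma lin_space_Y: "lin_space Y"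
  unfolding lin_space_def
proof (intro conjI ballI allI)
  show "(\<lambda>s. 0) \<in> Y" unfolding W_tau_def by (auto intro!: exI[of _ 0])
  fix u v a b assume h: "u \<in> Y" "v \<in> Y"
  show "(\<lambda>s. a * u s + b * v s) \<in> Y"
    unfolding W_tau_def
  proof (intro CollectI ballI)
    fix n assume n: "n \<in> {1..N}"
    have "degree (smult a (pp n u) + smult b (pp n v)) \<le> r n"
      using pp_props(1)[OF h(1) n] pp_props(1)[OF h(2) n]
      by (intro degree_add_le) (auto intro: order_trans[OF degree_smult_le])
    moreover have "\<forall>s\<in>slab t n. a * u s + b * v s = poly (smult a (pp n u) + smult b (pp n v)) s"
      using pp_props(2)[OF h(1) n] pp_props(2)[OF h(2) n] by simp
    ultimately show "\<exists>p::real poly. degree p \<le> r n \<and> (\<forall>s\<in>slab t n. a * u s + b * v s = poly p s)" by blast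
  qed
qed

lemma pp_comb:
  assumes "u \<in> Y" "v \<in> Y" "n \<in> {1..N}"
  shows "pp n (\<lambda>s. a * u s + b * v s) = smult a (pp n u) + smult b (pp n v)"
  by (rule pp_eqI[OF lin_space_comb[OF lin_space_Y assms(1,2)] assms(3)])
    (use pp_props(2)[OF assms(1,3)] pp_props(2)[OF assms(2,3)] in simp)

lemma slab_cover: "s \<in> {0<..T} \<Longrightarrow> \<exists>n\<in>{1..N}. s \<in> slab t n"
proof -
  assume s: "s \<in> {0<..T}"
  define n where "n = (LEAST n. s \<le> t n)"
  have ex: "s \<le> t N" using s tN by simp
  then have n: "s \<le> t n" unfolding n_def by (rule LeastI)
  have nN: "n \<le> N" unfolding n_def using ex by (rule Least_le)
  have n0: "n \<noteq> 0" using n s t0 by (cases n) auto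
  then have "\<not> s \<le> t (n - 1)" using not_less_Least[of "n - 1" "\<lambda>n. s \<le> t n"] unfolding n_def by simp
  then show ?thesis using n nN n0 by (intro bexI[of _ n]) (auto simp: slab_def)
qed

lemma t_mono: "m \<le> n \<Longrightarrow> n \<le> N \<Longrightarrow> t m \<le> t n"
proof (induction n)
  case (Suc n)
  then show ?case using t_less[of n] by (cases "m = Suc n") (auto simp: le_Suc_eq intro: order_trans)
qed simp

lemma slab_subset: "n \<in> {1..N} \<Longrightarrow> slab t n \<subseteq> {0<..T}"
proof -
  assume n: "n \<in> {1..N}"
  have "t 0 \<le> t (n - 1)" "t n \<le> t N" using n by (auto intro!: t_mono)
  then show ?thesis using t0 tN by (auto simp: slab_def)
qed

lemma deriv_slab:
  assumes n: "n \<in> {1..N}" and v: "\<And>s. s \<in> {t (n - 1)<..<t n} \<Longrightarrow> v s = poly p s" and s: "s \<in> {t (n - 1)<..<t n}"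
  shows "deriv v s = poly (pderiv p) s"
proof (rule DERIV_imp_deriv)
  show "(v has_field_derivative poly (pderiv p) s) (at s)"
    by (rule has_field_derivative_transform_within_open[OF poly_DERIV, of "{t (n - 1)<..<t n}"]) (use v s in auto)
qed

text \<open>Restricted to the open slab: at the right end \<open>v\<close> may jump, and its
  derivative there is not controlled.\<close>

lemma pp_deriv:
  assumes "v \<in> Y" "n \<in> {1..N}" "s \<in> {t (n - 1)<..<t n}"
  shows "v s = poly (pp n v) s" "deriv v s = poly (pderiv (pp n v)) s"
    "deriv (deriv v) s = poly (pderiv (pderiv (pp n v))) s"
proof -
  have v: "v s = poly (pp n v) s" if "s \<in> {t (n - 1)<..<t n}" for s
    using pp_props(2)[OF assms(1,2), of s] that by (simp add: slab_def)
  have d: "deriv v s = poly (pderiv (pp n v)) s" if "s \<in> {t (n - 1)<..<t n}" for s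
    by (rule deriv_slab[OF assms(2) v that])
  show "v s = poly (pp n v) s" "deriv v s = poly (pderiv (pp n v)) s" using v d assms(3) by auto
  show "deriv (deriv v) s = poly (pderiv (pderiv (pp n v))) s" by (rule deriv_slab[OF assms(2) d assms(3)])
qed

lemma rlim_slab:
  assumes n: "n \<in> {1..N}" and v: "\<And>s. s \<in> {t (n - 1)<..<t n} \<Longrightarrow> v s = poly p s"
  shows "rlim v (t (n - 1)) = poly p (t (n - 1))"
  unfolding rlim_def
proof (rule tendsto_Lim)
  show "(v \<longlongrightarrow> poly p (t (n - 1))) (at_right (t (n - 1)))"
  proof (rule Lim_transform_eventually)
    show "(poly p \<longlongrightarrow> poly p (t (n - 1))) (at_right (t (n - 1)))"
      by (rule tendsto_within_subset[OF _ subset_UNIV]) (rule poly_isCont[unfolded isCont_def])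
    show "\<forall>\<^sub>F s in at_right (t (n - 1)). poly p s = v s"
      using v slab_less[OF n] by (auto simp: eventually_at_right intro!: exI[of _ "t n"])
  qed
qed simp

lemma llim_slab:
  assumes n: "n \<in> {1..N}" and v: "\<And>s. s \<in> {t (n - 1)<..<t n} \<Longrightarrow> v s = poly p s"
  shows "llim v (t n) = poly p (t n)"
  unfolding llim_def
proof (rule tendsto_Lim)
  show "(v \<longlongrightarrow> poly p (t n)) (at_left (t n))"
  proof (rule Lim_transform_eventually)
    show "(poly p \<longlongrightarrow> poly p (t n)) (at_left (t n))"
      by (rule tendsto_within_subset[OF _ subset_UNIV]) (rule poly_isCont[unfolded isCont_def])
    show "\<forall>\<^sub>F s in at_left (t n). poly p s = v s"
      using v slab_less[OF n] by (auto simp: eventually_at_left intro!: exI[of _ "t (n - 1)"])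
  qed
qed simp

definition PI :: "nat \<Rightarrow> real poly \<Rightarrow> real" where
  "PI n p = integral {t (n - 1)..t n} (poly p)"

lemma poly_integrable: "poly p integrable_on {a..b::real}"
  by (intro integrable_continuous_real continuous_on_poly continuous_on_id)

lemma PI_add: "PI n (p + q) = PI n p + PI n q"
proof -
  have "poly (p + q) = (\<lambda>s. poly p s + poly q s)" by auto
  then show ?thesis unfolding PI_def
    using Henstock_Kurzweil_Integration.integral_add[OF poly_integrable poly_integrable] by simp
qed

lemma PI_0: "PI n 0 = 0"
proof -
  have "poly 0 = (\<lambda>s::real. 0::real)" by auto
  then show ?thesis unfolding PI_def by simp
qed

lemma PI_smult: "PI n (smult c p) = c * PI n p"
proof -
  have "poly (smult c p) = (\<lambda>s. c * poly p s)" by auto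
  then show ?thesis unfolding PI_def by (simp only: integral_mult_right)
qed

lemma PI_sum: "PI n (\<Sum>i\<in>I. f i) = (\<Sum>i\<in>I. PI n (f i))"
proof (induction I rule: infinite_finite_induct)
qed (simp_all add: PI_add PI_0)

lemma PI_pderiv:
  assumes "n \<in> {1..N}" shows "PI n (pderiv p) = poly p (t n) - poly p (t (n - 1))"
proof -
  have "(poly (pderiv p) has_integral (poly p (t n) - poly p (t (n - 1)))) {t (n - 1)..t n}"
    using slab_less[OF assms]
    by (intro fundamental_theorem_of_calculus)
      (auto simp: has_real_derivative_iff_has_vector_derivative[symmetric] intro: has_field_derivative_at_within poly_DERIV)
  then show ?thesis unfolding PI_def by (rule integral_unique)
qed

lemma PI_nonneg: "(\<And>s. 0 \<le> poly p s) \<Longrightarrow> 0 \<le> PI n p"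
  unfolding PI_def by (rule Henstock_Kurzweil_Integration.integral_nonneg) (auto intro: poly_integrable)

lemma PI_zero:
  assumes n: "n \<in> {1..N}" and nn: "\<And>s. 0 \<le> poly p s" and z: "PI n p = 0" shows "p = 0"
proof (rule poly_eq_on_slab[OF n])
  fix s assume s: "s \<in> slab t n"
  have "(poly p has_integral 0) (cbox (t (n - 1)) (t n))"
    using z integrable_integral[OF poly_integrable[of p "t (n - 1)" "t n"]] by (simp add: PI_def)
  from has_integral_0_cbox_imp_0[OF _ _ this, of s]
  have "poly p s = 0" using nn s slab_less[OF n] by (auto simp: slab_def continuous_on_poly continuous_on_id)
  then show "poly p s = poly 0 s" by simp
qed

text \<open>The functions are known on the open slab only. The end points form a null set, which
  also bridges the half-open slab and the closed interval of \<open>PI\<close>.\<close>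

lemma ip_slab:
  assumes n: "n \<in> {1..N}" and f: "\<And>s. s \<in> {t (n - 1)<..<t n} \<Longrightarrow> f s = poly p s"
    and g: "\<And>s. s \<in> {t (n - 1)<..<t n} \<Longrightarrow> g s = poly q s"
  shows "ip (slab t n) f g = PI n (p * q)"
proof -
  let ?J = "{t (n - 1)..t n}"
  have int: "set_integrable lebesgue ?J (poly (p * q))"
  proof -
    have "integrable lborel (\<lambda>s. indicator ?J s *\<^sub>R poly (p * q) s)"
      by (rule borel_integrable_compact) (auto intro!: continuous_intros continuous_on_poly)
    then show ?thesis unfolding set_integrable_def
      by (subst integrable_completion) (auto dest: borel_measurable_integrable)
  qed
  have m2: "(\<lambda>s. indicator ?J s * poly (p * q) s) \<in> borel_measurable lebesgue"
    using int unfolding set_integrable_def by (auto dest: borel_measurable_integrable)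
  have "negligible {t (n - 1), t n}" by (intro negligible_finite) simp
  then have ae: "AE s in lebesgue. indicator ?J s * poly (p * q) s = indicator (slab t n) s * (f s * g s)"
    unfolding eventually_ae_filter_negligible
  proof (intro exI conjI)
    show "{s. indicator ?J s * poly (p * q) s \<noteq> indicator (slab t n) s * (f s * g s)} \<subseteq> {t (n - 1), t n}"
    proof (rule subsetI, rule ccontr)
      fix s assume s: "s \<in> {s. indicator ?J s * poly (p * q) s \<noteq> indicator (slab t n) s * (f s * g s)}" "s \<notin> {t (n - 1), t n}"
      show False
      proof (cases "s \<in> {t (n - 1)<..<t n}")
        case True
        then show ?thesis using s f[OF True] g[OF True] by (simp add: slab_def)
      next
        case False
        then have "s \<notin> ?J" "s \<notin> slab t n" using s(2) by (auto simp: slab_def)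
        then show ?thesis using s(1) by simp
      qed
    qed
  qed
  have "ip (slab t n) f g = (LINT s|lebesgue. indicator ?J s * poly (p * q) s)"
    unfolding ip_eq
    by (rule integral_cong_AE[OF borel_measurable_AE[OF m2 ae] m2]) (use ae in \<open>auto elim: AE_mp\<close>)
  also have "\<dots> = (LINT s:?J|lebesgue. poly (p * q) s)" by (simp add: set_lebesgue_integral_def)
  also have "\<dots> = PI n (p * q)" unfolding PI_def by (rule set_lebesgue_integral_eq_integral(2)[OF int])
  finally show ?thesis .
qed

text \<open>The time forms multiplying \<open>m\<close> and \<open>a\<close>, in terms of the polynomial pieces \<open>p n\<close>, \<open>q n\<close> on the slabs.\<close>

definition jmp :: "(nat \<Rightarrow> real poly) \<Rightarrow> (nat \<Rightarrow> real poly) \<Rightarrow> real" where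
  "jmp p q = (\<Sum>n=1..N-1. (poly (p (Suc n)) (t n) - poly (p n) (t n)) * poly (q (Suc n)) (t n))"

definition km :: "real \<Rightarrow> (nat \<Rightarrow> real poly) \<Rightarrow> (nat \<Rightarrow> real poly) \<Rightarrow> real" where
  "km \<nu> p q = (\<Sum>n=1..N. PI n (pderiv (pderiv (p n)) * pderiv (q n)) + \<nu> * PI n (pderiv (p n) * pderiv (q n)))
     + jmp (\<lambda>n. pderiv (p n)) (\<lambda>n. pderiv (q n))
     + poly (pderiv (p 1)) 0 * poly (pderiv (q 1)) 0"

definition ka :: "(nat \<Rightarrow> real poly) \<Rightarrow> (nat \<Rightarrow> real poly) \<Rightarrow> real" where
  "ka p q = (\<Sum>n=1..N. PI n (p n * pderiv (q n)))
     + jmp p q + poly (p 1) 0 * poly (q 1) 0"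

definition tm :: "real \<Rightarrow> (real \<Rightarrow> real) \<Rightarrow> (real \<Rightarrow> real) \<Rightarrow> real" where
  "tm \<nu> v w = km \<nu> (\<lambda>n. pp n v) (\<lambda>n. pp n w)"

definition ta :: "(real \<Rightarrow> real) \<Rightarrow> (real \<Rightarrow> real) \<Rightarrow> real" where
  "ta v w = ka (\<lambda>n. pp n v) (\<lambda>n. pp n w)"

text \<open>Separates space from time: from here on the time dependence enters only through the
  scalar forms \<open>tm\<close> and \<open>ta\<close> of polynomial pieces.\<close>

lemma A_prod_eq:
  assumes v: "v2 \<in> Y" and w: "w2 \<in> Y"
  shows "A_prod m a \<nu> N t v1 v2 w1 w2 = m v1 w1 * tm \<nu> v2 w2 + a v1 w1 * ta v2 w2"
proof -
  define M where "M = m v1 w1"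
  define B where "B = a v1 w1"
  let ?p = "\<lambda>n. pp n v2" and ?q = "\<lambda>n. pp n w2"
  have i: "ip (slab t n) (deriv (deriv v2)) (deriv w2) = PI n (pderiv (pderiv (?p n)) * pderiv (?q n))"
    "ip (slab t n) (deriv v2) (deriv w2) = PI n (pderiv (?p n) * pderiv (?q n))"
    "ip (slab t n) v2 (deriv w2) = PI n (?p n * pderiv (?q n))" if "n \<in> {1..N}" for n
    using ip_slab[OF that pp_deriv(3)[OF v that] pp_deriv(2)[OF w that]]
      ip_slab[OF that pp_deriv(2)[OF v that] pp_deriv(2)[OF w that]]
      ip_slab[OF that pp_deriv(1)[OF v that] pp_deriv(2)[OF w that]] by blast+
  have rl: "rlim v (t n) = poly (pp (Suc n) v) (t n)" "rlim (deriv v) (t n) = poly (pderiv (pp (Suc n) v)) (t n)"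
    if "n < N" "v \<in> Y" for n v
    using rlim_slab[of "Suc n" v "pp (Suc n) v"] rlim_slab[of "Suc n" "deriv v" "pderiv (pp (Suc n) v)"]
      pp_deriv[OF that(2), of "Suc n"] that by auto
  have ll: "llim v (t n) = poly (pp n v) (t n)" "llim (deriv v) (t n) = poly (pderiv (pp n v)) (t n)"
    if "n \<in> {1..N}" "v \<in> Y" for n v
    using llim_slab[OF that(1), of v "pp n v"] llim_slab[OF that(1), of "deriv v" "pderiv (pp n v)"]
      pp_deriv[OF that(2,1)] by auto
  have s1: "(\<Sum>n=1..N. M * ip (slab t n) (deriv (deriv v2)) (deriv w2)
               + \<nu> * M * ip (slab t n) (deriv v2) (deriv w2) + B * ip (slab t n) v2 (deriv w2))
     = M * (\<Sum>n=1..N. PI n (pderiv (pderiv (?p n)) * pderiv (?q n)) + \<nu> * PI n (pderiv (?p n) * pderiv (?q n)))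
       + B * (\<Sum>n=1..N. PI n (?p n * pderiv (?q n)))"
    unfolding sum_distrib_left sum.distrib[symmetric] by (rule sum.cong) (auto simp: i algebra_simps)
  have s2: "(\<Sum>n=1..N-1. M * jump (deriv v2) (t n) * rlim (deriv w2) (t n) + B * jump v2 (t n) * rlim w2 (t n))
     = M * (\<Sum>n=1..N-1. (poly (pderiv (?p (Suc n))) (t n) - poly (pderiv (?p n)) (t n)) * poly (pderiv (?q (Suc n))) (t n))
     + B * (\<Sum>n=1..N-1. (poly (?p (Suc n)) (t n) - poly (?p n) (t n)) * poly (?q (Suc n)) (t n))"
    unfolding sum_distrib_left sum.distrib[symmetric]
  proof (rule sum.cong[OF refl])
    fix n assume "n \<in> {1..N-1}"
    then have n: "n < N" "n \<in> {1..N}" by auto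
    show "M * jump (deriv v2) (t n) * rlim (deriv w2) (t n) + B * jump v2 (t n) * rlim w2 (t n)
      = M * ((poly (pderiv (?p (Suc n))) (t n) - poly (pderiv (?p n)) (t n)) * poly (pderiv (?q (Suc n))) (t n))
       + B * ((poly (?p (Suc n)) (t n) - poly (?p n) (t n)) * poly (?q (Suc n)) (t n))"
      unfolding jump_def by (simp add: rl[OF n(1) v] rl[OF n(1) w] ll[OF n(2) v])
  qed
  have r0: "rlim v 0 = poly (pp 1 v) 0" "rlim (deriv v) 0 = poly (pderiv (pp 1 v)) 0" if "v \<in> Y" for v
    using rl[of 0 v] that N_pos t0 by auto
  show ?thesis
    unfolding A_prod_def M_def[symmetric] B_def[symmetric] s1 s2 r0[OF v] r0[OF w] tm_def ta_def km_def ka_def jmp_def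
    by (simp add: algebra_simps)
qed

definition pcomb :: "real \<Rightarrow> (nat \<Rightarrow> real poly) \<Rightarrow> real \<Rightarrow> (nat \<Rightarrow> real poly) \<Rightarrow> nat \<Rightarrow> real poly" where
  "pcomb a p b q n = smult a (p n) + smult b (q n)"

lemma PI_comb:
  "PI n (u * (smult a v + smult b w)) = a * PI n (u * v) + b * PI n (u * w)"
  "PI n ((smult a v + smult b w) * u) = a * PI n (v * u) + b * PI n (w * u)"
  by (simp_all add: distrib_left distrib_right PI_add PI_smult)

lemma sum_comb: "(\<Sum>i\<in>I. a * f i + b * g i) = a * sum f I + (b :: real) * sum g I"
  by (simp add: sum.distrib sum_distrib_left)

lemma jmp_comb:
  "jmp u (pcomb a v b w) = a * jmp u v + b * jmp u w" "jmp (pcomb a v b w) u = a * jmp v u + b * jmp w u"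
  unfolding jmp_def sum_comb[symmetric] by (rule sum.cong; simp add: pcomb_def algebra_simps)+

lemma ka_comb:
  "ka u (pcomb a v b w) = a * ka u v + b * ka u w" "ka (pcomb a v b w) u = a * ka v u + b * ka w u"
proof -
  have 1: "(\<Sum>n=1..N. PI n (u n * pderiv (pcomb a v b w n))) = a * (\<Sum>n=1..N. PI n (u n * pderiv (v n))) + b * (\<Sum>n=1..N. PI n (u n * pderiv (w n)))"
    unfolding sum_comb[symmetric] by (rule sum.cong) (simp_all add: pcomb_def pderiv_add pderiv_smult PI_comb)
  have 2: "(\<Sum>n=1..N. PI n (pcomb a v b w n * pderiv (u n))) = a * (\<Sum>n=1..N. PI n (v n * pderiv (u n))) + b * (\<Sum>n=1..N. PI n (w n * pderiv (u n)))"
    unfolding sum_comb[symmetric] by (rule sum.cong) (simp_all add: pcomb_def PI_comb)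
  show "ka u (pcomb a v b w) = a * ka u v + b * ka u w" "ka (pcomb a v b w) u = a * ka v u + b * ka w u"
    unfolding ka_def 1 2 jmp_comb by (simp_all add: pcomb_def algebra_simps)
qed

lemma pderiv_pcomb: "(\<lambda>n. pderiv (pcomb a p b q n)) = pcomb a (\<lambda>n. pderiv (p n)) b (\<lambda>n. pderiv (q n))"
  by (simp add: fun_eq_iff pcomb_def pderiv_add pderiv_smult)

lemma km_comb:
  "km \<nu> u (pcomb a v b w) = a * km \<nu> u v + b * km \<nu> u w" "km \<nu> (pcomb a v b w) u = a * km \<nu> v u + b * km \<nu> w u"
proof -
  have 1: "(\<Sum>n=1..N. PI n (pderiv (pderiv (u n)) * pderiv (pcomb a v b w n)) + \<nu> * PI n (pderiv (u n) * pderiv (pcomb a v b w n)))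
     = a * (\<Sum>n=1..N. PI n (pderiv (pderiv (u n)) * pderiv (v n)) + \<nu> * PI n (pderiv (u n) * pderiv (v n)))
     + b * (\<Sum>n=1..N. PI n (pderiv (pderiv (u n)) * pderiv (w n)) + \<nu> * PI n (pderiv (u n) * pderiv (w n)))"
    unfolding sum_comb[symmetric] by (rule sum.cong) (simp_all only: pcomb_def pderiv_add pderiv_smult PI_comb, simp_all add: algebra_simps)
  have 2: "(\<Sum>n=1..N. PI n (pderiv (pderiv (pcomb a v b w n)) * pderiv (u n)) + \<nu> * PI n (pderiv (pcomb a v b w n) * pderiv (u n)))
     = a * (\<Sum>n=1..N. PI n (pderiv (pderiv (v n)) * pderiv (u n)) + \<nu> * PI n (pderiv (v n) * pderiv (u n)))
     + b * (\<Sum>n=1..N. PI n (pderiv (pderiv (w n)) * pderiv (u n)) + \<nu> * PI n (pderiv (w n) * pderiv (u n)))"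
    unfolding sum_comb[symmetric]
    by (rule sum.cong) (simp_all only: pcomb_def pderiv_add pderiv_smult PI_comb, simp_all add: algebra_simps)
  show "km \<nu> u (pcomb a v b w) = a * km \<nu> u v + b * km \<nu> u w" "km \<nu> (pcomb a v b w) u = a * km \<nu> v u + b * km \<nu> w u"
    unfolding km_def 1 2 pderiv_pcomb jmp_comb by (simp_all add: pcomb_def pderiv_add pderiv_smult algebra_simps)
qed

lemma jmp_cong:
  assumes "\<And>n. n \<in> {1..N} \<Longrightarrow> p n = p' n" "\<And>n. n \<in> {1..N} \<Longrightarrow> q n = q' n"
  shows "jmp p q = jmp p' q'"
  unfolding jmp_def using assms by (intro sum.cong) auto

lemma ka_cong:
  assumes "\<And>n. n \<in> {1..N} \<Longrightarrow> p n = p' n" "\<And>n. n \<in> {1..N} \<Longrightarrow> q n = q' n"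
  shows "ka p q = ka p' q'"
proof -
  have "jmp p q = jmp p' q'" by (rule jmp_cong) (use assms in auto)
  moreover have "(\<Sum>n=1..N. PI n (p n * pderiv (q n))) = (\<Sum>n=1..N. PI n (p' n * pderiv (q' n)))"
    by (rule sum.cong) (use assms in auto)
  moreover have "p 1 = p' 1" "q 1 = q' 1" using N_pos assms by auto
  ultimately show ?thesis unfolding ka_def by simp
qed

lemma km_cong:
  assumes "\<And>n. n \<in> {1..N} \<Longrightarrow> p n = p' n" "\<And>n. n \<in> {1..N} \<Longrightarrow> q n = q' n"
  shows "km \<nu> p q = km \<nu> p' q'"
proof -
  have "jmp (\<lambda>n. pderiv (p n)) (\<lambda>n. pderiv (q n)) = jmp (\<lambda>n. pderiv (p' n)) (\<lambda>n. pderiv (q' n))"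
    by (rule jmp_cong) (use assms in auto)
  moreover have "(\<Sum>n=1..N. PI n (pderiv (pderiv (p n)) * pderiv (q n)) + \<nu> * PI n (pderiv (p n) * pderiv (q n)))
     = (\<Sum>n=1..N. PI n (pderiv (pderiv (p' n)) * pderiv (q' n)) + \<nu> * PI n (pderiv (p' n) * pderiv (q' n)))"
    by (rule sum.cong) (use assms in auto)
  moreover have "p 1 = p' 1" "q 1 = q' 1" using N_pos assms by auto
  ultimately show ?thesis unfolding km_def by simp
qed

lemma bilinear_ta: "bilinear_form_on Y ta"
proof (rule bilinear_formI)
  fix u v w a b assume h: "u \<in> Y" "v \<in> Y" "w \<in> Y"
  have pc: "n \<in> {1..N} \<Longrightarrow> pp n (\<lambda>x. a * v x + b * w x) = pcomb a (\<lambda>n. pp n v) b (\<lambda>n. pp n w) n" for n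
    unfolding pcomb_def by (rule pp_comb[OF h(2,3)])
  show "ta u (\<lambda>x. a * v x + b * w x) = a * ta u v + b * ta u w"
    unfolding ta_def ka_comb[symmetric] by (rule ka_cong) (use pc in auto)
  show "ta (\<lambda>x. a * v x + b * w x) u = a * ta v u + b * ta w u"
    unfolding ta_def ka_comb[symmetric] by (rule ka_cong) (use pc in auto)
qed

lemma bilinear_tm: "bilinear_form_on Y (tm \<nu>)"
proof (rule bilinear_formI)
  fix u v w a b assume h: "u \<in> Y" "v \<in> Y" "w \<in> Y"
  have pc: "n \<in> {1..N} \<Longrightarrow> pp n (\<lambda>x. a * v x + b * w x) = pcomb a (\<lambda>n. pp n v) b (\<lambda>n. pp n w) n" for n
    unfolding pcomb_def by (rule pp_comb[OF h(2,3)])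
  show "tm \<nu> u (\<lambda>x. a * v x + b * w x) = a * tm \<nu> u v + b * tm \<nu> u w"
    unfolding tm_def km_comb[symmetric] by (rule km_cong) (use pc in auto)
  show "tm \<nu> (\<lambda>x. a * v x + b * w x) u = a * tm \<nu> v u + b * tm \<nu> w u"
    unfolding tm_def km_comb[symmetric] by (rule km_cong) (use pc in auto)
qed

text \<open>Members of \<open>Y\<close> are arbitrary outside the slabs, so a nonzero function can
  be invisible to the time forms. Solvability has to account for such factors.\<close>

lemma time_forms_zero:
  assumes "w \<in> Y" "\<And>s. s \<in> {0<..T} \<Longrightarrow> w s = 0"
  shows "tm \<nu> v w = 0" "ta v w = 0"
proof -
  have "pp n w = 0" if n: "n \<in> {1..N}" for n
    using slab_subset[OF n] assms(2) by (intro pp_eqI[OF assms(1) n]) auto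
  then have "tm \<nu> v w = km \<nu> (\<lambda>n. pp n v) (\<lambda>n. 0)" "ta v w = ka (\<lambda>n. pp n v) (\<lambda>n. 0)"
    unfolding tm_def ta_def by (auto intro!: km_cong ka_cong)
  then show "tm \<nu> v w = 0" "ta v w = 0" by (simp_all add: km_def ka_def jmp_def PI_0)
qed

text \<open>The symmetric form left over by integration by parts: products of the values at the
  final time, at the initial time, and of the jumps.\<close>

definition kb :: "(nat \<Rightarrow> real poly) \<Rightarrow> (nat \<Rightarrow> real poly) \<Rightarrow> real" where
  "kb p q = poly (p N) (t N) * poly (q N) (t N) + poly (p 1) 0 * poly (q 1) 0
     + (\<Sum>n=1..N-1. (poly (p (Suc n)) (t n) - poly (p n) (t n)) * (poly (q (Suc n)) (t n) - poly (q n) (t n)))"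

lemma telescope:
  fixes L R :: "nat \<Rightarrow> real"
  assumes "K \<ge> 1"
  shows "(\<Sum>n=1..K. L n - R n) + (\<Sum>n=1..K-1. R (Suc n) - L n) = L K - R 1"
  using assms
proof (induction K rule: nat_induct_at_least)
  case (Suc K)
  have "(\<Sum>n=1..Suc K - 1. R (Suc n) - L n) = (\<Sum>n=1..K-1. R (Suc n) - L n) + (R (Suc K) - L K)"
    using Suc.hyps by (cases K) auto
  then show ?case using Suc.IH by simp
qed simp

text \<open>At each inner node the two mixed jump terms equal the product of the jumps plus the
  change of the product of the pieces across the node. These changes cancel against the end point
  values of the integrals by telescoping.\<close>

lemma boundary_sum:
  "(\<Sum>n=1..N. PI n (pderiv (p n * q n))) + (jmp p q + jmp q p) + 2 * (poly (p 1) 0 * poly (q 1) 0) = kb p q"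
proof -
  define L where "L = (\<lambda>n. poly (p n) (t n) * poly (q n) (t n))"
  define R where "R = (\<lambda>n. poly (p n) (t (n - 1)) * poly (q n) (t (n - 1)))"
  define D where "D = (\<lambda>n. (poly (p (Suc n)) (t n) - poly (p n) (t n)) * (poly (q (Suc n)) (t n) - poly (q n) (t n)))"
  have 1: "(\<Sum>n=1..N. PI n (pderiv (p n * q n))) = (\<Sum>n=1..N. L n - R n)"
    by (rule sum.cong) (auto simp: PI_pderiv L_def R_def)
  have 2: "jmp p q + jmp q p = (\<Sum>n=1..N-1. D n) + (\<Sum>n=1..N-1. R (Suc n) - L n)"
    unfolding jmp_def sum.distrib[symmetric] by (rule sum.cong) (auto simp: D_def L_def R_def algebra_simps)
  have 3: "R 1 = poly (p 1) 0 * poly (q 1) 0" by (simp add: R_def t0)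
  have 4: "kb p q = L N + R 1 + (\<Sum>n=1..N-1. D n)" unfolding kb_def 3 by (simp add: L_def D_def)
  show ?thesis unfolding 1 2 3[symmetric] 4 using telescope[OF N_pos, of L R] by linarith
qed

lemma ka_sym: "ka p q + ka q p = kb p q"
proof -
  have "PI n (p n * pderiv (q n)) + PI n (q n * pderiv (p n)) = PI n (pderiv (p n * q n))" for n
    by (simp add: pderiv_mult PI_add[symmetric])
  then have "(\<Sum>n=1..N. PI n (p n * pderiv (q n))) + (\<Sum>n=1..N. PI n (q n * pderiv (p n))) = (\<Sum>n=1..N. PI n (pderiv (p n * q n)))"
    by (simp add: sum.distrib[symmetric])
  moreover have "poly (q 1) 0 * poly (p 1) 0 = poly (p 1) 0 * poly (q 1) 0" by simp
  ultimately show ?thesis unfolding boundary_sum[of p q, symmetric] ka_def by linarith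
qed

text \<open>The second-order term is integrated by parts with the derivatives as pieces; the damping
  term is symmetric already and is merely doubled.\<close>

lemma km_sym: "km \<nu> p q + km \<nu> q p = kb (\<lambda>n. pderiv (p n)) (\<lambda>n. pderiv (q n))
    + 2 * \<nu> * (\<Sum>n=1..N. PI n (pderiv (p n) * pderiv (q n)))"
proof -
  have "PI n (pderiv (pderiv (p n)) * pderiv (q n)) + PI n (pderiv (pderiv (q n)) * pderiv (p n))
      = PI n (pderiv (pderiv (p n) * pderiv (q n)))" for n
    by (simp add: pderiv_mult PI_add[symmetric] add.commute mult.commute)
  moreover have "PI n (pderiv (q n) * pderiv (p n)) = PI n (pderiv (p n) * pderiv (q n))" for n by (simp add: mult.commute)
  ultimately have "(PI n (pderiv (pderiv (p n)) * pderiv (q n)) + \<nu> * PI n (pderiv (p n) * pderiv (q n)))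
     + (PI n (pderiv (pderiv (q n)) * pderiv (p n)) + \<nu> * PI n (pderiv (q n) * pderiv (p n)))
     = 1 * PI n (pderiv (pderiv (p n) * pderiv (q n))) + 2 * \<nu> * PI n (pderiv (p n) * pderiv (q n))" for n
    by (simp add: algebra_simps)
  then have "(\<Sum>n=1..N. PI n (pderiv (pderiv (p n)) * pderiv (q n)) + \<nu> * PI n (pderiv (p n) * pderiv (q n)))
     + (\<Sum>n=1..N. PI n (pderiv (pderiv (q n)) * pderiv (p n)) + \<nu> * PI n (pderiv (q n) * pderiv (p n)))
     = 1 * (\<Sum>n=1..N. PI n (pderiv (pderiv (p n) * pderiv (q n)))) + 2 * \<nu> * (\<Sum>n=1..N. PI n (pderiv (p n) * pderiv (q n)))"
    unfolding sum_comb[symmetric] sum.distrib[symmetric] by (intro sum.cong refl)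
  moreover have "poly (pderiv (q 1)) 0 * poly (pderiv (p 1)) 0 = poly (pderiv (p 1)) 0 * poly (pderiv (q 1)) 0" by simp
  ultimately show ?thesis
    unfolding boundary_sum[of "\<lambda>n. pderiv (p n)" "\<lambda>n. pderiv (q n)", symmetric] km_def by linarith
qed

end

section \<open>The discrete problem in space and time\<close>

text \<open>Turns a double sum over a tensor representation into the form evaluated at two single
  spatial functions.\<close>

lemma gram_sum:
  assumes X: "lin_space X" and g: "bilinear_form_on X g" and x: "\<And>i. i < (m::nat) \<Longrightarrow> x i \<in> X"
  shows "(\<Sum>i<m. \<Sum>j<m. g (x i) (x j) * (\<xi> i * \<eta> j)) = g (\<lambda>v. \<Sum>i<m. \<xi> i * x i v) (\<lambda>v. \<Sum>j<m. \<eta> j * x j v)"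
proof -
  have s: "(\<lambda>v. \<Sum>j<m. \<eta> j * x j v) \<in> X" by (rule lin_space_sum[OF X]) (use x in auto)
  have "g (\<lambda>v. \<Sum>i<m. \<xi> i * x i v) (\<lambda>v. \<Sum>j<m. \<eta> j * x j v) = (\<Sum>i<m. \<xi> i * g (x i) (\<lambda>v. \<Sum>j<m. \<eta> j * x j v))"
    by (rule linear_form_sum[OF X bilinear_left[OF g s]]) (use x in auto)
  also have "\<dots> = (\<Sum>i<m. \<xi> i * (\<Sum>j<m. \<eta> j * g (x i) (x j)))"
  proof (rule sum.cong[OF refl])
    fix i assume "i \<in> {..<m}"
    then have "x i \<in> X" using x by auto
    from linear_form_sum[OF X bilinear_right[OF g this], of "{..<m}" x \<eta>] x
    show "\<xi> i * g (x i) (\<lambda>v. \<Sum>j<m. \<eta> j * x j v) = \<xi> i * (\<Sum>j<m. \<eta> j * g (x i) (x j))" by simp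
  qed
  finally show ?thesis by (simp add: sum_distrib_left mult_ac)
qed

text \<open>The abstract problem: \<open>NX\<close> collects the isotropic vectors of both forms in
  \<open>X\<close>, and \<open>X\<close> has finite dimension modulo it.\<close>

locale dg_setup = time_grid N t r T for N t r T +
  fixes X NX :: "('b \<Rightarrow> real) set" and m a :: "('b \<Rightarrow> real) \<Rightarrow> ('b \<Rightarrow> real) \<Rightarrow> real" and \<nu> :: real
  assumes lin_X: "lin_space X" and lin_NX: "lin_space NX" and fd_X: "fin_dim_mod X NX"
    and psd_m: "psd_on X m" and psd_a: "psd_on X a" and \<nu>_pos: "\<nu> > 0"
    and m_null: "\<And>x. x \<in> X \<Longrightarrow> m x x = 0 \<longleftrightarrow> x \<in> NX" and a_null: "\<And>x. x \<in> X \<Longrightarrow> a x x = 0 \<longleftrightarrow> x \<in> NX"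
begin

abbreviation "Z \<equiv> tensor_space X Y"
abbreviation "AA \<equiv> bilinear_ext X Y (A_prod m a \<nu> N t)"

lemma bil_m: "bilinear_form_on X m" and bil_a: "bilinear_form_on X a"
  using psd_m psd_a by (auto simp: psd_on_def)

lemma A_prod_left: "w1 \<in> X \<Longrightarrow> w2 \<in> Y \<Longrightarrow> bilinear_map_on X Y (\<lambda>v1 v2. A_prod m a \<nu> N t v1 v2 w1 w2)"
  using bil_m bil_a bilinear_tm[of \<nu>] bilinear_ta
  by (intro bilinear_mapI) (simp_all add: A_prod_eq lin_space_comb[OF lin_space_Y] linear_form_comb[OF bilinear_left] algebra_simps)

lemma A_prod_right: "v1 \<in> X \<Longrightarrow> v2 \<in> Y \<Longrightarrow> bilinear_map_on X Y (A_prod m a \<nu> N t v1 v2)"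
  using bil_m bil_a bilinear_tm[of \<nu>] bilinear_ta
  by (intro bilinear_mapI) (simp_all add: A_prod_eq lin_space_comb[OF lin_space_Y] linear_form_comb[OF bilinear_right] algebra_simps)

lemma AA_bilinear: "bilinear_form_on Z AA"
  by (rule bilinear_ext_rep(1)[OF lin_X lin_space_Y]) (rule A_prod_left A_prod_right; assumption)+

lemma AA_rep:
  assumes "tensor_rep X Y u k x y" "tensor_rep X Y w k' x' y'"
  shows "AA u w = (\<Sum>i<k. \<Sum>j<k'. A_prod m a \<nu> N t (x i) (y i) (x' j) (y' j))"
  by (rule bilinear_ext_rep(2)[OF lin_X lin_space_Y _ _ assms]) (rule A_prod_left A_prod_right; assumption)+

lemma a_null_left: "d \<in> X \<Longrightarrow> w \<in> X \<Longrightarrow> a d d = 0 \<Longrightarrow> a d w = 0"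
  and a_null_right: "d \<in> X \<Longrightarrow> w \<in> X \<Longrightarrow> a d d = 0 \<Longrightarrow> a w d = 0"
  and m_null_right: "d \<in> X \<Longrightarrow> w \<in> X \<Longrightarrow> m d d = 0 \<Longrightarrow> m w d = 0"
  using psd_null[OF lin_X psd_a, of d w] psd_null[OF lin_X psd_m, of d w] by auto

lemma Z_rep: "z \<in> Z \<Longrightarrow> \<exists>k x y. tensor_rep X Y z k x y"
  using tensor_space_rep[OF lin_X, of z Y] by simp

lemma lin_Z: "lin_space Z"
  by (rule lin_space_tensor[OF lin_X])

text \<open>\<open>sl k x p s\<close> is the slice at time \<open>s\<close> of the function with time factors \<open>p i\<close>.\<close>

definition sl :: "nat \<Rightarrow> (nat \<Rightarrow> 'b \<Rightarrow> real) \<Rightarrow> (nat \<Rightarrow> real poly) \<Rightarrow> real \<Rightarrow> 'b \<Rightarrow> real" where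
  "sl k x p s = (\<lambda>v. \<Sum>i<k. poly (p i) s * x i v)"

lemma sl_X: "(\<And>i. i < k \<Longrightarrow> x i \<in> X) \<Longrightarrow> sl k x p s \<in> X"
  unfolding sl_def by (rule lin_space_sum[OF lin_X]) auto

lemma slice_eq:
  assumes "tensor_rep X Y z k x y" "n \<in> {1..N}" "s \<in> slab t n"
  shows "(\<lambda>v. z (v, s)) = sl k x (\<lambda>i. pp n (y i)) s"
  unfolding sl_def
proof
  fix v
  have "z (v, s) = (\<Sum>i<k. x i v * y i s)" using assms(1) by (simp add: tensor_rep_def)
  also have "\<dots> = (\<Sum>i<k. poly (pp n (y i)) s * x i v)"
    using assms pp_props(2)[OF _ assms(2,3)] by (intro sum.cong) (auto simp: tensor_rep_def)
  finally show "z (v, s) = (\<Sum>i<k. poly (pp n (y i)) s * x i v)" .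
qed

text \<open>\<open>kb\<close> is a sum of products of values of the pieces, so summation over a
  representation yields energies of time slices and of their jumps.\<close>

lemma kb_gram:
  assumes g: "psd_on X g" and x: "\<And>i. i < k \<Longrightarrow> x i \<in> X"
  shows "(\<Sum>i<k. \<Sum>j<k. g (x i) (x j) * kb (\<lambda>n. p n i) (\<lambda>n. p n j))
     = g (sl k x (p N) (t N)) (sl k x (p N) (t N)) + g (sl k x (p 1) 0) (sl k x (p 1) 0)
     + (\<Sum>n=1..N-1. g (\<lambda>v. sl k x (p (Suc n)) (t n) v - sl k x (p n) (t n) v) (\<lambda>v. sl k x (p (Suc n)) (t n) v - sl k x (p n) (t n) v))"
proof -
  have bg: "bilinear_form_on X g" using g by (simp add: psd_on_def)
  note G = gram_sum[OF lin_X bg x]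
  have d: "(\<lambda>v. sl k x (p (Suc n)) (t n) v - sl k x (p n) (t n) v) = (\<lambda>v. \<Sum>i<k. (poly (p (Suc n) i) (t n) - poly (p n i) (t n)) * x i v)" for n
    by (simp add: sl_def sum_subtractf[symmetric] left_diff_distrib)
  have "(\<Sum>i<k. \<Sum>j<k. g (x i) (x j) * (\<Sum>n=1..N-1. (poly (p (Suc n) i) (t n) - poly (p n i) (t n)) * (poly (p (Suc n) j) (t n) - poly (p n j) (t n))))
     = (\<Sum>n=1..N-1. \<Sum>i<k. \<Sum>j<k. g (x i) (x j) * ((poly (p (Suc n) i) (t n) - poly (p n i) (t n)) * (poly (p (Suc n) j) (t n) - poly (p n j) (t n))))"
    unfolding sum_distrib_left by (subst sum.swap[of _ "{1..N-1}"]) (rule sum.swap)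
  then show ?thesis
    unfolding kb_def d
    by (simp only: sl_def distrib_left sum.distrib G)
qed

lemma energy:
  assumes z: "tensor_rep X Y z k x y" and A0: "AA z z = 0"
  shows "n \<in> {1..N} \<Longrightarrow> m (sl k x (\<lambda>i. pderiv (pp n (y i))) s) (sl k x (\<lambda>i. pderiv (pp n (y i))) s) = 0"
    and "a (sl k x (\<lambda>i. pp 1 (y i)) 0) (sl k x (\<lambda>i. pp 1 (y i)) 0) = 0"
    and "n \<in> {1..N-1} \<Longrightarrow> a (\<lambda>v. sl k x (\<lambda>i. pp (Suc n) (y i)) (t n) v - sl k x (\<lambda>i. pp n (y i)) (t n) v)
         (\<lambda>v. sl k x (\<lambda>i. pp (Suc n) (y i)) (t n) v - sl k x (\<lambda>i. pp n (y i)) (t n) v) = 0"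
proof -
  have x: "\<And>i. i < k \<Longrightarrow> x i \<in> X" and y: "\<And>i. i < k \<Longrightarrow> y i \<in> Y" using z by (auto simp: tensor_rep_def)
  define p where "p = (\<lambda>n i. pp n (y i))"
  define dp where "dp = (\<lambda>n i. pderiv (pp n (y i)))"
  have symm: "m (x i) (x j) = m (x j) (x i)" "a (x i) (x j) = a (x j) (x i)" if "i < k" "j < k" for i j
    using psd_m psd_a x that by (auto simp: psd_on_def symmetric_on_def)
  \<comment> \<open>A polynomial in time whose value is the \<open>m\<close>-energy of the time
    derivative of the slice. Being nonnegative with zero integral it is the zero polynomial, so the
    first conclusion holds for every real \<open>s\<close>.\<close>
  define Q where "Q = (\<lambda>n. \<Sum>i<k. \<Sum>j<k. smult (m (x i) (x j)) (dp n i * dp n j))"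
  have Qs: "poly (Q n) s = m (sl k x (dp n) s) (sl k x (dp n) s)" for n s
    using gram_sum[OF lin_X bil_m x, where \<xi> = "\<lambda>i. poly (dp n i) s" and \<eta> = "\<lambda>i. poly (dp n i) s"]
    by (simp add: Q_def sl_def poly_sum)
  have nnm: "0 \<le> m v v" "0 \<le> a v v" if "v \<in> X" for v using psd_m psd_a that by (auto simp: psd_on_def)
  have slX: "sl k x q s \<in> X" for q s by (rule sl_X[OF x])
  have Qnn: "0 \<le> poly (Q n) s" for n s unfolding Qs by (intro nnm slX)
  have "AA z z = (\<Sum>i<k. \<Sum>j<k. m (x i) (x j) * tm \<nu> (y i) (y j) + a (x i) (x j) * ta (y i) (y j))"
    unfolding AA_rep[OF z z] using y by (intro sum.cong refl) (simp add: A_prod_eq)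
  \<comment> \<open>Interchanging the summations and using the symmetry of \<open>m\<close> and
    \<open>a\<close> transposes the time forms, so doubling the energy symmetrizes them.\<close>
  moreover have "\<dots> = (\<Sum>j<k. \<Sum>i<k. m (x i) (x j) * tm \<nu> (y i) (y j) + a (x i) (x j) * ta (y i) (y j))"
    by (rule sum.swap)
  moreover have "\<dots> = (\<Sum>i<k. \<Sum>j<k. m (x i) (x j) * tm \<nu> (y j) (y i) + a (x i) (x j) * ta (y j) (y i))"
    using symm by (intro sum.cong refl) auto
  ultimately have "2 * AA z z = (\<Sum>i<k. \<Sum>j<k. m (x i) (x j) * (tm \<nu> (y i) (y j) + tm \<nu> (y j) (y i))
       + a (x i) (x j) * (ta (y i) (y j) + ta (y j) (y i)))"
    by (simp add: distrib_left sum.distrib)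
  also have "\<dots> = (\<Sum>i<k. \<Sum>j<k. m (x i) (x j) * kb (\<lambda>n. dp n i) (\<lambda>n. dp n j)
       + 2 * \<nu> * (\<Sum>n=1..N. m (x i) (x j) * PI n (dp n i * dp n j)) + a (x i) (x j) * kb (\<lambda>n. p n i) (\<lambda>n. p n j))"
    unfolding tm_def ta_def ka_sym km_sym p_def dp_def by (simp add: distrib_left sum_distrib_left mult_ac)
  also have "\<dots> = (\<Sum>i<k. \<Sum>j<k. m (x i) (x j) * kb (\<lambda>n. dp n i) (\<lambda>n. dp n j))
       + 2 * \<nu> * (\<Sum>i<k. \<Sum>j<k. \<Sum>n=1..N. m (x i) (x j) * PI n (dp n i * dp n j))
       + (\<Sum>i<k. \<Sum>j<k. a (x i) (x j) * kb (\<lambda>n. p n i) (\<lambda>n. p n j))"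
    by (simp only: sum.distrib sum_distrib_left)
  also have "(\<Sum>i<k. \<Sum>j<k. \<Sum>n=1..N. m (x i) (x j) * PI n (dp n i * dp n j)) = (\<Sum>n=1..N. PI n (Q n))"
    unfolding Q_def PI_sum PI_smult by (subst sum.swap[of _ "{1..N}"]) (rule sum.swap)
  finally have E: "0 = (\<Sum>i<k. \<Sum>j<k. m (x i) (x j) * kb (\<lambda>n. dp n i) (\<lambda>n. dp n j))
       + 2 * \<nu> * (\<Sum>n=1..N. PI n (Q n)) + (\<Sum>i<k. \<Sum>j<k. a (x i) (x j) * kb (\<lambda>n. p n i) (\<lambda>n. p n j))"
    using A0 by simp
  have diffX: "(\<lambda>v. sl k x q s v - sl k x q' s v) \<in> X" for q q' s by (rule lin_space_diff[OF lin_X slX slX])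
  have 1: "0 \<le> (\<Sum>i<k. \<Sum>j<k. m (x i) (x j) * kb (\<lambda>n. dp n i) (\<lambda>n. dp n j))"
    by (simp only: kb_gram[OF psd_m x]) (intro add_nonneg_nonneg sum_nonneg nnm slX diffX)
  have 2: "0 \<le> (\<Sum>n=1..N. PI n (Q n))" by (intro sum_nonneg PI_nonneg Qnn)
  define J where "J = (\<lambda>n v. sl k x (p (Suc n)) (t n) v - sl k x (p n) (t n) v)"
  have JX: "J n \<in> X" for n unfolding J_def by (rule diffX)
  have 3: "(\<Sum>i<k. \<Sum>j<k. a (x i) (x j) * kb (\<lambda>n. p n i) (\<lambda>n. p n j)) =
      a (sl k x (p N) (t N)) (sl k x (p N) (t N)) + a (sl k x (p 1) 0) (sl k x (p 1) 0) + (\<Sum>n=1..N-1. a (J n) (J n))"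
    unfolding J_def by (rule kb_gram[OF psd_a x])
  have nn: "0 \<le> a (sl k x (p N) (t N)) (sl k x (p N) (t N))" "0 \<le> a (sl k x (p 1) 0) (sl k x (p 1) 0)"
    "0 \<le> (\<Sum>n=1..N-1. a (J n) (J n))"
    by (intro sum_nonneg nnm slX JX)+
  have "0 \<le> 2 * \<nu> * (\<Sum>n=1..N. PI n (Q n))" using 2 \<nu>_pos by simp
  with E 1 3 nn have z0: "2 * \<nu> * (\<Sum>n=1..N. PI n (Q n)) = 0" "a (sl k x (p 1) 0) (sl k x (p 1) 0) = 0"
    "(\<Sum>n=1..N-1. a (J n) (J n)) = 0" by linarith+
  then have Q0: "(\<Sum>n=1..N. PI n (Q n)) = 0" using \<nu>_pos by simp
  show "m (sl k x (\<lambda>i. pderiv (pp n (y i))) s) (sl k x (\<lambda>i. pderiv (pp n (y i))) s) = 0" if n: "n \<in> {1..N}"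
  proof -
    have "PI n (Q n) = 0" using Q0 n by (subst (asm) sum_nonneg_eq_0_iff) (auto intro: PI_nonneg Qnn)
    then have "Q n = 0" by (rule PI_zero[OF n Qnn])
    then show ?thesis using Qs[of n s] by (simp add: dp_def)
  qed
  show "a (sl k x (\<lambda>i. pp 1 (y i)) 0) (sl k x (\<lambda>i. pp 1 (y i)) 0) = 0" using z0(2) by (simp add: p_def)
  have "a (J n) (J n) = 0" if n: "n \<in> {1..N-1}" using z0(3) n by (subst (asm) sum_nonneg_eq_0_iff) (auto intro: nnm JX)
  then show "n \<in> {1..N-1} \<Longrightarrow> a (\<lambda>v. sl k x (\<lambda>i. pp (Suc n) (y i)) (t n) v - sl k x (\<lambda>i. pp n (y i)) (t n) v)
         (\<lambda>v. sl k x (\<lambda>i. pp (Suc n) (y i)) (t n) v - sl k x (\<lambda>i. pp n (y i)) (t n) v) = 0"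
    unfolding J_def p_def by blast
qed

text \<open>The null space in space-time, described slice by slice so that it can be reached from
  the forms on \<open>X\<close> at fixed times.\<close>

definition NZ :: "('b \<times> real \<Rightarrow> real) set" where
  "NZ = {z \<in> Z. \<forall>s\<in>{0<..T}. (\<lambda>v. z (v, s)) \<in> NX}"

lemma lin_NZ: "lin_space NZ"
  unfolding lin_space_def NZ_def
  using lin_space_0[OF lin_Z] lin_space_0[OF lin_NX] lin_space_comb[OF lin_Z] lin_space_comb[OF lin_NX] by simp

lemma a_sl:
  assumes x: "\<And>i. i < k \<Longrightarrow> x i \<in> X" and w: "w \<in> X"
  shows "a (sl k x p s) w = poly (\<Sum>i<k. smult (a (x i) w) (p i)) s"
  unfolding sl_def using linear_form_sum[OF lin_X bilinear_left[OF bil_a w], of "{..<k}" x "\<lambda>i. poly (p i) s"] x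
  by (simp add: poly_sum mult.commute)

text \<open>Slices are controlled only modulo \<open>NX\<close>, so they are tested with an
  arbitrary \<open>w\<close>. Then \<open>a (S n s) w\<close> is a scalar polynomial in
  \<open>s\<close> with zero derivative; it starts from 0 and is carried across the nodes by the
  vanishing jumps.\<close>

lemma isotropic_null_slices:
  assumes z: "z \<in> Z" and A0: "AA z z = 0" shows "z \<in> NZ"
proof -
  obtain k x y where rep: "tensor_rep X Y z k x y" using Z_rep[OF z] by blast
  have x: "\<And>i. i < k \<Longrightarrow> x i \<in> X" using rep by (auto simp: tensor_rep_def)
  define S where "S = (\<lambda>n. sl k x (\<lambda>i. pp n (y i)))"
  have SX: "S n s \<in> X" for n s unfolding S_def by (rule sl_X[OF x])
  have const: "a (S n s) w = a (S n s') w" if n: "n \<in> {1..N}" and w: "w \<in> X" for n s s' w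
  proof -
    let ?q = "\<Sum>i<k. smult (a (x i) w) (pp n (y i))"
    have "poly (pderiv ?q) u = 0" for u
    proof -
      let ?d = "sl k x (\<lambda>i. pderiv (pp n (y i))) u"
      have dX: "?d \<in> X" by (rule sl_X[OF x])
      \<comment> \<open>Damping gives isotropy of the time derivative for \<open>m\<close>; both
        forms have the same isotropic vectors, so it transfers to \<open>a\<close>.\<close>
      have "a ?d ?d = 0" using energy(1)[OF rep A0 n, of u] m_null[OF dX] a_null[OF dX] by simp
      from a_null_left[OF dX w this] have "a ?d w = 0" .
      moreover have "pderiv ?q = (\<Sum>i<k. smult (a (x i) w) (pderiv (pp n (y i))))"
        using pderiv_sum[where f = "\<lambda>i. smult (a (x i) w) (pp n (y i))" and I = "{..<k}"] by (simp add: pderiv_smult)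
      ultimately show ?thesis using a_sl[OF x w, where p = "\<lambda>i. pderiv (pp n (y i))" and s = u] by simp
    qed
    then have "pderiv ?q = 0" by (simp add: poly_all_0_iff_0[symmetric])
    then have "degree ?q = 0" by (simp add: pderiv_eq_0_iff)
    then obtain c where "?q = [:c:]" by (rule degree_eq_zeroE)
    then have "a (S n s) w = c" for s unfolding S_def using a_sl[OF x w, where p = "\<lambda>i. pp n (y i)" and s = s] by simp
    then show ?thesis by simp
  qed
  have null: "a (S n s) w = 0" if "n \<in> {1..N}" "w \<in> X" for n s w
    using that
  proof (induction n arbitrary: s)
    case (Suc n)
    show ?case
    proof (cases "n = 0")
      case True
      have "a (S 1 0) w = 0"
        by (rule a_null_left[OF SX Suc.prems(2)]) (use energy(2)[OF rep A0] in \<open>simp add: S_def\<close>)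
      then show ?thesis using const[of 1 w s 0] True Suc.prems by simp
    next
      case False
      then have n: "n \<in> {1..N-1}" "n \<in> {1..N}" using Suc.prems by auto
      let ?J = "\<lambda>v. S (Suc n) (t n) v - S n (t n) v"
      have JX: "?J \<in> X" by (rule lin_space_diff[OF lin_X SX SX])
      have "a ?J ?J = 0" using energy(3)[OF rep A0 n(1)] by (simp add: S_def)
      from a_null_left[OF JX Suc.prems(2) this]
      have "a (S (Suc n) (t n)) w = a (S n (t n)) w"
        using linear_form_diff[OF bilinear_left[OF bil_a Suc.prems(2)] SX SX] by simp
      also have "\<dots> = 0" using Suc.IH[OF n(2) Suc.prems(2)] .
      finally show ?thesis using const[OF Suc.prems, of s "t n"] by simp
    qed
  qed simp
  have "(\<lambda>v. z (v, s)) \<in> NX" if s: "s \<in> {0<..T}" for s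
  proof -
    obtain n where n: "n \<in> {1..N}" "s \<in> slab t n" using slab_cover[OF s] by blast
    have "(\<lambda>v. z (v, s)) = S n s" unfolding S_def by (rule slice_eq[OF rep n])
    moreover have "S n s \<in> NX" using a_null[OF SX] null[OF n(1) SX] by blast
    ultimately show ?thesis by simp
  qed
  then show ?thesis using z by (simp add: NZ_def)
qed

text \<open>Null slices of degree \<open>r n\<close> are detected at \<open>r n + 1\<close> nodes of each slab.\<close>

lemma fin_dim_Z: "fin_dim_mod Z NZ"
proof -
  \<comment> \<open>These nodes avoid the left end and include the right end, as the half-open slab
    does.\<close>
  define node where "node = (\<lambda>n l. t (n - 1) + (t n - t (n - 1)) * (real (Suc l) / real (Suc (r n))))"
  have node: "node n l \<in> slab t n" if n: "n \<in> {1..N}" and l: "l \<le> r n" for n l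
  proof -
    have d: "t n - t (n - 1) > 0" using slab_less[OF n] by simp
    have q: "0 < real (Suc l) / real (Suc (r n))" "real (Suc l) / real (Suc (r n)) \<le> 1" using l by (auto simp: field_simps)
    have "(t n - t (n - 1)) * (real (Suc l) / real (Suc (r n))) \<le> (t n - t (n - 1)) * 1"
      using d q by (intro mult_left_mono) auto
    moreover have "0 < (t n - t (n - 1)) * (real (Suc l) / real (Suc (r n)))" using d q by (intro mult_pos_pos)
    ultimately show ?thesis unfolding node_def slab_def by auto
  qed
  have inj: "inj_on (node n) {..r n}" if n: "n \<in> {1..N}" for n
    using slab_less[OF n] by (auto simp: inj_on_def node_def)
  define P where "P = (\<Union>n\<in>{1..N}. node n ` {..r n})"
  obtain d where d: "\<And>v (M::nat). (\<forall>j<M. v j \<in> X) \<Longrightarrow> kill d (\<lambda>c. (\<lambda>x. \<Sum>j<M. c j * v j x) \<in> NX)"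
    using fd_X unfolding fin_dim_mod_def by blast
  have slX: "(\<lambda>v. z (v, s)) \<in> X" if "z \<in> Z" for z s
  proof -
    obtain k x y where "tensor_rep X Y z k x y" using Z_rep[OF \<open>z \<in> Z\<close>] by blast
    then have "\<And>i. i \<in> {..<k} \<Longrightarrow> x i \<in> X" and eq: "(\<lambda>v. z (v, s)) = (\<lambda>v. \<Sum>i<k. y i s * x i v)"
      by (auto simp: tensor_rep_def mult.commute)
    from lin_space_sum[OF lin_X this(1)] show ?thesis unfolding eq .
  qed
  have det: "z \<in> NZ" if z: "z \<in> Z" and h: "\<forall>s\<in>P. (\<lambda>v. z (v, s)) \<in> NX" for z
  proof -
    obtain k x y where rep: "tensor_rep X Y z k x y" using Z_rep[OF z] by blast
    have x: "\<And>i. i < k \<Longrightarrow> x i \<in> X" and y: "\<And>i. i < k \<Longrightarrow> y i \<in> Y" using rep by (auto simp: tensor_rep_def)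
    have "(\<lambda>v. z (v, s)) \<in> NX" if s: "s \<in> {0<..T}" for s
    proof -
      obtain n where n: "n \<in> {1..N}" "s \<in> slab t n" using slab_cover[OF s] by blast
      let ?S = "sl k x (\<lambda>i. pp n (y i))"
      have SX: "?S u \<in> X" for u by (rule sl_X[OF x])
      have "a (?S s) w = 0" if w: "w \<in> X" for w
      proof -
        define q where "q = (\<Sum>i<k. smult (a (x i) w) (pp n (y i)))"
        have deg: "degree q \<le> r n" unfolding q_def
          using pp_props(1)[OF y n(1)] by (intro degree_sum_le) (auto intro: order_trans[OF degree_smult_le])
        have z: "poly q (node n l) = 0" if l: "l \<le> r n" for l
        proof -
          have "(\<lambda>v. z (v, node n l)) \<in> NX" using h n(1) l by (auto simp: P_def)
          then have "?S (node n l) \<in> NX" unfolding slice_eq[OF rep n(1) node[OF n(1) l]] .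
          then have "a (?S (node n l)) (?S (node n l)) = 0" using a_null[OF SX] by simp
          from a_null_left[OF SX w this] show ?thesis by (simp only: a_sl[OF x w] q_def)
        qed
        have "q = 0"
        proof (rule ccontr)
          assume q: "q \<noteq> 0"
          have "card (node n ` {..r n}) \<le> card {u. poly q u = 0}"
            using z by (intro card_mono poly_roots_finite q) auto
          also have "\<dots> \<le> r n" using card_poly_roots_bound[OF q] deg by simp
          finally show False using inj[OF n(1)] by (simp add: card_image)
        qed
        then show ?thesis using a_sl[OF x w, where p = "\<lambda>i. pp n (y i)" and s = s] q_def by simp
      qed
      then have "?S s \<in> NX" using a_null[OF SX] SX by blast
      then show ?thesis unfolding slice_eq[OF rep n] .
    qed
    then show ?thesis using z by (simp add: NZ_def)
  qed
  show ?thesis unfolding fin_dim_mod_def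
  proof (intro exI allI impI)
    fix v and M :: nat assume v: "\<forall>j<M. v j \<in> Z"
    have "kill (\<Prod>s\<in>P. d) (\<lambda>c. \<forall>s\<in>P. (\<lambda>x. \<Sum>j<M. c j * (\<lambda>x. v j (x, s)) x) \<in> NX)"
    proof (rule kill_ball)
      show "finite P" by (simp add: P_def)
      show "kill d (\<lambda>c. (\<lambda>x. \<Sum>j<M. c j * (\<lambda>x. v j (x, s)) x) \<in> NX)" for s by (rule d) (use v slX in blast)
      show "comb_closed (\<lambda>c. (\<lambda>x. \<Sum>j<M. c j * (\<lambda>x. v j (x, s)) x) \<in> NX)" for s by (rule comb_closed_in[OF lin_NX])
    qed
    then show "kill (\<Prod>s\<in>P. d) (\<lambda>c. (\<lambda>x. \<Sum>j<M. c j * v j x) \<in> NZ)"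
      by (rule kill_mono) (intro det lin_space_sum[OF lin_Z]; use v in auto)
  qed
qed

text \<open>The space factors are expanded in a basis modulo \<open>NX\<close>, with null remainders
  \<open>e i\<close>. Null slices then force the time coefficient of each basis vector to vanish at
  every time. Only finitely many null functions occur, whereas a slicewise argument would produce
  one for each time.\<close>

lemma null_slices_decomp:
  assumes rep: "tensor_rep X Y z k x y" and z: "z \<in> NZ"
  shows "\<exists>(p::nat) b \<xi> e. (\<forall>l<p. b l \<in> X) \<and> (\<forall>i<k. e i \<in> X \<and> e i \<in> NX \<and> x i = (\<lambda>v. e i v + (\<Sum>l<p. \<xi> i l * b l v)))
     \<and> (\<forall>l<p. \<forall>s\<in>{0<..T}. (\<Sum>i<k. \<xi> i l * y i s) = 0)"
proof -
  have x: "\<And>i. i < k \<Longrightarrow> x i \<in> X" and y: "\<And>i. i < k \<Longrightarrow> y i \<in> Y" using rep by (auto simp: tensor_rep_def)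
  obtain p :: nat and b where b: "\<forall>l<p. b l \<in> X" "\<forall>w\<in>X. \<exists>c. (\<lambda>v. w v - (\<Sum>l<p. c l * b l v)) \<in> NX"
    "\<forall>c. (\<lambda>v. \<Sum>l<p. c l * b l v) \<in> NX \<longrightarrow> (\<forall>l<p. c l = 0)"
    using fin_dim_mod_basis[OF lin_NX fd_X lin_X] by blast
  define \<xi> where "\<xi> = (\<lambda>i. SOME c. (\<lambda>v. x i v - (\<Sum>l<p. c l * b l v)) \<in> NX)"
  define e where "e = (\<lambda>i v. x i v - (\<Sum>l<p. \<xi> i l * b l v))"
  have eN: "e i \<in> NX" if "i < k" for i
  proof -
    have "\<exists>c. (\<lambda>v. x i v - (\<Sum>l<p. c l * b l v)) \<in> NX" using b(2) x[OF that] by blast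
    then show ?thesis unfolding e_def \<xi>_def by (rule someI_ex)
  qed
  have eX: "e i \<in> X" if "i < k" for i
    unfolding e_def by (intro lin_space_diff[OF lin_X x[OF that] lin_space_sum[OF lin_X]]) (use b in auto)
  have "(\<Sum>i<k. \<xi> i l * y i s) = 0" if l: "l < p" and s: "s \<in> {0<..T}" for l s
  proof -
    have "(\<lambda>v. z (v, s)) \<in> NX" using z s by (simp add: NZ_def)
    moreover have "(\<lambda>v. \<Sum>i<k. y i s * e i v) \<in> NX" by (rule lin_space_sum[OF lin_NX]) (use eN in auto)
    ultimately have "(\<lambda>v. z (v, s) - (\<Sum>i<k. y i s * e i v)) \<in> NX" by (rule lin_space_diff[OF lin_NX])
    moreover have "z (v, s) - (\<Sum>i<k. y i s * e i v) = (\<Sum>l<p. (\<Sum>i<k. \<xi> i l * y i s) * b l v)" for v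
    proof -
      have "z (v, s) - (\<Sum>i<k. y i s * e i v) = (\<Sum>i<k. y i s * (\<Sum>l<p. \<xi> i l * b l v))"
        using rep by (simp add: tensor_rep_def e_def sum_subtractf[symmetric] algebra_simps)
      also have "\<dots> = (\<Sum>l<p. (\<Sum>i<k. \<xi> i l * y i s) * b l v)"
        unfolding sum_distrib_left sum_distrib_right by (subst sum.swap) (simp add: mult_ac)
      finally show ?thesis .
    qed
    ultimately have "(\<lambda>v. \<Sum>l<p. (\<Sum>i<k. \<xi> i l * y i s) * b l v) \<in> NX" by simp
    from mp[OF spec[OF b(3), of "\<lambda>l. \<Sum>i<k. \<xi> i l * y i s"] this] l show ?thesis by simp
  qed
  then show ?thesis using b(1) eN eX
    by (intro exI[of _ p] exI[of _ b] exI[of _ \<xi>] exI[of _ e]) (auto simp: e_def)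
qed

text \<open>After the decomposition each contribution has either a null space factor or a time
  factor vanishing on the slabs, and the two assumptions on \<open>L\<close> dispose of
  them.\<close>

lemma null_slices_form:
  assumes L: "bilinear_map_on X Y L" and z: "z \<in> NZ" and rep: "tensor_rep X Y z k x y"
    and L1: "\<And>x y. x \<in> X \<Longrightarrow> x \<in> NX \<Longrightarrow> y \<in> Y \<Longrightarrow> L x y = 0"
    and L2: "\<And>x y. x \<in> X \<Longrightarrow> y \<in> Y \<Longrightarrow> (\<forall>s\<in>{0<..T}. y s = 0) \<Longrightarrow> L x y = 0"
  shows "(\<Sum>i<k. L (x i) (y i)) = 0"
proof -
  have y: "\<And>i. i < k \<Longrightarrow> y i \<in> Y" using rep by (auto simp: tensor_rep_def)
  have lx: "\<And>y. y \<in> Y \<Longrightarrow> linear_form_on X (\<lambda>x. L x y)" and ly: "\<And>x. x \<in> X \<Longrightarrow> linear_form_on Y (L x)"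
    using L by (auto simp: bilinear_map_on_def)
  obtain p :: nat and b \<xi> e where b: "\<And>l. l < p \<Longrightarrow> b l \<in> X"
    and e: "\<And>i. i < k \<Longrightarrow> e i \<in> X \<and> e i \<in> NX \<and> x i = (\<lambda>v. e i v + (\<Sum>l<p. \<xi> i l * b l v))"
    and \<xi>: "\<And>l s. l < p \<Longrightarrow> s \<in> {0<..T} \<Longrightarrow> (\<Sum>i<k. \<xi> i l * y i s) = 0"
    using null_slices_decomp[OF rep z] by blast
  have "L (x i) (y i) = (\<Sum>l<p. \<xi> i l * L (b l) (y i))" if i: "i < k" for i
  proof -
    have ei: "e i \<in> X" "e i \<in> NX" and xi: "x i = (\<lambda>v. e i v + (\<Sum>l<p. \<xi> i l * b l v))" using e[OF i] by auto
    have s: "(\<lambda>v. \<Sum>l<p. \<xi> i l * b l v) \<in> X" by (rule lin_space_sum[OF lin_X]) (use b in auto)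
    have "L (x i) (y i) = L (e i) (y i) + L (\<lambda>v. \<Sum>l<p. \<xi> i l * b l v) (y i)"
      unfolding xi by (rule linear_form_add[OF lx[OF y[OF i]] ei(1) s])
    also have "L (e i) (y i) = 0" by (rule L1[OF ei y[OF i]])
    also have "L (\<lambda>v. \<Sum>l<p. \<xi> i l * b l v) (y i) = (\<Sum>l<p. \<xi> i l * L (b l) (y i))"
      by (rule linear_form_sum[OF lin_X lx[OF y[OF i]]]) (use b in auto)
    finally show ?thesis by simp
  qed
  then have "(\<Sum>i<k. L (x i) (y i)) = (\<Sum>i<k. \<Sum>l<p. \<xi> i l * L (b l) (y i))" by simp
  also have "\<dots> = (\<Sum>l<p. \<Sum>i<k. \<xi> i l * L (b l) (y i))" by (rule sum.swap)
  also have "\<dots> = (\<Sum>l<p. L (b l) (\<lambda>s. \<Sum>i<k. \<xi> i l * y i s))"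
  proof (rule sum.cong[OF refl])
    fix l assume "l \<in> {..<p}"
    then have "b l \<in> X" using b by auto
    from linear_form_sum[OF lin_space_Y ly[OF this], of "{..<k}" y "\<lambda>i. \<xi> i l"] y
    show "(\<Sum>i<k. \<xi> i l * L (b l) (y i)) = L (b l) (\<lambda>s. \<Sum>i<k. \<xi> i l * y i s)" by simp
  qed
  also have "\<dots> = 0"
  proof (rule sum.neutral, rule ballI)
    fix l assume "l \<in> {..<p}"
    then have l: "l < p" by simp
    show "L (b l) (\<lambda>s. \<Sum>i<k. \<xi> i l * y i s) = 0"
      by (rule L2[OF b[OF l] lin_space_sum[OF lin_space_Y]]) (use y \<xi>[OF l] in auto)
  qed
  finally show ?thesis .
qed

text \<open>Together with \<open>isotropic_null_slices\<close> this supplies the right radical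
  property that the Galerkin lemma asks for.\<close>

lemma AA_null_right:
  assumes "u \<in> Z" "e \<in> NZ" shows "AA u e = 0"
proof -
  have eZ: "e \<in> Z" using assms(2) by (simp add: NZ_def)
  obtain k x y where u: "tensor_rep X Y u k x y" using Z_rep[OF assms(1)] by blast
  obtain k' x' y' where e: "tensor_rep X Y e k' x' y'" using Z_rep[OF eZ] by blast
  have xy: "x i \<in> X" "y i \<in> Y" if "i < k" for i using u that by (auto simp: tensor_rep_def)
  have "(\<Sum>j<k'. A_prod m a \<nu> N t (x i) (y i) (x' j) (y' j)) = 0" if i: "i < k" for i
  proof (rule null_slices_form[OF A_prod_right[OF xy[OF i]] assms(2) e])
    fix w1 w2 assume w: "w1 \<in> X" "w2 \<in> Y"
    show "A_prod m a \<nu> N t (x i) (y i) w1 w2 = 0" if "w1 \<in> NX"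
    proof -
      have "m w1 w1 = 0" "a w1 w1 = 0" using m_null[OF w(1)] a_null[OF w(1)] that by auto
      then have "m (x i) w1 = 0" "a (x i) w1 = 0"
        using m_null_right[OF w(1) xy(1)[OF i]] a_null_right[OF w(1) xy(1)[OF i]] by auto
      then show ?thesis by (simp add: A_prod_eq[OF xy(2)[OF i] w(2)])
    qed
    show "A_prod m a \<nu> N t (x i) (y i) w1 w2 = 0" if "\<forall>s\<in>{0<..T}. w2 s = 0"
      using time_forms_zero[OF w(2)] that by (simp add: A_prod_eq[OF xy(2)[OF i] w(2)])
  qed
  then show ?thesis unfolding AA_rep[OF u e] by simp
qed

text \<open>Stated for any load that ignores null space factors and time factors vanishing on the
  slabs. This is the compatibility that a degenerate form demands of its right-hand side.\<close>

theorem dg_problem: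
  assumes F: "bilinear_map_on X Y F"
    and F1: "\<And>x y. x \<in> X \<Longrightarrow> x \<in> NX \<Longrightarrow> y \<in> Y \<Longrightarrow> F x y = 0"
    and F2: "\<And>x y. x \<in> X \<Longrightarrow> y \<in> Y \<Longrightarrow> (\<forall>s\<in>{0<..T}. y s = 0) \<Longrightarrow> F x y = 0"
  shows "\<exists>u\<in>Z. (\<forall>w\<in>Z. AA u w = linear_ext X Y F w) \<and>
     (\<forall>u'\<in>Z. (\<forall>w\<in>Z. AA u' w = linear_ext X Y F w) \<longrightarrow> (\<lambda>p. u' p - u p) \<in> NZ)"
proof -
  let ?F = "linear_ext X Y F"
  have Flin: "linear_form_on Z ?F" by (rule linear_ext_rep(1)[OF lin_X lin_space_Y F])
  have F0: "?F e = 0" if "e \<in> Z" "AA e e = 0" for e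
  proof -
    obtain k x y where e: "tensor_rep X Y e k x y" using Z_rep[OF \<open>e \<in> Z\<close>] by blast
    show ?thesis unfolding linear_ext_rep(2)[OF lin_X lin_space_Y F e]
      by (rule null_slices_form[OF F isotropic_null_slices[OF that] e F1 F2])
  qed
  obtain n :: nat and b where b: "\<forall>i<n. b i \<in> Z" "\<forall>w\<in>Z. \<exists>c. (\<lambda>x. w x - (\<Sum>i<n. c i * b i x)) \<in> NZ"
    using fin_dim_mod_basis[OF lin_NZ fin_dim_Z lin_Z] by blast
  have "\<exists>u\<in>Z. \<forall>w\<in>Z. AA u w = ?F w"
  proof (rule galerkin[where v = b and n = n, OF lin_Z AA_bilinear])
    show "AA u e = 0" if "e \<in> Z" "u \<in> Z" "AA e e = 0" for e u
      by (rule AA_null_right[OF that(2) isotropic_null_slices[OF that(1,3)]])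
    show "\<exists>c. AA (\<lambda>x. w x - (\<Sum>i<n. c i * b i x)) (\<lambda>x. w x - (\<Sum>i<n. c i * b i x)) = 0" if w: "w \<in> Z" for w
    proof -
      obtain c where c: "(\<lambda>x. w x - (\<Sum>i<n. c i * b i x)) \<in> NZ" using b(2) w by blast
      then have "(\<lambda>x. w x - (\<Sum>i<n. c i * b i x)) \<in> Z" by (simp add: NZ_def)
      from AA_null_right[OF this c] show ?thesis by (rule exI[of _ c])
    qed
  qed (use b(1) Flin F0 in auto)
  then obtain u where u: "u \<in> Z" "\<And>w. w \<in> Z \<Longrightarrow> AA u w = ?F w" by blast
  have "(\<lambda>p. u' p - u p) \<in> NZ" if u': "u' \<in> Z" "\<forall>w\<in>Z. AA u' w = ?F w" for u'
  proof -
    let ?e = "\<lambda>p. u' p - u p"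
    have e: "?e \<in> Z" by (rule lin_space_diff[OF lin_Z u'(1) u(1)])
    have "AA ?e ?e = AA u' ?e - AA u ?e" by (rule linear_form_diff[OF bilinear_left[OF AA_bilinear e] u'(1) u(1)])
    also have "\<dots> = 0" using u'(2) u(2) e by simp
    finally show ?thesis by (rule isotropic_null_slices[OF e])
  qed
  then show ?thesis using u by blast
qed

end

section \<open>The source term\<close>

text \<open>Lebesgue measure on the product space completes the product of the Borel measures, so
  the null set is enlarged to a Borel one before taking a cylinder.\<close>

lemma AE_lebesgue_fst:
  assumes "AE x in lebesgue. P x"
  shows "AE z in (lebesgue :: ('a::euclidean_space \<times> real) measure). P (fst z)"
proof -
  obtain B where B: "B \<in> null_sets lborel" "{x. \<not> P x} \<subseteq> B"
    using assms unfolding AE_completion_iff by (auto simp: eventually_ae_filter)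
  have "B \<times> UNIV \<in> null_sets (lborel \<Otimes>\<^sub>M (lborel :: real measure))"
    by (rule lborel.times_in_null_sets1[OF B(1)]) simp
  then have "AE z in (lborel :: ('a \<times> real) measure). P (fst z)"
    using B(2) unfolding lborel_prod by (intro AE_I'[of "B \<times> UNIV"]) auto
  then show ?thesis by (simp only: AE_completion_iff)
qed

lemma AE_lebesgue_snd:
  assumes "AE s in lebesgue. P s"
  shows "AE z in (lebesgue :: ('a::euclidean_space \<times> real) measure). P (snd z)"
proof -
  obtain B where B: "B \<in> null_sets lborel" "{x. \<not> P x} \<subseteq> B"
    using assms unfolding AE_completion_iff by (auto simp: eventually_ae_filter)
  have "UNIV \<times> B \<in> null_sets ((lborel :: 'a measure) \<Otimes>\<^sub>M lborel)"
    by (rule lborel.times_in_null_sets2[OF _ B(1)]) simp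
  then have "AE z in (lborel :: ('a \<times> real) measure). P (snd z)"
    using B(2) unfolding lborel_prod by (intro AE_I'[of "UNIV \<times> B"]) auto
  then show ?thesis by (simp only: AE_completion_iff)
qed

text \<open>Fubini for null sets, again after passing to a Borel superset.\<close>

lemma AE_lebesgue_slices:
  assumes "AE z in (lebesgue :: ('a::euclidean_space \<times> real) measure). P z"
  shows "AE s in lborel. AE x in lborel. P (x, s)"
proof -
  obtain B where B: "B \<in> null_sets (lborel :: ('a \<times> real) measure)" "{z. \<not> P z} \<subseteq> B"
    using assms unfolding AE_completion_iff by (auto simp: eventually_ae_filter)
  have B': "B \<in> null_sets (lborel \<Otimes>\<^sub>M lborel)" using B(1) unfolding lborel_prod .
  then have ae: "AE z in lborel \<Otimes>\<^sub>M lborel. z \<notin> B" by (rule AE_not_in)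
  have "{z \<in> space (lborel \<Otimes>\<^sub>M lborel). (fst z, snd z) \<notin> B} = space (lborel \<Otimes>\<^sub>M lborel) - B" by auto
  also have "\<dots> \<in> sets (lborel \<Otimes>\<^sub>M lborel)" using B' by (intro sets.Diff sets.top) auto
  finally have "(AE x in lborel. AE s in lborel. (x, s) \<notin> B) \<longleftrightarrow> (AE s in lborel. AE x in lborel. (x, s) \<notin> B)"
    by (rule lborel_pair.AE_commute)
  with lborel_pair.AE_pair[OF ae] have *: "AE s in lborel. AE x in lborel. (x, s) \<notin> B" by simp
  show ?thesis
  proof (rule AE_mp[OF * AE_I2], rule impI)
    fix s assume "AE x in lborel. (x, s) \<notin> B"
    then show "AE x in lborel. P (x, s)" by (rule AE_mp) (use B(2) in auto)
  qed
qed

lemma integrable_lebesgue_borel_version: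
  fixes f :: "'a::euclidean_space \<Rightarrow> real"
  assumes "integrable lebesgue f"
  shows "\<exists>f'. integrable lborel f' \<and> (AE x in lebesgue. f x = f' x)"
proof -
  obtain f' where f': "f' \<in> borel_measurable lborel" "AE x in lborel. f x = f' x"
    using completion_ex_borel_measurable_real[of f lborel] assms by auto
  then have ae: "AE x in lebesgue. f x = f' x" by (simp only: AE_completion_iff)
  have "integrable lebesgue f'"
    by (rule integrable_cong_AE_imp[OF assms]) (use f' ae in \<open>auto simp: measurable_completion elim: AE_mp\<close>)
  then show ?thesis using f' ae by (auto simp: integrable_completion)
qed

text \<open>Fubini works with product measurable functions, so both factors are replaced by Borel
  representatives.\<close>

lemma integrable_lebesgue_times:
  fixes f :: "'a::euclidean_space \<Rightarrow> real" and g :: "real \<Rightarrow> real"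
  assumes "integrable lebesgue f" "integrable lebesgue g"
  shows "integrable lebesgue (\<lambda>z. f (fst z) * g (snd z))"
proof -
  obtain f' where f': "integrable lborel f'" "AE x in lebesgue. f x = f' x"
    using integrable_lebesgue_borel_version[OF assms(1)] by blast
  obtain g' where g': "integrable lborel g'" "AE x in lebesgue. g x = g' x"
    using integrable_lebesgue_borel_version[OF assms(2)] by blast
  have [measurable]: "f' \<in> borel_measurable borel" "g' \<in> borel_measurable borel"
    using borel_measurable_integrable[OF f'(1)] borel_measurable_integrable[OF g'(1)] by simp_all
  have "integrable (lborel \<Otimes>\<^sub>M lborel) (\<lambda>z. f' (fst z) * g' (snd z))"
  proof (rule lborel_pair.Fubini_integrable)
    have "integrable lborel (\<lambda>x. \<bar>f' x\<bar> * (LBINT y. \<bar>g' y\<bar>))"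
      using f'(1) by (intro integrable_mult_left) simp
    then show "integrable lborel (\<lambda>x. LBINT y. norm (f' (fst (x, y)) * g' (snd (x, y))))"
      by (simp add: abs_mult)
    show "AE x in lborel. integrable lborel (\<lambda>y. f' (fst (x, y)) * g' (snd (x, y)))"
      using g'(1) by simp
  qed measurable
  then have i: "integrable lborel (\<lambda>z. f' (fst z) * g' (snd z))" unfolding lborel_prod .
  then have i': "integrable lebesgue (\<lambda>z. f' (fst z) * g' (snd z))"
    by (subst integrable_completion) (auto dest: borel_measurable_integrable)
  have ae: "AE z in lebesgue. f' (fst z) * g' (snd z) = f (fst z) * g (snd z)"
    using AE_lebesgue_fst[OF f'(2)] AE_lebesgue_snd[OF g'(2)] by eventually_elim simp
  show ?thesis
    by (rule integrable_cong_AE_imp[OF i'])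
      (use ae borel_measurable_AE[OF borel_measurable_integrable[OF i'] ae] in \<open>auto elim: AE_mp\<close>)
qed

context
  fixes \<Omega> :: "'a::euclidean_space set" and T :: real and f :: "'a \<times> real \<Rightarrow> real"
  assumes \<Omega>: "open \<Omega>" "bounded \<Omega>" and f: "f \<in> L2 (\<Omega> \<times> {0<..<T})"
begin

text \<open>Fubini is applied to this representative; the last property says that almost all of its
  time slices agree with those of \<open>f\<close> up to null sets.\<close>

lemma borel_version:
  obtains g where "g \<in> borel_measurable borel" "integrable lborel (\<lambda>z. (g z)\<^sup>2)"
    "AE s in lborel. AE x in lborel. indicator (\<Omega> \<times> {0<..<T}) (x, s) * f (x, s) = g (x, s)"
proof -
  let ?E = "\<Omega> \<times> {0<..<T}"
  obtain g where g: "g \<in> borel_measurable lborel" "AE z in lborel. indicator ?E z * f z = g z"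
    using completion_ex_borel_measurable_real[OF L2_measurable[OF f]] by blast
  then have ae: "AE z in lebesgue. indicator ?E z * f z = g z" by (simp only: AE_completion_iff)
  have gb: "g \<in> borel_measurable borel" using g(1) by simp
  have "integrable lebesgue (\<lambda>z. (g z)\<^sup>2)"
  proof (rule integrable_cong_AE_imp)
    show "integrable lebesgue (\<lambda>z. indicator ?E z * (f z)\<^sup>2)" using f by (simp add: L2_iff)
    have "g \<in> borel_measurable lebesgue" by (rule measurable_completion[OF g(1)])
    then show "(\<lambda>z. (g z)\<^sup>2) \<in> borel_measurable lebesgue" by measurable
    show "AE z in lebesgue. indicator ?E z * (f z)\<^sup>2 = (g z)\<^sup>2"
      using ae
    proof eventually_elim
      case (elim z)
      show ?case unfolding elim[symmetric] by (simp add: indicator_def)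
    qed
  qed
  moreover have "(\<lambda>z. (g z)\<^sup>2) \<in> borel_measurable lborel" using g(1) by measurable
  ultimately have "integrable lborel (\<lambda>z. (g z)\<^sup>2)" by (simp only: integrable_completion)
  then show ?thesis by (rule that[OF gb _ AE_lebesgue_slices[OF ae]])
qed

lemma slices_L2: "AE s in lebesgue. s \<in> {0<..<T} \<longrightarrow> (\<lambda>y. f (y, s)) \<in> L2 \<Omega>"
proof -
  obtain g where [measurable]: "g \<in> borel_measurable borel" and g2: "integrable lborel (\<lambda>z. (g z)\<^sup>2)"
    and ae: "AE s in lborel. AE x in lborel. indicator (\<Omega> \<times> {0<..<T}) (x, s) * f (x, s) = g (x, s)"
    using borel_version .
  have "integrable (lborel \<Otimes>\<^sub>M lborel) (\<lambda>(x, s). (g (x, s))\<^sup>2)"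
    using g2 by (simp add: lborel_prod split_def)
  from lborel_pair.AE_integrable_snd[OF this] have i: "AE s in lborel. integrable lborel (\<lambda>x. (g (x, s))\<^sup>2)" .
  have "AE s in lborel. s \<in> {0<..<T} \<longrightarrow> (\<lambda>y. f (y, s)) \<in> L2 \<Omega>"
    using ae i
  proof eventually_elim
    case (elim s)
    show ?case
    proof
      assume s: "s \<in> {0<..<T}"
      have e: "AE x in lborel. g (x, s) = indicator \<Omega> x * f (x, s)"
        using elim(1) by (rule AE_mp) (use s in \<open>auto simp: indicator_def\<close>)
      then have e': "AE x in lebesgue. g (x, s) = indicator \<Omega> x * f (x, s)" by (simp only: AE_completion_iff)
      have gs: "(\<lambda>x. g (x, s)) \<in> borel_measurable lebesgue" by (rule measurable_completion) measurable
      have m1: "(\<lambda>x. indicator \<Omega> x * f (x, s)) \<in> borel_measurable lebesgue" by (rule borel_measurable_AE[OF gs e'])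
      then have "(\<lambda>x. (indicator \<Omega> x * f (x, s))\<^sup>2) \<in> borel_measurable lebesgue" by measurable
      then have m2: "(\<lambda>x. indicator \<Omega> x * (f (x, s))\<^sup>2) \<in> borel_measurable lebesgue"
        by (rule measurable_cong[THEN iffD1, rotated]) (simp add: indicator_def)
      have "integrable lebesgue (\<lambda>x. (g (x, s))\<^sup>2)"
        using elim(2) by (subst integrable_completion) measurable
      then have "integrable lebesgue (\<lambda>x. indicator \<Omega> x * (f (x, s))\<^sup>2)"
      proof (rule integrable_cong_AE_imp[OF _ m2])
        show "AE x in lebesgue. (g (x, s))\<^sup>2 = indicator \<Omega> x * (f (x, s))\<^sup>2"
          using e' by eventually_elim (simp add: indicator_def)
      qed
      then show "(\<lambda>y. f (y, s)) \<in> L2 \<Omega>" using m1 by (simp add: L2_iff)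
    qed
  qed
  then show ?thesis by (simp only: AE_completion_iff)
qed

text \<open>The product of the source and \<open>u\<close> is dominated by the sum of their squares,
  which is integrable over space-time; Fubini then gives integrability in time.\<close>

lemma slice_ip_integrable:
  assumes K: "open K" "K \<subseteq> \<Omega>" and u: "continuous_on UNIV u"
  shows "integrable lebesgue (\<lambda>s. indicator {0<..<T} s * ip K (\<lambda>y. f (y, s)) u)"
proof -
  obtain g where gm[measurable]: "g \<in> borel_measurable borel" and g2: "integrable lborel (\<lambda>z. (g z)\<^sup>2)"
    and ae: "AE s in lborel. AE x in lborel. indicator (\<Omega> \<times> {0<..<T}) (x, s) * f (x, s) = g (x, s)"
    using borel_version .
  have um[measurable]: "u \<in> borel_measurable borel" by (rule borel_measurable_continuous_onI[OF u])
  have Km[measurable]: "K \<in> sets borel" using K(1) by simp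
  define h where "h = (\<lambda>z. g z * (indicator K (fst z) * u (fst z) * indicator {0<..<T} (snd z)))"
  have hm[measurable]: "h \<in> borel_measurable borel"
    unfolding h_def borel_prod[symmetric] using gm unfolding borel_prod[symmetric] by measurable
  have KL: "K \<in> sets lebesgue" "bounded K" using K \<Omega>(2) bounded_subset by auto
  have "integrable lebesgue (\<lambda>x. indicator K x * (u x)\<^sup>2)" using L2_continuous[OF KL u] by (simp add: L2_iff)
  moreover have "integrable lebesgue (indicator {0<..<T} :: real \<Rightarrow> real)"
    using lmeasurable_iff_integrable by (metis lmeasurable_box box_real(1))
  ultimately have "integrable lebesgue (\<lambda>z. (indicator K (fst z) * (u (fst z))\<^sup>2) * indicator {0<..<T} (snd z))"
    by (rule integrable_lebesgue_times)
  moreover have "integrable lebesgue (\<lambda>z. (g z)\<^sup>2)" using g2 by (subst integrable_completion) measurable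
  ultimately have dom: "integrable lebesgue (\<lambda>z. (g z)\<^sup>2 + (indicator K (fst z) * (u (fst z))\<^sup>2) * indicator {0<..<T} (snd z))"
    by (rule Bochner_Integration.integrable_add[rotated])
  have "integrable lebesgue h"
  proof (rule Bochner_Integration.integrable_bound[OF dom])
    show "h \<in> borel_measurable lebesgue" by (rule measurable_completion) measurable
    show "AE z in lebesgue. norm (h z) \<le> norm ((g z)\<^sup>2 + (indicator K (fst z) * (u (fst z))\<^sup>2) * indicator {0<..<T} (snd z))"
    proof (rule AE_I2)
      fix z
      have "\<bar>p * q\<bar> \<le> p\<^sup>2 + q\<^sup>2" for p q :: real
        using sum_squares_bound[of "\<bar>p\<bar>" "\<bar>q\<bar>"] mult_nonneg_nonneg[of "\<bar>p\<bar>" "\<bar>q\<bar>"]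
        unfolding abs_mult power2_abs by linarith
      from this[of "g z" "u (fst z)"]
      show "norm (h z) \<le> norm ((g z)\<^sup>2 + (indicator K (fst z) * (u (fst z))\<^sup>2) * indicator {0<..<T} (snd z))"
        by (auto simp: h_def indicator_def)
    qed
  qed
  then have "integrable lborel h" by (subst (asm) integrable_completion) measurable
  then have hi: "integrable (lborel \<Otimes>\<^sub>M lborel) (\<lambda>(x, s). h (x, s))" by (simp add: lborel_prod split_def)
  from lborel_pair.integrable_snd[OF hi]
  have D: "integrable lebesgue (\<lambda>s. LBINT x. h (x, s))"
    by (subst integrable_completion) (auto dest: borel_measurable_integrable)
  have "AE s in lborel. (LBINT x. h (x, s)) = indicator {0<..<T} s * ip K (\<lambda>y. f (y, s)) u"
    using ae
  proof eventually_elim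
    case (elim s)
    show ?case
    proof (cases "s \<in> {0<..<T}")
      case True
      have e: "AE x in lborel. h (x, s) = indicator K x * (f (x, s) * u x)"
        using elim by (rule AE_mp) (use True K(2) in \<open>auto simp: h_def indicator_def\<close>)
      then have e: "AE x in lebesgue. h (x, s) = indicator K x * (f (x, s) * u x)" by (simp only: AE_completion_iff)
      have hs: "(\<lambda>x. h (x, s)) \<in> borel_measurable lborel" by measurable
      have hs': "(\<lambda>x. h (x, s)) \<in> borel_measurable lebesgue" by (rule measurable_completion[OF hs])
      have "(LBINT x. h (x, s)) = (LINT x|lebesgue. h (x, s))" by (rule integral_completion[OF hs, symmetric])
      also have "\<dots> = ip K (\<lambda>y. f (y, s)) u" unfolding ip_eq
        by (rule integral_cong_AE[OF hs' borel_measurable_AE[OF hs' e] e])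
      finally show ?thesis using True by simp
    qed (simp add: h_def)
  qed
  then have e: "AE s in lebesgue. (LBINT x. h (x, s)) = indicator {0<..<T} s * ip K (\<lambda>y. f (y, s)) u"
    by (simp only: AE_completion_iff)
  show ?thesis by (rule integrable_cong_AE_imp[OF D borel_measurable_AE[OF borel_measurable_integrable[OF D] e] e])
qed

end

context element_domain
begin

text \<open>The projection is given by a description. Its expansion in an orthonormal family shows
  the dependence on \<open>w\<close> through finitely many inner products, which yields
  measurability in time.\<close>

lemma Pk_orthonormal:
  "\<exists>(n::nat) u. (\<forall>i<n. u i \<in> Pk k) \<and> (\<forall>w\<in>L2 E. proj_L2 k E w = (\<lambda>x. \<Sum>i<n. ip E w (u i) * u i x))"
proof -
  have PL: "Pk k \<subseteq> L2 E" using Pk_L2 by blast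
  have psdP: "psd_on (Pk k) (ip E)" by (rule psd_on_subset[OF psd_ip PL])
  obtain M :: nat and v :: "nat \<Rightarrow> 'a \<Rightarrow> real"
    where Mv: "(\<forall>i<M. v i \<in> Pk k) \<and> (\<forall>w\<in>Pk k. \<exists>c. w = (\<lambda>x. \<Sum>i<M. c i * v i x))"
    using Pk_span[of k, where 'a = 'a] by (elim exE)
  have v: "v i \<in> Pk k" if "i < M" for i using Mv that by blast
  have span: "\<exists>c. w = (\<lambda>x. \<Sum>i<M. c i * v i x)" if "w \<in> Pk k" for w using Mv that by blast
  obtain n :: nat and u where u: "\<And>i. i < n \<Longrightarrow> u i \<in> Pk k"
    and on: "\<And>i j. i < n \<Longrightarrow> j < n \<Longrightarrow> ip E (u i) (u j) = (if i = j then 1 else 0)"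
    and vu: "\<And>i. i < M \<Longrightarrow> \<exists>c. ip E (\<lambda>x. v i x - (\<Sum>j<n. c j * u j x)) (\<lambda>x. v i x - (\<Sum>j<n. c j * u j x)) = 0"
    using orthonormal_exists[OF lin_space_Pk psdP, of M v] v by blast
  have "\<exists>c. v i = (\<lambda>x. \<Sum>j<n. c j * u j x)" if i: "i < M" for i
  proof -
    obtain c where c: "ip E (\<lambda>x. v i x - (\<Sum>j<n. c j * u j x)) (\<lambda>x. v i x - (\<Sum>j<n. c j * u j x)) = 0"
      using vu[OF i] by blast
    have d: "(\<lambda>x. v i x - (\<Sum>j<n. c j * u j x)) \<in> Pk k"
      by (intro lin_space_diff[OF lin_space_Pk v[OF i]] lin_space_sum[OF lin_space_Pk]) (use u in auto)
    \<comment> \<open>Polynomials of zero norm vanish identically, so Gram-Schmidt recovers the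
      spanning family exactly.\<close>
    from L2_proj.definite[OF d c] have "v i x = (\<Sum>j<n. c j * u j x)" for x by (simp add: fun_eq_iff)
    then show ?thesis by (intro exI[of _ c]) auto
  qed
  then obtain e where e: "\<And>i. i < M \<Longrightarrow> v i = (\<lambda>x. \<Sum>j<n. e i j * u j x)" by metis
  have "proj_L2 k E w = (\<lambda>x. \<Sum>i<n. ip E w (u i) * u i x)" if w: "w \<in> L2 E" for w
  proof -
    define p where "p = proj_L2 k E w"
    have p: "p \<in> Pk k" "\<And>q. q \<in> Pk k \<Longrightarrow> ip E p q = ip E w q"
      using L2_proj.proj_props[where k = k, OF w] unfolding p_def proj_L2_eq by auto
    obtain c where c: "p = (\<lambda>x. \<Sum>i<M. c i * v i x)" using span[OF p(1)] by blast
    define d where "d = (\<lambda>j. \<Sum>i<M. c i * e i j)"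
    have pd: "p = (\<lambda>x. \<Sum>j<n. d j * u j x)"
    proof
      fix x
      have "p x = (\<Sum>i<M. \<Sum>j<n. c i * e i j * u j x)"
        unfolding c by (intro sum.cong refl) (simp add: e sum_distrib_left mult.assoc)
      also have "\<dots> = (\<Sum>j<n. d j * u j x)" unfolding d_def sum_distrib_right by (rule sum.swap)
      finally show "p x = (\<Sum>j<n. d j * u j x)" .
    qed
    have "d l = ip E w (u l)" if l: "l < n" for l
    proof -
      have "ip E p (u l) = (\<Sum>j<n. d j * ip E (u j) (u l))"
        unfolding pd using u l PL
        by (intro linear_form_sum[OF lin_space_Pk bilinear_left[OF conjunct1[OF psdP[unfolded psd_on_def]]]]) auto
      also have "\<dots> = (\<Sum>j<n. if j = l then d j else 0)" using on l by (intro sum.cong refl) auto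
      also have "\<dots> = d l" using l by simp
      finally show ?thesis using p(2)[OF u[OF l]] by simp
    qed
    then show ?thesis unfolding p_def[symmetric] pd by (intro ext sum.cong refl) auto
  qed
  then show ?thesis using u by blast
qed

end

lemma integrable_mult_bounded:
  fixes C b :: "'b \<Rightarrow> real"
  assumes C: "integrable M C" and b: "b \<in> borel_measurable M" "\<And>x. \<bar>b x\<bar> \<le> D"
  shows "integrable M (\<lambda>x. C x * b x)"
proof (rule Bochner_Integration.integrable_bound)
  show "integrable M (\<lambda>x. D * C x)" using C by simp
  show "(\<lambda>x. C x * b x) \<in> borel_measurable M" using C b(1) by measurable
  show "AE x in M. norm (C x * b x) \<le> norm (D * C x)"
  proof (rule AE_I2)
    fix x
    have "0 \<le> D" using b(2)[of x] by (meson abs_ge_zero order_trans)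
    then show "norm (C x * b x) \<le> norm (D * C x)"
      using mult_left_mono[OF b(2)[of x] abs_ge_zero[of "C x"]] by (simp add: abs_mult mult.commute)
  qed
qed

locale vem_source = vem_mesh k \<Omega> Th + time_grid N t r T
  for k and \<Omega> :: "'a::euclidean_space set" and Th N t r T +
  fixes f :: "'a \<times> real \<Rightarrow> real"
  assumes f: "f \<in> L2 (\<Omega> \<times> {0<..<T})"
begin

text \<open>For almost every time the slice of \<open>f\<close> is square integrable on the cell, so
  the orthonormal formula applies and separates time coefficients from polynomials in space.\<close>

lemma f_h_expansion:
  assumes K: "K \<in> Th"
  shows "\<exists>(n::nat) u C. (\<forall>i<n. u i \<in> Pk k \<and> integrable lebesgue (C i)) \<and>
    (AE s in lebesgue. s \<in> {0<..<T} \<longrightarrow> proj_L2 k (cell K) (\<lambda>y. f (y, s)) = (\<lambda>x. \<Sum>i<n. C i s * u i x))"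
proof -
  interpret K: element_domain "cell K" by (rule elem_domain[OF elem[OF K]])
  obtain n :: nat and u where u: "\<And>i. i < n \<Longrightarrow> u i \<in> Pk k"
    and p: "\<And>w. w \<in> L2 (cell K) \<Longrightarrow> proj_L2 k (cell K) w = (\<lambda>x. \<Sum>i<n. ip (cell K) w (u i) * u i x)"
    using K.Pk_orthonormal[of k] by blast
  define C where "C = (\<lambda>i s. indicator {0<..<T} s * ip (cell K) (\<lambda>y. f (y, s)) (u i))"
  have "integrable lebesgue (C i)" if i: "i < n" for i
    unfolding C_def
    by (rule slice_ip_integrable[OF open_\<Omega> bounded_\<Omega> f K.open_E cell_\<Omega>[OF K] smooth_continuous[OF Pk_smooth[OF u[OF i]]]])
  moreover have "AE s in lebesgue. s \<in> {0<..<T} \<longrightarrow> proj_L2 k (cell K) (\<lambda>y. f (y, s)) = (\<lambda>x. \<Sum>i<n. C i s * u i x)"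
    using slices_L2[OF open_\<Omega> bounded_\<Omega> f]
  proof eventually_elim
    case (elim s)
    show ?case
    proof
      assume s: "s \<in> {0<..<T}"
      then have "(\<lambda>y. f (y, s)) \<in> L2 (cell K)" using elim L2_subset[OF _ cell_\<Omega>[OF K] K.sets_E] by blast
      from p[OF this] show "proj_L2 k (cell K) (\<lambda>y. f (y, s)) = (\<lambda>x. \<Sum>i<n. C i s * u i x)"
        using s by (simp add: C_def)
    qed
  qed
  ultimately show ?thesis using u by (intro exI[of _ n] exI[of _ u] exI[of _ C]) blast
qed

lemma AE_not_eq: "AE s in lebesgue. s \<noteq> (c :: real)"
  using AE_lborel_singleton[of c] by (simp add: AE_completion_iff)

text \<open>With \<open>f_h\<close> separated into products, integrability reduces to that of space
  and time factors. Linearity of the load functional depends on it.\<close>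

lemma source_integrable:
  assumes w: "w \<in> X" and n: "n \<in> {1..N}"
  shows "integrable lebesgue (\<lambda>z. indicator (\<Omega> \<times> slab t n) z * (f_h k Th f z * tprod w (poly q) z))"
proof -
  define nn where "nn = (\<lambda>K :: 'a element. SOME n. \<exists>u C. (\<forall>i<n. u i \<in> Pk k \<and> integrable lebesgue (C i)) \<and>
    (AE s in lebesgue. s \<in> {0<..<T} \<longrightarrow> proj_L2 k (cell K) (\<lambda>y. f (y, s)) = (\<lambda>x. \<Sum>i<n::nat. C i s * u i x)))"
  have "\<forall>K\<in>Th. \<exists>u C. (\<forall>i<nn K. u i \<in> Pk k \<and> integrable lebesgue (C i)) \<and>
    (AE s in lebesgue. s \<in> {0<..<T} \<longrightarrow> proj_L2 k (cell K) (\<lambda>y. f (y, s)) = (\<lambda>x. \<Sum>i<nn K. C i s * u i x))"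
  proof
    fix K assume "K \<in> Th"
    from someI_ex[OF f_h_expansion[OF this]]
    show "\<exists>u C. (\<forall>i<nn K. u i \<in> Pk k \<and> integrable lebesgue (C i)) \<and>
    (AE s in lebesgue. s \<in> {0<..<T} \<longrightarrow> proj_L2 k (cell K) (\<lambda>y. f (y, s)) = (\<lambda>x. \<Sum>i<nn K. C i s * u i x))"
      unfolding nn_def .
  qed
  then obtain u where "\<forall>K\<in>Th. \<exists>C. (\<forall>i<nn K. u K i \<in> Pk k \<and> integrable lebesgue (C i)) \<and>
    (AE s in lebesgue. s \<in> {0<..<T} \<longrightarrow> proj_L2 k (cell K) (\<lambda>y. f (y, s)) = (\<lambda>x. \<Sum>i<nn K. C i s * u K i x))"
    unfolding bchoice_iff by blast
  then obtain C where uC: "\<forall>K\<in>Th. (\<forall>i<nn K. u K i \<in> Pk k \<and> integrable lebesgue (C K i)) \<and>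
    (AE s in lebesgue. s \<in> {0<..<T} \<longrightarrow> proj_L2 k (cell K) (\<lambda>y. f (y, s)) = (\<lambda>x. \<Sum>i<nn K. C K i s * u K i x))"
    unfolding bchoice_iff by blast
  have u: "u K i \<in> Pk k" and C: "integrable lebesgue (C K i)" if "K \<in> Th" "i < nn K" for K i
    using uC that by auto
  have ae: "AE s in lebesgue. \<forall>K\<in>Th. s \<in> {0<..<T} \<longrightarrow>
      proj_L2 k (cell K) (\<lambda>y. f (y, s)) = (\<lambda>x. \<Sum>i<nn K. C K i s * u K i x)"
    by (rule AE_finite_allI[OF finite_Th]) (use uC in blast)
  define b where "b = (\<lambda>s. indicator (slab t n) s * poly q s)"
  have "compact (poly q ` {t (n - 1)..t n})"
    by (intro compact_continuous_image continuous_on_poly continuous_on_id) simp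
  from compact_imp_bounded[OF this] obtain D where "\<forall>v\<in>poly q ` {t (n - 1)..t n}. norm v \<le> D"
    unfolding bounded_iff by (elim exE)
  then have D: "\<And>s. s \<in> {t (n - 1)..t n} \<Longrightarrow> \<bar>poly q s\<bar> \<le> D" by auto
  have "\<bar>b s\<bar> \<le> max D 0" for s using D[of s] by (auto simp: b_def slab_def indicator_def)
  moreover have "b \<in> borel_measurable lebesgue"
  proof (rule measurable_completion)
    have "poly q \<in> borel_measurable borel" by (intro borel_measurable_continuous_onI continuous_on_poly continuous_on_id)
    then show "b \<in> borel_measurable lborel" unfolding b_def slab_def by measurable
  qed
  ultimately have Cb: "integrable lebesgue (\<lambda>s. C K i s * b s)" if "K \<in> Th" "i < nn K" for K i
    by (intro integrable_mult_bounded[OF C[OF that]])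
  have uw: "integrable lebesgue (\<lambda>x. indicator (cell K) x * (u K i x * w x))" if K: "K \<in> Th" "i < nn K" for K i
  proof -
    interpret K: element_domain "cell K" by (rule elem_domain[OF elem[OF K(1)]])
    show ?thesis
      using K.Pk_L2[OF u[OF K]] X_L2[OF w] L2_subset[OF _ cell_\<Omega>[OF K(1)] K.sets_E]
      by (intro L2_prod_integrable) auto
  qed
  let ?G = "\<lambda>z. \<Sum>K\<in>Th. \<Sum>i<nn K. (indicator (cell K) (fst z) * (u K i (fst z) * w (fst z))) * (C K i (snd z) * b (snd z))"
  have G: "integrable lebesgue ?G"
    by (intro Bochner_Integration.integrable_sum integrable_lebesgue_times) (use Cb uw in auto)
  \<comment> \<open>The last slab contains \<open>T\<close>, whereas the expansion holds on the open
    interval only; dropping the right end of the slab repairs this.\<close>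
  have "AE s in lebesgue. s \<noteq> t n" by (rule AE_not_eq)
  with ae have "AE s in lebesgue. s \<noteq> t n \<and> (\<forall>K\<in>Th. s \<in> {0<..<T} \<longrightarrow>
      proj_L2 k (cell K) (\<lambda>y. f (y, s)) = (\<lambda>x. \<Sum>i<nn K. C K i s * u K i x))" by eventually_elim simp
  from AE_lebesgue_snd[OF this, where 'a = 'a]
  have e: "AE z in lebesgue. ?G z = indicator (\<Omega> \<times> slab t n) z * (f_h k Th f z * tprod w (poly q) z)"
  proof eventually_elim
    case (elim z)
    obtain x s where z: "z = (x, s)" by (cases z)
    show ?case
    proof (cases "s \<in> slab t n")
      case True
      have "s < t n" using True elim z by (auto simp: slab_def less_le)
      moreover have "t n \<le> T" "0 < s" using slab_subset[OF n] True slab_less[OF n] tN t_mono[of n N] n by auto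
      ultimately have s: "s \<in> {0<..<T}" by simp
      have K: "indicator (cell K) x * proj_L2 k (cell K) (\<lambda>y. f (y, s)) x * (w x * poly q s)
        = (\<Sum>i<nn K. (indicator (cell K) x * (u K i x * w x)) * (C K i s * b s))" if K: "K \<in> Th" for K
      proof -
        have "proj_L2 k (cell K) (\<lambda>y. f (y, s)) = (\<lambda>x. \<Sum>i<nn K. C K i s * u K i x)"
          using elim z s K by simp
        then show ?thesis using True by (simp add: b_def sum_distrib_left sum_distrib_right mult_ac)
      qed
      have "f_h k Th f (x, s) * (w x * poly q s) = ?G z"
        unfolding f_h_def prod.case sum_distrib_right by (rule sum.cong[OF refl]) (simp only: K z fst_conv snd_conv)
      moreover have "?G z = 0" if "x \<notin> \<Omega>"
        using that cell_\<Omega> by (intro sum.neutral ballI) (auto simp: z indicator_def)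
      ultimately show ?thesis using True by (cases "x \<in> \<Omega>") (simp_all add: z tprod_def)
    qed (simp add: z b_def)
  qed
  show ?thesis by (rule integrable_cong_AE_imp[OF G borel_measurable_AE[OF borel_measurable_integrable[OF G] e] e])
qed

text \<open>The load with a polynomial in place of the time derivative of the test function, so that
  linearity in time can be read off the pieces \<open>pp n y\<close>.\<close>

definition src :: "nat \<Rightarrow> ('a \<Rightarrow> real) \<Rightarrow> real poly \<Rightarrow> real" where
  "src n w q = ip (\<Omega> \<times> slab t n) (f_h k Th f) (tprod w (poly q))"

lemma src_deriv:
  assumes w: "w \<in> X" and y: "y \<in> Y" and n: "n \<in> {1..N}"
  shows "ip (\<Omega> \<times> slab t n) (f_h k Th f) (tprod w (deriv y)) = src n w (pderiv (pp n y))"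
  unfolding src_def ip_eq
proof (rule integral_cong_AE)
  let ?I = "\<lambda>d z. indicator (\<Omega> \<times> slab t n) z * (f_h k Th f z * tprod w d z)"
  show m: "?I (poly (pderiv (pp n y))) \<in> borel_measurable lebesgue"
    by (rule borel_measurable_integrable[OF source_integrable[OF w n]])
  from AE_lebesgue_snd[OF AE_not_eq, of "t n", where 'a = 'a]
  have e: "AE z in lebesgue. ?I (poly (pderiv (pp n y))) z = ?I (deriv y) z"
  proof eventually_elim
    case (elim z)
    show ?case
    proof (cases "snd z \<in> slab t n")
      case True
      then have "snd z \<in> {t (n - 1)<..<t n}" using elim by (auto simp: slab_def)
      from pp_deriv(2)[OF y n this] show ?thesis by (simp add: tprod_def split_def)
    qed (simp add: indicator_def mem_Times_iff)
  qed
  show "?I (deriv y) \<in> borel_measurable lebesgue" by (rule borel_measurable_AE[OF m e])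
  show "AE z in lebesgue. ?I (deriv y) z = ?I (poly (pderiv (pp n y))) z" using e by eventually_elim (rule sym)
qed

lemma src_comb:
  assumes n: "n \<in> {1..N}" and w: "w \<in> X" "w' \<in> X"
  shows "src n (\<lambda>x. a * w x + b * w' x) q = a * src n w q + b * src n w' q"
    "src n w (smult a q + smult b q') = a * src n w q + b * src n w q'"
proof -
  note I = source_integrable[OF _ n]
  have "src n (\<lambda>x. a * w x + b * w' x) q =
    (LINT z|lebesgue. a * (indicator (\<Omega> \<times> slab t n) z * (f_h k Th f z * tprod w (poly q) z))
      + b * (indicator (\<Omega> \<times> slab t n) z * (f_h k Th f z * tprod w' (poly q) z)))"
    unfolding src_def ip_eq by (rule Bochner_Integration.integral_cong) (auto simp: tprod_def split_def algebra_simps)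
  then show "src n (\<lambda>x. a * w x + b * w' x) q = a * src n w q + b * src n w' q"
    using I[OF w(1)] I[OF w(2)] by (simp add: src_def ip_eq Bochner_Integration.integral_add)
  have "src n w (smult a q + smult b q') =
    (LINT z|lebesgue. a * (indicator (\<Omega> \<times> slab t n) z * (f_h k Th f z * tprod w (poly q) z))
      + b * (indicator (\<Omega> \<times> slab t n) z * (f_h k Th f z * tprod w (poly q') z)))"
    unfolding src_def ip_eq by (rule Bochner_Integration.integral_cong) (auto simp: tprod_def split_def algebra_simps)
  then show "src n w (smult a q + smult b q') = a * src n w q + b * src n w q'"
    using I[OF w(1)] by (simp add: src_def ip_eq Bochner_Integration.integral_add)
qed

lemma src_null:
  assumes w: "w \<in> zae \<Omega>"
  shows "src n w q = 0"
  unfolding src_def ip_eq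
proof (rule integral_eq_zero_AE)
  have "AE x in lebesgue. x \<in> \<Omega> \<longrightarrow> w x = 0" using w by (simp add: zae_def)
  from AE_lebesgue_fst[OF this]
  show "AE z in lebesgue. indicator (\<Omega> \<times> slab t n) z * (f_h k Th f z * tprod w (poly q) z) = 0"
    by eventually_elim (auto simp: tprod_def indicator_def)
qed

lemma src_0: "src n w 0 = 0"
  by (simp add: src_def ip_eq tprod_def split_def)

lemma F_prod_eq:
  assumes "w \<in> X" "y \<in> Y"
  shows "F_prod m a (f_h k Th f) uh0 zh0 \<Omega> N t w y =
    (\<Sum>n=1..N. src n w (pderiv (pp n y))) + m zh0 w * poly (pderiv (pp 1 y)) 0 + a uh0 w * poly (pp 1 y) 0"
proof -
  have 1: "1 \<in> {1..N}" using N_pos by simp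
  have "rlim (deriv y) 0 = poly (pderiv (pp 1 y)) 0" "rlim y 0 = poly (pp 1 y) 0"
    using rlim_slab[OF 1, of "deriv y" "pderiv (pp 1 y)"] rlim_slab[OF 1, of y "pp 1 y"] pp_deriv[OF assms(2) 1] t0 by auto
  then show ?thesis unfolding F_prod_def using src_deriv[OF assms] by simp
qed

lemma F_prod_bilinear:
  assumes m: "bilinear_form_on X m" and a: "bilinear_form_on X a" and uz: "uh0 \<in> X" "zh0 \<in> X"
  shows "bilinear_map_on X Y (F_prod m a (f_h k Th f) uh0 zh0 \<Omega> N t)"
proof (rule bilinear_mapI)
  have 1: "1 \<in> {1..N}" using N_pos by simp
  fix x y y' \<alpha> \<beta> assume x: "x \<in> X" and y: "y \<in> Y" "y' \<in> Y"
  have pd: "pderiv (pp n (\<lambda>s. \<alpha> * y s + \<beta> * y' s)) = smult \<alpha> (pderiv (pp n y)) + smult \<beta> (pderiv (pp n y'))" if "n \<in> {1..N}" for n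
    by (simp add: pp_comb[OF y that] pderiv_add pderiv_smult)
  have "(\<Sum>n=1..N. src n x (pderiv (pp n (\<lambda>s. \<alpha> * y s + \<beta> * y' s)))) =
      \<alpha> * (\<Sum>n=1..N. src n x (pderiv (pp n y))) + \<beta> * (\<Sum>n=1..N. src n x (pderiv (pp n y')))"
    unfolding sum_distrib_left sum.distrib[symmetric]
    by (rule sum.cong[OF refl]) (simp only: pd src_comb(2)[OF _ x x])
  then show "F_prod m a (f_h k Th f) uh0 zh0 \<Omega> N t x (\<lambda>s. \<alpha> * y s + \<beta> * y' s) =
      \<alpha> * F_prod m a (f_h k Th f) uh0 zh0 \<Omega> N t x y + \<beta> * F_prod m a (f_h k Th f) uh0 zh0 \<Omega> N t x y'"
    unfolding F_prod_eq[OF x y(1)] F_prod_eq[OF x y(2)] F_prod_eq[OF x lin_space_comb[OF lin_space_Y y]]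
    by (simp only: pd[OF 1] pp_comb[OF y 1] poly_add poly_smult) (simp add: algebra_simps pderiv_add pderiv_smult)
next
  fix x x' y \<alpha> \<beta> assume x: "x \<in> X" "x' \<in> X" and y: "y \<in> Y"
  have "(\<Sum>n=1..N. src n (\<lambda>v. \<alpha> * x v + \<beta> * x' v) (pderiv (pp n y))) =
      \<alpha> * (\<Sum>n=1..N. src n x (pderiv (pp n y))) + \<beta> * (\<Sum>n=1..N. src n x' (pderiv (pp n y)))"
    unfolding sum_distrib_left sum.distrib[symmetric]
    by (rule sum.cong[OF refl]) (simp only: src_comb(1)[OF _ x])
  then show "F_prod m a (f_h k Th f) uh0 zh0 \<Omega> N t (\<lambda>v. \<alpha> * x v + \<beta> * x' v) y =
      \<alpha> * F_prod m a (f_h k Th f) uh0 zh0 \<Omega> N t x y + \<beta> * F_prod m a (f_h k Th f) uh0 zh0 \<Omega> N t x' y"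
    unfolding F_prod_eq[OF x(1) y] F_prod_eq[OF x(2) y] F_prod_eq[OF lin_space_comb[OF lin_space_X x] y]
      linear_form_comb[OF bilinear_right[OF m uz(2)] x] linear_form_comb[OF bilinear_right[OF a uz(1)] x]
    by (simp add: algebra_simps)
qed

end

theorem theorem5p3:
  fixes \<Omega> :: "'a::euclidean_space set" and Th :: "'a element set"
    and k N :: nat and \<gamma> c T \<nu> :: real
    and S R :: "'a elem_form"
    and f :: "'a \<times> real \<Rightarrow> real" and u0 z0 uh0 zh0 :: "'a \<Rightarrow> real"
    and t :: "nat \<Rightarrow> real" and r :: "nat \<Rightarrow> nat"
  assumes dim: "DIM('a) = 2 \<or> DIM('a) = 3"
    and domain: "open \<Omega>" "\<Omega> \<noteq> {}" "bounded \<Omega>" "convex \<Omega>" "polytope (closure \<Omega>)"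
    and T: "T > 0" and \<nu>: "\<nu> > 0"
    and f: "f \<in> L2 (\<Omega> \<times> {0<..<T})"
    and mesh: "\<gamma> > 0" "c > 0" "is_mesh \<gamma> c \<Omega> Th"
    and k: "k \<ge> 1"
    and stab: "stabilizes_a k Th S" "stabilizes_m k Th R"
    and u0: "u0 \<in> H10 \<Omega>" "continuous_on (closure \<Omega>) u0" "is_interpolant k \<Omega> Th uh0 u0"
    and z0: "z0 \<in> H10 \<Omega>" "continuous_on (closure \<Omega>) z0" "is_interpolant k \<Omega> Th zh0 z0"
    and time: "t 0 = 0" "t N = T" "\<And>n. n < N \<Longrightarrow> t n < t (Suc n)"
    and r: "\<And>n. n \<in> {1..N} \<Longrightarrow> r n \<ge> 2"
  shows "\<exists>u. solves_vem_dg k \<Omega> Th S R N t r \<nu> f uh0 zh0 u \<and>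
           (\<forall>u'. solves_vem_dg k \<Omega> Th S R N t r \<nu> f uh0 zh0 u' \<longrightarrow>
                 (AE z in lebesgue. z \<in> \<Omega> \<times> {0<..<T} \<longrightarrow> u' z = u z))"
proof -
  interpret M: vem_source k \<Omega> Th N t r T f
  proof unfold_locales
    show "DIM('a) = 2 \<or> DIM('a) = 3" by (rule dim)
    show "elem_ok K" if "K \<in> Th" for K
      using mesh(3) that dim unfolding is_mesh_def elem_ok_def by auto
  qed (use domain T f mesh time in \<open>auto simp: is_mesh_def\<close>)
  let ?m = "m_h k Th R" and ?a = "a_h k Th S"
  interpret D: dg_setup N t r T M.X "zae \<Omega>" ?m ?a \<nu>
    by unfold_locales (use M.lin_space_X lin_space_zae M.fin_dim_X M.m_h_props[OF stab(2)] M.a_h_props[OF stab(1)] \<nu> in auto)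
  have uz: "uh0 \<in> M.X" "zh0 \<in> M.X" using u0 z0 by (auto simp: is_interpolant_def)
  let ?F = "F_prod ?m ?a (f_h k Th f) uh0 zh0 \<Omega> N t"
  have F: "bilinear_map_on M.X M.Y ?F" by (rule M.F_prod_bilinear[OF D.bil_m D.bil_a uz])
  have F1: "?F x y = 0" if "x \<in> M.X" "x \<in> zae \<Omega>" "y \<in> M.Y" for x y
    using D.m_null_right[OF that(1) uz(2)] D.a_null_right[OF that(1) uz(1)] D.m_null[OF that(1)] D.a_null[OF that(1)] that
    by (simp add: M.F_prod_eq M.src_null)
  have F2: "?F x y = 0" if "x \<in> M.X" "y \<in> M.Y" "\<forall>s\<in>{0<..T}. y s = 0" for x y
  proof -
    have p: "M.pp n y = 0" if n: "n \<in> {1..N}" for n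
      using M.slab_subset[OF n] that(1) \<open>\<forall>s\<in>{0<..T}. y s = 0\<close> by (intro M.pp_eqI[OF \<open>y \<in> M.Y\<close> n]) auto
    have "(\<Sum>n=1..N. M.src n x (pderiv (M.pp n y))) = 0" by (rule sum.neutral) (simp add: p M.src_0)
    moreover have "M.pp 1 y = 0" using M.N_pos by (intro p) simp
    ultimately show ?thesis unfolding M.F_prod_eq[OF that(1,2)] by simp
  qed
  have sol: "solves_vem_dg k \<Omega> Th S R N t r \<nu> f uh0 zh0 u \<longleftrightarrow> u \<in> D.Z \<and> (\<forall>w\<in>D.Z. D.AA u w = linear_ext M.X M.Y ?F w)" for u
    by (simp add: solves_vem_dg_def Let_def)
  obtain u where u: "u \<in> D.Z" "\<forall>w\<in>D.Z. D.AA u w = linear_ext M.X M.Y ?F w"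
    and unique: "\<forall>u'\<in>D.Z. (\<forall>w\<in>D.Z. D.AA u' w = linear_ext M.X M.Y ?F w) \<longrightarrow> (\<lambda>p. u' p - u p) \<in> D.NZ"
    using D.dg_problem[OF F F1 F2] by blast
  \<comment> \<open>Null slices at each time must become one null set of space-time. The exceptional
    set comes from the finitely many space factors \<open>d i\<close> and does not depend on
    time.\<close>
  have "AE z in lebesgue. z \<in> \<Omega> \<times> {0<..<T} \<longrightarrow> e z = 0" if e: "e \<in> D.NZ" for e
  proof -
    have "e \<in> D.Z" using e by (simp add: D.NZ_def)
    then obtain n x y where rep: "tensor_rep M.X M.Y e n x y" using D.Z_rep by blast
    obtain p :: nat and b \<xi> d where d: "\<And>i. i < n \<Longrightarrow> d i \<in> zae \<Omega> \<and> x i = (\<lambda>v. d i v + (\<Sum>l<p. \<xi> i l * b l v))"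
      and \<xi>: "\<And>l s. l < p \<Longrightarrow> s \<in> {0<..T} \<Longrightarrow> (\<Sum>i<n. \<xi> i l * y i s) = 0"
      using D.null_slices_decomp[OF rep e] by blast
    have "AE v in lebesgue. \<forall>i\<in>{..<n}. v \<in> \<Omega> \<longrightarrow> d i v = 0"
      using d by (intro AE_finite_allI) (auto simp: zae_def)
    from AE_lebesgue_fst[OF this] show ?thesis
    proof eventually_elim
      case (elim z)
      show ?case
      proof
        assume "z \<in> \<Omega> \<times> {0<..<T}"
        then obtain v s where z: "z = (v, s)" "v \<in> \<Omega>" "s \<in> {0<..T}" by auto
        have "e z = (\<Sum>i<n. x i v * y i s)" using rep z by (simp add: tensor_rep_def)
        also have "\<dots> = (\<Sum>i<n. \<Sum>l<p. \<xi> i l * y i s * b l v)"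
        proof (rule sum.cong[OF refl])
          fix i assume i: "i \<in> {..<n}"
          then have "x i v = (\<Sum>l<p. \<xi> i l * b l v)" using d[of i] elim z by simp
          then show "x i v * y i s = (\<Sum>l<p. \<xi> i l * y i s * b l v)" by (simp add: sum_distrib_left mult_ac)
        qed
        also have "\<dots> = (\<Sum>l<p. (\<Sum>i<n. \<xi> i l * y i s) * b l v)"
          unfolding sum_distrib_right by (rule sum.swap)
        also have "\<dots> = 0" using \<xi> z(3) by simp
        finally show "e z = 0" .
      qed
    qed
  qed
  from this[of "\<lambda>p. u' p - u p" for u'] unique u show ?thesis unfolding sol by (intro exI[of _ u]) auto
qed

end
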